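(* Let $T>0$, $\mu^0 \in \mathcal{P}_c(\mathbb{R}^d)$, let $(\mathbf{U},d_{\mathbf{U}})$ be a metric space, let $U(t,\mu) \subset \mathbf{U}$, $(t,\mu) \in [0,T]\times\mathcal{P}_c(\mathbb{R}^d)$, be a family of compact subsets, let $v : [0,T] \times \mathcal{P}_c(\mathbb{R}^d) \times \mathbf{U} \to C^0(\mathbb{R}^d,\mathbb{R}^d)$, $\varphi : \mathcal{P}_c(\mathbb{R}^d) \to \mathbb{R}$, $\mathcal{K}(t) \subset \mathcal{P}_c(\mathbb{R}^d)$ for $t \in [0,T]$, and $\mathcal{Q}_T \subset \mathcal{P}_c(\mathbb{R}^d)$. Set $V(t,\mu) := \{ v(t,\mu,u) : u \in U(t,\mu) \} \subset C^0(\mathbb{R}^d,\mathbb{R}^d)$. Suppose that for any compact set $K \subset \mathbb{R}^d$ the following holds. (i) The set-valued map $(t,\mu) \mapsto U(t,\mu) \subset \mathbf{U}$ is $\mathcal{L}^1$-measurable in $t \in [0,T]$ and continuous with respect to $\mu \in \mathcal{P}_c(\mathbb{R}^d)$ in the $W_1$-metric. (ii) The map $(t,\mu,u,x) \mapsto v(t,\mu,u)(x) \in \mathbb{R}^d$ is $\mathcal{L}^1$-measurable with respect to $t \in [0,T]$ and continuous with respect to $(u,x) \in \mathbf{U} \times \mathbb{R}^d$. Moreover, there exists $m \in L^1([0,T],\mathbb{R}_+)$ such that for $\mathcal{L}^1$-a.e. $t \in [0,T]$, $|v(t,\mu,u)(x)| \leq m(t)(1+|x|+\mathcal{M}_1(\mu))$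 for all $(\mu,u,x) \in \mathcal{P}_c(\mathbb{R}^d) \times \mathbf{U} \times \mathbb{R}^d$. There exist $l_K, L_K \in L^1([0,T],\mathbb{R}_+)$ such that for $\mathcal{L}^1$-a.e. $t \in [0,T]$, $\mathrm{Lip}(v(t,\mu,u);K) \leq l_K(t)$ for any $(\mu,u) \in \mathcal{P}(K) \times \mathbf{U}$, and $\| v(t,\mu,u) - v(t,\nu,u) \|_{C^0(K,\mathbb{R}^d)} \leq L_K(t) W_1(\mu,\nu)$ for any $\mu,\nu \in \mathcal{P}(K)$ and $u \in \mathbf{U}$. (iii) The set-valued map $(t,\mu) \in [0,T] \times \mathcal{P}_c(\mathbb{R}^d) \rightrightarrows V(t,\mu)$ has convex values. (iv) The final cost $\varphi$ is lower-semicontinuous over $\mathcal{P}(K)$ in the $W_1$-metric. (v) The running and final constraint sets $\mathcal{K}(t)$, $t \in [0,T]$, and $\mathcal{Q}_T$ are $W_1$-closed. Consider the optimal control problem $$(\mathcal{P}) \quad \left\{\begin{aligned} \min_{u(\cdot) \in \mathcal{U}} & \ \varphi(\mu(T)) \\ \text{s.t.} \ & \partial_t \mu(t) + \mathrm{div} \big( v(t,\mu(t),u(t)) \mu(t) \big) = 0, \quad \mu(0) = \mu^0, \\ \text{and} \ & \mu(t) \in \mathcal{K}(t) \ \text{for all } t \in [0,T], \quad \mu(T) \in \mathcal{Q}_T, \end{aligned}\right.$$ where $\mathcal{U}$ is the set of admissible controls, i.e. of measurable selections $t \in [0,T] \mapsto u(t) \in U(t,\mu(t))$. Then there exists an optimal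 trajectory-control pair $(\mu(\cdot),u(\cdot)) \in \mathrm{AC}([0,T],\mathcal{P}_c(\mathbb{R}^d)) \times \mathcal{U}$ for $(\mathcal{P})$.
   Context: Notation. $\mathcal{P}(\mathbb{R}^d)$ is the set of Borel probability measures on $\mathbb{R}^d$; $\mathcal{P}_c(\mathbb{R}^d)$ is the subset of those with compact support; for $K \subset \mathbb{R}^d$, $\mathcal{P}(K)$ is the set of probability measures supported in $K$. $\mathcal{M}_1(\mu) := \int_{\mathbb{R}^d} |x| \, \mathrm{d}\mu(x)$. $W_1(\mu,\nu) := \min_{\gamma} \int_{\mathbb{R}^{2d}} |x-y| \, \mathrm{d}\gamma(x,y)$, the minimum being over all transport plans $\gamma$ between $\mu$ and $\nu$, i.e. probability measures on $\mathbb{R}^{2d}$ with first marginal $\mu$ and second marginal $\nu$ (1-Wasserstein distance). $\mathcal{P}_c(\mathbb{R}^d)$ is endowed with $W_1$ and $\mathrm{AC}([0,T],\mathcal{P}_c(\mathbb{R}^d))$ denotes the curves absolutely continuous for $W_1$. $\mathcal{L}^1$ is the Lebesgue measure on $[0,T]$. $\mathrm{Lip}(v;K)$ is the Lipschitz constant of $v$ on $K$. Continuity equation. A curve $\mu(\cdot) \in \mathrm{AC}([0,T],\mathcal{P}_c(\mathbb{R}^d))$ solves $\partial_t \mu(t) + \mathrm{div}(v(t)\mu(t)) = 0$, $\mu(0)=\mu^0$, if $\mu(0)=\mu^0$ and $$\int_0^T \int_{\mathbb{R}^d} \big( \partial_t \phi(t,x) + \langle \nabla_x \phi(t,x), v(t,x)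 \rangle \big) \mathrm{d}\mu(t)(x) \, \mathrm{d}t = 0$$ for every $\phi \in C^\infty_c((0,T) \times \mathbb{R}^d)$. The controlled dynamics in $(\mathcal{P})$ is understood in this sense with velocity field $(t,x) \mapsto v(t,\mu(t),u(t))(x)$. Set-valued maps. A set-valued map $\mathcal{F} : [0,T] \rightrightarrows \mathcal{S}$ into a metric space is $\mathcal{L}^1$-measurable if $\{t : \mathcal{F}(t) \cap \mathcal{O} \neq \emptyset\}$ is $\mathcal{L}^1$-measurable for every open $\mathcal{O} \subset \mathcal{S}$. A measurable selection in $\mathcal{F}$ is a measurable map $f$ with $f(t) \in \mathcal{F}(t)$ for $\mathcal{L}^1$-a.e. $t$. Continuity of a set-valued map is understood in the usual sense (both upper and lower semicontinuity). A trajectory-control pair $(\mu(\cdot),u(\cdot))$ satisfying all the constraints of $(\mathcal{P})$ is optimal if $\varphi(\mu(T)) \leq \varphi(\nu(T))$ for every other such pair $(\nu(\cdot),w(\cdot))$.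
   Formalization: The formal theorem additionally assumes that at least one trajectory-control pair satisfies all the constraints of (P); without this the claim fails, for instance when the final constraint set Q_T is empty. *)

theory Defs
  imports "HOL-Probability.Probability"
begin

section \<open>Probability measures and the 1-Wasserstein distance\<close>

definition msupp :: "'a::euclidean_space measure \<Rightarrow> 'a set" where
  "msupp \<mu> = {x. \<forall>G. open G \<and> x \<in> G \<longrightarrow> emeasure \<mu> G > 0}"

definition Prob :: "'a::euclidean_space measure set" where
  "Prob = {\<mu>. sets \<mu> = sets borel \<and> prob_space \<mu>}"

definition Prob_c :: "'a::euclidean_space measure set" where
  "Prob_c = {\<mu> \<in> Prob. compact (msupp \<mu>)}"

definition Prob_on :: "'a::euclidean_space set \<Rightarrow> 'a measure set" where
  "Prob_on K = {\<mu> \<in> Prob. msupp \<mu> \<subseteq> K}"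

definition moment1 :: "'a::euclidean_space measure \<Rightarrow> real" where
  "moment1 \<mu> = (\<integral>x. norm x \<partial>\<mu>)"

definition transport_plans ::
    "'a::euclidean_space measure \<Rightarrow> 'a measure \<Rightarrow> ('a \<times> 'a) measure set" where
  "transport_plans \<mu> \<nu> =
     {\<gamma> \<in> Prob. distr \<gamma> borel fst = \<mu> \<and> distr \<gamma> borel snd = \<nu>}"

text \<open>
  The distance is only ever used between elements of \<^const>\<open>Prob_c\<close>.  There the cost is
  bounded almost everywhere, so the Bochner integral below is never the default value for
  non-integrable functions, and the infimum is the minimum.
\<close>

definition W1 :: "'a::euclidean_space measure \<Rightarrow> 'a measure \<Rightarrow> real" where
  "W1 \<mu> \<nu> = (INF \<gamma> \<in> transport_plans \<mu> \<nu>. \<integral>(x, y). norm (x - y) \<partial>\<gamma>)"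

text \<open>
  This is what the metric topology of \<^locale>\<open>Metric_space\<close> unfolds to.  It is written out because
  the library definition can only be unfolded once the metric axioms for \<^const>\<open>W1\<close> are
  available, which are not needed to know that these sets form a topology.
\<close>

definition W1_topology :: "'a::euclidean_space measure topology" where
  "W1_topology = topology (\<lambda>S. S \<subseteq> Prob_c \<and>
     (\<forall>\<mu>\<in>S. \<exists>r>0. \<forall>\<nu>\<in>Prob_c. W1 \<mu> \<nu> < r \<longrightarrow> \<nu> \<in> S))"

lemma openin_W1_topology:
  "openin W1_topology S \<longleftrightarrow>
     S \<subseteq> Prob_c \<and> (\<forall>\<mu>\<in>S. \<exists>r>0. \<forall>\<nu>\<in>Prob_c. W1 \<mu> \<nu> < r \<longrightarrow> \<nu> \<in> S)"
proof -
  define P :: "'a measure set \<Rightarrow> bool" where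
    "P S \<longleftrightarrow> S \<subseteq> Prob_c \<and> (\<forall>\<mu>\<in>S. \<exists>r>0. \<forall>\<nu>\<in>Prob_c. W1 \<mu> \<nu> < r \<longrightarrow> \<nu> \<in> S)" for S
  have int: "P (S \<inter> T)" if S: "P S" and T: "P T" for S T
    unfolding P_def
  proof (intro conjI ballI)
    show "S \<inter> T \<subseteq> Prob_c" using S by (auto simp: P_def)
    fix \<mu> assume \<mu>: "\<mu> \<in> S \<inter> T"
    obtain r where r: "r > 0" "\<forall>\<nu>\<in>Prob_c. W1 \<mu> \<nu> < r \<longrightarrow> \<nu> \<in> S"
      using S \<mu> by (auto simp: P_def)
    obtain s where s: "s > 0" "\<forall>\<nu>\<in>Prob_c. W1 \<mu> \<nu> < s \<longrightarrow> \<nu> \<in> T"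
      using T \<mu> by (auto simp: P_def)
    show "\<exists>r>0. \<forall>\<nu>\<in>Prob_c. W1 \<mu> \<nu> < r \<longrightarrow> \<nu> \<in> S \<inter> T"
      using r s by (intro exI[of _ "min r s"]) auto
  qed
  have un: "P (\<Union>\<S>)" if "\<forall>S\<in>\<S>. P S" for \<S>
    using that unfolding P_def by (meson Sup_least UnionE UnionI)
  have "istopology P" unfolding istopology_def using int un by blast
  then have "openin (topology P) = P"
    by (rule topology_inverse')
  moreover have "W1_topology = topology P"
    unfolding W1_topology_def P_def ..
  ultimately have "openin W1_topology = P"
    by (rule ssubst[where P = "\<lambda>X. openin X = P", rotated])
  then show ?thesis
    by (simp only: P_def)
qed

lemma topspace_W1_topology: "topspace W1_topology = (Prob_c :: 'a::euclidean_space measure set)"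
proof
  show "topspace W1_topology \<subseteq> (Prob_c :: 'a measure set)"
    by (auto simp: topspace_def openin_W1_topology)
  have "openin W1_topology (Prob_c :: 'a measure set)"
    unfolding openin_W1_topology using zero_less_one by blast
  then show "(Prob_c :: 'a measure set) \<subseteq> topspace W1_topology"
    by (rule openin_subset)
qed

definition W1_lsc_on :: "'a::euclidean_space measure set \<Rightarrow> ('a measure \<Rightarrow> real) \<Rightarrow> bool" where
  "W1_lsc_on S f \<longleftrightarrow>
     (\<forall>c. closedin (subtopology W1_topology S) {\<mu> \<in> Prob_c \<inter> S. f \<mu> \<le> c})"

section \<open>Integrable functions and curves of measures\<close>

definition L1_nonneg :: "real \<Rightarrow> (real \<Rightarrow> real) \<Rightarrow> bool" where
  "L1_nonneg T g \<longleftrightarrow> g absolutely_integrable_on {0..T} \<and> (\<forall>t\<in>{0..T}. 0 \<le> g t)"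

definition AC_curve :: "real \<Rightarrow> (real \<Rightarrow> 'a::euclidean_space measure) \<Rightarrow> bool" where
  "AC_curve T \<mu> \<longleftrightarrow>
     (\<forall>t\<in>{0..T}. \<mu> t \<in> Prob_c) \<and>
     (\<exists>g. L1_nonneg T g \<and>
        (\<forall>s t. 0 \<le> s \<and> s \<le> t \<and> t \<le> T \<longrightarrow> W1 (\<mu> s) (\<mu> t) \<le> (LINT r:{s..t}|lebesgue. g r)))"

section \<open>The continuity equation\<close>

primrec C_k :: "nat \<Rightarrow> ('b::euclidean_space \<Rightarrow> real) \<Rightarrow> bool" where
  "C_k 0 f \<longleftrightarrow> continuous_on UNIV f"
| "C_k (Suc k) f \<longleftrightarrow>
     (\<forall>x. f differentiable at x) \<and> (\<forall>b\<in>Basis. C_k k (\<lambda>x. frechet_derivative f (at x) b))"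

definition test_functions :: "real \<Rightarrow> (real \<times> 'a::euclidean_space \<Rightarrow> real) set" where
  "test_functions T =
     {\<phi>. (\<forall>k. C_k k \<phi>) \<and> compact (closure {p. \<phi> p \<noteq> 0}) \<and>
         closure {p. \<phi> p \<noteq> 0} \<subseteq> {0<..<T} \<times> UNIV}"

definition grad :: "('a::euclidean_space \<Rightarrow> real) \<Rightarrow> 'a \<Rightarrow> 'a" where
  "grad f x = (THE D. GDERIV f x :> D)"

definition CE_integrand ::
    "(real \<times> 'a::euclidean_space \<Rightarrow> real) \<Rightarrow> (real \<Rightarrow> 'a \<Rightarrow> 'a) \<Rightarrow> real \<Rightarrow> 'a \<Rightarrow> real" where
  "CE_integrand \<phi> w t x = deriv (\<lambda>s. \<phi> (s, x)) t + grad (\<lambda>y. \<phi> (t, y)) x \<bullet> w t x"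

text \<open>
  The two integrability clauses say that the iterated integral is well defined; without them
  the last clause could hold vacuously, because the library integral of a non-integrable function
  is zero.
\<close>

definition solves_CE ::
    "real \<Rightarrow> (real \<Rightarrow> 'a::euclidean_space measure) \<Rightarrow> (real \<Rightarrow> 'a \<Rightarrow> 'a) \<Rightarrow> bool" where
  "solves_CE T \<mu> w \<longleftrightarrow>
     (\<forall>\<phi>\<in>test_functions T.
        (AE t in lebesgue_on {0..T}. integrable (\<mu> t) (CE_integrand \<phi> w t)) \<and>
        set_integrable lebesgue {0..T} (\<lambda>t. \<integral>x. CE_integrand \<phi> w t x \<partial>\<mu> t) \<and>
        (LINT t:{0..T}|lebesgue. (\<integral>x. CE_integrand \<phi> w t x \<partial>\<mu> t)) = 0)"

section \<open>Set-valued maps\<close>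

definition setmap_measurable :: "real \<Rightarrow> (real \<Rightarrow> 'u::metric_space set) \<Rightarrow> bool" where
  "setmap_measurable T F \<longleftrightarrow>
     (\<forall>G. open G \<longrightarrow> {t \<in> {0..T}. F t \<inter> G \<noteq> {}} \<in> sets lebesgue)"

definition setmap_W1_continuous ::
    "('a::euclidean_space measure \<Rightarrow> 'u::metric_space set) \<Rightarrow> bool" where
  "setmap_W1_continuous F \<longleftrightarrow>
     (\<forall>G. open G \<longrightarrow>
        openin W1_topology {\<mu> \<in> Prob_c. F \<mu> \<subseteq> G} \<and>
        openin W1_topology {\<mu> \<in> Prob_c. F \<mu> \<inter> G \<noteq> {}})"

definition measurable_selection ::
    "real \<Rightarrow> (real \<Rightarrow> 'u::metric_space set) \<Rightarrow> (real \<Rightarrow> 'u) \<Rightarrow> bool" where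
  "measurable_selection T F f \<longleftrightarrow>
     f \<in> borel_measurable (lebesgue_on {0..T}) \<and> (AE t in lebesgue_on {0..T}. f t \<in> F t)"

text \<open>The function space carries no \<^class>\<open>real_vector\<close> instance, so \<^const>\<open>convex\<close> does not apply.\<close>

definition convex_functions :: "('a \<Rightarrow> 'b::real_vector) set \<Rightarrow> bool" where
  "convex_functions A \<longleftrightarrow>
     (\<forall>f\<in>A. \<forall>g\<in>A. \<forall>r s. 0 \<le> r \<and> 0 \<le> s \<and> r + s = 1 \<longrightarrow>
        (\<lambda>x. r *\<^sub>R f x + s *\<^sub>R g x) \<in> A)"

text \<open>Used only for non-empty compact \<open>K\<close> and continuous \<open>f\<close>.\<close>

definition C0_norm :: "'a set \<Rightarrow> ('a \<Rightarrow> 'b::real_normed_vector) \<Rightarrow> real" where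
  "C0_norm K f = (SUP x\<in>K. norm (f x))"

section \<open>The optimal control problem\<close>

text \<open>\<open>\<K>\<close> and \<open>\<Q>\<close> are the running and the final constraint sets.\<close>

definition admissible_pair ::
    "real \<Rightarrow> 'a::euclidean_space measure \<Rightarrow>
     (real \<Rightarrow> 'a measure \<Rightarrow> 'u::metric_space set) \<Rightarrow>
     (real \<Rightarrow> 'a measure \<Rightarrow> 'u \<Rightarrow> 'a \<Rightarrow> 'a) \<Rightarrow>
     (real \<Rightarrow> 'a measure set) \<Rightarrow> 'a measure set \<Rightarrow>
     (real \<Rightarrow> 'a measure) \<Rightarrow> (real \<Rightarrow> 'u) \<Rightarrow> bool" where
  "admissible_pair T \<mu>0 U v \<K> \<Q> \<mu> u \<longleftrightarrow>
     AC_curve T \<mu> \<and>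
     measurable_selection T (\<lambda>t. U t (\<mu> t)) u \<and>
     \<mu> 0 = \<mu>0 \<and>
     solves_CE T \<mu> (\<lambda>t x. v t (\<mu> t) (u t) x) \<and>
     (\<forall>t\<in>{0..T}. \<mu> t \<in> \<K> t) \<and>
     \<mu> T \<in> \<Q>"

definition optimal_pair ::
    "real \<Rightarrow> 'a::euclidean_space measure \<Rightarrow>
     (real \<Rightarrow> 'a measure \<Rightarrow> 'u::metric_space set) \<Rightarrow>
     (real \<Rightarrow> 'a measure \<Rightarrow> 'u \<Rightarrow> 'a \<Rightarrow> 'a) \<Rightarrow>
     ('a measure \<Rightarrow> real) \<Rightarrow>
     (real \<Rightarrow> 'a measure set) \<Rightarrow> 'a measure set \<Rightarrow>
     (real \<Rightarrow> 'a measure) \<Rightarrow> (real \<Rightarrow> 'u) \<Rightarrow> bool" where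
  "optimal_pair T \<mu>0 U v \<phi> \<K> \<Q> \<mu> u \<longleftrightarrow>
     admissible_pair T \<mu>0 U v \<K> \<Q> \<mu> u \<and>
     (\<forall>\<nu> w. admissible_pair T \<mu>0 U v \<K> \<Q> \<nu> w \<longrightarrow> \<phi> (\<mu> T) \<le> \<phi> (\<nu> T))"

end

theory Submission
  imports Defs "HOL-Library.Diagonal_Subsequence"
begin

text \<open>
  The direct method.  Admissible curves share an a priori bound: testing the continuity equation with
  truncated powers of \<open>|x|\<close>, Gronwall estimates of the moments of all orders confine the supports
  to one ball, and testing with smooth Kantorovich potentials gives one \<open>W1\<close>-modulus of continuity.
  By compactness of the probability measures on a ball, a subsequence of a minimising sequence of
  curves converges at every time.  Convex combinations of the corresponding velocity fields converge
  almost everywhere (Mazur), their limit lies in \<open>V(t, \<mu>(t))\<close> by convexity of \<open>V\<close> and compactness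
  of \<open>U\<close>, and a measurable control generating it is selected as in Filippov's lemma.  Linearity of
  the continuity equation in the velocity then identifies the limit equation.

  The triangle inequality for \<open>W1\<close> is not available in the library; it follows from Kantorovich
  duality, which discretisation reduces to Farkas' lemma.  Neither \<open>U\<close> nor the control space is
  assumed to be separable.  A finite Borel measure on the line makes every compact-valued measurable
  map essentially separably valued, because a point-finite family of null sets all of whose unions
  are measurable has a null union.
\<close>

section \<open>Smooth functions\<close>

text \<open>The controls have no limit in any useful sense, and the weak equation is the only access
  to the curves, so every estimate has to come from a test function. The growth bound involves the
  moment of the unknown curve, which makes the a priori bound circular. Continuity of the moment
  gives a support bound that depends on the curve; this makes the \<open>W1\<close> estimate
  available, and its Gronwall inequality bounds the moment by the data alone. A second support
  estimate is then uniform. In the limit, velocity and measure vary together, and velocities taken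
  at different measures lie in different convex sets. The measure is therefore exchanged for its
  limit at a cost controlled by the Lipschitz constants on the ball. Velocities are compared only at
  countably many points of the ball; the Lipschitz bound in x covers the rest. The field v is
  measurable in t only with its other arguments frozen, whereas the equation evaluates it along a
  curve and a control. Treating the time inside the curve as a further continuous argument gives a
  Caratheodory function.\<close>

lemma C_k_SucI:
  assumes "\<And>x. (f has_derivative f' x) (at x)" and "\<And>b. b \<in> Basis \<Longrightarrow> C_k k (\<lambda>x. f' x b)"
  shows "C_k (Suc k) f"
proof -
  have "frechet_derivative f (at x) = f' x" for x
    using frechet_derivative_at[OF assms(1)[of x]] by simp
  then show ?thesis using assms by (auto simp: differentiable_def)
qed

lemma C_k_SucD:
  assumes "C_k (Suc k) f"
  shows "(f has_derivative frechet_derivative f (at x)) (at x)"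
    and "b \<in> Basis \<Longrightarrow> C_k k (\<lambda>x. frechet_derivative f (at x) b)"
  using assms by (auto simp: frechet_derivative_works)

lemma C_k_Suc_imp: "C_k (Suc k) f \<Longrightarrow> C_k k f"
proof (induction k arbitrary: f)
  case 0
  then show ?case
    by (auto intro!: continuous_at_imp_continuous_on differentiable_imp_continuous_within)
next
  case (Suc k)
  then show ?case by (metis C_k.simps(2))
qed

lemma C_k_continuous: "C_k k f \<Longrightarrow> continuous_on UNIV f"
  by (induction k) (auto dest: C_k_Suc_imp simp del: C_k.simps(2))

lemma C_k_const [simp]: "C_k k (\<lambda>_. c)"
proof (induction k arbitrary: c)
  case (Suc k)
  show ?case by (rule C_k_SucI[where f' = "\<lambda>_ _. 0"]) (auto simp: Suc)
qed auto

lemma C_k_bounded_linear: "bounded_linear f \<Longrightarrow> C_k k f"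
proof (cases k)
  case 0
  assume "bounded_linear f" then show ?thesis
    using 0 by (simp add: linear_continuous_on)
next
  case (Suc n)
  assume "bounded_linear f" then show ?thesis
    unfolding Suc by (intro C_k_SucI[where f' = "\<lambda>_. f"]) (auto intro: bounded_linear_imp_has_derivative)
qed

lemma C_k_add: "C_k k f \<Longrightarrow> C_k k g \<Longrightarrow> C_k k (\<lambda>x. f x + g x)"
proof (induction k arbitrary: f g)
  case 0 then show ?case by (auto intro: continuous_intros)
next
  case (Suc k)
  show ?case
    by (rule C_k_SucI[OF has_derivative_add[OF C_k_SucD(1)[OF Suc.prems(1)] C_k_SucD(1)[OF Suc.prems(2)]]])
      (intro Suc.IH C_k_SucD(2)[OF Suc.prems(1)] C_k_SucD(2)[OF Suc.prems(2)])
qed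

lemma C_k_mult: "C_k k f \<Longrightarrow> C_k k g \<Longrightarrow> C_k k (\<lambda>x. f x * g x)"
proof (induction k arbitrary: f g)
  case 0 then show ?case by (auto intro: continuous_intros)
next
  case (Suc k)
  show ?case
    by (rule C_k_SucI[OF has_derivative_mult[OF C_k_SucD(1)[OF Suc.prems(1)] C_k_SucD(1)[OF Suc.prems(2)]]])
      (intro Suc.IH C_k_add C_k_SucD(2)[OF Suc.prems(1)] C_k_SucD(2)[OF Suc.prems(2)] C_k_Suc_imp[OF Suc.prems(1)] C_k_Suc_imp[OF Suc.prems(2)])
qed

lemma C_k_cmult: "C_k k f \<Longrightarrow> C_k k (\<lambda>x. c * f x)"
  by (intro C_k_mult C_k_const)

lemma C_k_diff: "C_k k f \<Longrightarrow> C_k k g \<Longrightarrow> C_k k (\<lambda>x. f x - g x)"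
  using C_k_add[OF _ C_k_cmult[of k g "-1"], of f] by simp

lemma C_k_power: "C_k k f \<Longrightarrow> C_k k (\<lambda>x. f x ^ n)"
  by (induction n) (auto intro: C_k_mult)

lemma C_k_sum: "(\<And>i. i \<in> I \<Longrightarrow> C_k k (f i)) \<Longrightarrow> C_k k (\<lambda>x. \<Sum>i\<in>I. f i x)"
  by (induction I rule: infinite_finite_induct) (auto intro: C_k_add)

lemma C_k_inner_self: "C_k k (\<lambda>x::'a::euclidean_space. (x - a) \<bullet> (x - a))"
proof -
  have "C_k k (\<lambda>x::'a. \<Sum>b\<in>Basis. (x \<bullet> b - a \<bullet> b) * (x \<bullet> b - a \<bullet> b))"
    by (intro C_k_sum C_k_mult C_k_diff C_k_const C_k_bounded_linear bounded_linear_intros)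
  then show ?thesis
    unfolding euclidean_inner[of "x - a" "x - a" for x] by (simp add: inner_diff_left)
qed

text \<open>\<open>C_k\<close> tracks only partial derivatives along \<open>Basis\<close>. The
  derivative of the composite along b is that of f along \<open>L b\<close>, which has to be
  expanded in the target basis before the induction hypothesis applies.\<close>

lemma C_k_compose_linear:
  assumes "bounded_linear L" shows "C_k k f \<Longrightarrow> C_k k (\<lambda>x. f (L x))"
proof (induction k arbitrary: f)
  case 0
  then show ?case using assms
    by (auto intro: continuous_on_compose2[of UNIV f] linear_continuous_on)
next
  case (Suc k)
  let ?D = "\<lambda>x. frechet_derivative f (at x)"
  have D: "((\<lambda>x. f (L x)) has_derivative (\<lambda>h. ?D (L x) (L h))) (at x)" for x
    by (rule has_derivative_compose[OF bounded_linear_imp_has_derivative[OF assms] C_k_SucD(1)[OF Suc.prems]])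
  have "?D (L x) (L b) = (\<Sum>c\<in>Basis. (L b \<bullet> c) * ?D (L x) c)" for x b
  proof -
    have lin: "linear (?D (L x))"
      using C_k_SucD(1)[OF Suc.prems] has_derivative_linear by blast
    have "?D (L x) (\<Sum>c\<in>Basis. (L b \<bullet> c) *\<^sub>R c) = (\<Sum>c\<in>Basis. (L b \<bullet> c) * ?D (L x) c)"
      by (simp add: linear_sum[OF lin] linear_scale[OF lin])
    then show ?thesis by (simp add: euclidean_representation)
  qed
  then show ?case
    by (intro C_k_SucI[OF D]) (simp del: C_k.simps, intro C_k_sum C_k_cmult Suc.IH C_k_SucD(2)[OF Suc.prems])
qed

section \<open>Smooth functions of one real variable\<close>

text \<open>The domain S is a parameter because \<open>ln\<close>, \<open>sqrt\<close> and powers,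
  which serve as outer functions in compositions, are smooth on the positive half-line only.
  Derivatives are existential, so that explicit formulas and antiderivatives can be supplied as
  witnesses.\<close>

primrec Cr_k :: "nat \<Rightarrow> real set \<Rightarrow> (real \<Rightarrow> real) \<Rightarrow> bool" where
  "Cr_k 0 S g \<longleftrightarrow> continuous_on S g"
| "Cr_k (Suc k) S g \<longleftrightarrow> (\<exists>g'. (\<forall>x\<in>S. (g has_real_derivative g' x) (at x)) \<and> Cr_k k S g')"

lemma Cr_k_SucI:
  "(\<And>x. x \<in> S \<Longrightarrow> (g has_real_derivative g' x) (at x)) \<Longrightarrow> Cr_k k S g' \<Longrightarrow> Cr_k (Suc k) S g"
  by auto

lemma Cr_k_Suc_imp: "Cr_k (Suc k) S g \<Longrightarrow> Cr_k k S g"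
proof (induction k arbitrary: g)
  case 0
  then obtain g' where "\<forall>x\<in>S. (g has_real_derivative g' x) (at x)" by auto
  then show ?case
    unfolding Cr_k.simps by (metis DERIV_isCont continuous_at_imp_continuous_on)
next
  case (Suc k)
  then show ?case by (metis Cr_k.simps(2))
qed

lemma Cr_k_continuous: "Cr_k k S g \<Longrightarrow> continuous_on S g"
  by (induction k) (auto dest: Cr_k_Suc_imp simp del: Cr_k.simps(2))

lemma C_k_compose:
  "C_k k f \<Longrightarrow> Cr_k k S g \<Longrightarrow> (\<And>x. f x \<in> S) \<Longrightarrow> C_k k (\<lambda>x. g (f x))"
proof (induction k arbitrary: g)
  case 0
  then show ?case by (auto intro: continuous_on_compose2[of S g])
next
  case (Suc k)
  obtain g' where g': "\<And>x. x \<in> S \<Longrightarrow> (g has_real_derivative g' x) (at x)" "Cr_k k S g'"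
    using Suc.prems(2) by auto
  have D: "((\<lambda>x. g (f x)) has_derivative (\<lambda>h. g' (f x) * frechet_derivative f (at x) h)) (at x)" for x
    using has_derivative_compose[OF C_k_SucD(1)[OF Suc.prems(1)]
        g'(1)[OF Suc.prems(3), unfolded has_field_derivative_def]] by simp
  show ?case
    by (rule C_k_SucI[OF D], rule C_k_mult, rule Suc.IH[OF C_k_Suc_imp[OF Suc.prems(1)] g'(2) Suc.prems(3)],
        rule C_k_SucD(2)[OF Suc.prems(1)])
qed

lemma Cr_k_const [simp]: "Cr_k k S (\<lambda>_. c)"
proof (induction k arbitrary: c)
  case (Suc k)
  show ?case by (rule Cr_k_SucI[where g' = "\<lambda>_. 0"]) (auto simp: Suc)
qed auto

lemma Cr_k_add: "Cr_k k S f \<Longrightarrow> Cr_k k S g \<Longrightarrow> Cr_k k S (\<lambda>x. f x + g x)"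
proof (induction k arbitrary: f g)
  case 0 then show ?case by (auto intro: continuous_intros)
next
  case (Suc k)
  obtain f' g' where *: "\<And>x. x \<in> S \<Longrightarrow> (f has_real_derivative f' x) (at x)" "Cr_k k S f'"
     "\<And>x. x \<in> S \<Longrightarrow> (g has_real_derivative g' x) (at x)" "Cr_k k S g'"
    using Suc.prems by auto
  show ?case
    by (rule Cr_k_SucI[OF DERIV_add[OF *(1) *(3)]]) (auto intro: Suc.IH *)
qed

lemma Cr_k_mult: "Cr_k k S f \<Longrightarrow> Cr_k k S g \<Longrightarrow> Cr_k k S (\<lambda>x. f x * g x)"
proof (induction k arbitrary: f g)
  case 0 then show ?case by (auto intro: continuous_intros)
next
  case (Suc k)
  obtain f' g' where *: "\<And>x. x \<in> S \<Longrightarrow> (f has_real_derivative f' x) (at x)" "Cr_k k S f'"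
     "\<And>x. x \<in> S \<Longrightarrow> (g has_real_derivative g' x) (at x)" "Cr_k k S g'"
    using Suc.prems by auto
  show ?case
    by (rule Cr_k_SucI[OF DERIV_mult[OF *(1) *(3)]])
       (auto intro!: Cr_k_add Suc.IH * Cr_k_Suc_imp[OF Suc.prems(1)] Cr_k_Suc_imp[OF Suc.prems(2)] simp del: Cr_k.simps)
qed

lemma Cr_k_affine: "Cr_k k UNIV g \<Longrightarrow> Cr_k k UNIV (\<lambda>x. g (a * x + b))"
proof (induction k arbitrary: g)
  case 0 then show ?case by (auto intro!: continuous_intros intro: continuous_on_compose2[of UNIV g])
next
  case (Suc k)
  obtain g' where *: "\<And>x. (g has_real_derivative g' x) (at x)" "Cr_k k UNIV g'"
    using Suc.prems by auto
  have "((\<lambda>x. g (a * x + b)) has_real_derivative g' (a * x + b) * a) (at x)" for x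
    by (rule DERIV_chain2[OF *(1)]) (auto intro!: derivative_eq_intros)
  then show ?case
    by (rule Cr_k_SucI) (rule Cr_k_mult[OF Suc.IH[OF *(2)] Cr_k_const])
qed

lemma Cr_k_exp: "Cr_k k S exp"
  by (induction k) (auto intro!: continuous_intros Cr_k_SucI[where g' = exp] DERIV_exp simp del: Cr_k.simps(2))

text \<open>The induction runs over all exponents, since differentiation lowers the exponent by 1.
  \<open>ln\<close> and \<open>sqrt\<close> land in this family after one derivative.\<close>

lemma Cr_k_powr: "Cr_k k {0<..} (\<lambda>x. x powr a)"
proof (induction k arbitrary: a)
  case 0 then show ?case by (auto intro!: continuous_intros)
next
  case (Suc k)
  show ?case
    by (rule Cr_k_SucI[where g' = "\<lambda>x. a * x powr (a - 1)"]) (auto intro!: has_real_derivative_powr Cr_k_mult Suc)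
qed

lemma Cr_k_ln: "Cr_k k {0<..} ln"
proof (cases k)
  case 0 then show ?thesis by (auto intro!: continuous_intros)
next
  case (Suc k')
  have "(ln has_real_derivative x powr (-1)) (at x)" if "x > 0" for x :: real
    using DERIV_ln[OF that] that by (simp add: powr_minus)
  then show ?thesis unfolding Suc
    by (intro Cr_k_SucI[where g' = "\<lambda>x. x powr (-1)"] Cr_k_powr) simp
qed

lemma Cr_k_sqrt: "Cr_k k {0<..} sqrt"
proof (cases k)
  case 0 then show ?thesis by (auto intro!: continuous_intros)
next
  case (Suc k')
  have "(sqrt has_real_derivative (1/2) * x powr (-1/2)) (at x)" if "x > 0" for x :: real
    using DERIV_real_sqrt[OF that] that
    by (simp add: powr_minus powr_half_sqrt[symmetric] mult.commute)
  then show ?thesis unfolding Suc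
    by (intro Cr_k_SucI[where g' = "\<lambda>x. (1/2) * x powr (-1/2)"] Cr_k_powr Cr_k_mult Cr_k_const) simp
qed

section \<open>Flat functions, bumps and the smooth step\<close>

text \<open>The classical functions p(1/x) exp(-1/x), extended by 0. Keeping the polynomial general
  makes the family closed under differentiation, so that smoothness is a single induction over all
  p.\<close>

definition flat :: "real poly \<Rightarrow> real \<Rightarrow> real" where
  "flat p x = (if x \<le> 0 then 0 else poly p (1 / x) * exp (- (1 / x)))"

lemma poly_mult_exp_minus_tendsto_0:
  "((\<lambda>y::real. poly p y * exp (- y)) \<longlongrightarrow> 0) at_top"
proof -
  have "((\<lambda>y. \<Sum>i\<le>degree p. coeff p i * (y ^ i / exp y)) \<longlongrightarrow> (\<Sum>i\<le>degree p. coeff p i * 0)) at_top"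
    by (intro tendsto_intros tendsto_power_div_exp_0)
  then show ?thesis
    by (simp add: poly_altdef sum_distrib_right exp_minus divide_inverse mult.assoc)
qed

text \<open>For x > 0 and y = 1/x the chain rule brings out y^2 and replaces p by p - p', whence the
  factor \<open>[:0, 0, 1:]\<close>; at 0 the exponential beats every polynomial.\<close>

lemma flat_DERIV:
  "(flat p has_real_derivative flat ([:0, 0, 1:] * (p - pderiv p)) x) (at x)"
proof -
  consider "x < 0" | "x = 0" | "x > 0" by linarith
  then show ?thesis
  proof cases
    case 1
    have "((\<lambda>_. 0) has_real_derivative 0) (at x)" by simp
    then have "(flat p has_real_derivative 0) (at x)"
      by (rule has_field_derivative_transform_within_open[of _ _ _ "{..<0}"]) (use 1 in \<open>auto simp: flat_def\<close>)
    then show ?thesis using 1 by (simp add: flat_def)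
  next
    case 3
    have "((\<lambda>x. poly p (1 / x) * exp (- (1 / x))) has_real_derivative
        flat ([:0, 0, 1:] * (p - pderiv p)) x) (at x)"
      using 3 by (auto intro!: derivative_eq_intros DERIV_chain2[OF poly_DERIV] simp: flat_def)
        (auto simp: field_simps power2_eq_square)
    then show ?thesis
      by (rule has_field_derivative_transform_within_open[of _ _ _ "{0<..}"]) (use 3 in \<open>auto simp: flat_def\<close>)
  next
    case 2
    \<comment> \<open>With y = 1/h the right difference quotient at 0 is y p(y) exp(-y), hence the
      extra factor \<open>[:0,1:]\<close>.\<close>
    have "((\<lambda>h. poly ([:0,1:] * p) (1/h) * exp (- (1/h))) \<longlongrightarrow> 0) (at_right (0::real))"
      using filterlim_compose[OF poly_mult_exp_minus_tendsto_0[of "[:0,1:] * p"] filterlim_inverse_at_top_right]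
      by (simp add: divide_inverse)
    then have "((\<lambda>h. flat p h / h) \<longlongrightarrow> 0) (at_right (0::real))"
      by (rule Lim_transform_eventually)
        (auto simp: flat_def eventually_at_filter intro!: always_eventually)
    moreover have "((\<lambda>h. flat p h / h) \<longlongrightarrow> 0) (at_left (0::real))"
      by (rule Lim_transform_eventually[OF tendsto_const])
        (auto simp: flat_def eventually_at_filter intro!: always_eventually)
    ultimately have "((\<lambda>h. flat p h / h) \<longlongrightarrow> 0) (at (0::real))"
      by (simp add: filterlim_at_split)
    then show ?thesis unfolding 2 DERIV_def by (simp add: flat_def)
  qed
qed

lemma Cr_k_flat: "Cr_k k S (flat p)"
proof (induction k arbitrary: p)
  case 0
  show ?case by (auto intro!: continuous_at_imp_continuous_on DERIV_isCont flat_DERIV)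
next
  case (Suc k)
  show ?case by (rule Cr_k_SucI[OF flat_DERIV Suc])
qed

definition bump :: "real \<Rightarrow> real" where
  "bump x = flat 1 x * flat 1 (1 - x)"

lemma bump_nonneg: "bump x \<ge> 0" by (auto simp: bump_def flat_def)
lemma bump_eq_0: "x \<le> 0 \<or> x \<ge> 1 \<Longrightarrow> bump x = 0" by (auto simp: bump_def flat_def)
lemma bump_pos: "0 < x \<Longrightarrow> x < 1 \<Longrightarrow> bump x > 0" by (auto simp: bump_def flat_def)

lemma Cr_k_bump: "Cr_k k UNIV bump"
  unfolding bump_def [abs_def] using Cr_k_affine[of k "flat 1" "-1" 1]
  by (intro Cr_k_mult) (auto simp: Cr_k_flat algebra_simps)

lemma continuous_antiderivative:
  assumes "continuous_on UNIV (f::real \<Rightarrow> real)"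
  obtains F where "\<And>x. (F has_real_derivative f x) (at x)"
  using einterval_antiderivative[of "-\<infinity>" \<infinity> f] assms
  by (auto simp: continuous_on_eq_continuous_at has_real_derivative_iff_has_vector_derivative)

text \<open>An antiderivative of \<open>bump\<close> is constant wherever \<open>bump\<close>
  vanishes; subtracting its value at 0 and dividing by the total mass c gives the step.\<close>

lemma smooth_step_exists:
  "\<exists>S S'. (\<forall>x. (S has_real_derivative S' x) (at x)) \<and> (\<forall>x. 0 \<le> S' x) \<and> (\<forall>x. x \<le> 0 \<or> 1 \<le> x \<longrightarrow> S' x = 0) \<and>
     (\<forall>x\<le>0. S x = 0) \<and> (\<forall>x\<ge>1. S x = 1) \<and> (\<forall>k. Cr_k k UNIV S) \<and> (\<forall>k. Cr_k k UNIV S')"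
proof -
  obtain G where G: "\<And>x. (G has_real_derivative bump x) (at x)"
    using continuous_antiderivative[OF Cr_k_continuous[OF Cr_k_bump]] by blast
  define c where "c = G 1 - G 0"
  have const: "G x = G y" if "x < y" "y \<le> 0 \<or> 1 \<le> x" for x y
  proof -
    obtain z where "x < z" "z < y" "G y - G x = (y - x) * bump z"
      using MVT2[OF \<open>x < y\<close>, of G bump] G by blast
    then show ?thesis using that bump_eq_0[of z] by auto
  qed
  have "c > 0"
  proof -
    obtain z where "0 < z" "z < 1" "G 1 - G 0 = (1 - 0) * bump z"
      using MVT2[of 0 1 G bump] G by auto
    then show ?thesis unfolding c_def using bump_pos by simp
  qed
  define S where "S x = (1/c) * (G x + - G 0)" for x
  have S: "(S has_real_derivative (1/c) * bump x) (at x)" for x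
    unfolding S_def [abs_def]
    by (rule DERIV_cmult) (use DERIV_add[OF G[of x] DERIV_const[where k = "- G 0"]] in simp)
  have G_sm: "Cr_k k UNIV G" for k
    by (rule Cr_k_Suc_imp) (rule Cr_k_SucI[OF G Cr_k_bump])
  have "S x = 0" if "x \<le> 0" for x using const[of x 0] that by (cases "x = 0") (auto simp: S_def)
  moreover have "S x = 1" if "x \<ge> 1" for x
  proof -
    have "G x = G 1" using const[of 1 x] that by (cases "x = 1") auto
    then show ?thesis using \<open>c > 0\<close> by (simp add: S_def c_def)
  qed
  moreover have "Cr_k k UNIV S" for k
    unfolding S_def [abs_def] by (intro Cr_k_mult Cr_k_add Cr_k_const G_sm)
  moreover have "Cr_k k UNIV (\<lambda>x. (1/c) * bump x)" for k
    by (intro Cr_k_mult Cr_k_const Cr_k_bump)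
  ultimately show ?thesis
    using S \<open>c > 0\<close> bump_nonneg bump_eq_0
    by (intro exI[of _ S] exI[of _ "\<lambda>x. (1/c) * bump x"]) auto
qed

text \<open>One step is fixed once and for all; the time cut-offs and mollifying kernels used later
  are affine rescalings of it and of its derivative.\<close>

definition smooth_step where
  "smooth_step = (SOME S. \<exists>S'. (\<forall>x. (S has_real_derivative S' x) (at x)) \<and> (\<forall>x. 0 \<le> S' x) \<and> (\<forall>x. x \<le> 0 \<or> 1 \<le> x \<longrightarrow> S' x = 0) \<and>
     (\<forall>x\<le>0. S x = 0) \<and> (\<forall>x\<ge>1. S x = 1) \<and> (\<forall>k. Cr_k k UNIV S) \<and> (\<forall>k. Cr_k k UNIV S'))"

lemma smooth_step:
  "(smooth_step has_real_derivative deriv smooth_step x) (at x)"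
  "0 \<le> deriv smooth_step x"
  "x \<le> 0 \<or> 1 \<le> x \<Longrightarrow> deriv smooth_step x = 0"
  "x \<le> 0 \<Longrightarrow> smooth_step x = 0" "1 \<le> x \<Longrightarrow> smooth_step x = 1"
  "Cr_k k UNIV smooth_step" "Cr_k k UNIV (deriv smooth_step)"
proof -
  obtain S' where *: "(\<forall>x. (smooth_step has_real_derivative S' x) (at x)) \<and> (\<forall>x. 0 \<le> S' x) \<and> (\<forall>x. x \<le> 0 \<or> 1 \<le> x \<longrightarrow> S' x = 0) \<and>
     (\<forall>x\<le>0. smooth_step x = 0) \<and> (\<forall>x\<ge>1. smooth_step x = 1) \<and> (\<forall>k. Cr_k k UNIV smooth_step) \<and> (\<forall>k. Cr_k k UNIV S')"
    unfolding smooth_step_def using someI_ex[OF smooth_step_exists] by blast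
  then have "deriv smooth_step = S'" using DERIV_imp_deriv by blast
  with * show "(smooth_step has_real_derivative deriv smooth_step x) (at x)"
  "0 \<le> deriv smooth_step x"
  "x \<le> 0 \<or> 1 \<le> x \<Longrightarrow> deriv smooth_step x = 0"
  "x \<le> 0 \<Longrightarrow> smooth_step x = 0" "1 \<le> x \<Longrightarrow> smooth_step x = 1"
  "Cr_k k UNIV smooth_step" "Cr_k k UNIV (deriv smooth_step)" by auto
qed

lemma smooth_step_mono: "x \<le> y \<Longrightarrow> smooth_step x \<le> smooth_step y"
  by (rule DERIV_nonneg_imp_nondecreasing) (use smooth_step(1,2) in blast)+

lemma smooth_step_bounds: "0 \<le> smooth_step x" "smooth_step x \<le> 1"
proof -
  show "0 \<le> smooth_step x" using smooth_step_mono[of "min x 0" x] smooth_step(4)[of "min x 0"] by simp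
  show "smooth_step x \<le> 1" using smooth_step_mono[of x "max x 1"] smooth_step(5)[of "max x 1"] by simp
qed

section \<open>Gradients and test functions\<close>

lemma grad_eq: "GDERIV f x :> D \<Longrightarrow> grad f x = D"
  unfolding grad_def
proof (rule the_equality)
  fix E assume "GDERIV f x :> D" "GDERIV f x :> E"
  then have "(\<lambda>h. h \<bullet> E) = (\<lambda>h. h \<bullet> D)"
    unfolding gderiv_def by (rule has_derivative_unique[rotated])
  then show "E = D" by (metis vector_eq_ldot inner_commute)
qed

lemma has_derivative_GDERIV:
  fixes f :: "'a::euclidean_space \<Rightarrow> real"
  assumes "(f has_derivative D) (at x)"
  shows "GDERIV f x :> (\<Sum>b\<in>Basis. D b *\<^sub>R b)"
proof -
  have lin: "linear D" using assms has_derivative_linear by blast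
  have "D h = h \<bullet> (\<Sum>b\<in>Basis. D b *\<^sub>R b)" for h
  proof -
    have "D h = D (\<Sum>b\<in>Basis. (h \<bullet> b) *\<^sub>R b)" by (simp add: euclidean_representation)
    also have "\<dots> = (\<Sum>b\<in>Basis. (h \<bullet> b) * D b)" by (simp add: linear_sum[OF lin] linear_scale[OF lin])
    finally show ?thesis by (simp add: inner_sum_right mult.commute)
  qed
  then have "D = (\<lambda>h. h \<bullet> (\<Sum>b\<in>Basis. D b *\<^sub>R b))" (is "D = ?E") by (rule ext)
  then have "(f has_derivative ?E) (at x)" by (rule subst) (rule assms)
  then show ?thesis unfolding gderiv_def .
qed

lemma C_k_GDERIV:
  assumes "C_k (Suc k) f" shows "GDERIV f x :> grad f x"
  using grad_eq[OF has_derivative_GDERIV[OF C_k_SucD(1)[OF assms]]]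
    has_derivative_GDERIV[OF C_k_SucD(1)[OF assms]] by simp

text \<open>The function is locally zero off its support, so its partial derivatives vanish there
  and are bounded as continuous functions on a compact set; the mean value inequality does the rest.
  The last conclusion passes the compact support on to the partial derivatives, so that the estimate
  can be applied to them as well.\<close>

lemma C_k_bounded_Lipschitz:
  fixes f :: "'a::euclidean_space \<Rightarrow> real"
  assumes f: "C_k (Suc 0) f" and cpt: "compact (closure {p. f p \<noteq> 0})"
  obtains B where "B \<ge> 0" "\<And>x. \<bar>f x\<bar> \<le> B" "B-lipschitz_on UNIV f"
    "\<And>b x. b \<in> Basis \<Longrightarrow> frechet_derivative f (at x) b \<noteq> 0 \<Longrightarrow> x \<in> closure {p. f p \<noteq> 0}"
proof -
  let ?K = "closure {p. f p \<noteq> 0}"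
  let ?D = "\<lambda>x. frechet_derivative f (at x)"
  have D: "(f has_derivative ?D x) (at x)" for x using C_k_SucD(1)[OF f] .
  have out: "?D x = (\<lambda>_. 0)" if "x \<notin> ?K" for x
  proof -
    have "((\<lambda>_. 0) has_derivative (\<lambda>_. 0)) (at x)" by simp
    then have "(f has_derivative (\<lambda>_. 0)) (at x)"
      by (rule has_derivative_transform_within_open[of _ _ _ _ "- ?K"])
        (use that closure_subset[of "{p. f p \<noteq> 0}"] in auto)
    then show ?thesis using frechet_derivative_at by metis
  qed
  have bd: "\<exists>B. \<forall>x. \<bar>g x\<bar> \<le> B" if "continuous_on UNIV g" "\<And>x. x \<notin> ?K \<Longrightarrow> g x = 0" for g :: "'a \<Rightarrow> real"
  proof -
    have "bounded (g ` ?K)"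
      using compact_imp_bounded[OF compact_continuous_image[OF continuous_on_subset[OF that(1)] cpt]] by auto
    then obtain B where "\<forall>x\<in>?K. \<bar>g x\<bar> \<le> B" by (auto simp: bounded_iff)
    then show ?thesis using that(2) by (intro exI[of _ "max B 0"]) (metis abs_zero max.cobounded2 max.coboundedI1)
  qed
  obtain B0 where B0: "\<And>x. \<bar>f x\<bar> \<le> B0"
    using bd[OF C_k_continuous[OF f]] closure_subset[of "{p. f p \<noteq> 0}"] by blast
  have "\<exists>B. \<forall>x. \<bar>?D x b\<bar> \<le> B" if "b \<in> Basis" for b
    using C_k_continuous[OF C_k_SucD(2)[OF f that]] out by (intro bd) auto
  then obtain B1 where B1: "\<And>b x. b \<in> Basis \<Longrightarrow> \<bar>?D x b\<bar> \<le> B1 b" by metis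
  define B2 where "B2 = (\<Sum>b\<in>Basis. B1 b)"
  have "onorm (?D x) \<le> B2" for x
  proof (rule onorm_le)
    fix h
    have lin: "linear (?D x)" using D has_derivative_linear by blast
    have "?D x h = ?D x (\<Sum>b\<in>Basis. (h \<bullet> b) *\<^sub>R b)" by (simp add: euclidean_representation)
    also have "\<dots> = (\<Sum>b\<in>Basis. (h \<bullet> b) * ?D x b)" by (simp add: linear_sum[OF lin] linear_scale[OF lin])
    finally have "norm (?D x h) \<le> (\<Sum>b\<in>Basis. \<bar>h \<bullet> b\<bar> * \<bar>?D x b\<bar>)"
      using sum_abs[of "\<lambda>b. (h \<bullet> b) * ?D x b" Basis] by (simp add: abs_mult)
    also have "\<dots> \<le> (\<Sum>b\<in>Basis. norm h * B1 b)"
      using B1 by (intro sum_mono mult_mono) (auto simp: Basis_le_norm)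
    finally show "norm (?D x h) \<le> B2 * norm h" by (simp add: B2_def sum_distrib_left mult.commute)
  qed
  then have lip: "norm (f x - f y) \<le> B2 * norm (x - y)" for x y
    using differentiable_bound[of UNIV f ?D B2 x y] D by auto
  define B where "B = max B0 B2"
  have "0 \<le> \<bar>f 0\<bar>" by simp
  then have B_nonneg: "B \<ge> 0" using B0[of 0] unfolding B_def by linarith
  moreover have "\<bar>f x\<bar> \<le> B" for x using B0[of x] by (simp add: B_def)
  moreover have "B-lipschitz_on UNIV f"
  proof (rule lipschitz_onI)
    show "dist (f x) (f y) \<le> B * dist x y" for x y
      using lip[of x y] mult_right_mono[of B2 B "norm (x - y)"] by (auto simp: dist_norm B_def)
  qed fact
  moreover have "x \<in> ?K" if "?D x b \<noteq> 0" for x b using out[of x] that by (cases "x \<in> ?K") auto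
  ultimately show thesis using that by blast
qed

lemma C_k_partial_compact_support:
  fixes f :: "'a::euclidean_space \<Rightarrow> real"
  assumes f: "C_k (Suc 0) f" and cpt: "compact (closure {p. f p \<noteq> 0})" and b: "b \<in> Basis"
  shows "compact (closure {p. frechet_derivative f (at p) b \<noteq> 0})"
proof -
  have "{p. frechet_derivative f (at p) b \<noteq> 0} \<subseteq> closure {p. f p \<noteq> 0}"
    using C_k_bounded_Lipschitz[OF f cpt] b by (metis (mono_tags, lifting) mem_Collect_eq subsetI)
  then have "closure {p. frechet_derivative f (at p) b \<noteq> 0} \<subseteq> closure {p. f p \<noteq> 0}"
    by (simp add: closure_minimal)
  then show ?thesis using cpt by (meson closed_closure bounded_subset compact_eq_bounded_closed)
qed

text \<open>The integrand is affine in the velocity: P is the time derivative and Q the spatial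
  gradient of the test function. Both are partial derivatives of a compactly supported smooth
  function, hence bounded and Lipschitz, and the limit arguments use nothing else about the test
  function.\<close>

lemma test_function_representation:
  assumes "\<phi> \<in> test_functions T"
  obtains P :: "real \<times> 'a::euclidean_space \<Rightarrow> real" and Q B where
    "\<And>w t x. CE_integrand \<phi> w t x = P (t, x) + Q (t, x) \<bullet> w t x" "B \<ge> 0"
    "\<And>p. \<bar>P p\<bar> \<le> B" "\<And>p. norm (Q p) \<le> B" "B-lipschitz_on UNIV P" "B-lipschitz_on UNIV Q"
proof -
  let ?D = "\<lambda>p. frechet_derivative \<phi> (at p)"
  have C: "C_k k \<phi>" for k using assms by (auto simp: test_functions_def)
  have cpt: "compact (closure {p. \<phi> p \<noteq> 0})"
    using assms by (auto simp: test_functions_def)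
  have D: "(\<phi> has_derivative ?D p) (at p)" for p using C_k_SucD(1)[OF C] .
  have D1: "\<exists>B\<ge>0. (\<forall>p. \<bar>?D p b\<bar> \<le> B) \<and> B-lipschitz_on UNIV (\<lambda>p. ?D p b)" if "b \<in> Basis" for b
    using C_k_bounded_Lipschitz[OF C_k_SucD(2)[OF C[of "Suc (Suc 0)"] that]
      C_k_partial_compact_support[OF C cpt that]] by metis
  define P where "P p = ?D p (1, 0)" for p
  define Q where "Q p = (\<Sum>b\<in>Basis. ?D p (0, b) *\<^sub>R b)" for p
  have Pd: "deriv (\<lambda>s. \<phi> (s, x)) t = P (t, x)" for t x
  proof -
    have "((\<lambda>s. (s, x)) has_derivative (\<lambda>h. (h, 0))) (at t)"
      by (auto intro!: derivative_eq_intros)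
    from has_derivative_compose[OF this D]
    have "((\<lambda>s. \<phi> (s, x)) has_derivative (\<lambda>h. ?D (t, x) (h, 0))) (at t)" .
    moreover have "?D (t, x) (h, 0) = P (t, x) * h" for h
      using linear_scale[OF has_derivative_linear[OF D], of "(t,x)" h "(1,0)"]
      by (simp add: mult.commute P_def)
    ultimately have "((\<lambda>s. \<phi> (s, x)) has_real_derivative P (t, x)) (at t)"
      unfolding has_field_derivative_def by simp
    then show ?thesis by (rule DERIV_imp_deriv)
  qed
  have Qd: "grad (\<lambda>y. \<phi> (t, y)) x = Q (t, x)" for t x
  proof -
    have "((\<lambda>y. (t, y)) has_derivative (\<lambda>h. (0, h))) (at x)"
      by (auto intro!: derivative_eq_intros)
    from has_derivative_compose[OF this D]
    have "((\<lambda>y. \<phi> (t, y)) has_derivative (\<lambda>h. ?D (t, x) (0, h))) (at x)" .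
    from grad_eq[OF has_derivative_GDERIV[OF this]] show ?thesis by (simp add: Q_def)
  qed
  obtain BP where BP: "BP \<ge> 0" "\<And>p. \<bar>P p\<bar> \<le> BP" "BP-lipschitz_on UNIV P"
    using D1[of "(1, 0)"] by (auto simp: P_def [abs_def] Basis_prod_def)
  have "\<exists>B\<ge>0. (\<forall>p. \<bar>?D p (0, b)\<bar> \<le> B) \<and> B-lipschitz_on UNIV (\<lambda>p. ?D p (0, b))" if "b \<in> Basis" for b
    using D1[of "(0, b)"] that by (auto simp: Basis_prod_def)
  then obtain b where b: "\<And>c. c \<in> Basis \<Longrightarrow> b c \<ge> 0" "\<And>c p. c \<in> Basis \<Longrightarrow> \<bar>?D p (0, c)\<bar> \<le> b c"
      "\<And>c. c \<in> Basis \<Longrightarrow> (b c)-lipschitz_on UNIV (\<lambda>p. ?D p (0, c))" by metis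
  define BQ where "BQ = (\<Sum>c\<in>Basis. b c)"
  have Qn: "norm (Q p) \<le> BQ" for p
    unfolding Q_def BQ_def by (rule order_trans[OF norm_sum]) (auto intro!: sum_mono b)
  have Ql: "norm (Q p - Q q) \<le> BQ * norm (p - q)" for p q
  proof -
    have "norm (Q p - Q q) = norm (\<Sum>c\<in>Basis. (?D p (0, c) - ?D q (0, c)) *\<^sub>R c)"
      by (simp add: Q_def sum_subtractf scaleR_diff_left)
    also have "\<dots> \<le> (\<Sum>c\<in>Basis. \<bar>?D p (0, c) - ?D q (0, c)\<bar>)"
      by (rule order_trans[OF norm_sum]) (auto intro!: sum_mono)
    also have "\<dots> \<le> (\<Sum>c\<in>Basis. b c * norm (p - q))"
      using lipschitz_onD[OF b(3)] by (intro sum_mono) (auto simp: dist_norm dist_real_def)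
    finally show ?thesis by (simp add: BQ_def sum_distrib_right)
  qed
  have BQ: "BQ \<ge> 0" unfolding BQ_def using b(1) by (rule sum_nonneg)
  have "(max BP BQ)-lipschitz_on UNIV P" using BP(3) by (rule lipschitz_on_le) auto
  moreover have "BQ-lipschitz_on UNIV Q"
    using Ql BQ by (intro lipschitz_onI) (auto simp: dist_norm)
  then have "(max BP BQ)-lipschitz_on UNIV Q" by (rule lipschitz_on_le) auto
  moreover have "\<bar>P p\<bar> \<le> max BP BQ" for p using BP(2)[of p] by linarith
  moreover have "norm (Q p) \<le> max BP BQ" for p using Qn[of p] by linarith
  moreover have "max BP BQ \<ge> 0" using BQ by linarith
  ultimately show thesis using that[of P Q "max BP BQ"] by (simp add: CE_integrand_def Pd Qd)
qed

text \<open>Separated test functions turn the continuity equation into a scalar statement about the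
  weak time derivative of the integral of \<open>\<psi>\<close>.\<close>

lemma test_function_product:
  fixes \<psi> :: "'a::euclidean_space \<Rightarrow> real"
  assumes \<eta>: "\<And>k. Cr_k k UNIV \<eta>" "\<And>t. t \<notin> {a..b} \<Longrightarrow> \<eta> t = 0" "0 < a" "b < T"
    and \<psi>: "\<And>k. C_k k \<psi>" "\<And>x. norm x > R \<Longrightarrow> \<psi> x = 0"
  shows "(\<lambda>p. \<eta> (fst p) * \<psi> (snd p)) \<in> test_functions T"
    and "(\<eta> has_real_derivative d) (at t) \<Longrightarrow>
       CE_integrand (\<lambda>p. \<eta> (fst p) * \<psi> (snd p)) w t x = d * \<psi> x + \<eta> t * (grad \<psi> x \<bullet> w t x)"
proof -
  let ?\<phi> = "\<lambda>p. \<eta> (fst p) * \<psi> (snd p)"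
  have sub: "{p. ?\<phi> p \<noteq> 0} \<subseteq> {a..b} \<times> cball 0 R"
  proof
    fix p assume "p \<in> {p. ?\<phi> p \<noteq> 0}"
    then have "\<eta> (fst p) \<noteq> 0" "\<psi> (snd p) \<noteq> 0" by auto
    with \<eta>(2)[of "fst p"] \<psi>(2)[of "snd p"] have "fst p \<in> {a..b}" "snd p \<in> cball 0 R"
      by auto force
    then show "p \<in> {a..b} \<times> cball 0 R" by (cases p) auto
  qed
  have cpt: "compact ({a..b} \<times> cball (0::'a) R)" by (intro compact_Times) auto
  have cl: "closure {p. ?\<phi> p \<noteq> 0} \<subseteq> {a..b} \<times> cball 0 R"
    by (rule closure_minimal[OF sub compact_imp_closed[OF cpt]])
  have "C_k k ?\<phi>" for k
    using C_k_mult[OF C_k_compose[OF C_k_bounded_linear[OF bounded_linear_fst] \<eta>(1)]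
        C_k_compose_linear[OF bounded_linear_snd \<psi>(1)]] by simp
  moreover have "compact (closure {p. ?\<phi> p \<noteq> 0})"
    using bounded_subset[OF compact_imp_bounded[OF cpt] sub] by simp
  moreover have "closure {p. ?\<phi> p \<noteq> 0} \<subseteq> {0<..<T} \<times> UNIV"
    using cl \<eta>(3,4) by force
  ultimately show "?\<phi> \<in> test_functions T" by (simp add: test_functions_def)
  assume "(\<eta> has_real_derivative d) (at t)"
  then have "((\<lambda>s. \<eta> s * \<psi> x) has_real_derivative d * \<psi> x) (at t)"
    by (auto intro!: derivative_eq_intros)
  moreover have "GDERIV (\<lambda>y. \<eta> t * \<psi> y) x :> \<eta> t *\<^sub>R grad \<psi> x"
  proof -
    have "(\<psi> has_derivative (\<lambda>h. h \<bullet> grad \<psi> x)) (at x)"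
      using C_k_GDERIV[OF \<psi>(1)] unfolding gderiv_def .
    from has_derivative_mult_right[OF this, of "\<eta> t"]
    show ?thesis unfolding gderiv_def by simp
  qed
  ultimately show "CE_integrand ?\<phi> w t x = d * \<psi> x + \<eta> t * (grad \<psi> x \<bullet> w t x)"
    unfolding CE_integrand_def by (simp add: DERIV_imp_deriv grad_eq)
qed

section \<open>The Wasserstein distance\<close>

lemma Prob_simps:
  assumes "\<mu> \<in> Prob"
  shows "sets \<mu> = sets borel" "space \<mu> = UNIV" "prob_space \<mu>" "measurable \<mu> N = measurable borel N"
  using assms sets_eq_imp_space_eq[of \<mu> borel] by (auto simp: Prob_def cong: measurable_cong_sets)

lemma closed_msupp: "closed (msupp \<mu>)"
proof -
  have "- msupp \<mu> = \<Union>{G. open G \<and> \<not> emeasure \<mu> G > 0}"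
    unfolding msupp_def by auto
  then show ?thesis unfolding closed_def by auto
qed

text \<open>The complement of the support is a union of open null sets, and the Lindelof property
  reduces it to countably many.\<close>

lemma AE_msupp: assumes "\<mu> \<in> Prob" shows "AE x in \<mu>. x \<in> msupp \<mu>"
proof -
  let ?F = "{G. open G \<and> \<not> emeasure \<mu> G > 0}"
  obtain F' where F': "F' \<subseteq> ?F" "countable F'" "\<Union>F' = \<Union>?F"
    using Lindelof[of ?F] by auto
  have eq: "- msupp \<mu> = \<Union>?F" unfolding msupp_def by auto
  have "(\<Union>G\<in>F'. G) \<in> null_sets \<mu>"
    using F'(1,2) Prob_simps(1)[OF assms] by (intro null_sets_UN') (auto simp: null_sets_def)
  then have "- msupp \<mu> \<in> null_sets \<mu>" using eq F'(3) by simp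
  then show ?thesis by (rule AE_I') auto
qed

text \<open>Closedness matters for the converse: the complement of K is then an open null set around
  each of its points.\<close>

lemma Prob_on_iff:
  assumes "closed K" shows "\<mu> \<in> Prob_on K \<longleftrightarrow> \<mu> \<in> Prob \<and> (AE x in \<mu>. x \<in> K)"
proof
  assume "\<mu> \<in> Prob_on K" then show "\<mu> \<in> Prob \<and> (AE x in \<mu>. x \<in> K)"
    using AE_msupp[of \<mu>] by (auto simp: Prob_on_def)
next
  assume *: "\<mu> \<in> Prob \<and> (AE x in \<mu>. x \<in> K)"
  then have "emeasure \<mu> (- K) = 0"
    using assms Prob_simps[of \<mu>] by (subst AE_iff_measurable[symmetric, where P = "\<lambda>x. x \<in> K"]) auto
  then have "msupp \<mu> \<subseteq> K" using assms unfolding msupp_def by force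
  then show "\<mu> \<in> Prob_on K" using * by (simp add: Prob_on_def)
qed

lemma Prob_onD:
  assumes "\<mu> \<in> Prob_on K"
  shows "\<mu> \<in> Prob" "AE x in \<mu>. x \<in> K"
  using assms AE_msupp[of \<mu>] by (auto simp: Prob_on_def)

lemma Prob_on_Prob_c: "compact K \<Longrightarrow> \<mu> \<in> Prob_on K \<Longrightarrow> \<mu> \<in> Prob_c"
  unfolding Prob_on_def Prob_c_def using closed_msupp[of \<mu>]
  by (metis (mono_tags, lifting) bounded_subset compact_eq_bounded_closed mem_Collect_eq)

lemma Prob_on_mono: "K \<subseteq> K' \<Longrightarrow> Prob_on K \<subseteq> Prob_on K'"
  by (auto simp: Prob_on_def)

lemma Prob_on_cball_mono: "R \<le> R' \<Longrightarrow> \<mu> \<in> Prob_on (cball 0 R) \<Longrightarrow> \<mu> \<in> Prob_on (cball 0 R')"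
  by (rule subsetD[OF Prob_on_mono[OF subset_cball]])

lemma Prob_c_D:
  assumes "\<mu> \<in> Prob_c" shows "\<mu> \<in> Prob" "compact (msupp \<mu>)" "\<mu> \<in> Prob_on (msupp \<mu>)"
  using assms by (auto simp: Prob_c_def Prob_on_def)

lemma Prob_c_cball:
  assumes "\<mu> \<in> Prob_c" obtains R where "R > 0" "\<mu> \<in> Prob_on (cball 0 R)"
proof -
  obtain R where "R > 0" "msupp \<mu> \<subseteq> cball 0 R"
    using compact_imp_bounded[OF Prob_c_D(2)[OF assms]] bounded_pos[of "msupp \<mu>"] by (auto simp: subset_iff)
  then show thesis using that[of R] assms by (auto simp: Prob_on_def Prob_c_def)
qed

lemma Prob_on_cball2:
  assumes "\<mu> \<in> Prob_c" "\<nu> \<in> Prob_c"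
  obtains R where "R > 0" "\<mu> \<in> Prob_on (cball 0 R)" "\<nu> \<in> Prob_on (cball 0 R)"
proof -
  obtain R R' where "R > 0" "\<mu> \<in> Prob_on (cball 0 R)" "R' > 0" "\<nu> \<in> Prob_on (cball 0 R')"
    using assms Prob_c_cball by metis
  then show thesis
    using that[of "max R R'"] Prob_on_cball_mono[of R "max R R'" \<mu>] Prob_on_cball_mono[of R' "max R R'" \<nu>]
    by (simp add: less_max_iff_disj)
qed

lemma integrable_Prob_on_bounded:
  fixes f :: "'a::euclidean_space \<Rightarrow> 'b::{banach, second_countable_topology}"
  assumes "\<mu> \<in> Prob_on K" "f \<in> borel_measurable borel" "\<And>x. x \<in> K \<Longrightarrow> norm (f x) \<le> B"
  shows "integrable \<mu> f"
proof -
  interpret prob_space \<mu> using Prob_simps(3)[OF Prob_onD(1)[OF assms(1)]] .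
  show ?thesis
  proof (rule integrable_const_bound)
    show "AE x in \<mu>. norm (f x) \<le> B" using Prob_onD(2)[OF assms(1)] assms(3) by auto
    show "f \<in> borel_measurable \<mu>" using assms(2) by (simp add: Prob_simps(4)[OF Prob_onD(1)[OF assms(1)]])
  qed
qed

lemma integral_Prob_on_le:
  fixes f :: "'a::euclidean_space \<Rightarrow> real"
  assumes "\<mu> \<in> Prob_on K" "integrable \<mu> f" "\<And>x. x \<in> K \<Longrightarrow> f x \<le> B"
  shows "(\<integral>x. f x \<partial>\<mu>) \<le> B"
proof -
  interpret prob_space \<mu> using Prob_simps(3)[OF Prob_onD(1)[OF assms(1)]] .
  have "(\<integral>x. f x \<partial>\<mu>) \<le> (\<integral>x. B \<partial>\<mu>)"
    using Prob_onD(2)[OF assms(1)] assms by (intro integral_mono_AE) auto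
  then show ?thesis by (simp add: prob_space)
qed

lemma norm_integral_Prob_on_le:
  fixes f :: "'a::euclidean_space \<Rightarrow> 'b::{banach, second_countable_topology}"
  assumes "\<mu> \<in> Prob_on K" "integrable \<mu> f" "\<And>x. x \<in> K \<Longrightarrow> norm (f x) \<le> B"
  shows "norm (\<integral>x. f x \<partial>\<mu>) \<le> B"
  by (rule order_trans[OF integral_norm_bound integral_Prob_on_le[OF assms(1) integrable_norm[OF assms(2)] assms(3)]])

lemma integrable_Prob_on:
  fixes f :: "'a::euclidean_space \<Rightarrow> 'b::{banach, second_countable_topology}"
  assumes "\<mu> \<in> Prob_on K" "compact K" "continuous_on UNIV f"
  shows "integrable \<mu> f"
proof -
  have "bounded (f ` K)"
    using compact_imp_bounded[OF compact_continuous_image[OF continuous_on_subset[OF assms(3)] assms(2)]] by auto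
  then obtain B where "\<forall>x\<in>K. norm (f x) \<le> B" by (auto simp: bounded_iff)
  then show ?thesis
    using integrable_Prob_on_bounded[OF assms(1) borel_measurable_continuous_onI[OF assms(3)]] by auto
qed

lemma integrable_Prob_c:
  fixes f :: "'a::euclidean_space \<Rightarrow> 'b::{banach, second_countable_topology}"
  assumes "\<mu> \<in> Prob_c" "continuous_on UNIV f"
  shows "integrable \<mu> f"
  using integrable_Prob_on[OF Prob_c_D(3,2) assms(2)] assms(1) by simp

section \<open>Transport plans and elementary bounds\<close>

lemma transport_plansD:
  fixes \<mu> \<nu> :: "'a::euclidean_space measure"
  assumes "\<gamma> \<in> transport_plans \<mu> \<nu>"
  shows "prob_space \<gamma>" "sets \<gamma> = sets borel" "fst \<in> measurable \<gamma> borel" "snd \<in> measurable \<gamma> borel"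
    "distr \<gamma> borel fst = \<mu>" "distr \<gamma> borel snd = \<nu>"
proof -
  show g: "prob_space \<gamma>" "sets \<gamma> = sets borel" "distr \<gamma> borel fst = \<mu>" "distr \<gamma> borel snd = \<nu>"
    using assms by (auto simp: transport_plans_def Prob_def)
  have "fst \<in> borel_measurable (borel :: ('a \<times> 'a) measure)" "snd \<in> borel_measurable (borel :: ('a \<times> 'a) measure)"
    by (intro borel_measurable_continuous_onI continuous_intros)+
  then show "fst \<in> measurable \<gamma> borel" "snd \<in> measurable \<gamma> borel"
    using measurable_cong_sets[OF g(2) refl] by blast+
qed

lemma transport_plan_AE:
  assumes "\<gamma> \<in> transport_plans \<mu> \<nu>" "AE x in \<mu>. P x" "AE y in \<nu>. Q y"
  shows "AE p in \<gamma>. P (fst p) \<and> Q (snd p)"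
proof -
  note pl = transport_plansD[OF assms(1)]
  have "AE p in \<gamma>. P (fst p)" using assms(2) AE_distrD[OF pl(3)] pl(5) by metis
  moreover have "AE p in \<gamma>. Q (snd p)" using assms(3) AE_distrD[OF pl(4)] pl(6) by metis
  ultimately show ?thesis by auto
qed

lemma transport_plan_integrable:
  fixes \<mu> \<nu> :: "'a::euclidean_space measure"
  assumes "\<gamma> \<in> transport_plans \<mu> \<nu>" "\<mu> \<in> Prob_c" "\<nu> \<in> Prob_c"
  shows "integrable \<gamma> (\<lambda>(x, y). norm (x - y))"
proof -
  note pl = transport_plansD[OF assms(1)]
  interpret prob_space \<gamma> by (rule pl)
  obtain R where R: "\<mu> \<in> Prob_on (cball 0 R)" "\<nu> \<in> Prob_on (cball 0 R)"
    using Prob_on_cball2[OF assms(2,3)] by metis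
  have ae: "AE p in \<gamma>. fst p \<in> cball 0 R \<and> snd p \<in> cball 0 R"
    using transport_plan_AE[OF assms(1) Prob_onD(2)[OF R(1)] Prob_onD(2)[OF R(2)]] .
  show ?thesis
  proof (rule integrable_const_bound)
    show "AE p in \<gamma>. norm (case p of (x, y) \<Rightarrow> norm (x - y)) \<le> R + R"
      using ae
    proof (rule eventually_mono)
      fix p :: "'a \<times> 'a" assume "fst p \<in> cball 0 R \<and> snd p \<in> cball 0 R"
      then show "norm (case p of (x, y) \<Rightarrow> norm (x - y)) \<le> R + R"
        using norm_triangle_ineq4[of "fst p" "snd p"] by (auto simp: split_beta)
    qed
    have "(\<lambda>p. norm (fst p - snd p)) \<in> borel_measurable \<gamma>" using pl(3,4) by measurable
    then show "(\<lambda>(x, y). norm (x - y)) \<in> borel_measurable \<gamma>" by (simp add: split_beta)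
  qed
qed

lemma W1_le_plan:
  assumes "\<gamma> \<in> transport_plans \<mu> \<nu>" shows "W1 \<mu> \<nu> \<le> (\<integral>(x, y). norm (x - y) \<partial>\<gamma>)"
  unfolding W1_def
proof (rule cINF_lower[OF _ assms])
  show "bdd_below ((\<lambda>\<gamma>. \<integral>(x, y). norm (x - y) \<partial>\<gamma>) ` transport_plans \<mu> \<nu>)"
    by (rule bdd_belowI[of _ 0]) (auto intro!: integral_nonneg_AE)
qed

lemma coupling_transport_plan:
  fixes X Y :: "'w \<Rightarrow> 'a::euclidean_space"
  assumes "prob_space M" "X \<in> borel_measurable M" "Y \<in> borel_measurable M"
  shows "distr M borel (\<lambda>\<omega>. (X \<omega>, Y \<omega>)) \<in> transport_plans (distr M borel X) (distr M borel Y)"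
proof -
  have m: "(\<lambda>\<omega>. (X \<omega>, Y \<omega>)) \<in> borel_measurable M"
    using assms(2,3) by (rule borel_measurable_Pair)
  interpret prob_space M by fact
  have f: "fst \<in> borel_measurable (borel :: ('a \<times> 'a) measure)" "snd \<in> borel_measurable (borel :: ('a \<times> 'a) measure)"
    by (auto intro!: borel_measurable_continuous_onI continuous_intros)
  show ?thesis unfolding transport_plans_def Prob_def
    using f m by (auto intro!: prob_space_distr simp: distr_distr o_def)
qed

lemma W1_le_coupling:
  fixes X Y :: "'w \<Rightarrow> 'a::euclidean_space"
  assumes "prob_space M" "X \<in> borel_measurable M" "Y \<in> borel_measurable M"
  shows "W1 (distr M borel X) (distr M borel Y) \<le> (\<integral>\<omega>. norm (X \<omega> - Y \<omega>) \<partial>M)"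
proof -
  have m: "(\<lambda>\<omega>. (X \<omega>, Y \<omega>)) \<in> borel_measurable M"
    using assms(2,3) by (rule borel_measurable_Pair)
  have "(\<lambda>p. norm (fst p - snd p)) \<in> borel_measurable (borel :: ('a \<times> 'a) measure)"
    by (intro borel_measurable_continuous_onI continuous_intros)
  then show ?thesis
    using W1_le_plan[OF coupling_transport_plan[OF assms]] integral_distr[OF m, of "\<lambda>(x, y). norm (x - y)"]
    by (simp add: split_beta)
qed

lemma Prob_distr_id: "\<mu> \<in> Prob \<Longrightarrow> distr \<mu> borel (\<lambda>x. x) = \<mu>"
  by (rule distr_id2) (simp add: Prob_simps)

text \<open>The product measure is a plan. Nonemptiness is what lets lower bounds pass to the
  infimum that defines \<open>W1\<close>.\<close>

lemma transport_plans_nonempty: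
  fixes \<mu> \<nu> :: "'a::euclidean_space measure"
  assumes "\<mu> \<in> Prob" "\<nu> \<in> Prob" shows "transport_plans \<mu> \<nu> \<noteq> {}"
proof -
  interpret m: prob_space \<mu> using assms Prob_simps(3) by blast
  interpret n: prob_space \<nu> using assms Prob_simps(3) by blast
  interpret p: pair_prob_space \<mu> \<nu> ..
  have s: "sets (\<mu> \<Otimes>\<^sub>M \<nu>) = sets borel"
    using sets_pair_measure_cong[OF Prob_simps(1)[OF assms(1)] Prob_simps(1)[OF assms(2)]] borel_prod by metis
  have [simp]: "distr (\<mu> \<Otimes>\<^sub>M \<nu>) borel fst = \<mu>"
  proof -
    have "distr (\<mu> \<Otimes>\<^sub>M \<nu>) borel fst = distr (\<mu> \<Otimes>\<^sub>M \<nu>) \<mu> fst"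
      using Prob_simps(1)[OF assms(1)] by (intro distr_cong) auto
    then show ?thesis using n.distr_pair_fst by simp
  qed
  have [simp]: "distr (\<mu> \<Otimes>\<^sub>M \<nu>) borel snd = \<nu>"
  proof (rule measure_eqI)
    fix A assume "A \<in> sets (distr (\<mu> \<Otimes>\<^sub>M \<nu>) borel snd)"
    then have A: "A \<in> sets \<nu>" using Prob_simps(1)[OF assms(2)] by simp
    have "snd -` A \<inter> space (\<mu> \<Otimes>\<^sub>M \<nu>) = space \<mu> \<times> A"
      using sets.sets_into_space[OF A] by (auto simp: space_pair_measure)
    moreover have "snd \<in> measurable (\<mu> \<Otimes>\<^sub>M \<nu>) borel"
      using measurable_snd[of \<mu> \<nu>] Prob_simps(1)[OF assms(2)] by (simp cong: measurable_cong_sets)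
    ultimately show "emeasure (distr (\<mu> \<Otimes>\<^sub>M \<nu>) borel snd) A = emeasure \<nu> A"
      using A Prob_simps(1)[OF assms(2)]
      by (simp add: emeasure_distr n.emeasure_pair_measure_Times m.emeasure_space_1)
  qed (simp add: Prob_simps[OF assms(2)])
  have "\<mu> \<Otimes>\<^sub>M \<nu> \<in> transport_plans \<mu> \<nu>"
    unfolding transport_plans_def Prob_def using s p.prob_space_axioms by simp
  then show ?thesis by auto
qed

lemma W1_nonneg: "\<mu> \<in> Prob \<Longrightarrow> \<nu> \<in> Prob \<Longrightarrow> 0 \<le> W1 \<mu> \<nu>"
  unfolding W1_def by (rule cINF_greatest[OF transport_plans_nonempty]) (auto intro!: integral_nonneg_AE)

lemma W1_refl: assumes "\<mu> \<in> Prob" shows "W1 \<mu> \<mu> = 0"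
proof -
  have "W1 (distr \<mu> borel (\<lambda>x. x)) (distr \<mu> borel (\<lambda>x. x)) \<le> (\<integral>x. norm (x - x) \<partial>\<mu>)"
    using assms by (intro W1_le_coupling) (auto simp: Prob_simps)
  then show ?thesis using W1_nonneg[OF assms assms] by (simp add: Prob_distr_id[OF assms])
qed

text \<open>The easy half of Kantorovich duality. A Lipschitz bound on K is enough because every
  plan between measures on K is concentrated on the square of K.\<close>

lemma W1_Lipschitz_bound:
  fixes f :: "'a::euclidean_space \<Rightarrow> real"
  assumes "\<mu> \<in> Prob_on K" "\<nu> \<in> Prob_on K" "compact K" and f: "f \<in> borel_measurable borel"
    "L-lipschitz_on K f"
  shows "\<bar>(\<integral>x. f x \<partial>\<mu>) - (\<integral>x. f x \<partial>\<nu>)\<bar> \<le> L * W1 \<mu> \<nu>"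
\<comment> \<open>For L > 0 the estimate is divided by L in order to pass through the infimum over
  plans; for L = 0 the function is constant on K.\<close>
proof (cases "L = 0")
  case True
  define c where "c = f (SOME x. x \<in> K)"
  have c: "f x = c" if "x \<in> K" for x
    using lipschitz_onD[OF f(2) that someI_ex[of "\<lambda>x. x \<in> K"]] that True by (auto simp: c_def)
  have "(\<integral>x. f x \<partial>\<mu>) = c" if \<mu>: "\<mu> \<in> Prob_on K" for \<mu>
  proof -
    interpret prob_space \<mu> using Prob_simps(3)[OF Prob_onD(1)[OF \<mu>]] .
    have "(\<integral>x. f x \<partial>\<mu>) = (\<integral>x. c \<partial>\<mu>)"
      using Prob_onD(2)[OF \<mu>] c f(1)
      by (intro integral_cong_AE) (auto simp: Prob_simps(4)[OF Prob_onD(1)[OF \<mu>]])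
    then show ?thesis by (simp add: prob_space)
  qed
  then show ?thesis using assms True by simp
next
  case False
  have L: "L > 0" using lipschitz_on_nonneg[OF f(2)] False by simp
  have pc: "\<mu> \<in> Prob_c" "\<nu> \<in> Prob_c" using assms Prob_on_Prob_c by blast+
  have "bounded (f ` K)"
    using compact_imp_bounded[OF compact_continuous_image[OF lipschitz_on_continuous_on[OF f(2)] assms(3)]] by auto
  then obtain B where "\<forall>x\<in>K. norm (f x) \<le> B" by (auto simp: bounded_iff)
  then have int: "integrable \<mu> f" "integrable \<nu> f"
    using integrable_Prob_on_bounded[of _ K f B] assms by auto
  have "\<bar>(\<integral>x. f x \<partial>\<mu>) - (\<integral>x. f x \<partial>\<nu>)\<bar> / L \<le> (\<integral>(x, y). norm (x - y) \<partial>\<gamma>)"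
    if \<gamma>: "\<gamma> \<in> transport_plans \<mu> \<nu>" for \<gamma>
  proof -
    note pl = transport_plansD[OF \<gamma>]
    have i1: "integrable \<gamma> (\<lambda>p. f (fst p))" "(\<integral>x. f x \<partial>\<mu>) = (\<integral>p. f (fst p) \<partial>\<gamma>)"
      using int(1) unfolding pl(5)[symmetric] using integrable_distr_eq[OF pl(3) f(1)] integral_distr[OF pl(3) f(1)] by auto
    have i2: "integrable \<gamma> (\<lambda>p. f (snd p))" "(\<integral>x. f x \<partial>\<nu>) = (\<integral>p. f (snd p) \<partial>\<gamma>)"
      using int(2) unfolding pl(6)[symmetric] using integrable_distr_eq[OF pl(4) f(1)] integral_distr[OF pl(4) f(1)] by auto
    have "\<bar>(\<integral>x. f x \<partial>\<mu>) - (\<integral>x. f x \<partial>\<nu>)\<bar> = \<bar>\<integral>p. f (fst p) - f (snd p) \<partial>\<gamma>\<bar>"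
      using i1 i2 by simp
    also have "\<dots> \<le> (\<integral>p. \<bar>f (fst p) - f (snd p)\<bar> \<partial>\<gamma>)" by (rule integral_abs_bound)
    also have "\<dots> \<le> (\<integral>p. L * (case p of (x, y) \<Rightarrow> norm (x - y)) \<partial>\<gamma>)"
    proof (rule integral_mono_AE)
      show "integrable \<gamma> (\<lambda>p. \<bar>f (fst p) - f (snd p)\<bar>)" using i1 i2 by simp
      show "integrable \<gamma> (\<lambda>p. L * (case p of (x, y) \<Rightarrow> norm (x - y)))"
        using transport_plan_integrable[OF \<gamma> pc] by simp
      show "AE p in \<gamma>. \<bar>f (fst p) - f (snd p)\<bar> \<le> L * (case p of (x, y) \<Rightarrow> norm (x - y))"
        using transport_plan_AE[OF \<gamma> Prob_onD(2)[OF assms(1)] Prob_onD(2)[OF assms(2)]]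
      proof (rule eventually_mono)
        fix p assume "fst p \<in> K \<and> snd p \<in> K"
        then show "\<bar>f (fst p) - f (snd p)\<bar> \<le> L * (case p of (x, y) \<Rightarrow> norm (x - y))"
          using lipschitz_onD[OF f(2), of "fst p" "snd p"] by (simp add: split_beta dist_norm)
      qed
    qed
    also have "\<dots> = L * (\<integral>(x, y). norm (x - y) \<partial>\<gamma>)" by simp
    finally show ?thesis using L by (simp add: divide_le_eq mult.commute)
  qed
  then have "\<bar>(\<integral>x. f x \<partial>\<mu>) - (\<integral>x. f x \<partial>\<nu>)\<bar> / L \<le> W1 \<mu> \<nu>"
    unfolding W1_def using assms by (intro cINF_greatest[OF transport_plans_nonempty]) (auto dest: Prob_onD(1))
  then show ?thesis using L by (simp add: divide_le_eq mult.commute)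
qed

lemma W1_Lipschitz_bound_UNIV:
  fixes f :: "'a::euclidean_space \<Rightarrow> real"
  assumes "\<mu> \<in> Prob_c" "\<nu> \<in> Prob_c" "L-lipschitz_on UNIV f"
  shows "\<bar>(\<integral>x. f x \<partial>\<mu>) - (\<integral>x. f x \<partial>\<nu>)\<bar> \<le> L * W1 \<mu> \<nu>"
proof -
  obtain R where R: "\<mu> \<in> Prob_on (cball 0 R)" "\<nu> \<in> Prob_on (cball 0 R)"
    using Prob_on_cball2[OF assms(1,2)] by metis
  show ?thesis
    using R lipschitz_on_subset[OF assms(3)] borel_measurable_continuous_onI[OF lipschitz_on_continuous_on[OF assms(3)]]
    by (intro W1_Lipschitz_bound[where K = "cball 0 R"]) auto
qed

section \<open>Kantorovich duality\<close>

definition fun_linear :: "(('i \<Rightarrow> real) \<Rightarrow> real) \<Rightarrow> bool" where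
  "fun_linear f \<longleftrightarrow> (\<forall>r s x y. f (\<lambda>i. r * x i + s * y i) = r * f x + s * f y)"

lemma fun_linearD: "fun_linear f \<Longrightarrow> f (\<lambda>i. r * x i + s * y i) = r * f x + s * f y"
  by (simp add: fun_linear_def)

text \<open>Bartl's induction on the number of constraints.\<close>

lemma Farkas:
  fixes \<alpha> :: "'j \<Rightarrow> ('i \<Rightarrow> real) \<Rightarrow> real"
  assumes "finite J" "\<And>j. j \<in> J \<Longrightarrow> fun_linear (\<alpha> j)" "fun_linear \<gamma>"
    "\<And>x. (\<And>j. j \<in> J \<Longrightarrow> \<alpha> j x \<le> 0) \<Longrightarrow> \<gamma> x \<le> 0"
  shows "\<exists>l. (\<forall>j\<in>J. 0 \<le> l j) \<and> (\<forall>x. \<gamma> x = (\<Sum>j\<in>J. l j * \<alpha> j x))"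
  using assms
proof (induction J arbitrary: \<alpha> \<gamma> rule: finite_induct)
  case empty
  have "\<gamma> x = 0" for x
  proof -
    have "\<gamma> (\<lambda>i. (- 1) * x i + 0 * x i) = (- 1) * \<gamma> x + 0 * \<gamma> x"
      by (rule fun_linearD[OF empty.prems(2)])
    moreover have "\<gamma> (\<lambda>i. (- 1) * x i + 0 * x i) \<le> 0" "\<gamma> x \<le> 0" using empty.prems(3) by auto
    ultimately show ?thesis by simp
  qed
  then show ?case by simp
next
  case (insert k J)
  show ?case
  proof (cases "\<forall>x. (\<forall>j\<in>J. \<alpha> j x \<le> 0) \<longrightarrow> \<gamma> x \<le> 0")
    case True
    obtain l where l: "\<forall>j\<in>J. 0 \<le> l j" "\<forall>x. \<gamma> x = (\<Sum>j\<in>J. l j * \<alpha> j x)"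
      using insert.IH[of \<alpha> \<gamma>] insert.prems True by auto
    have "(\<Sum>j\<in>J. (l(k := 0)) j * \<alpha> j x) = (\<Sum>j\<in>J. l j * \<alpha> j x)" for x
      using insert.hyps by (intro sum.cong) auto
    then show ?thesis using l insert.hyps by (intro exI[of _ "l(k := 0)"]) auto
  next
    case False
    \<comment> \<open>This point satisfies the constraints in J but not the conclusion, so it must
      violate constraint k; z is x1 rescaled to \<open>\<alpha> k z = 1\<close>.\<close>
    then obtain x1 where x1: "\<And>j. j \<in> J \<Longrightarrow> \<alpha> j x1 \<le> 0" "\<gamma> x1 > 0" by force
    have kpos: "\<alpha> k x1 > 0" using insert.prems(3)[of x1] x1 by force
    define c where "c = 1 / \<alpha> k x1"
    define z where "z = (\<lambda>i. c * x1 i + 0 * x1 i)"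
    have c: "c > 0" using kpos by (simp add: c_def)
    have z: "f z = c * f x1" if "fun_linear f" for f
      unfolding z_def using fun_linearD[OF that, of c x1 0 x1] by simp
    have kz: "\<alpha> k z = 1" using z[of "\<alpha> k"] insert.prems(1) kpos by (simp add: c_def)
    have jz: "\<alpha> j z \<le> 0" if "j \<in> J" for j
      using z[of "\<alpha> j"] insert.prems(1) x1(1)[OF that] that c by (simp add: mult_nonneg_nonpos)
    have gz: "\<gamma> z > 0" using z[of \<gamma>] insert.prems(2) x1(2) c by simp
    \<comment> \<open>Projection along z onto the kernel of \<open>\<alpha> k\<close>: constraint k
      holds trivially at \<open>P x\<close>, so composition with P leaves only the constraints in
      J.\<close>
    define P where "P x = (\<lambda>i. 1 * x i + (- \<alpha> k x) * z i)" for x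
    have P: "f (P x) = f x - \<alpha> k x * f z" if "fun_linear f" for f x
      unfolding P_def using fun_linearD[OF that, of 1 x "- \<alpha> k x" z] by simp
    have lin': "fun_linear (\<lambda>x. f x - \<alpha> k x * f z)" if "fun_linear f" for f
      unfolding fun_linear_def
      by (simp add: fun_linearD[OF that] fun_linearD[OF insert.prems(1)[of k, simplified]] algebra_simps)
    have "\<exists>l. (\<forall>j\<in>J. 0 \<le> l j) \<and> (\<forall>x. \<gamma> x - \<alpha> k x * \<gamma> z = (\<Sum>j\<in>J. l j * (\<alpha> j x - \<alpha> k x * \<alpha> j z)))"
    proof (rule insert.IH)
      show "fun_linear (\<lambda>x. \<alpha> j x - \<alpha> k x * \<alpha> j z)" if "j \<in> J" for j
        using insert.prems(1)[of j] that by (intro lin') auto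
      show "fun_linear (\<lambda>x. \<gamma> x - \<alpha> k x * \<gamma> z)" using insert.prems(2) by (intro lin')
      fix x assume *: "\<And>j. j \<in> J \<Longrightarrow> \<alpha> j x - \<alpha> k x * \<alpha> j z \<le> 0"
      have "\<gamma> (P x) \<le> 0"
      proof (rule insert.prems(3))
        fix j assume "j \<in> insert k J"
        then show "\<alpha> j (P x) \<le> 0"
          using P[OF insert.prems(1)[of j]] * kz by auto
      qed
      then show "\<gamma> x - \<alpha> k x * \<gamma> z \<le> 0" using P[OF insert.prems(2)] by simp
    qed
    then obtain l where l: "\<forall>j\<in>J. 0 \<le> l j"
      "\<And>x. \<gamma> x - \<alpha> k x * \<gamma> z = (\<Sum>j\<in>J. l j * (\<alpha> j x - \<alpha> k x * \<alpha> j z))" by auto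
    \<comment> \<open>The multiplier forced by evaluating the desired identity at z. It is
      nonnegative because \<open>\<gamma> z\<close> is positive while
      \<open>\<alpha> j z \<le> 0\<close> for j in J.\<close>
    define lk where "lk = \<gamma> z - (\<Sum>j\<in>J. l j * \<alpha> j z)"
    have "(\<Sum>j\<in>J. l j * \<alpha> j z) \<le> 0" using l(1) jz by (intro sum_nonpos) (auto intro: mult_nonneg_nonpos)
    then have "lk \<ge> 0" using gz by (simp add: lk_def)
    moreover have "\<gamma> x = lk * \<alpha> k x + (\<Sum>j\<in>J. l j * \<alpha> j x)" for x
    proof -
      have "(\<Sum>j\<in>J. l j * (\<alpha> j x - \<alpha> k x * \<alpha> j z)) = (\<Sum>j\<in>J. l j * \<alpha> j x) - \<alpha> k x * (\<Sum>j\<in>J. l j * \<alpha> j z)"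
        by (simp add: right_diff_distrib sum_subtractf sum_distrib_left mult.left_commute)
      then show ?thesis using l(2)[of x] by (simp add: lk_def algebra_simps)
    qed
    moreover have "(\<Sum>j\<in>J. (l(k := lk)) j * \<alpha> j x) = (\<Sum>j\<in>J. l j * \<alpha> j x)" for x
      using insert.hyps by (intro sum.cong) auto
    ultimately show ?thesis using l(1) insert.hyps by (intro exI[of _ "l(k := lk)"]) auto
  qed
qed

text \<open>Farkas' lemma for the homogenised dual problem. The coordinates (0, i), (1, j) and (2,
  0) stand for the two potentials and a scale; \<open>None\<close> is the constraint that the scale
  is nonnegative, and \<open>Some (i, j)\<close> the potential inequality for the pair multiplied by
  the scale.\<close>

lemma finite_transport_duality:
  fixes a b :: "nat \<Rightarrow> real" and d :: "nat \<Rightarrow> nat \<Rightarrow> real"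
  assumes a: "\<And>i. i < n \<Longrightarrow> 0 \<le> a i" "(\<Sum>i<n. a i) = 1" and b: "\<And>i. i < n \<Longrightarrow> 0 \<le> b i" "(\<Sum>i<n. b i) = 1"
    and dual: "\<And>\<phi> \<psi>. (\<And>i j. i < n \<Longrightarrow> j < n \<Longrightarrow> \<phi> i - \<psi> j \<le> d i j) \<Longrightarrow> (\<Sum>i<n. a i * \<phi> i) - (\<Sum>j<n. b j * \<psi> j) \<le> C"
  shows "\<exists>p. (\<forall>i<n. \<forall>j<n. 0 \<le> p i j) \<and> (\<forall>i<n. (\<Sum>j<n. p i j) = a i) \<and> (\<forall>j<n. (\<Sum>i<n. p i j) = b j) \<and>
     (\<Sum>i<n. \<Sum>j<n. p i j * d i j) \<le> C"
proof -
  define J where "J = insert None (Some ` ({..<n} \<times> {..<n}))"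
  define \<alpha> :: "(nat \<times> nat) option \<Rightarrow> (nat \<times> nat \<Rightarrow> real) \<Rightarrow> real" where
    "\<alpha> o' x = (case o' of None \<Rightarrow> - x (2, 0) | Some (i, j) \<Rightarrow> x (0, i) - x (1, j) - d i j * x (2, 0))" for o' x
  define \<gamma> where "\<gamma> x = (\<Sum>i<n. a i * x (0, i)) - (\<Sum>j<n. b j * x (1, j)) - C * x (2, 0)" for x :: "nat \<times> nat \<Rightarrow> real"
  have "\<exists>l. (\<forall>j\<in>J. 0 \<le> l j) \<and> (\<forall>x. \<gamma> x = (\<Sum>j\<in>J. l j * \<alpha> j x))"
  proof (rule Farkas)
    show "finite J" by (simp add: J_def)
    show "fun_linear (\<alpha> j)" for j
      unfolding fun_linear_def \<alpha>_def by (auto split: option.split simp: algebra_simps)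
    show "fun_linear \<gamma>"
      unfolding fun_linear_def \<gamma>_def by (auto simp: algebra_simps sum.distrib sum_distrib_left)
    fix x assume x: "\<And>j. j \<in> J \<Longrightarrow> \<alpha> j x \<le> 0"
    have s: "x (2, 0) \<ge> 0" using x[of None] by (simp add: J_def \<alpha>_def)
    have ij: "x (0, i) - x (1, j) \<le> d i j * x (2, 0)" if "i < n" "j < n" for i j
      using x[of "Some (i, j)"] that by (auto simp: J_def \<alpha>_def)
    show "\<gamma> x \<le> 0"
    \<comment> \<open>Scale zero is out of reach of the dual hypothesis. There the constraints read
      \<open>x (0, i) \<le> x (1, j)\<close>, and averaging them with weights
      \<open>a i * b j\<close> settles the case.\<close>
    proof (cases "x (2, 0) = 0")
      case True
      have "(\<Sum>i<n. a i * x (0, i)) = (\<Sum>i<n. \<Sum>j<n. a i * b j * x (0, i))"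
        by (simp add: sum_distrib_left[symmetric] sum_distrib_right[symmetric] b)
      moreover have "(\<Sum>j<n. b j * x (1, j)) = (\<Sum>i<n. \<Sum>j<n. a i * b j * x (1, j))"
        by (subst sum.swap) (simp add: sum_distrib_left[symmetric] sum_distrib_right[symmetric] a)
      ultimately have "\<gamma> x = (\<Sum>i<n. \<Sum>j<n. a i * b j * (x (0, i) - x (1, j)))"
        by (simp add: \<gamma>_def True right_diff_distrib sum_subtractf)
      also have "\<dots> \<le> 0" using ij True a(1) b(1)
        by (intro sum_nonpos) (auto intro!: mult_nonneg_nonpos)
      finally show ?thesis .
    next
      case False
      with s have s: "x (2, 0) > 0" by simp
      have "(\<Sum>i<n. a i * (x (0, i) / x (2, 0))) - (\<Sum>j<n. b j * (x (1, j) / x (2, 0))) \<le> C"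
        using ij s by (intro dual) (simp add: diff_divide_distrib[symmetric] divide_le_eq)
      then have "((\<Sum>i<n. a i * x (0, i)) - (\<Sum>j<n. b j * x (1, j))) / x (2, 0) \<le> C"
        by (simp add: sum_divide_distrib diff_divide_distrib)
      then show ?thesis using s by (simp add: \<gamma>_def divide_le_eq)
    qed
  qed
  then obtain l where l: "\<And>j. j \<in> J \<Longrightarrow> 0 \<le> l j" "\<And>x. \<gamma> x = (\<Sum>j\<in>J. l j * \<alpha> j x)" by auto
  \<comment> \<open>The multipliers of the pair constraints form the plan. Evaluating the identity
    at unit vectors reads off both marginals and the cost, the multiplier of \<open>None\<close>
    being the slack below C.\<close>
  define p where "p i j = l (Some (i, j))" for i j
  have \<gamma>: "\<gamma> x = (\<Sum>i<n. \<Sum>j<n. p i j * (x (0, i) - x (1, j) - d i j * x (2, 0))) - l None * x (2, 0)" for x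
  proof -
    have "\<gamma> x = l None * \<alpha> None x + (\<Sum>q\<in>{..<n} \<times> {..<n}. l (Some q) * \<alpha> (Some q) x)"
      unfolding l(2) J_def by (subst sum.insert) (auto simp: sum.reindex)
    then show ?thesis
      by (simp add: sum.cartesian_product[symmetric] p_def \<alpha>_def split_beta)
        (simp add: sum.cartesian_product split_beta)
  qed
  have "(\<Sum>j<n. p i j) = a i" if "i < n" for i
  proof -
    have "(\<Sum>i'<n. \<Sum>j<n. p i' j * (if i' = i then 1 else 0)) = (\<Sum>i'<n. if i' = i then \<Sum>j<n. p i j else 0)"
      by (intro sum.cong) auto
    moreover have "(\<Sum>i'<n. a i' * (if i' = i then 1 else 0)) = (\<Sum>i'<n. if i' = i then a i' else 0)"
      by (intro sum.cong) auto
    ultimately show ?thesis using \<gamma>[of "\<lambda>q. if q = (0, i) then 1 else 0"] that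
      by (simp add: \<gamma>_def cong: if_cong)
  qed
  moreover have "(\<Sum>i<n. p i j) = b j" if "j < n" for j
  proof -
    have pick: "(\<Sum>k<n. h k * (if k = j then 1 else 0)) = h j" for h :: "nat \<Rightarrow> real"
    proof -
      have "(\<Sum>k<n. h k * (if k = j then 1 else 0)) = (\<Sum>k<n. if k = j then h k else 0)"
        by (intro sum.cong) auto
      then show ?thesis using that by simp
    qed
    show ?thesis using \<gamma>[of "\<lambda>q. if q = (1, j) then 1 else 0"] that
      by (simp add: \<gamma>_def sum_negf pick cong: if_cong)
  qed
  moreover have "(\<Sum>i<n. \<Sum>j<n. p i j * d i j) \<le> C"
    using \<gamma>[of "\<lambda>q. if q = (2, 0) then 1 else 0"] l(1)[of None]
    by (simp add: \<gamma>_def J_def sum_negf)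
  ultimately show ?thesis using l(1) by (intro exI[of _ p]) (auto simp: p_def J_def)
qed

section \<open>From finite to smooth duality\<close>

text \<open>A soft minimum of cones: f is -\<epsilon> times the logarithm of the sum of
  exp(-(\<open>\<psi> j\<close> + \<open>\<rho> j\<close>)/\<epsilon>), where
  \<open>\<rho> j\<close> is the distance to \<open>p j\<close> rounded at the apex. Its gradient is
  a convex combination of vectors of norm at most 1. A soft minimum lies below the true minimum of
  the rounded cones by at most \<epsilon> times the logarithm of their number.\<close>

lemma soft_min_potential:
  fixes p :: "nat \<Rightarrow> 'a::euclidean_space"
  assumes \<epsilon>: "\<epsilon> > 0" and n: "n > 0"
  obtains f where "\<And>k. C_k k f" "\<And>x. norm (grad f x) \<le> 1"
    "\<And>x j. j < n \<Longrightarrow> f x \<le> \<psi> j + sqrt (\<epsilon>\<^sup>2 + (norm (x - p j))\<^sup>2)"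
    "\<And>x q. (\<And>j. j < n \<Longrightarrow> q \<le> \<psi> j + norm (x - p j)) \<Longrightarrow> q - \<epsilon> * ln n \<le> f x"
proof -
  define \<rho> where "\<rho> j x = sqrt (\<epsilon>\<^sup>2 + (x - p j) \<bullet> (x - p j))" for j x
  define e where "e j x = exp ((- 1/\<epsilon>) * (\<psi> j + \<rho> j x))" for j x
  define N where "N x = (\<Sum>j<n. e j x)" for x
  define f where "f x = (- \<epsilon>) * ln (N x)" for x
  have pos: "\<epsilon>\<^sup>2 + (x - p j) \<bullet> (x - p j) > 0" for x j using \<epsilon> by (simp add: add_pos_nonneg)
  have \<rho>pos: "\<rho> j x > 0" for j x using pos by (simp add: \<rho>_def)
  have epos: "e j x > 0" for j x by (simp add: e_def)
  have Npos: "N x > 0" for x unfolding N_def using epos n by (intro sum_pos) auto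
  have C\<rho>: "C_k k (\<rho> j)" for k j
    unfolding \<rho>_def [abs_def]
    using C_k_compose[OF C_k_add[OF C_k_const C_k_inner_self] Cr_k_sqrt, of "\<epsilon>\<^sup>2" "p j" k] pos by simp
  have "C_k k (\<lambda>x. (- 1/\<epsilon>) * (\<psi> j + \<rho> j x))" for k j
    by (rule C_k_cmult[OF C_k_add[OF C_k_const C\<rho>]])
  then have Ce: "C_k k (e j)" for k j
    unfolding e_def [abs_def] by (rule C_k_compose[OF _ Cr_k_exp[of _ UNIV]]) auto
  have CN: "C_k k N" for k unfolding N_def [abs_def] by (rule C_k_sum) (rule Ce)
  have "C_k k (\<lambda>x. ln (N x))" for k
    using C_k_compose[OF CN Cr_k_ln] Npos by auto
  then have Cf: "C_k k f" for k unfolding f_def [abs_def] by (rule C_k_cmult)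
  have D\<rho>: "(\<rho> j has_derivative (\<lambda>h. ((x - p j) \<bullet> h) / \<rho> j x)) (at x)" for j x
    unfolding \<rho>_def [abs_def]
    by (rule has_derivative_eq_rhs, rule has_derivative_real_sqrt)
      (use pos[of x j] in \<open>auto intro!: derivative_eq_intros simp: fun_eq_iff inner_commute field_simps\<close>)
  have De: "(e j has_derivative (\<lambda>h. (- 1/\<epsilon>) * e j x * (((x - p j) \<bullet> h) / \<rho> j x))) (at x)" for j x
    unfolding e_def [abs_def] using \<epsilon>
    by (auto intro!: derivative_eq_intros D\<rho> simp: fun_eq_iff field_simps)
  have DN: "(N has_derivative (\<lambda>h. \<Sum>j<n. (- 1/\<epsilon>) * e j x * (((x - p j) \<bullet> h) / \<rho> j x))) (at x)" for x
    unfolding N_def [abs_def] by (rule has_derivative_sum) (rule De)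
  have Df: "(f has_derivative (\<lambda>h. \<Sum>j<n. e j x / N x * (((x - p j) \<bullet> h) / \<rho> j x))) (at x)" for x
  proof -
    have "(f has_derivative (\<lambda>h. (- \<epsilon>) * ((\<Sum>j<n. (- 1/\<epsilon>) * e j x * (((x - p j) \<bullet> h) / \<rho> j x)) * inverse (N x)))) (at x)"
      unfolding f_def [abs_def]
      by (rule has_derivative_mult_right) (rule has_derivative_eq_rhs[OF has_derivative_ln[OF Npos DN]], simp add: mult.commute)
    moreover have "(- \<epsilon>) * ((\<Sum>j<n. (- 1/\<epsilon>) * e j x * (((x - p j) \<bullet> h) / \<rho> j x)) * inverse (N x))
       = (\<Sum>j<n. e j x / N x * (((x - p j) \<bullet> h) / \<rho> j x))" for h
      unfolding sum_distrib_right sum_distrib_left using \<epsilon>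
      by (intro sum.cong) (auto simp: field_simps)
    ultimately show ?thesis by simp
  qed
  have G: "GDERIV f x :> (\<Sum>j<n. (e j x / N x / \<rho> j x) *\<^sub>R (x - p j))" for x
    unfolding gderiv_def
    by (rule has_derivative_eq_rhs[OF Df]) (auto simp: inner_sum_right inner_commute)
  have "norm (grad f x) \<le> 1" for x
  proof -
    have "norm (grad f x) \<le> (\<Sum>j<n. norm ((e j x / N x / \<rho> j x) *\<^sub>R (x - p j)))"
      unfolding grad_eq[OF G] by (rule norm_sum)
    also have "\<dots> \<le> (\<Sum>j<n. e j x / N x)"
    proof (rule sum_mono)
      fix j
      have "norm (x - p j) \<le> \<rho> j x"
        unfolding \<rho>_def norm_eq_sqrt_inner by (rule real_sqrt_le_mono) simp
      then have "norm (x - p j) / \<rho> j x \<le> 1" using \<rho>pos[of j x] by simp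
      then have "e j x / N x * (norm (x - p j) / \<rho> j x) \<le> e j x / N x * 1"
        using epos[of j x] Npos[of x] by (intro mult_left_mono) auto
      then show "norm ((e j x / N x / \<rho> j x) *\<^sub>R (x - p j)) \<le> e j x / N x"
        using epos[of j x] Npos[of x] \<rho>pos[of j x] by simp
    qed
    also have "\<dots> = 1" using Npos[of x] by (simp add: sum_divide_distrib[symmetric] N_def)
    finally show ?thesis .
  qed
  moreover have "f x \<le> \<psi> j + sqrt (\<epsilon>\<^sup>2 + (norm (x - p j))\<^sup>2)" if "j < n" for x j
  proof -
    have "e j x \<le> N x" unfolding N_def using that epos by (intro member_le_sum) (auto intro: less_imp_le)
    then have "ln (e j x) \<le> ln (N x)" using epos Npos by simp
    then have "(- 1/\<epsilon>) * (\<psi> j + \<rho> j x) \<le> ln (N x)" by (simp add: e_def)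
    then have "f x \<le> \<psi> j + \<rho> j x" using \<epsilon> by (simp add: f_def field_simps)
    then show ?thesis by (simp add: \<rho>_def power2_norm_eq_inner)
  qed
  moreover have "q - \<epsilon> * ln n \<le> f x" if q: "\<And>j. j < n \<Longrightarrow> q \<le> \<psi> j + norm (x - p j)" for x q
  proof -
    have "e j x \<le> exp (- q / \<epsilon>)" if "j < n" for j
    proof -
      have "norm (x - p j) \<le> \<rho> j x"
        unfolding \<rho>_def norm_eq_sqrt_inner by (rule real_sqrt_le_mono) simp
      then have "q \<le> \<psi> j + \<rho> j x" using q[OF that] by simp
      then show ?thesis using \<epsilon> by (simp add: e_def field_simps)
    qed
    then have "N x \<le> n * exp (- q / \<epsilon>)"
      unfolding N_def using sum_bounded_above[of "{..<n}" "\<lambda>j. e j x" "exp (- q / \<epsilon>)"] by simp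
    then have "ln (N x) \<le> ln (n * exp (- q / \<epsilon>))" using Npos n by simp
    also have "\<dots> = ln n - q / \<epsilon>" using n by (simp add: ln_mult)
    finally have "\<epsilon> * ln (N x) \<le> \<epsilon> * (ln n - q / \<epsilon>)" using \<epsilon> by (intro mult_left_mono) auto
    also have "\<dots> = \<epsilon> * ln n - q" using \<epsilon> by (simp add: right_diff_distrib)
    finally show ?thesis by (simp add: f_def)
  qed
  ultimately show thesis using that[OF Cf] by blast
qed

lemma C_k_grad_Lipschitz:
  fixes f :: "'a::euclidean_space \<Rightarrow> real"
  assumes "C_k (Suc 0) f" "\<And>x. norm (grad f x) \<le> B"
  shows "B-lipschitz_on UNIV f"
proof -
  have D: "(f has_derivative (\<lambda>h. h \<bullet> grad f x)) (at x)" for x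
    using C_k_GDERIV[OF assms(1)] unfolding gderiv_def .
  have B: "B \<ge> 0" using assms(2)[of 0] norm_ge_zero[of "grad f 0"] by linarith
  have "onorm (\<lambda>h. h \<bullet> grad f x) \<le> B" for x
  proof (rule onorm_le)
    fix h
    have "norm (h \<bullet> grad f x) \<le> norm h * norm (grad f x)" by (simp add: Cauchy_Schwarz_ineq2)
    also have "\<dots> \<le> norm h * B" using assms(2) by (intro mult_left_mono) auto
    finally show "norm (h \<bullet> grad f x) \<le> B * norm h" by (simp add: mult.commute)
  qed
  then have "norm (f x - f y) \<le> B * norm (x - y)" for x y
    using differentiable_bound[of UNIV f "\<lambda>x h. h \<bullet> grad f x" B x y] D by auto
  then show ?thesis using B by (intro lipschitz_onI) (auto simp: dist_norm)
qed


text \<open>A point is sent to the first member of a finite net close to it. Taking the least index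
  makes the cells disjoint and the index Borel measurable.\<close>

lemma finite_partition_index:
  fixes K :: "'a::euclidean_space set"
  assumes "compact K" "\<delta> > 0"
  obtains n :: nat and p :: "nat \<Rightarrow> 'a" and \<iota> where "n > 0" "\<iota> \<in> measurable borel (count_space UNIV)"
    "\<And>x. x \<in> K \<Longrightarrow> \<iota> x < n \<and> norm (x - p (\<iota> x)) \<le> \<delta>"
proof -
  obtain S where S: "finite S" "K \<subseteq> (\<Union>x\<in>S. ball x \<delta>)"
    using assms by (metis compact_eq_totally_bounded)
  obtain xs where xs: "set xs = S" using finite_list[OF S(1)] by auto
  define p where "p i = (if i < length xs then xs ! i else 0)" for i
  define \<iota> where "\<iota> x = (LEAST i. dist (p i) x < \<delta>)" for x
  have "\<iota> x < Suc (length xs) \<and> norm (x - p (\<iota> x)) \<le> \<delta>" if xK: "x \<in> K" for x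
  proof -
    obtain c where "c \<in> set xs" "x \<in> ball c \<delta>" using S(2) xK xs by blast
    then obtain i where i: "i < length xs" "x \<in> ball (xs ! i) \<delta>"
      by (metis in_set_conv_nth)
    then have "dist (p i) x < \<delta>" by (simp add: p_def)
    then have "\<iota> x \<le> i" "dist (p (\<iota> x)) x < \<delta>"
      unfolding \<iota>_def by (fact Least_le, fact LeastI)
    then show ?thesis using i by (auto simp: dist_norm norm_minus_commute)
  qed
  moreover have "\<iota> \<in> measurable borel (count_space UNIV)"
    unfolding \<iota>_def by measurable
  \<comment> \<open>The successor keeps n positive even when the net is empty.\<close>
  ultimately show thesis using that[of "Suc (length xs)" \<iota> p] by auto
qed

lemma nn_integral_finite_index:
  fixes n :: nat
  assumes "prob_space M" "\<iota> \<in> measurable M (count_space UNIV)" "AE x in M. \<iota> x < n"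
    "\<And>i. i < n \<Longrightarrow> 0 \<le> F i"
  shows "(\<integral>\<^sup>+x. ennreal (F (\<iota> x)) \<partial>M) = ennreal (\<Sum>i<n. F i * measure M {x \<in> space M. \<iota> x = i})"
proof -
  interpret prob_space M by fact
  have m: "{x \<in> space M. \<iota> x = i} \<in> sets M" for i using assms(2) by measurable
  have "(\<integral>\<^sup>+x. ennreal (F (\<iota> x)) \<partial>M) = (\<integral>\<^sup>+x. (\<Sum>i<n. ennreal (F i) * indicator {x \<in> space M. \<iota> x = i} x) \<partial>M)"
  proof (rule nn_integral_cong_AE)
    show "AE x in M. ennreal (F (\<iota> x)) = (\<Sum>i<n. ennreal (F i) * indicator {x \<in> space M. \<iota> x = i} x)"
      using assms(3) AE_space
    proof eventually_elim
      fix x assume "\<iota> x < n" "x \<in> space M"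
      have "(\<Sum>i<n. ennreal (F i) * indicator {x \<in> space M. \<iota> x = i} x) = (\<Sum>i<n. if i = \<iota> x then ennreal (F i) else 0)"
        using \<open>x \<in> space M\<close> by (intro sum.cong) (auto simp: indicator_def)
      then show "ennreal (F (\<iota> x)) = (\<Sum>i<n. ennreal (F i) * indicator {x \<in> space M. \<iota> x = i} x)"
        using \<open>\<iota> x < n\<close> by simp
    qed
  qed
  also have "\<dots> = (\<Sum>i<n. ennreal (F i) * emeasure M {x \<in> space M. \<iota> x = i})"
    using m by (subst nn_integral_sum) (auto simp: nn_integral_cmult_indicator)
  also have "\<dots> = (\<Sum>i<n. ennreal (F i * measure M {x \<in> space M. \<iota> x = i}))"
    using assms(4) by (intro sum.cong) (auto simp: emeasure_eq_measure ennreal_mult)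
  also have "\<dots> = ennreal (\<Sum>i<n. F i * measure M {x \<in> space M. \<iota> x = i})"
    using assms(4) by (subst sum_ennreal) auto
  finally show ?thesis .
qed

text \<open>The finite plan is spread over the cells with density \<open>q i j / (a i * b j)\<close>
  relative to the product measure, which produces the right marginals. Each endpoint is within
  \<open>\<delta>\<close> of the representative of its cell, which costs twice
  \<open>\<delta>\<close>.\<close>

lemma W1_le_finite_plan:
  fixes n :: nat and \<mu> \<nu> :: "'a::euclidean_space measure"
  assumes \<mu>: "\<mu> \<in> Prob_on K" and \<nu>: "\<nu> \<in> Prob_on K" and n: "n > 0"
    and \<iota>: "\<iota> \<in> measurable borel (count_space UNIV)" "\<And>x. x \<in> K \<Longrightarrow> \<iota> x < n \<and> norm (x - p (\<iota> x)) \<le> \<delta>"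
    and q: "\<And>i j. i < n \<Longrightarrow> j < n \<Longrightarrow> 0 \<le> q i j"
      "\<And>i. i < n \<Longrightarrow> (\<Sum>j<n. q i j) = measure \<mu> {x. \<iota> x = i}"
      "\<And>j. j < n \<Longrightarrow> (\<Sum>i<n. q i j) = measure \<nu> {x. \<iota> x = j}"
      "(\<Sum>i<n. \<Sum>j<n. q i j * norm (p i - p j)) \<le> C" and C: "0 \<le> C" and \<delta>: "0 \<le> \<delta>"
  shows "W1 \<mu> \<nu> \<le> C + 2 * \<delta>"
proof -
  note P\<mu> = Prob_simps[OF Prob_onD(1)[OF \<mu>]] and P\<nu> = Prob_simps[OF Prob_onD(1)[OF \<nu>]]
  interpret m: prob_space \<mu> by (rule P\<mu>)
  interpret n: prob_space \<nu> by (rule P\<nu>)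
  interpret pr: pair_prob_space \<mu> \<nu> ..
  define a where "a i = measure \<mu> {x. \<iota> x = i}" for i
  define b where "b i = measure \<nu> {x. \<iota> x = i}" for i
  have [simp]: "a i \<ge> 0" "b i \<ge> 0" for i by (auto simp: a_def b_def)
  define G where "G i j = (if i < n \<and> j < n then q i j / (a i * b j) else 0)" for i j
  have Gnn: "0 \<le> G i j" for i j using q(1) by (simp add: G_def)
  \<comment> \<open>A row or column of mass zero carries no transport, so the value 0 that division
    by zero gives to \<open>G\<close> is the right one.\<close>
  have qa: "q i j = 0" if "i < n" "j < n" "a i = 0" for i j
    using q(2)[OF that(1)] that member_le_sum[of j "{..<n}" "q i"] q(1)[of i] by (auto simp: a_def intro: antisym)
  have qb: "q i j = 0" if "i < n" "j < n" "b j = 0" for i j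
    using q(3)[OF that(2)] that member_le_sum[of i "{..<n}" "\<lambda>i. q i j"] q(1) by (auto simp: b_def intro: antisym)
  have Gab: "G i j * a i * b j = q i j" if "i < n" "j < n" for i j
    using that qa[OF that] qb[OF that] by (auto simp: G_def)
  have ae\<mu>: "AE x in \<mu>. \<iota> x < n" using Prob_onD(2)[OF \<mu>] by eventually_elim (use \<iota>(2) in auto)
  have ae\<nu>: "AE x in \<nu>. \<iota> x < n" using Prob_onD(2)[OF \<nu>] by eventually_elim (use \<iota>(2) in auto)
  have \<iota>\<mu>: "\<iota> \<in> measurable \<mu> (count_space UNIV)" using \<iota>(1) by (simp add: P\<mu>(4))
  have ev\<mu>: "{x. \<iota> x = i} \<in> sets \<mu>" for i
    using measurable_sets[OF \<iota>\<mu>, of "{i}"] by (simp add: P\<mu>(2) vimage_def)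
  have \<iota>\<nu>: "\<iota> \<in> measurable \<nu> (count_space UNIV)" using \<iota>(1) by (simp add: P\<nu>(4))
  have ev\<nu>: "{x. \<iota> x = i} \<in> sets \<nu>" for i
    using measurable_sets[OF \<iota>\<nu>, of "{i}"] by (simp add: P\<nu>(2) vimage_def)
  have int\<mu>: "(\<integral>\<^sup>+x. ennreal (F (\<iota> x)) \<partial>\<mu>) = ennreal (\<Sum>i<n. F i * a i)" if "\<And>i. 0 \<le> F i" for F
    using nn_integral_finite_index[OF m.prob_space_axioms \<iota>\<mu> ae\<mu>, of F] that by (simp add: a_def P\<mu>(2))
  have int\<nu>: "(\<integral>\<^sup>+x. ennreal (F (\<iota> x)) \<partial>\<nu>) = ennreal (\<Sum>i<n. F i * b i)" if "\<And>i. 0 \<le> F i" for F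
    using nn_integral_finite_index[OF n.prob_space_axioms \<iota>\<nu> ae\<nu>, of F] that by (simp add: b_def P\<nu>(2))
  \<comment> \<open>Cells of mass zero are avoided almost everywhere; on the others the inner
    integral of the density can be normalised by division.\<close>
  have apos: "AE x in \<mu>. \<iota> x < n \<and> a (\<iota> x) \<noteq> 0"
  proof -
    have "AE x in \<mu>. \<forall>i\<in>{i. a i = 0}. \<iota> x \<noteq> i"
    proof (subst AE_ball_countable)
      show "\<forall>i\<in>{i. a i = 0}. AE x in \<mu>. \<iota> x \<noteq> i"
      proof
        fix i assume "i \<in> {i. a i = 0}"
        then show "AE x in \<mu>. \<iota> x \<noteq> i" using ev\<mu>[of i]
          by (intro AE_I[where N = "{x. \<iota> x = i}"]) (auto simp: a_def m.emeasure_eq_measure P\<mu>(2)[symmetric])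
      qed
    qed auto
    with ae\<mu> show ?thesis by eventually_elim auto
  qed
  have bpos: "AE x in \<nu>. \<iota> x < n \<and> b (\<iota> x) \<noteq> 0"
  proof -
    have "AE x in \<nu>. \<forall>i\<in>{i. b i = 0}. \<iota> x \<noteq> i"
    proof (subst AE_ball_countable)
      show "\<forall>i\<in>{i. b i = 0}. AE x in \<nu>. \<iota> x \<noteq> i"
      proof
        fix i assume "i \<in> {i. b i = 0}"
        then show "AE x in \<nu>. \<iota> x \<noteq> i" using ev\<nu>[of i]
          by (intro AE_I[where N = "{x. \<iota> x = i}"]) (auto simp: b_def n.emeasure_eq_measure P\<nu>(2)[symmetric])
      qed
    qed auto
    with ae\<nu> show ?thesis by eventually_elim auto
  qed
  have one\<mu>: "AE x in \<mu>. (\<integral>\<^sup>+y. ennreal (G (\<iota> x) (\<iota> y)) \<partial>\<nu>) = 1"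
    using apos
  proof eventually_elim
    fix x assume x: "\<iota> x < n \<and> a (\<iota> x) \<noteq> 0"
    have "(\<Sum>j<n. G (\<iota> x) j * b j) * a (\<iota> x) = (\<Sum>j<n. q (\<iota> x) j)"
      unfolding sum_distrib_right using x Gab[of "\<iota> x"] by (intro sum.cong) (auto simp: mult_ac)
    also have "\<dots> = a (\<iota> x)" using q(2) x by (simp add: a_def)
    finally show "(\<integral>\<^sup>+y. ennreal (G (\<iota> x) (\<iota> y)) \<partial>\<nu>) = 1"
      using x by (subst int\<nu>) (auto simp: Gnn)
  qed
  have one\<nu>: "AE y in \<nu>. (\<integral>\<^sup>+x. ennreal (G (\<iota> x) (\<iota> y)) \<partial>\<mu>) = 1"
    using bpos
  proof eventually_elim
    fix y assume y: "\<iota> y < n \<and> b (\<iota> y) \<noteq> 0"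
    have "(\<Sum>i<n. G i (\<iota> y) * a i) * b (\<iota> y) = (\<Sum>i<n. q i (\<iota> y))"
      unfolding sum_distrib_right using y Gab[of _ "\<iota> y"] by (intro sum.cong) auto
    also have "\<dots> = b (\<iota> y)" using q(3) y by (simp add: b_def)
    finally show "(\<integral>\<^sup>+x. ennreal (G (\<iota> x) (\<iota> y)) \<partial>\<mu>) = 1"
      using y by (subst int\<mu>) (auto simp: Gnn)
  qed
  define g where "g z = ennreal (G (\<iota> (fst z)) (\<iota> (snd z)))" for z
  have gm [measurable]: "g \<in> borel_measurable (\<mu> \<Otimes>\<^sub>M \<nu>)"
  proof -
    have "(\<lambda>z. (\<iota> (fst z), \<iota> (snd z))) \<in> measurable (\<mu> \<Otimes>\<^sub>M \<nu>) (count_space UNIV \<Otimes>\<^sub>M count_space UNIV)"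
      using \<iota>\<mu> \<iota>\<nu> by measurable
    then have "(\<lambda>z. (\<iota> (fst z), \<iota> (snd z))) \<in> measurable (\<mu> \<Otimes>\<^sub>M \<nu>) (count_space UNIV)"
      by (simp add: pair_measure_countable)
    from measurable_compose[OF this, of "\<lambda>(i, j). ennreal (G i j)" borel]
    show ?thesis unfolding g_def by (simp add: split_beta)
  qed
  have sb: "sets (\<mu> \<Otimes>\<^sub>M \<nu>) = sets borel"
    using sets_pair_measure_cong[OF P\<mu>(1) P\<nu>(1)] borel_prod by metis
  define \<gamma> where "\<gamma> = density (\<mu> \<Otimes>\<^sub>M \<nu>) g"
  have s\<gamma>: "sets \<gamma> = sets borel" by (simp add: \<gamma>_def sb)
  have sp\<gamma>: "space \<gamma> = UNIV" using sets_eq_imp_space_eq[OF s\<gamma>] by simp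
  have fsb: "fst \<in> borel_measurable (borel :: ('a \<times> 'a) measure)" "snd \<in> borel_measurable (borel :: ('a \<times> 'a) measure)"
    by (intro borel_measurable_continuous_onI continuous_intros)+
  then have fs: "fst \<in> measurable \<gamma> borel" "snd \<in> measurable \<gamma> borel"
    unfolding measurable_cong_sets[OF s\<gamma> refl] .
  have nn\<gamma>: "(\<integral>\<^sup>+z. h z \<partial>\<gamma>) = (\<integral>\<^sup>+z. g z * h z \<partial>(\<mu> \<Otimes>\<^sub>M \<nu>))" if "h \<in> borel_measurable borel" for h
    unfolding \<gamma>_def using that measurable_cong_sets[OF sb refl] by (intro nn_integral_density) auto
  have marg1: "emeasure (distr \<gamma> borel fst) A = emeasure \<mu> A" if A: "A \<in> sets borel" for A
  proof -
    have A': "fst -` A \<inter> space \<gamma> \<in> sets \<gamma>" "A \<in> sets \<mu>" using measurable_sets[OF fs(1) A] A P\<mu>(1) by auto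
    have "emeasure (distr \<gamma> borel fst) A = (\<integral>\<^sup>+z. indicator A (fst z) \<partial>\<gamma>)"
      using A' A fs by (subst emeasure_distr) (auto simp: nn_integral_indicator[symmetric] indicator_def sp\<gamma> intro!: nn_integral_cong)
    also have "\<dots> = (\<integral>\<^sup>+z. g z * indicator A (fst z) \<partial>(\<mu> \<Otimes>\<^sub>M \<nu>))"
      by (intro nn\<gamma> measurable_compose[OF fsb(1) borel_measurable_indicator[OF A]])
    also have "\<dots> = (\<integral>\<^sup>+x. \<integral>\<^sup>+y. g (x, y) * indicator A x \<partial>\<nu> \<partial>\<mu>)"
      using A'(2) by (subst n.nn_integral_fst[symmetric]) auto
    also have "\<dots> = (\<integral>\<^sup>+x. indicator A x \<partial>\<mu>)"
    proof (rule nn_integral_cong_AE)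
      show "AE x in \<mu>. (\<integral>\<^sup>+y. g (x, y) * indicator A x \<partial>\<nu>) = indicator A x"
        using one\<mu>
      proof eventually_elim
        fix x assume x: "(\<integral>\<^sup>+y. ennreal (G (\<iota> x) (\<iota> y)) \<partial>\<nu>) = 1"
        have "(\<lambda>y. ennreal (G (\<iota> x) (\<iota> y))) \<in> borel_measurable \<nu>"
          using measurable_compose[OF \<iota>\<nu>, of "\<lambda>j. ennreal (G (\<iota> x) j)" borel] by simp
        then show "(\<integral>\<^sup>+y. g (x, y) * indicator A x \<partial>\<nu>) = indicator A x"
          using x by (simp add: g_def nn_integral_multc)
      qed
    qed
    also have "\<dots> = emeasure \<mu> A" using A'(2) by simp
    finally show ?thesis .
  qed
  have marg2: "emeasure (distr \<gamma> borel snd) A = emeasure \<nu> A" if A: "A \<in> sets borel" for A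
  proof -
    have A': "snd -` A \<inter> space \<gamma> \<in> sets \<gamma>" "A \<in> sets \<nu>" using measurable_sets[OF fs(2) A] A P\<nu>(1) by auto
    have "emeasure (distr \<gamma> borel snd) A = (\<integral>\<^sup>+z. indicator A (snd z) \<partial>\<gamma>)"
      using A' A fs by (subst emeasure_distr) (auto simp: nn_integral_indicator[symmetric] indicator_def sp\<gamma> intro!: nn_integral_cong)
    also have "\<dots> = (\<integral>\<^sup>+z. g z * indicator A (snd z) \<partial>(\<mu> \<Otimes>\<^sub>M \<nu>))"
      by (intro nn\<gamma> measurable_compose[OF fsb(2) borel_measurable_indicator[OF A]])
    also have "\<dots> = (\<integral>\<^sup>+y. \<integral>\<^sup>+x. g (x, y) * indicator A y \<partial>\<mu> \<partial>\<nu>)"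
      using A'(2) by (subst pr.nn_integral_snd[symmetric]) (auto simp: split_beta)
    also have "\<dots> = (\<integral>\<^sup>+x. indicator A x \<partial>\<nu>)"
    proof (rule nn_integral_cong_AE)
      show "AE y in \<nu>. (\<integral>\<^sup>+x. g (x, y) * indicator A y \<partial>\<mu>) = indicator A y"
        using one\<nu>
      proof eventually_elim
        fix y assume y: "(\<integral>\<^sup>+x. ennreal (G (\<iota> x) (\<iota> y)) \<partial>\<mu>) = 1"
        have "(\<lambda>x. ennreal (G (\<iota> x) (\<iota> y))) \<in> borel_measurable \<mu>"
          using measurable_compose[OF \<iota>\<mu>, of "\<lambda>j. ennreal (G j (\<iota> y))" borel] by simp
        then show "(\<integral>\<^sup>+x. g (x, y) * indicator A y \<partial>\<mu>) = indicator A y"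
          using y by (simp add: g_def nn_integral_multc)
      qed
    qed
    also have "\<dots> = emeasure \<nu> A" using A'(2) by simp
    finally show ?thesis .
  qed
  have d1: "distr \<gamma> borel fst = \<mu>" by (rule measure_eqI) (auto simp: P\<mu>(1) marg1)
  have d2: "distr \<gamma> borel snd = \<nu>" by (rule measure_eqI) (auto simp: P\<nu>(1) marg2)
  have "prob_space \<gamma>"
  proof
    have "emeasure \<gamma> (space \<gamma>) = emeasure (distr \<gamma> borel fst) UNIV"
      using fs by (subst emeasure_distr) (auto simp: sp\<gamma>)
    then show "emeasure \<gamma> (space \<gamma>) = 1" using m.emeasure_space_1 P\<mu>(2) by (simp add: d1)
  qed
  then have plan: "\<gamma> \<in> transport_plans \<mu> \<nu>"
    unfolding transport_plans_def Prob_def using s\<gamma> d1 d2 by simp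
  define D where "D i j = norm (p i - p j) + 2 * \<delta>" for i j
  have Dnn: "0 \<le> D i j" for i j using \<delta> by (simp add: D_def)
  have "(\<integral>\<^sup>+z. ennreal (case z of (x, y) \<Rightarrow> norm (x - y)) \<partial>\<gamma>) \<le> (\<integral>\<^sup>+z. ennreal (D (\<iota> (fst z)) (\<iota> (snd z))) \<partial>\<gamma>)"
  proof (rule nn_integral_mono_AE)
    show "AE z in \<gamma>. ennreal (case z of (x, y) \<Rightarrow> norm (x - y)) \<le> ennreal (D (\<iota> (fst z)) (\<iota> (snd z)))"
      using transport_plan_AE[OF plan Prob_onD(2)[OF \<mu>] Prob_onD(2)[OF \<nu>]]
    proof eventually_elim
      fix z :: "'a \<times> 'a" assume z: "fst z \<in> K \<and> snd z \<in> K"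
      have "fst z - snd z = (fst z - p (\<iota> (fst z))) + (p (\<iota> (fst z)) - p (\<iota> (snd z))) - (snd z - p (\<iota> (snd z)))"
        by simp
      then have "norm (fst z - snd z) \<le> norm (fst z - p (\<iota> (fst z))) + norm (p (\<iota> (fst z)) - p (\<iota> (snd z))) + norm (snd z - p (\<iota> (snd z)))"
        by (metis norm_triangle_ineq norm_triangle_ineq4 add_right_mono order_trans)
      then show "ennreal (case z of (x, y) \<Rightarrow> norm (x - y)) \<le> ennreal (D (\<iota> (fst z)) (\<iota> (snd z)))"
        using \<iota>(2)[of "fst z"] \<iota>(2)[of "snd z"] z by (intro ennreal_leI) (simp add: D_def split_beta)
    qed
  qed
  also have "\<dots> = (\<integral>\<^sup>+z. g z * ennreal (D (\<iota> (fst z)) (\<iota> (snd z))) \<partial>(\<mu> \<Otimes>\<^sub>M \<nu>))"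
  proof (rule nn\<gamma>)
    have "(\<lambda>z. (\<iota> (fst z), \<iota> (snd z))) \<in> measurable (borel \<Otimes>\<^sub>M borel) (count_space UNIV \<Otimes>\<^sub>M count_space UNIV)"
      using \<iota>(1) by measurable
    then have "(\<lambda>z. (\<iota> (fst z), \<iota> (snd z))) \<in> measurable borel (count_space UNIV)"
      by (simp add: pair_measure_countable borel_prod)
    from measurable_compose[OF this, of "\<lambda>(i, j). ennreal (D i j)" borel]
    show "(\<lambda>z. ennreal (D (\<iota> (fst z)) (\<iota> (snd z)))) \<in> borel_measurable borel" by (simp add: split_beta)
  qed
  also have "\<dots> = (\<integral>\<^sup>+z. ennreal (G (\<iota> (fst z)) (\<iota> (snd z)) * D (\<iota> (fst z)) (\<iota> (snd z))) \<partial>(\<mu> \<Otimes>\<^sub>M \<nu>))"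
    by (simp add: g_def ennreal_mult Gnn Dnn)
  also have "\<dots> = (\<integral>\<^sup>+x. \<integral>\<^sup>+y. ennreal (G (\<iota> x) (\<iota> y) * D (\<iota> x) (\<iota> y)) \<partial>\<nu> \<partial>\<mu>)"
  proof (subst n.nn_integral_fst[symmetric])
    have "(\<lambda>z. (\<iota> (fst z), \<iota> (snd z))) \<in> measurable (\<mu> \<Otimes>\<^sub>M \<nu>) (count_space UNIV \<Otimes>\<^sub>M count_space UNIV)"
      using \<iota>\<mu> \<iota>\<nu> by measurable
    then have "(\<lambda>z. (\<iota> (fst z), \<iota> (snd z))) \<in> measurable (\<mu> \<Otimes>\<^sub>M \<nu>) (count_space UNIV)"
      by (simp add: pair_measure_countable)
    from measurable_compose[OF this, of "\<lambda>(i, j). ennreal (G i j * D i j)" borel]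
    show "(\<lambda>z. ennreal (G (\<iota> (fst z)) (\<iota> (snd z)) * D (\<iota> (fst z)) (\<iota> (snd z)))) \<in> borel_measurable (\<mu> \<Otimes>\<^sub>M \<nu>)"
      by (simp add: split_beta)
  qed simp
  also have "\<dots> = (\<integral>\<^sup>+x. ennreal (\<Sum>j<n. G (\<iota> x) j * D (\<iota> x) j * b j) \<partial>\<mu>)"
    by (subst int\<nu>) (auto simp: Gnn Dnn)
  also have "\<dots> = ennreal (\<Sum>i<n. (\<Sum>j<n. G i j * D i j * b j) * a i)"
    by (subst int\<mu>) (auto simp: Gnn Dnn intro!: sum_nonneg)
  also have "(\<Sum>i<n. (\<Sum>j<n. G i j * D i j * b j) * a i) = (\<Sum>i<n. \<Sum>j<n. q i j * D i j)"
    unfolding sum_distrib_right by (intro sum.cong refl) (simp add: Gab[symmetric] mult_ac)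
  also have "(\<Sum>i<n. \<Sum>j<n. q i j * D i j) = (\<Sum>i<n. \<Sum>j<n. q i j * norm (p i - p j)) + 2 * \<delta> * (\<Sum>i<n. \<Sum>j<n. q i j)"
    by (simp add: D_def distrib_left sum.distrib sum_distrib_left mult_ac)
  also have "(\<Sum>i<n. \<Sum>j<n. q i j) = 1"
  proof -
    have "(\<Sum>i<n. \<Sum>j<n. q i j) = (\<Sum>i<n. 1 * a i)" using q(2) by (intro sum.cong) (auto simp: a_def)
    moreover have "ennreal (\<Sum>i<n. 1 * a i) = 1" using int\<mu>[of "\<lambda>_. 1"] m.emeasure_space_1 by simp
    ultimately show ?thesis by (metis ennreal_eq_1)
  qed
  finally have "(\<integral>\<^sup>+z. ennreal (case z of (x, y) \<Rightarrow> norm (x - y)) \<partial>\<gamma>) \<le> ennreal (C + 2 * \<delta>)"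
    using q(4) by (auto elim!: order_trans intro!: ennreal_leI)
  then have "(\<integral>(x, y). norm (x - y) \<partial>\<gamma>) \<le> C + 2 * \<delta>"
    using C \<delta> by (intro integral_real_bounded) auto
  then show ?thesis using W1_le_plan[OF plan] by simp
qed

text \<open>The potentials are restricted to smooth functions with gradient at most 1, exactly those
  with which the continuity equation can be tested. After discretisation, a pair of finite
  potentials is interpolated by a soft minimum.\<close>

theorem Kantorovich_duality:
  fixes \<mu> \<nu> :: "'a::euclidean_space measure"
  assumes \<mu>: "\<mu> \<in> Prob_on K" and \<nu>: "\<nu> \<in> Prob_on K" and K: "compact K"
    and dual: "\<And>f. (\<And>k. C_k k f) \<Longrightarrow> (\<And>x. norm (grad f x) \<le> 1) \<Longrightarrow> (\<integral>x. f x \<partial>\<mu>) - (\<integral>x. f x \<partial>\<nu>) \<le> c"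
  shows "W1 \<mu> \<nu> \<le> c"
proof (rule field_le_epsilon)
  fix e :: real assume e: "e > 0"
  \<comment> \<open>Each of the two measures is moved to the representatives of the cells once in
    the dual inequality and once in the spreading of the plan: four errors of size
    \<open>\<delta>\<close>.\<close>
  define \<delta> where "\<delta> = e / 4"
  have \<delta>: "\<delta> > 0" using e by (simp add: \<delta>_def)
  note P\<mu> = Prob_simps[OF Prob_onD(1)[OF \<mu>]] and P\<nu> = Prob_simps[OF Prob_onD(1)[OF \<nu>]]
  interpret m: prob_space \<mu> by (rule P\<mu>)
  interpret n: prob_space \<nu> by (rule P\<nu>)
  obtain n :: nat and p \<iota> where n: "n > 0" and \<iota>: "\<iota> \<in> measurable borel (count_space UNIV)"
    "\<And>x. x \<in> K \<Longrightarrow> \<iota> x < n \<and> norm (x - p (\<iota> x)) \<le> \<delta>"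
    using finite_partition_index[OF K \<delta>] by metis
  have grad0: "grad (\<lambda>_. 0) x = (0::'a)" for x by (rule grad_eq) (simp add: GDERIV_const)
  have c0: "c \<ge> 0" using dual[of "\<lambda>_. 0"] by (simp add: grad0)
  have sumint: "(\<Sum>i<n. measure M {x. \<iota> x = i} * F i) = (\<integral>x. F (\<iota> x) \<partial>M) \<and> integrable M (\<lambda>x. F (\<iota> x))
      \<and> (\<Sum>i<n. measure M {x. \<iota> x = i}) = 1"
    if M: "M \<in> Prob_on K" for F :: "nat \<Rightarrow> real" and M
  proof -
    note P = Prob_simps[OF Prob_onD(1)[OF M]]
    interpret prob_space M by (rule P)
    have \<iota>M: "\<iota> \<in> measurable M (count_space UNIV)" using \<iota>(1) by (simp add: P(4))
    have mi: "{x. \<iota> x = i} \<in> sets M" for i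
      using measurable_sets[OF \<iota>M, of "{i}"] by (simp add: P(2) vimage_def)
    have ae: "AE x in M. F (\<iota> x) = (\<Sum>i<n. F i * indicator {x. \<iota> x = i} x)" for F :: "nat \<Rightarrow> real"
      using Prob_onD(2)[OF M]
    proof eventually_elim
      fix x assume "x \<in> K"
      then have "\<iota> x < n" using \<iota>(2) by auto
      have "(\<Sum>i<n. F i * indicator {x. \<iota> x = i} x) = (\<Sum>i<n. if i = \<iota> x then F i else 0)"
        by (intro sum.cong) (auto simp: indicator_def)
      then show "F (\<iota> x) = (\<Sum>i<n. F i * indicator {x. \<iota> x = i} x)" using \<open>\<iota> x < n\<close> by simp
    qed
    have Fm: "(\<lambda>x. F (\<iota> x)) \<in> borel_measurable M" for F :: "nat \<Rightarrow> real"
      using measurable_compose[OF \<iota>M, of F borel] by simp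
    have i: "integrable M (\<lambda>x. \<Sum>i<n. F i * indicator {x. \<iota> x = i} x)" for F :: "nat \<Rightarrow> real"
    proof (intro Bochner_Integration.integrable_sum integrable_mult_right)
      show "integrable M (indicator {x. \<iota> x = i} :: _ \<Rightarrow> real)" for i
        using mi by (rule integrable_real_indicator) (simp add: emeasure_eq_measure)
    qed
    have v: "(\<integral>x. F (\<iota> x) \<partial>M) = (\<Sum>i<n. F i * measure M {x. \<iota> x = i})" for F :: "nat \<Rightarrow> real"
    proof -
      have "(\<integral>x. F (\<iota> x) \<partial>M) = (\<integral>x. (\<Sum>i<n. F i * indicator {x. \<iota> x = i} x) \<partial>M)"
        by (intro integral_cong_AE ae Fm borel_measurable_integrable[OF i])
      also have "\<dots> = (\<Sum>i<n. \<integral>x. F i * indicator {x. \<iota> x = i} x \<partial>M)"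
        using mi by (intro Bochner_Integration.integral_sum) (auto intro!: integrable_real_indicator simp: emeasure_eq_measure)
      finally show ?thesis by (simp add: P(2))
    qed
    have "integrable M (\<lambda>x. F (\<iota> x))"
      by (rule iffD2[OF integrable_cong_AE[OF Fm[of F] borel_measurable_integrable[OF i[of F]] ae[of F]] i[of F]])
    then show ?thesis using v[of F] v[of "\<lambda>_. 1"] by (simp add: prob_space mult.commute)
  qed
  have dualn: "(\<Sum>i<n. measure \<mu> {x. \<iota> x = i} * \<phi> i) - (\<Sum>j<n. measure \<nu> {x. \<iota> x = j} * \<psi> j) \<le> c + 2 * \<delta>"
    if \<phi>\<psi>: "\<And>i j. i < n \<Longrightarrow> j < n \<Longrightarrow> \<phi> i - \<psi> j \<le> norm (p i - p j)" for \<phi> \<psi>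
  proof (rule field_le_epsilon)
    fix r :: real assume r: "r > 0"
    \<comment> \<open>The soft minimum loses \<open>\<epsilon> * ln n\<close> and the rounding of
      the cones another \<open>\<epsilon>\<close> at the nodes; together this is r.\<close>
    define \<epsilon> where "\<epsilon> = r / (1 + ln n)"
    have ln: "ln n \<ge> 0" using n by simp
    have \<epsilon>: "\<epsilon> > 0" using r ln by (simp add: \<epsilon>_def)
    obtain f where f: "\<And>k. C_k k f" "\<And>x. norm (grad f x) \<le> 1"
    "\<And>x j. j < n \<Longrightarrow> f x \<le> \<psi> j + sqrt (\<epsilon>\<^sup>2 + (norm (x - p j))\<^sup>2)"
    "\<And>x q. (\<And>j. j < n \<Longrightarrow> q \<le> \<psi> j + norm (x - p j)) \<Longrightarrow> q - \<epsilon> * ln n \<le> f x"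
      using soft_min_potential[OF \<epsilon> n, of \<psi> p] by metis
    have f1: "\<phi> i \<le> f (p i) + \<epsilon> * ln n" if "i < n" for i
      using f(4)[of "\<phi> i" "p i"] \<phi>\<psi>[OF that] by (force simp: algebra_simps)
    have f2: "f (p j) \<le> \<psi> j + \<epsilon>" if "j < n" for j using f(3)[OF that, of "p j"] \<epsilon> by simp
    have lip: "1-lipschitz_on UNIV f" by (rule C_k_grad_Lipschitz[OF f(1,2)])
    have fc: "continuous_on UNIV f" using C_k_continuous[OF f(1)] .
    have near: "\<bar>f (p (\<iota> x)) - f x\<bar> \<le> \<delta>" if "x \<in> K" for x
      using lipschitz_onD[OF lip, of "p (\<iota> x)" x] \<iota>(2)[OF that] by (simp add: dist_norm norm_minus_commute)
    have nearint: "\<bar>(\<Sum>i<n. measure M {x. \<iota> x = i} * f (p i)) - (\<integral>x. f x \<partial>M)\<bar> \<le> \<delta>" if M: "M \<in> Prob_on K" for M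
    proof -
      have i1: "integrable M (\<lambda>x. f (p (\<iota> x)))" "(\<Sum>i<n. measure M {x. \<iota> x = i} * f (p i)) = (\<integral>x. f (p (\<iota> x)) \<partial>M)"
        using sumint[OF M, of "\<lambda>i. f (p i)"] by auto
      have i2: "integrable M f" using integrable_Prob_on[OF M K fc] .
      have "norm (\<integral>x. f (p (\<iota> x)) - f x \<partial>M) \<le> \<delta>"
        using i1 i2 near by (intro norm_integral_Prob_on_le[OF M]) auto
      then show ?thesis using i1 i2 by simp
    qed
    have "(\<Sum>i<n. measure \<mu> {x. \<iota> x = i} * \<phi> i) \<le> (\<Sum>i<n. measure \<mu> {x. \<iota> x = i} * (f (p i) + \<epsilon> * ln n))"
      using f1 by (intro sum_mono mult_left_mono) auto
    also have "\<dots> = (\<Sum>i<n. measure \<mu> {x. \<iota> x = i} * f (p i)) + \<epsilon> * ln n"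
      using sumint[OF \<mu>] by (simp add: distrib_left sum.distrib sum_distrib_right[symmetric])
    finally have A: "(\<Sum>i<n. measure \<mu> {x. \<iota> x = i} * \<phi> i) \<le> (\<Sum>i<n. measure \<mu> {x. \<iota> x = i} * f (p i)) + \<epsilon> * ln n" .
    have "(\<Sum>i<n. measure \<nu> {x. \<iota> x = i} * f (p i)) \<le> (\<Sum>i<n. measure \<nu> {x. \<iota> x = i} * (\<psi> i + \<epsilon>))"
      using f2 by (intro sum_mono mult_left_mono) auto
    also have "\<dots> = (\<Sum>i<n. measure \<nu> {x. \<iota> x = i} * \<psi> i) + \<epsilon>"
      using sumint[OF \<nu>] by (simp add: distrib_left sum.distrib sum_distrib_right[symmetric])
    finally have B: "(\<Sum>i<n. measure \<nu> {x. \<iota> x = i} * f (p i)) \<le> (\<Sum>i<n. measure \<nu> {x. \<iota> x = i} * \<psi> i) + \<epsilon>" .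
    have "\<epsilon> * (1 + ln n) = r" using ln by (simp add: \<epsilon>_def)
    then show "(\<Sum>i<n. measure \<mu> {x. \<iota> x = i} * \<phi> i) - (\<Sum>j<n. measure \<nu> {x. \<iota> x = j} * \<psi> j) \<le> c + 2 * \<delta> + r"
      using A B nearint[OF \<mu>] nearint[OF \<nu>] dual[OF f(1,2)] by (simp add: distrib_left abs_le_iff)
  qed
  obtain q where q: "\<forall>i<n. \<forall>j<n. 0 \<le> q i j" "\<forall>i<n. (\<Sum>j<n. q i j) = measure \<mu> {x. \<iota> x = i}"
    "\<forall>j<n. (\<Sum>i<n. q i j) = measure \<nu> {x. \<iota> x = j}" "(\<Sum>i<n. \<Sum>j<n. q i j * norm (p i - p j)) \<le> c + 2 * \<delta>"
    using finite_transport_duality[of n "\<lambda>i. measure \<mu> {x. \<iota> x = i}" "\<lambda>i. measure \<nu> {x. \<iota> x = i}"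
      "\<lambda>i j. norm (p i - p j)" "c + 2 * \<delta>"] dualn sumint[OF \<mu>] sumint[OF \<nu>] by auto
  have "W1 \<mu> \<nu> \<le> (c + 2 * \<delta>) + 2 * \<delta>"
    using q \<delta> c0 by (intro W1_le_finite_plan[OF \<mu> \<nu> n \<iota>, where q = q]) auto
  then show "W1 \<mu> \<nu> \<le> c + e" by (simp add: \<delta>_def)
qed

section \<open>Metric axioms\<close>

text \<open>Duality takes the place of gluing plans: a potential is 1-Lipschitz, so its increments
  over the two steps are bounded by the two distances.\<close>

lemma W1_triangle:
  fixes \<mu> \<nu> \<rho> :: "'a::euclidean_space measure"
  assumes "\<mu> \<in> Prob_c" "\<nu> \<in> Prob_c" "\<rho> \<in> Prob_c"
  shows "W1 \<mu> \<rho> \<le> W1 \<mu> \<nu> + W1 \<nu> \<rho>"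
proof -
  obtain R where R: "\<mu> \<in> Prob_on (cball 0 R)" "\<rho> \<in> Prob_on (cball 0 R)"
    using Prob_on_cball2[OF assms(1,3)] by metis
  show ?thesis
  proof (rule Kantorovich_duality[OF R compact_cball])
    fix f :: "'a \<Rightarrow> real" assume "\<And>k. C_k k f" "\<And>x. norm (grad f x) \<le> 1"
    then have lip: "1-lipschitz_on UNIV f" by (rule C_k_grad_Lipschitz)
    show "(\<integral>x. f x \<partial>\<mu>) - (\<integral>x. f x \<partial>\<rho>) \<le> W1 \<mu> \<nu> + W1 \<nu> \<rho>"
      using W1_Lipschitz_bound_UNIV[OF assms(1,2) lip] W1_Lipschitz_bound_UNIV[OF assms(2,3) lip] by simp
  qed
qed

text \<open>The Lipschitz bound has an absolute value on the left, so duality can be applied with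
  the roles of the measures exchanged.\<close>

lemma W1_commute:
  fixes \<mu> \<nu> :: "'a::euclidean_space measure"
  assumes "\<mu> \<in> Prob_c" "\<nu> \<in> Prob_c"
  shows "W1 \<mu> \<nu> = W1 \<nu> \<mu>"
proof -
  have "W1 \<mu> \<nu> \<le> W1 \<nu> \<mu>" if pc: "\<mu> \<in> Prob_c" "\<nu> \<in> Prob_c" for \<mu> \<nu> :: "'a measure"
  proof -
    obtain R where R: "\<mu> \<in> Prob_on (cball 0 R)" "\<nu> \<in> Prob_on (cball 0 R)"
      using Prob_on_cball2[OF pc] by metis
    show ?thesis
    proof (rule Kantorovich_duality[OF R compact_cball])
      fix f :: "'a \<Rightarrow> real" assume "\<And>k. C_k k f" "\<And>x. norm (grad f x) \<le> 1"
      then have lip: "1-lipschitz_on UNIV f" by (rule C_k_grad_Lipschitz)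
      show "(\<integral>x. f x \<partial>\<mu>) - (\<integral>x. f x \<partial>\<nu>) \<le> W1 \<nu> \<mu>"
        using W1_Lipschitz_bound_UNIV[OF pc(2,1) lip] by simp
    qed
  qed
  then show ?thesis using assms by (simp add: antisym)
qed

section \<open>Compactness\<close>

text \<open>Cantor's coding: a base 3 expansion whose digits 0 and 2 record membership in the sets
  \<open>B k\<close>. Leaving out the digit 1 creates gaps, so that each digit depends continuously
  on the code.\<close>

definition ternary_code :: "(nat \<Rightarrow> 'a set) \<Rightarrow> 'a \<Rightarrow> real" where
  "ternary_code B x = (\<Sum>k. 2 * indicator (B k) x / 3 ^ Suc k)"

lemma ternary_code_sums: "summable (\<lambda>k. 2 * indicator (B k) x / 3 ^ Suc k :: real)"
proof (rule summable_comparison_test)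
  have "summable (\<lambda>k. (2/3) * (1/3::real) ^ k)" by (intro summable_mult summable_geometric) simp
  then show "summable (\<lambda>k. 2 / 3 ^ Suc k :: real)" by (simp add: power_divide)
qed (auto intro!: exI[of _ 0] simp: indicator_def)

lemma geometric_tail: "(\<Sum>k. 2 / 3 ^ Suc (k + n) :: real) = 1 / 3 ^ n" "summable (\<lambda>k. 2 / 3 ^ Suc (k + n) :: real)"
proof -
  have "(\<lambda>k. (2 / 3 ^ Suc n) * (1/3::real) ^ k) sums ((2 / 3 ^ Suc n) * (1 / (1 - 1/3)))"
    by (intro sums_mult geometric_sums) simp
  moreover have "(2 / 3 ^ Suc n) * (1/3::real) ^ k = 2 / 3 ^ Suc (k + n)" for k
    by (simp add: power_add power_divide)
  ultimately have "(\<lambda>k. 2 / 3 ^ Suc (k + n) :: real) sums (1 / 3 ^ n)" by simp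
  then show "(\<Sum>k. 2 / 3 ^ Suc (k + n) :: real) = 1 / 3 ^ n" "summable (\<lambda>k. 2 / 3 ^ Suc (k + n) :: real)"
    by (auto simp: sums_iff)
qed

lemma ternary_code_tail:
  fixes x :: 'a and n :: nat and B :: "nat \<Rightarrow> 'a set"
  defines "d k \<equiv> 2 * indicator (B k) x / 3 ^ Suc k :: real"
  shows "ternary_code B x = (\<Sum>k. d (k + n)) + (\<Sum>k<n. d k)" "0 \<le> (\<Sum>k. d (k + n))" "(\<Sum>k. d (k + n)) \<le> 1 / 3 ^ n"
proof -
  have s: "summable d" unfolding d_def by (rule ternary_code_sums)
  then have s': "summable (\<lambda>k. d (k + n))" by (subst summable_iff_shift)
  have "ternary_code B x = suminf d" unfolding ternary_code_def d_def ..
  then show "ternary_code B x = (\<Sum>k. d (k + n)) + (\<Sum>k<n. d k)"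
    using suminf_split_initial_segment[OF s, of n] by simp
  show "0 \<le> (\<Sum>k. d (k + n))" by (rule suminf_nonneg[OF s']) (simp add: d_def)
  have "d k \<le> 2 / 3 ^ Suc k" for k by (auto simp: d_def indicator_def)
  then have "(\<Sum>k. d (k + n)) \<le> (\<Sum>k. 2 / 3 ^ Suc (k + n))" by (intro suminf_le s' geometric_tail) auto
  then show "(\<Sum>k. d (k + n)) \<le> 1 / 3 ^ n" by (simp only: geometric_tail)
qed

lemma ternary_code_bounds: "0 \<le> ternary_code B x" "ternary_code B x \<le> 1"
  using ternary_code_tail[where B = B and x = x and n = 0] by auto

text \<open>At the first differing digit j the codes differ by \<open>2 / 3 ^ Suc j\<close>, of
  which the tails can cancel at most \<open>1 / 3 ^ Suc j\<close>.\<close>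

lemma ternary_code_separates:
  assumes "\<bar>ternary_code B x - ternary_code B y\<bar> < 1 / 3 ^ m" "k < m"
  shows "x \<in> B k \<longleftrightarrow> y \<in> B k"
proof (rule ccontr)
  assume ne: "\<not> (x \<in> B k \<longleftrightarrow> y \<in> B k)"
  define j where "j = (LEAST k. \<not> (x \<in> B k \<longleftrightarrow> y \<in> B k))"
  have j: "\<not> (x \<in> B j \<longleftrightarrow> y \<in> B j)" unfolding j_def by (rule LeastI[of "\<lambda>k. \<not> (x \<in> B k \<longleftrightarrow> y \<in> B k)", OF ne])
  have lt: "x \<in> B i \<longleftrightarrow> y \<in> B i" if "i < j" for i using not_less_Least[OF that[unfolded j_def]] by blast
  have "j \<le> k" unfolding j_def by (rule Least_le[of "\<lambda>k. \<not> (x \<in> B k \<longleftrightarrow> y \<in> B k)", OF ne])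
  have main: "ternary_code B x - ternary_code B y \<ge> 1 / 3 ^ Suc j"
    if "x \<in> B j" "y \<notin> B j" "\<And>i. i < j \<Longrightarrow> x \<in> B i \<longleftrightarrow> y \<in> B i" for x y
  proof -
    have eq: "(\<Sum>i<j. 2 * indicator (B i) x / 3 ^ Suc i :: real) = (\<Sum>i<j. 2 * indicator (B i) y / 3 ^ Suc i)"
      using that(3) by (intro sum.cong) (auto simp: indicator_def)
    show ?thesis
      using ternary_code_tail[where B = B and x = x and n = "Suc j"] ternary_code_tail[where B = B and x = y and n = "Suc j"] eq that(1,2) by simp
  qed
  have "\<bar>ternary_code B x - ternary_code B y\<bar> \<ge> 1 / 3 ^ Suc j"
    using main[of x y] main[of y x] j lt by fastforce
  moreover have "1 / 3 ^ m \<le> (1 / 3 ^ Suc j :: real)"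
    using \<open>j \<le> k\<close> assms(2) by (intro divide_left_mono power_increasing) auto
  ultimately show False using assms(1) by linarith
qed

text \<open>The sets coded are a countable base of the topology. The code e is merely Borel, but its
  inverse is uniformly continuous on the image of K, and it is the continuous decoder D that carries
  convergence on the line back to K.\<close>

lemma borel_coding:
  fixes K :: "'a::euclidean_space set"
  assumes K: "compact K"
  obtains e :: "'a \<Rightarrow> real" and D R where "e \<in> borel_measurable borel" "\<And>x. 0 \<le> e x \<and> e x \<le> 1"
    "continuous_on UNIV D" "\<And>s. norm (D s) \<le> R" "\<And>x. x \<in> K \<Longrightarrow> D (e x) = x"
proof -
  obtain B :: "nat \<Rightarrow> 'a set" where "inj B" and B: "\<And>n. open (B n)" "\<And>S. open S \<Longrightarrow> \<exists>k. S = \<Union>{B n |n. n \<in> k}"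
    by (rule univ_second_countable_sequence, rule that) (assumption, meson, meson)
  define e where "e = ternary_code B"
  have em: "e \<in> borel_measurable borel"
    unfolding e_def ternary_code_def
    by (intro borel_measurable_suminf borel_measurable_divide borel_measurable_times borel_measurable_indicator borel_measurable_const)
      (use B(1) in auto)
  \<comment> \<open>Finitely many basic sets of small diameter cover K. Points whose codes are
    closer than \<open>1 / 3 ^ m\<close> agree on membership in each of them, so they share one of
    these sets.\<close>
  have inv: "\<exists>\<delta>>0. \<forall>x\<in>K. \<forall>y\<in>K. \<bar>e x - e y\<bar> < \<delta> \<longrightarrow> dist x y < \<epsilon>" if \<epsilon>: "\<epsilon> > 0" for \<epsilon>
  proof -
    define I where "I = {k. \<exists>z. B k \<subseteq> ball z (\<epsilon>/2)}"
    have "K \<subseteq> (\<Union>k\<in>I. B k)"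
    proof
      fix x assume "x \<in> K"
      from B(2)[OF open_ball, of x "\<epsilon>/2"]
      obtain J where J: "ball x (\<epsilon>/2) = \<Union>{B n |n. n \<in> J}" ..
      have "x \<in> ball x (\<epsilon>/2)" using \<epsilon> by simp
      then obtain n where n: "n \<in> J" "x \<in> B n" unfolding J by blast
      then have "B n \<subseteq> ball x (\<epsilon>/2)" unfolding J by blast
      then have "n \<in> I" unfolding I_def by blast
      with n(2) show "x \<in> (\<Union>k\<in>I. B k)" by blast
    qed
    then obtain F where F: "F \<subseteq> I" "finite F" "K \<subseteq> (\<Union>k\<in>F. B k)"
      by (rule compactE_image[OF K B(1)])
    define m where "m = Suc (Max (insert 0 F))"
    have "dist x y < \<epsilon>" if xy: "x \<in> K" "y \<in> K" "\<bar>e x - e y\<bar> < 1 / 3 ^ m" for x y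
    proof -
      obtain k where k: "k \<in> F" "x \<in> B k" using F xy by auto
      have "k < m" using k F(2) by (auto simp: m_def less_Suc_eq_le)
      then have "y \<in> B k" using ternary_code_separates[OF xy(3)[unfolded e_def]] k by blast
      moreover obtain z where "B k \<subseteq> ball z (\<epsilon>/2)" using k F(1) by (auto simp: I_def)
      ultimately have "dist z x < \<epsilon>/2" "dist z y < \<epsilon>/2" using k by auto
      then show ?thesis using dist_triangle3[of x y z] by linarith
    qed
    then show ?thesis by (intro exI[of _ "1 / 3 ^ m"]) auto
  qed
  have inj: "inj_on e K"
  proof (rule inj_onI, rule ccontr)
    fix x y assume xy: "x \<in> K" "y \<in> K" "e x = e y" "x \<noteq> y"
    then have "\<exists>\<delta>>0. \<forall>a\<in>K. \<forall>b\<in>K. \<bar>e a - e b\<bar> < \<delta> \<longrightarrow> dist a b < dist x y"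
      by (intro inv) simp
    then have "dist x y < dist x y" using xy by force
    then show False by simp
  qed
  define g where "g = inv_into K e"
  have g: "g (e x) = x" if "x \<in> K" for x unfolding g_def using inj that by simp
  have "uniformly_continuous_on (e ` K) g"
    unfolding uniformly_continuous_on_def
  proof (intro allI impI)
    fix \<epsilon> :: real assume "\<epsilon> > 0"
    from inv[OF this] obtain \<delta> where "\<delta> > 0" "\<forall>x\<in>K. \<forall>y\<in>K. \<bar>e x - e y\<bar> < \<delta> \<longrightarrow> dist x y < \<epsilon>" by auto
    then show "\<exists>d>0. \<forall>x\<in>e ` K. \<forall>x'\<in>e ` K. dist x' x < d \<longrightarrow> dist (g x') (g x) < \<epsilon>"
      using g by (intro exI[of _ \<delta>]) (auto simp: dist_real_def)
  qed
  \<comment> \<open>The decoder extends to the closure of the image by uniform continuity, and from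
    there to the whole line by Tietze's theorem with the same bound.\<close>
  then obtain h where h: "uniformly_continuous_on (closure (e ` K)) h" "\<And>x. x \<in> e ` K \<Longrightarrow> g x = h x"
    using uniformly_continuous_on_extension_on_closure by metis
  have hc: "continuous_on (closure (e ` K)) h" by (rule uniformly_continuous_imp_continuous[OF h(1)])
  have "h ` closure (e ` K) \<subseteq> K"
    by (rule image_closure_subset[OF hc compact_imp_closed[OF K]]) (use h(2) g in force)
  moreover obtain R where R: "R > 0" "\<And>x. x \<in> K \<Longrightarrow> norm x \<le> R" using compact_imp_bounded[OF K] bounded_pos by metis
  ultimately have hb: "norm (h s) \<le> R" if "s \<in> closure (e ` K)" for s using that by blast
  have "\<exists>D. continuous_on UNIV D \<and> (\<forall>s\<in>closure (e ` K). D s = h s) \<and> (\<forall>s. norm (D s) \<le> R)"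
    by (rule Tietze[OF hc, of UNIV R]) (simp, use R(1) in simp, erule hb, blast)
  then obtain D where D: "continuous_on UNIV D" "\<And>s. s \<in> closure (e ` K) \<Longrightarrow> D s = h s" "\<And>s. norm (D s) \<le> R"
    by blast
  have "D (e x) = x" if "x \<in> K" for x
  proof -
    have "e x \<in> closure (e ` K)" by (rule subsetD[OF closure_subset imageI[OF that]])
    then have "D (e x) = h (e x)" by (rule D(2))
    also have "\<dots> = g (e x)" using h(2)[OF imageI[OF that]] by (rule sym)
    finally show ?thesis using g[OF that] by (rule trans)
  qed
  moreover have "0 \<le> e x \<and> e x \<le> 1" for x using ternary_code_bounds[of B x] by (simp add: e_def)
  ultimately show thesis using that[OF em _ D(1) D(3)] by simp
qed

section \<open>Sequential compactness of measures and of curves\<close>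

text \<open>Pushed to the line by e, the measures live on [0, 1] and are tight. A weakly convergent
  subsequence and Skorohod's theorem give representatives that converge pointwise; D returns them to
  K, and dominated convergence of the coupling cost gives convergence in \<open>W1\<close>.\<close>

theorem Prob_on_seq_compact:
  fixes \<mu> :: "nat \<Rightarrow> 'a::euclidean_space measure"
  assumes K: "compact K" and \<mu>: "\<And>n. \<mu> n \<in> Prob_on K"
  obtains r \<nu> where "strict_mono r" "\<nu> \<in> Prob_on K" "(\<lambda>n. W1 (\<mu> (r n)) \<nu>) \<longlonglongrightarrow> 0"
proof -
  obtain e D R where e: "e \<in> borel_measurable borel" "\<And>x::'a. 0 \<le> e x \<and> e x \<le> (1::real)"
    and D: "continuous_on UNIV D" "\<And>s. norm (D s) \<le> R" "\<And>x. x \<in> K \<Longrightarrow> D (e x) = x"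
    using borel_coding[OF K] by metis
  note P = Prob_simps[OF Prob_onD(1)[OF \<mu>]]
  have Dm: "D \<in> borel_measurable borel" by (rule borel_measurable_continuous_onI[OF D(1)])
  define \<Lambda> where "\<Lambda> n = distr (\<mu> n) borel e" for n
  have em: "e \<in> borel_measurable (\<mu> n)" for n using e(1) by (simp add: P(4))
  have rd: "real_distribution (\<Lambda> n)" for n
  proof -
    interpret prob_space "\<mu> n" by (rule P)
    show ?thesis unfolding \<Lambda>_def real_distribution_def real_distribution_axioms_def
      using prob_space_distr[OF em] by simp
  qed
  have "tight \<Lambda>"
    unfolding tight_def
  proof (intro conjI allI impI rd)
    fix \<epsilon> :: real assume "\<epsilon> > 0"
    have "measure (\<Lambda> n) {-1<..1} = 1" for n
    proof -
      interpret prob_space "\<mu> n" by (rule P)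
      have "measure (\<Lambda> n) {-1<..1} = measure (\<mu> n) (e -` {-1<..1} \<inter> space (\<mu> n))"
        unfolding \<Lambda>_def by (rule measure_distr[OF em]) simp
      also have "e -` {-1<..1} \<inter> space (\<mu> n) = space (\<mu> n)"
      proof -
        have "e x \<in> {-1<..1}" for x using e(2)[of x] by auto
        then show ?thesis by auto
      qed
      finally show ?thesis by (simp add: prob_space)
    qed
    then show "\<exists>a b. a < b \<and> (\<forall>n. 1 - \<epsilon> < measure (\<Lambda> n) {a<..b})"
      using \<open>\<epsilon> > 0\<close> by (intro exI[of _ "-1"] exI[of _ 1]) auto
  qed
  then obtain r M where r: "strict_mono r" and M: "real_distribution M" "weak_conv_m (\<Lambda> \<circ> id \<circ> r) M"
    using tight_imp_convergent_subsubsequence[of \<Lambda> id] by (auto simp: strict_mono_def)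
  have "\<exists> (\<Omega> :: real measure) (Y_seq :: nat \<Rightarrow> real \<Rightarrow> real) (Y :: real \<Rightarrow> real).
    prob_space \<Omega> \<and> (\<forall>n. Y_seq n \<in> measurable \<Omega> borel) \<and> (\<forall>n. distr \<Omega> borel (Y_seq n) = (\<Lambda> \<circ> id \<circ> r) n) \<and>
    Y \<in> measurable \<Omega> lborel \<and> distr \<Omega> borel Y = M \<and> (\<forall>x \<in> space \<Omega>. (\<lambda>n. Y_seq n x) \<longlonglongrightarrow> Y x)"
    by (rule Skorohod[OF _ M]) (simp add: rd)
  then obtain \<Omega> :: "real measure" and Ys Y where "prob_space \<Omega> \<and> (\<forall>n. Ys n \<in> measurable \<Omega> borel) \<and> (\<forall>n. distr \<Omega> borel (Ys n) = (\<Lambda> \<circ> id \<circ> r) n) \<and>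
    Y \<in> measurable \<Omega> lborel \<and> distr \<Omega> borel Y = M \<and> (\<forall>x \<in> space \<Omega>. (\<lambda>n. Ys n x) \<longlonglongrightarrow> Y x)"
    by (elim exE) (rule that, assumption)
  then have \<Omega>: "prob_space \<Omega>" "\<And>n. Ys n \<in> measurable \<Omega> borel" "\<And>n. distr \<Omega> borel (Ys n) = \<Lambda> (r n)"
    "Y \<in> measurable \<Omega> borel" "\<And>x. x \<in> space \<Omega> \<Longrightarrow> (\<lambda>n. Ys n x) \<longlonglongrightarrow> Y x"
    by auto
  interpret prob_space \<Omega> by fact
  define X where "X n x = D (Ys n x)" for n x
  define X' where "X' x = D (Y x)" for x
  have Xm: "X n \<in> borel_measurable \<Omega>" "X' \<in> borel_measurable \<Omega>" for n
    unfolding X_def [abs_def] X'_def [abs_def] using \<Omega> Dm by (auto intro: measurable_compose)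
  have dX: "distr \<Omega> borel (X n) = \<mu> (r n)" for n
  proof -
    have "distr \<Omega> borel (X n) = distr (\<Lambda> (r n)) borel D"
      unfolding \<Omega>(3)[symmetric] using Dm \<Omega>(2) by (subst distr_distr) (auto simp: X_def [abs_def] o_def)
    also have "\<dots> = distr (\<mu> (r n)) borel (\<lambda>x. D (e x))"
      unfolding \<Lambda>_def using Dm em by (subst distr_distr) (auto simp: o_def)
    also have "\<dots> = distr (\<mu> (r n)) borel (\<lambda>x. x)"
    proof (rule distr_cong_AE)
      show "AE x in \<mu> (r n). D (e x) = x" using Prob_onD(2)[OF \<mu>] by eventually_elim (rule D(3))
      show "(\<lambda>x. D (e x)) \<in> borel_measurable (\<mu> (r n))" using em Dm by (rule measurable_compose)
      show "(\<lambda>x. x) \<in> borel_measurable (\<mu> (r n))" by (simp add: P(4))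
    qed auto
    finally show ?thesis using Prob_distr_id[OF Prob_onD(1)[OF \<mu>]] by simp
  qed
  have lim: "(\<lambda>n. X n x) \<longlonglongrightarrow> X' x" if "x \<in> space \<Omega>" for x
    unfolding X_def X'_def using D(1) \<Omega>(5)[OF that]
    by (intro isCont_tendsto_compose[of "Y x" D]) (auto simp: continuous_on_eq_continuous_at)
  define \<nu> where "\<nu> = distr \<Omega> borel X'"
  have "\<nu> \<in> Prob" unfolding \<nu>_def Prob_def using prob_space_distr[OF Xm(2)] by simp
  moreover have "AE x in \<nu>. x \<in> K"
  proof -
    have "AE x in \<Omega>. X n x \<in> K" for n
      by (rule AE_distrD[OF Xm(1)[of n]]) (unfold dX, rule Prob_onD(2)[OF \<mu>])
    then have "AE x in \<Omega>. \<forall>n. X n x \<in> K" by (simp add: AE_all_countable)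
    then have "AE x in \<Omega>. X' x \<in> K"
      using AE_space
    proof eventually_elim
      fix x assume x: "\<forall>n. X n x \<in> K" "x \<in> space \<Omega>"
      show "X' x \<in> K" by (rule closed_sequentially[OF compact_imp_closed[OF K] _ lim[OF x(2)]]) (use x(1) in simp)
    qed
    then show ?thesis unfolding \<nu>_def using Xm(2) compact_imp_closed[OF K]
      by (subst AE_distr_iff) (auto simp: borel_closed)
  qed
  ultimately have \<nu>: "\<nu> \<in> Prob_on K" using Prob_on_iff[OF compact_imp_closed[OF K]] by blast
  have "(\<lambda>n. \<integral>x. norm (X n x - X' x) \<partial>\<Omega>) \<longlonglongrightarrow> (\<integral>x. 0 \<partial>\<Omega>)"
  proof (rule integral_dominated_convergence[where w = "\<lambda>_. R + R"])
    show "AE x in \<Omega>. (\<lambda>n. norm (X n x - X' x)) \<longlonglongrightarrow> 0"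
      using lim by (intro AE_I2) (simp add: LIM_zero_iff tendsto_norm_zero_iff)
    have "norm (X n x - X' x) \<le> R + R" for n x
      unfolding X_def X'_def by (rule order_trans[OF norm_triangle_ineq4 add_mono[OF D(2) D(2)]])
    then show "AE x in \<Omega>. norm (norm (X n x - X' x)) \<le> R + R" for n by (intro AE_I2) simp
  qed (use Xm in measurable)
  then have "(\<lambda>n. \<integral>x. norm (X n x - X' x) \<partial>\<Omega>) \<longlonglongrightarrow> 0" by simp
  then have "(\<lambda>n. W1 (\<mu> (r n)) \<nu>) \<longlonglongrightarrow> 0"
  proof (rule Lim_null_comparison[rotated])
    have "W1 (\<mu> (r n)) \<nu> \<le> (\<integral>x. norm (X n x - X' x) \<partial>\<Omega>)" for n
      unfolding dX[symmetric] \<nu>_def by (rule W1_le_coupling[OF prob_space_axioms Xm])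
    moreover have "0 \<le> W1 (\<mu> (r n)) \<nu>" for n by (intro W1_nonneg Prob_onD(1)[OF \<mu>] Prob_onD(1)[OF \<nu>])
    ultimately show "\<forall>\<^sub>F n in sequentially. norm (W1 (\<mu> (r n)) \<nu>) \<le> (\<integral>x. norm (X n x - X' x) \<partial>\<Omega>)"
      by (intro always_eventually) auto
  qed
  with r \<nu> that show thesis by blast
qed

text \<open>Arzela-Ascoli: a diagonal sequence converges at rational times, the common modulus makes
  it Cauchy at every time, and compactness at that time supplies the limit.\<close>

theorem curves_seq_compact:
  fixes \<mu> :: "nat \<Rightarrow> real \<Rightarrow> 'a::euclidean_space measure" and I :: "real \<Rightarrow> real"
  assumes T: "T > 0" and K: "compact K" and \<mu>: "\<And>n t. t \<in> {0..T} \<Longrightarrow> \<mu> n t \<in> Prob_on K"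
    and I: "continuous_on {0..T} I"
    and lip: "\<And>n s t. 0 \<le> s \<Longrightarrow> s \<le> t \<Longrightarrow> t \<le> T \<Longrightarrow> W1 (\<mu> n s) (\<mu> n t) \<le> I t - I s"
  obtains r \<nu> where "strict_mono r" "\<And>t. t \<in> {0..T} \<Longrightarrow> \<nu> t \<in> Prob_on K"
    "\<And>t. t \<in> {0..T} \<Longrightarrow> (\<lambda>n. W1 (\<mu> (r n) t) (\<nu> t)) \<longlonglongrightarrow> 0"
    "\<And>s t. 0 \<le> s \<Longrightarrow> s \<le> t \<Longrightarrow> t \<le> T \<Longrightarrow> W1 (\<nu> s) (\<nu> t) \<le> I t - I s"
proof -
  have \<mu>c: "\<mu> n t \<in> Prob_c" if "t \<in> {0..T}" for n t using Prob_on_Prob_c[OF K \<mu>[OF that]] .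
  define Q where "Q = \<rat> \<inter> {0..T}"
  have Q: "countable Q" "Q \<noteq> {}" "Q \<subseteq> {0..T}" using T by (auto simp: Q_def countable_rat intro!: exI[of _ 0])
  have dense: "\<exists>q\<in>Q. \<bar>q - t\<bar> < \<delta>" if t: "t \<in> {0..T}" and \<delta>: "\<delta> > 0" for t \<delta>
  proof (cases "t < T")
    case True
    then obtain q where "q \<in> \<rat>" "t < q" "q < min T (t + \<delta>)" using Rats_dense_in_real[of t "min T (t + \<delta>)"] \<delta> by auto
    then show ?thesis using t by (intro bexI[of _ q]) (auto simp: Q_def)
  next
    case False
    then have "t = T" using t by simp
    then obtain q where "q \<in> \<rat>" "max 0 (t - \<delta>) < q" "q < t" using Rats_dense_in_real[of "max 0 (t - \<delta>)" t] \<delta> T by auto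
    then show ?thesis using t \<open>t = T\<close> by (intro bexI[of _ q]) (auto simp: Q_def)
  qed
  define q where "q = from_nat_into Q"
  have q: "q k \<in> {0..T}" for k unfolding q_def using from_nat_into[OF Q(2), of k] Q(3) by blast
  define P where "P k s \<longleftrightarrow> (\<exists>\<nu>\<in>Prob_on K. (\<lambda>n. W1 (\<mu> (s n) (q k)) \<nu>) \<longlonglongrightarrow> 0)" for k and s :: "nat \<Rightarrow> nat"
  interpret subseqs P
  proof
    fix k and s :: "nat \<Rightarrow> nat" assume "strict_mono s"
    obtain r \<nu> where "strict_mono r" "\<nu> \<in> Prob_on K" "(\<lambda>n. W1 (\<mu> (s (r n)) (q k)) \<nu>) \<longlonglongrightarrow> 0"
      using Prob_on_seq_compact[OF K, of "\<lambda>n. \<mu> (s n) (q k)"] \<mu>[OF q] by metis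
    then show "\<exists>r. strict_mono r \<and> P k (s \<circ> r)" by (auto simp: P_def)
  qed
  have "P k (diagseq \<circ> ((+) (Suc k)))" for k
  proof (rule diagseq_holds)
    fix r s :: "nat \<Rightarrow> nat" and n assume "strict_mono r" "P n s"
    then obtain \<nu> where "\<nu> \<in> Prob_on K" "(\<lambda>i. W1 (\<mu> (s i) (q n)) \<nu>) \<longlonglongrightarrow> 0" by (auto simp: P_def)
    with LIMSEQ_subseq_LIMSEQ[OF this(2) \<open>strict_mono r\<close>]
    show "P n (s \<circ> r)" by (auto simp: P_def o_def)
  qed
  define d where "d = diagseq"
  have d: "strict_mono d" unfolding d_def by (rule subseq_diagseq)
  have conv: "\<exists>\<nu>\<in>Prob_on K. (\<lambda>n. W1 (\<mu> (d n) (q k)) \<nu>) \<longlonglongrightarrow> 0" for k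
  proof -
    obtain \<nu> where \<nu>: "\<nu> \<in> Prob_on K" "(\<lambda>n. W1 (\<mu> (d (Suc k + n)) (q k)) \<nu>) \<longlonglongrightarrow> 0"
      using \<open>P k (diagseq \<circ> ((+) (Suc k)))\<close> by (auto simp: P_def d_def)
    then have "(\<lambda>n. W1 (\<mu> (d (n + Suc k)) (q k)) \<nu>) \<longlonglongrightarrow> 0" by (simp add: add.commute)
    from LIMSEQ_offset[OF this] \<nu>(1) show ?thesis by blast
  qed
  have cauchy: "\<exists>N. \<forall>m\<ge>N. \<forall>n\<ge>N. W1 (\<mu> (d m) t) (\<mu> (d n) t) < \<epsilon>" if t: "t \<in> {0..T}" and \<epsilon>: "\<epsilon> > 0" for t \<epsilon>
  proof -
    obtain \<delta> where \<delta>: "\<delta> > 0" "\<And>s. s \<in> {0..T} \<Longrightarrow> \<bar>s - t\<bar> < \<delta> \<Longrightarrow> \<bar>I s - I t\<bar> < \<epsilon> / 5"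
      using I t \<epsilon> unfolding continuous_on_iff dist_real_def by (metis divide_pos_pos zero_less_numeral)
    obtain s where s: "s \<in> Q" "\<bar>s - t\<bar> < \<delta>" using dense[OF t \<delta>(1)] by auto
    obtain k where k: "s = q k" using from_nat_into_surj[OF Q(1) s(1)] by (auto simp: q_def)
    have sT: "s \<in> {0..T}" using s Q by auto
    have near: "W1 (\<mu> n t) (\<mu> n s) < \<epsilon> / 5" for n
    proof (cases "s \<le> t")
      case True
      then have "W1 (\<mu> n s) (\<mu> n t) \<le> I t - I s" using sT t by (intro lip) auto
      then show ?thesis
        using \<delta>(2)[OF sT s(2)] W1_commute[OF \<mu>c[OF t, of n] \<mu>c[OF sT, of n]] by linarith
    next
      case False
      then have "W1 (\<mu> n t) (\<mu> n s) \<le> I s - I t" using sT t by (intro lip) auto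
      then show ?thesis
        using \<delta>(2)[OF sT s(2)] by linarith
    qed
    obtain \<nu> where \<nu>: "\<nu> \<in> Prob_on K" "(\<lambda>n. W1 (\<mu> (d n) s) \<nu>) \<longlonglongrightarrow> 0" using conv[of k] k by auto
    have \<nu>c: "\<nu> \<in> Prob_c" using Prob_on_Prob_c[OF K \<nu>(1)] .
    obtain N where N: "\<And>n. n \<ge> N \<Longrightarrow> W1 (\<mu> (d n) s) \<nu> < \<epsilon> / 5"
      using order_tendstoD(2)[OF \<nu>(2), of "\<epsilon> / 5"] \<epsilon> by (auto simp: eventually_sequentially)
    have "W1 (\<mu> (d m) t) (\<mu> (d n) t) < \<epsilon>" if "m \<ge> N" "n \<ge> N" for m n
    proof -
      note tri = W1_triangle and c = \<mu>c[OF t] \<mu>c[OF sT]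
      have "W1 (\<mu> (d m) t) (\<mu> (d n) t) \<le> W1 (\<mu> (d m) t) (\<mu> (d m) s) + W1 (\<mu> (d m) s) (\<mu> (d n) t)"
        by (intro tri c)
      moreover have "W1 (\<mu> (d m) s) (\<mu> (d n) t) \<le> W1 (\<mu> (d m) s) \<nu> + W1 \<nu> (\<mu> (d n) t)" by (intro tri c \<nu>c)
      moreover have "W1 \<nu> (\<mu> (d n) t) \<le> W1 \<nu> (\<mu> (d n) s) + W1 (\<mu> (d n) s) (\<mu> (d n) t)" by (intro tri c \<nu>c)
      moreover have "W1 \<nu> (\<mu> (d n) s) = W1 (\<mu> (d n) s) \<nu>" "W1 (\<mu> (d n) s) (\<mu> (d n) t) = W1 (\<mu> (d n) t) (\<mu> (d n) s)"
        by (intro W1_commute c \<nu>c)+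
      ultimately show ?thesis using near[of "d m"] near[of "d n"] N[OF that(1)] N[OF that(2)] \<epsilon> by linarith
    qed
    then show ?thesis by blast
  qed
  have "\<exists>\<nu>\<in>Prob_on K. (\<lambda>n. W1 (\<mu> (d n) t) \<nu>) \<longlonglongrightarrow> 0" if t: "t \<in> {0..T}" for t
  proof -
    obtain r \<nu> where r: "strict_mono r" and \<nu>: "\<nu> \<in> Prob_on K" "(\<lambda>n. W1 (\<mu> (d (r n)) t) \<nu>) \<longlonglongrightarrow> 0"
      using Prob_on_seq_compact[OF K, of "\<lambda>n. \<mu> (d n) t"] \<mu>[OF t] by metis
    have \<nu>c: "\<nu> \<in> Prob_c" using Prob_on_Prob_c[OF K \<nu>(1)] .
    have "(\<lambda>n. W1 (\<mu> (d n) t) \<nu>) \<longlonglongrightarrow> 0"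
    proof (rule LIMSEQ_I)
      fix \<epsilon> :: real assume \<epsilon>: "\<epsilon> > 0"
      obtain N where N: "\<And>m n. m \<ge> N \<Longrightarrow> n \<ge> N \<Longrightarrow> W1 (\<mu> (d m) t) (\<mu> (d n) t) < \<epsilon> / 2"
        using cauchy[OF t, of "\<epsilon> / 2"] \<epsilon> by auto
      have "\<forall>\<^sub>F n in sequentially. W1 (\<mu> (d (r n)) t) \<nu> < \<epsilon> / 2" using order_tendstoD(2)[OF \<nu>(2), of "\<epsilon> / 2"] \<epsilon> by auto
      moreover have "\<forall>\<^sub>F n in sequentially. n \<ge> N" by (rule eventually_ge_at_top)
      ultimately obtain k where k: "W1 (\<mu> (d (r k)) t) \<nu> < \<epsilon> / 2" "k \<ge> N"
        using eventually_happens'[OF sequentially_bot eventually_conj] by blast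
      have "r k \<ge> N" using k(2) seq_suble[OF r, of k] by simp
      have "norm (W1 (\<mu> (d n) t) \<nu> - 0) < \<epsilon>" if "n \<ge> N" for n
        using W1_triangle[OF \<mu>c[OF t, of "d n"] \<mu>c[OF t, of "d (r k)"] \<nu>c] N[OF that \<open>r k \<ge> N\<close>] k(1)
          W1_nonneg[OF Prob_c_D(1)[OF \<mu>c[OF t, of "d n"]] Prob_c_D(1)[OF \<nu>c]] by simp
      then show "\<exists>no. \<forall>n\<ge>no. norm (W1 (\<mu> (d n) t) \<nu> - 0) < \<epsilon>" by blast
    qed
    then show ?thesis using \<nu>(1) by blast
  qed
  then obtain \<nu> where \<nu>: "\<And>t. t \<in> {0..T} \<Longrightarrow> \<nu> t \<in> Prob_on K"
    "\<And>t. t \<in> {0..T} \<Longrightarrow> (\<lambda>n. W1 (\<mu> (d n) t) (\<nu> t)) \<longlonglongrightarrow> 0" by metis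
  have \<nu>c: "\<nu> t \<in> Prob_c" if "t \<in> {0..T}" for t using Prob_on_Prob_c[OF K \<nu>(1)[OF that]] .
  have "W1 (\<nu> s) (\<nu> t) \<le> I t - I s" if st: "0 \<le> s" "s \<le> t" "t \<le> T" for s t
  proof (rule LIMSEQ_le_const)
    have s: "s \<in> {0..T}" and t: "t \<in> {0..T}" using st by auto
    show "(\<lambda>n. W1 (\<mu> (d n) s) (\<nu> s) + (I t - I s) + W1 (\<mu> (d n) t) (\<nu> t)) \<longlonglongrightarrow> I t - I s"
      using tendsto_add[OF tendsto_add[OF \<nu>(2)[OF s] tendsto_const[of "I t - I s"]] \<nu>(2)[OF t]] by simp
    have "W1 (\<nu> s) (\<nu> t) \<le> W1 (\<mu> (d n) s) (\<nu> s) + (I t - I s) + W1 (\<mu> (d n) t) (\<nu> t)" for n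
    proof -
      have "W1 (\<nu> s) (\<nu> t) \<le> W1 (\<nu> s) (\<mu> (d n) s) + W1 (\<mu> (d n) s) (\<nu> t)"
        by (intro W1_triangle \<nu>c \<mu>c s t)
      moreover have "W1 (\<mu> (d n) s) (\<nu> t) \<le> W1 (\<mu> (d n) s) (\<mu> (d n) t) + W1 (\<mu> (d n) t) (\<nu> t)"
        by (intro W1_triangle \<nu>c \<mu>c s t)
      moreover have "W1 (\<nu> s) (\<mu> (d n) s) = W1 (\<mu> (d n) s) (\<nu> s)" by (intro W1_commute \<nu>c \<mu>c s)
      ultimately show ?thesis using lip[OF st, of "d n"] by linarith
    qed
    then show "\<exists>N. \<forall>n\<ge>N. W1 (\<nu> s) (\<nu> t) \<le> W1 (\<mu> (d n) s) (\<nu> s) + (I t - I s) + W1 (\<mu> (d n) t) (\<nu> t)" by blast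
  qed
  with d \<nu> that show thesis by blast
qed

section \<open>Measurable selections in a non-separable metric space\<close>

text \<open>Infinitely many sets of measure above a fixed positive bound would have a limes superior
  of positive measure, by continuity from above, and a point of it lies in infinitely many of
  them.\<close>

lemma (in finite_measure) countable_non_null_point_finite:
  assumes P: "\<And>i. P i \<in> sets M" and fin: "\<And>x. x \<in> space M \<Longrightarrow> finite {i. x \<in> P i}"
  shows "countable {i. P i \<notin> null_sets M}"
proof -
  have "finite {i. 1 / Suc k < measure M (P i)}" (is "finite ?S") for k
  proof (rule ccontr)
    assume "infinite ?S"
    then obtain f :: "nat \<Rightarrow> _" where f: "inj f" "range f \<subseteq> ?S"
      using infinite_countable_subset by blast
    define A where "A n = (\<Union>m\<in>{n..}. P (f m))" for n
    have A: "A n \<in> sets M" for n unfolding A_def using P by (intro sets.countable_UN'') auto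
    have "decseq A" unfolding decseq_def A_def by (auto intro: order_trans)
    then have "(\<lambda>n. measure M (A n)) \<longlonglongrightarrow> measure M (\<Inter>n. A n)"
      using A by (intro finite_Lim_measure_decseq) auto
    moreover have "1 / Suc k \<le> measure M (A n)" for n
    proof -
      have "1 / Suc k < measure M (P (f n))" using f(2) by auto
      also have "\<dots> \<le> measure M (A n)" using A by (intro finite_measure_mono) (auto simp: A_def)
      finally show ?thesis by simp
    qed
    ultimately have "1 / Suc k \<le> measure M (\<Inter>n. A n)" by (intro LIMSEQ_le_const) auto
    then have "(\<Inter>n. A n) \<noteq> {}" by (metis measure_empty not_le of_nat_0_less_iff zero_less_Suc zero_less_divide_1_iff)
    then obtain x where x: "\<And>n. x \<in> A n" by auto
    have xs: "x \<in> space M" using x[of 0] A[of 0] sets.sets_into_space by blast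
    have "infinite {m. x \<in> P (f m)}"
      unfolding infinite_nat_iff_unbounded_le using x by (fastforce simp: A_def)
    then have "infinite (f ` {m. x \<in> P (f m)})"
      using finite_imageD[of f "{m. x \<in> P (f m)}"] inj_on_subset[OF f(1)] by blast
    then show False using fin[OF xs] finite_subset[of "f ` {m. x \<in> P (f m)}" "{i. x \<in> P i}"] by blast
  qed
  then have "countable (\<Union>k. {i. 1 / Suc k < measure M (P i)})" by (intro countable_UN) (auto intro: countable_finite)
  moreover have "{i. P i \<notin> null_sets M} \<subseteq> (\<Union>k. {i. 1 / Suc k < measure M (P i)})"
  proof
    fix i assume "i \<in> {i. P i \<notin> null_sets M}"
    then have "measure M (P i) > 0" using P by (auto simp: null_sets_def emeasure_eq_measure zero_less_measure_iff)
    then obtain k where "inverse (real (Suc k)) < measure M (P i)" using reals_Archimedean by blast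
    then show "i \<in> (\<Union>k. {i. 1 / Suc k < measure M (P i)})" by (auto simp: inverse_eq_divide)
  qed
  ultimately show ?thesis by (rule countable_subset[rotated])
qed

text \<open>
  The index set is well-ordered and cut down so that the union over every proper initial segment is
  null.  Covering these null unions by open sets turns the order relation into a measurable subset
  of the square all of whose horizontal sections are null while its vertical sections are conull.
\<close>

lemma null_union_point_finite:
  fixes M :: "'a::euclidean_space measure" and P :: "'i \<Rightarrow> 'a set"
  assumes M: "finite_measure M" and op: "\<And>G. open G \<Longrightarrow> G \<inter> space M \<in> sets M"
    and outer: "\<And>N e. N \<in> null_sets M \<Longrightarrow> 0 < e \<Longrightarrow> \<exists>G. open G \<and> N \<subseteq> G \<and> measure M (G \<inter> space M) < e"
    and un: "\<And>J. (\<Union>i\<in>J. P i) \<in> sets M" and null: "\<And>i. P i \<in> null_sets M"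
    and fin: "\<And>x. x \<in> space M \<Longrightarrow> finite {i. x \<in> P i}"
  shows "(\<Union>i. P i) \<in> null_sets M"
proof (rule ccontr)
  assume neg: "(\<Union>i. P i) \<notin> null_sets M"
  interpret finite_measure M by fact
  have sf: "sigma_finite_measure M" using M by (simp add: finite_measure_def)
  interpret pair_sigma_finite M M ..
  obtain r :: "'i rel" where r: "well_order_on UNIV r" using well_order_on by blast
  then have wf: "wf (r - Id)" and tot: "\<And>i j. i \<noteq> j \<Longrightarrow> (i, j) \<in> r \<or> (j, i) \<in> r" and rf: "\<And>i. (i, i) \<in> r"
    by (auto simp: well_order_on_def linear_order_on_def partial_order_on_def preorder_on_def total_on_def refl_on_def)
  define below where "below i = {j. (j, i) \<in> r - Id}" for i
  define bad where "bad i \<longleftrightarrow> (\<Union>j\<in>below i. P j) \<notin> null_sets M" for i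
  \<comment> \<open>Below the least bad index every initial segment is null while the whole union is
    not. If there is no bad index, the full index set has the same property.\<close>
  obtain I where I: "(\<Union>i\<in>I. P i) \<notin> null_sets M" "\<And>i. i \<in> I \<Longrightarrow> \<not> bad i"
  proof (cases "\<exists>i. bad i")
    case True
    then obtain i0 where i0: "bad i0" "\<And>j. (j, i0) \<in> r - Id \<Longrightarrow> \<not> bad j"
      using wfE_min[OF wf, of _ "Collect bad"] by (metis mem_Collect_eq)
    show thesis by (rule that[of "below i0"]) (use i0 in \<open>auto simp: bad_def below_def\<close>)
  next
    case False then show thesis using that[of UNIV] neg by auto
  qed
  define Q where "Q i = (\<Union>j\<in>below i. P j) \<union> P i" for i
  have Q: "Q i \<in> null_sets M" if "i \<in> I" for i
    unfolding Q_def using I(2)[OF that] null[of i] by (intro null_sets.Un) (auto simp: bad_def)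
  have "\<exists>G. open G \<and> Q i \<subseteq> G \<and> measure M (G \<inter> space M) < 1 / Suc k" if "i \<in> I" for i k
    using outer[OF Q[OF that], of "1 / Suc k"] by simp
  then obtain G where G: "\<And>i k. i \<in> I \<Longrightarrow> open (G i k) \<and> Q i \<subseteq> G i k \<and> measure M (G i k \<inter> space M) < 1 / Suc k"
    by metis
  obtain B :: "nat \<Rightarrow> 'a set" where "inj B" and B: "\<And>n. open (B n)" "\<And>S. open S \<Longrightarrow> \<exists>k. S = \<Union>{B n |n. n \<in> k}"
    by (rule univ_second_countable_sequence, rule that) (assumption, meson, meson)
  have Bx: "\<exists>j. x \<in> B j \<and> B j \<subseteq> S" if S: "open S" "x \<in> S" for S x
  proof -
    from B(2)[OF S(1)] obtain k where k: "S = \<Union>{B n |n. n \<in> k}" ..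
    then obtain j where "j \<in> k" "x \<in> B j" using S(2) by blast
    then show ?thesis using k by blast
  qed
  \<comment> \<open>A pair (x, y) belongs to R iff for every k some i in I has x in
    \<open>G i k\<close> and y in \<open>P i\<close>. Grouping the indices by basic open sets
    \<open>B j\<close> writes R with countably many rectangles, whose second factors are measurable
    because all unions of the \<open>P i\<close> are.\<close>
  define R where "R = (\<Inter>k. \<Union>j. (B j \<inter> space M) \<times> (\<Union>i\<in>{i\<in>I. B j \<subseteq> G i k}. P i))"
  have R: "R \<in> sets (M \<Otimes>\<^sub>M M)"
  proof -
    have "(B j \<inter> space M) \<times> (\<Union>i\<in>{i\<in>I. B j \<subseteq> G i k}. P i) \<in> sets (M \<Otimes>\<^sub>M M)" for j k
      by (intro pair_measureI op B(1) un)
    then have "(\<Union>j. (B j \<inter> space M) \<times> (\<Union>i\<in>{i\<in>I. B j \<subseteq> G i k}. P i)) \<in> sets (M \<Otimes>\<^sub>M M)" for k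
      by (intro sets.countable_UN) blast
    then show ?thesis unfolding R_def by (intro sets.countable_INT) auto
  qed
  \<comment> \<open>Only finitely many i have y in \<open>P i\<close>, and each contributes an open
    set of measure below \<open>1 / Suc k\<close>.\<close>
  have sec: "emeasure M ((\<lambda>x. (x, y)) -` R) = 0" if y: "y \<in> space M" for y
  proof -
    let ?F = "{i\<in>I. y \<in> P i}"
    have fF: "finite ?F" using fin[OF y] by (rule rev_finite_subset) auto
    have m: "(\<lambda>x. (x, y)) -` R \<in> sets M" using sets_Pair2[OF R] .
    have "measure M ((\<lambda>x. (x, y)) -` R) \<le> real (card ?F) * (1 / Suc k)" for k
    proof -
      have sub: "(\<lambda>x. (x, y)) -` R \<subseteq> (\<Union>i\<in>?F. G i k \<inter> space M)" unfolding R_def by auto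
      have mG: "G i k \<inter> space M \<in> sets M" if "i \<in> ?F" for i using G that op by auto
      have "measure M ((\<lambda>x. (x, y)) -` R) \<le> measure M (\<Union>i\<in>?F. G i k \<inter> space M)"
        using mG fF by (intro finite_measure_mono[OF sub] sets.finite_UN) auto
      also have "\<dots> \<le> (\<Sum>i\<in>?F. measure M (G i k \<inter> space M))"
        using mG fF by (intro finite_measure_subadditive_finite) auto
      also have "\<dots> \<le> (\<Sum>i\<in>?F. 1 / Suc k)" using G by (intro sum_mono) (auto intro: less_imp_le)
      finally show ?thesis by simp
    qed
    moreover have "(\<lambda>k. real (card ?F) * (1 / Suc k)) \<longlonglongrightarrow> real (card ?F) * 0"
      by (intro tendsto_intros LIMSEQ_Suc[OF lim_1_over_n])
    ultimately have "measure M ((\<lambda>x. (x, y)) -` R) \<le> 0" by (intro LIMSEQ_le_const) auto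
    then show ?thesis by (simp add: emeasure_eq_measure measure_le_0_iff)
  qed
  have "emeasure (M \<Otimes>\<^sub>M M) R = 0"
    using sec by (subst emeasure_pair_measure_alt2[OF R]) (auto simp: nn_integral_0_iff_AE cong: nn_integral_cong)
  then have "(\<integral>\<^sup>+x. emeasure M (Pair x -` R) \<partial>M) = 0"
    using sigma_finite_measure.emeasure_pair_measure_alt[OF sf R] by simp
  then have ae: "AE x in M. emeasure M (Pair x -` R) = 0"
    using sigma_finite_measure.measurable_emeasure_Pair[OF sf R] by (simp add: nn_integral_0_iff_AE)
  have "\<exists>x\<in>(\<Union>i\<in>I. P i). emeasure M (Pair x -` R) = 0"
  proof (rule ccontr)
    assume "\<not> ?thesis"
    then have "AE x in M. x \<notin> (\<Union>i\<in>I. P i)" using ae by (rule_tac eventually_mono[OF ae]) blast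
    then have "(\<Union>i\<in>I. P i) \<in> null_sets M" using AE_iff_null_sets[OF un] by blast
    then show False using I(1) by simp
  qed
  then obtain x i0 where x: "i0 \<in> I" "x \<in> P i0" "emeasure M (Pair x -` R) = 0" by blast
  have xs: "x \<in> space M" using null[of i0] x(2) sets.sets_into_space by blast
  \<comment> \<open>If i is not below i0, then \<open>Q i\<close> contains \<open>P i0\<close> and
    hence x. The section of R at x thus contains all of the union except a null initial segment,
    although it is null by Fubini.\<close>
  have "(\<Union>i\<in>I. P i) - (\<Union>j\<in>below i0. P j) \<subseteq> Pair x -` R"
  proof
    fix y assume "y \<in> (\<Union>i\<in>I. P i) - (\<Union>j\<in>below i0. P j)"
    then obtain i where i: "i \<in> I" "y \<in> P i" "i \<notin> below i0" by blast
    then have "i = i0 \<or> i0 \<in> below i" using tot[of i i0] by (auto simp: below_def)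
    then have xQ: "x \<in> Q i" using x(2) by (auto simp: Q_def)
    have "\<exists>j. x \<in> B j \<inter> space M \<and> y \<in> (\<Union>i\<in>{i\<in>I. B j \<subseteq> G i k}. P i)" for k
    proof -
      obtain j where "x \<in> B j" "B j \<subseteq> G i k" using Bx[of "G i k" x] G[OF i(1)] xQ by blast
      then show ?thesis using i xs by blast
    qed
    then show "y \<in> Pair x -` R" by (auto simp: R_def)
  qed
  moreover have "Pair x -` R \<in> null_sets M" using x(3) sets_Pair1[OF R] by auto
  moreover have "(\<Union>i\<in>I. P i) - (\<Union>j\<in>below i0. P j) \<in> sets M" using un by auto
  ultimately have "(\<Union>i\<in>I. P i) - (\<Union>j\<in>below i0. P j) \<in> null_sets M" by (rule null_sets_subset[rotated 2])
  moreover have "(\<Union>j\<in>below i0. P j) \<in> null_sets M" using I(2)[OF x(1)] by (simp add: bad_def)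
  ultimately have "((\<Union>i\<in>I. P i) - (\<Union>j\<in>below i0. P j)) \<union> (\<Union>j\<in>below i0. P j) \<in> null_sets M" by (rule null_sets.Un)
  then have "(\<Union>i\<in>I. P i) \<in> null_sets M" by (rule null_sets_subset) (use un in auto)
  then show False using I(1) by simp
qed

text \<open>Only countably many members are non-null. Replacing these by the empty set leaves a
  point-finite family of null sets, which has a null union.\<close>

lemma point_finite_countable_union:
  fixes M :: "'a::euclidean_space measure" and P :: "'i \<Rightarrow> 'a set"
  assumes M: "finite_measure M" and op: "\<And>G. open G \<Longrightarrow> G \<inter> space M \<in> sets M"
    and outer: "\<And>N e. N \<in> null_sets M \<Longrightarrow> 0 < e \<Longrightarrow> \<exists>G. open G \<and> N \<subseteq> G \<and> measure M (G \<inter> space M) < e"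
    and un: "\<And>J. (\<Union>i\<in>J. P i) \<in> sets M" and fin: "\<And>x. x \<in> space M \<Longrightarrow> finite {i. x \<in> P i}"
  obtains C where "countable C" "(\<Union>i\<in>-C. P i) \<in> null_sets M"
proof -
  interpret finite_measure M by fact
  define C where "C = {i. P i \<notin> null_sets M}"
  have "P i \<in> sets M" for i using un[of "{i}"] by simp
  then have "countable C" unfolding C_def using fin by (intro countable_non_null_point_finite) auto
  moreover have "(\<Union>i. if i \<in> C then {} else P i) \<in> null_sets M"
  proof (rule null_union_point_finite[OF M op outer])
    fix J
    have "(\<Union>i\<in>J. if i \<in> C then {} else P i) = (\<Union>i\<in>J - C. P i)" by auto
    then show "(\<Union>i\<in>J. if i \<in> C then {} else P i) \<in> sets M" using un by simp
  next
    fix x assume "x \<in> space M"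
    then show "finite {i. x \<in> (if i \<in> C then {} else P i)}" using fin by (auto intro: rev_finite_subset)
  qed (auto simp: C_def)
  moreover have "(\<Union>i. if i \<in> C then {} else P i) = (\<Union>i\<in>-C. P i)" by auto
  ultimately show thesis using that by simp
qed

text \<open>Stone's construction of a \<open>\<sigma>\<close>-discrete open refinement of a cover by balls.\<close>

lemma sigma_discrete_ball_refinement:
  fixes \<epsilon> :: real assumes \<epsilon>: "\<epsilon> > 0"
  obtains E :: "nat \<Rightarrow> 'u::metric_space \<Rightarrow> 'u set" where "\<And>n y. open (E n y)" "\<And>n y. E n y \<subseteq> ball y \<epsilon>"
    "\<And>x. \<exists>n y. x \<in> E n y"
    "\<And>n y y' x x'. x \<in> E n y \<Longrightarrow> x' \<in> E n y' \<Longrightarrow> dist x x' < 1 / Suc n / 4 \<Longrightarrow> y = y'"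
proof -
  obtain r :: "'u rel" where r: "well_order_on UNIV r" using well_order_on by blast
  then have wf: "wf (r - Id)" and tot: "\<And>i j. i \<noteq> j \<Longrightarrow> (i, j) \<in> r \<or> (j, i) \<in> r"
    by (auto simp: well_order_on_def linear_order_on_def total_on_def)
  have "\<exists>y. dist c y < \<epsilon> \<and> (\<forall>y'. (y', y) \<in> r - Id \<longrightarrow> \<not> dist c y' < \<epsilon>)" for c :: 'u
    using wfE_min[OF wf, of c "{y. dist c y < \<epsilon>}"] \<epsilon> by (metis dist_self mem_Collect_eq)
  then obtain lst :: "'u \<Rightarrow> 'u" where lst: "\<And>c. dist c (lst c) < \<epsilon>"
    "\<And>c y'. (y', lst c) \<in> r - Id \<Longrightarrow> \<not> dist c y' < \<epsilon>" by metis
  define \<delta> where "\<delta> n = 1 / real (Suc n)" for n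
  \<comment> \<open>\<open>lst c\<close> is the first centre within \<open>\<epsilon>\<close> of c
    in the well-order. A point c counts for y at level n only if its ball of radius
    \<open>\<delta> n\<close> fits into the ball of y; taking quarter radii leaves a gap between
    different members.\<close>
  define E where "E n y = (\<Union>c\<in>{c. lst c = y \<and> ball c (\<delta> n) \<subseteq> ball y \<epsilon>}. ball c (\<delta> n / 4))" for n y
  have \<delta>: "\<delta> n > 0" for n by (simp add: \<delta>_def)
  have "open (E n y)" for n y unfolding E_def by auto
  moreover have "E n y \<subseteq> ball y \<epsilon>" for n y
  proof
    fix x assume "x \<in> E n y"
    then obtain c where "ball c (\<delta> n) \<subseteq> ball y \<epsilon>" "dist c x < \<delta> n / 4" by (auto simp: E_def)
    then show "x \<in> ball y \<epsilon>" using \<delta>[of n] by (auto simp: subset_eq)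
  qed
  moreover have "\<exists>n y. x \<in> E n y" for x
  proof -
    have "x \<in> ball (lst x) \<epsilon>" using lst(1)[of x] by (simp add: dist_commute)
    then obtain d where d: "d > 0" "ball x d \<subseteq> ball (lst x) \<epsilon>" using open_contains_ball[THEN iffD1, OF open_ball] by blast
    obtain n where n: "inverse (real (Suc n)) < d" using reals_Archimedean[OF d(1)] by blast
    then have "ball x (\<delta> n) \<subseteq> ball (lst x) \<epsilon>" using d(2) by (auto simp: \<delta>_def inverse_eq_divide)
    then have "x \<in> E n (lst x)" unfolding E_def using \<delta>[of n] by auto
    then show ?thesis by blast
  qed
  moreover have "y = y'" if "x \<in> E n y" "x' \<in> E n y'" "dist x x' < 1 / Suc n / 4" for n y y' x x'
  proof (rule ccontr)
    assume "y \<noteq> y'"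
    \<comment> \<open>If y precedes y', two close points would put c' into the ball of y, against
      the choice of y' as the first centre of c'.\<close>
    have key: False if yy: "(y, y') \<in> r" "y \<noteq> y'" "x \<in> E n y" "x' \<in> E n y'" "dist x x' < \<delta> n / 4" for y y' x x'
    proof -
      obtain c where c: "ball c (\<delta> n) \<subseteq> ball y \<epsilon>" "dist c x < \<delta> n / 4" using yy(3) by (auto simp: E_def)
      obtain c' where c': "lst c' = y'" "dist c' x' < \<delta> n / 4" using yy(4) by (auto simp: E_def)
      have "dist c c' \<le> dist c x + dist x x' + dist x' c'"
        using dist_triangle[of c c' x] dist_triangle[of x c' x'] by linarith
      also have "\<dots> < \<delta> n" using c(2) c'(2) yy(5) \<delta>[of n] dist_commute[of x' c'] by linarith
      finally have "c' \<in> ball y \<epsilon>" using c(1) by auto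
      then have "dist c' y < \<epsilon>" by (simp add: dist_commute)
      moreover have "(y, lst c') \<in> r - Id" using yy(1,2) c'(1) by simp
      ultimately show False using lst(2) by blast
    qed
    show False
      using key[of y y' x x'] key[of y' y x' x] tot[OF \<open>y \<noteq> y'\<close>] that \<open>y \<noteq> y'\<close>
      by (auto simp: \<delta>_def dist_commute)
  qed
  ultimately show thesis by (rule that)
qed

text \<open>A compact set meets only finitely many members of a discrete family, so each level n of
  the refinement gives a point-finite family of measurable sets \<open>P n y\<close>. All but
  countably many centres are then discarded at the cost of a null set, for each of countably many
  radii.\<close>

lemma compact_multifunction_essentially_separable:
  fixes M :: "'a::euclidean_space measure" and F :: "'a \<Rightarrow> 'u::metric_space set"
  assumes M: "finite_measure M" and op: "\<And>G. open G \<Longrightarrow> G \<inter> space M \<in> sets M"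
    and outer: "\<And>N e. N \<in> null_sets M \<Longrightarrow> 0 < e \<Longrightarrow> \<exists>G. open G \<and> N \<subseteq> G \<and> measure M (G \<inter> space M) < e"
    and F: "\<And>t. t \<in> space M \<Longrightarrow> compact (F t)"
    and meas: "\<And>G. open G \<Longrightarrow> {t \<in> space M. F t \<inter> G \<noteq> {}} \<in> sets M"
  obtains Y N where "countable Y" "N \<in> null_sets M" "\<And>t. t \<in> space M - N \<Longrightarrow> F t \<subseteq> closure Y"
proof -
  have "\<exists>Y N. countable Y \<and> N \<in> null_sets M \<and> (\<forall>t\<in>space M - N. \<forall>x\<in>F t. \<exists>y\<in>Y. dist y x < \<epsilon>)"
    if \<epsilon>: "\<epsilon> > 0" for \<epsilon>
  proof -
    obtain E :: "nat \<Rightarrow> 'u \<Rightarrow> 'u set" where Eo: "\<And>n y. open (E n y)" and Eb: "\<And>n y. E n y \<subseteq> ball y \<epsilon>"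
      and Ec: "\<And>x. \<exists>n y. x \<in> E n y"
      and Es: "\<And>n y y' x x'. x \<in> E n y \<Longrightarrow> x' \<in> E n y' \<Longrightarrow> dist x x' < 1 / Suc n / 4 \<Longrightarrow> y = y'"
      by (rule sigma_discrete_ball_refinement[OF \<epsilon>]) blast
    define P where "P n y = {t \<in> space M. F t \<inter> E n y \<noteq> {}}" for n y
    have "\<exists>C. countable C \<and> (\<Union>y\<in>-C. P n y) \<in> null_sets M" for n
    proof (rule point_finite_countable_union[OF M op outer, of "P n"])
      fix J
      have "(\<Union>y\<in>J. P n y) = {t \<in> space M. F t \<inter> (\<Union>y\<in>J. E n y) \<noteq> {}}" by (auto simp: P_def)
      then show "(\<Union>y\<in>J. P n y) \<in> sets M" using meas[of "\<Union>y\<in>J. E n y"] Eo by (simp add: open_UN)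
    next
      fix t assume t: "t \<in> space M"
      obtain k where k: "finite k" "F t \<subseteq> (\<Union>z\<in>k. ball z (1 / Suc n / 8))"
        using F[OF t, unfolded compact_eq_totally_bounded, THEN conjunct2, rule_format, of "1 / Suc n / 8"] by auto
      have "\<exists>z\<in>k. \<exists>x\<in>E n y. dist z x < 1 / Suc n / 8" if "y \<in> {y. t \<in> P n y}" for y
        using that k(2) by (force simp: P_def)
      then obtain z where z: "\<And>y. y \<in> {y. t \<in> P n y} \<Longrightarrow> z y \<in> k \<and> (\<exists>x\<in>E n y. dist (z y) x < 1 / Suc n / 8)"
        by metis
      \<comment> \<open>Members of level n near the same net point would violate their mutual gap,
        so the net bounds the number of members that \<open>F t\<close> meets.\<close>
      have "inj_on z {y. t \<in> P n y}"
      proof (rule inj_onI)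
        fix y y' assume y: "y \<in> {y. t \<in> P n y}" "y' \<in> {y. t \<in> P n y}" "z y = z y'"
        obtain x where x: "x \<in> E n y" "dist (z y) x < 1 / Suc n / 8" using z[OF y(1)] by blast
        obtain x' where x': "x' \<in> E n y'" "dist (z y') x' < 1 / Suc n / 8" using z[OF y(2)] by blast
        have "dist x x' < 1 / Suc n / 4" proof -
          have aux: "c < d / 4" if "a < d / 8" "b < d / 8" "c \<le> a + b" for a b c d :: real
            using that by linarith
          show ?thesis by (rule aux[OF x(2)[unfolded y(3)] x'(2) dist_triangle3])
        qed
        then show "y = y'" using Es x(1) x'(1) by blast
      qed
      moreover have "z ` {y. t \<in> P n y} \<subseteq> k" using z by blast
      ultimately show "finite {y. t \<in> P n y}" using k(1) inj_on_finite by blast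
    qed auto
    then obtain C where C: "\<And>n. countable (C n)" "\<And>n. (\<Union>y\<in>- C n. P n y) \<in> null_sets M" by metis
    show ?thesis
    proof (intro exI conjI ballI)
      show "countable (\<Union>n. C n)" using C(1) by auto
      show "(\<Union>n. \<Union>y\<in>- C n. P n y) \<in> null_sets M" using C(2) by (intro null_sets_UN) auto
      fix t x assume tx: "t \<in> space M - (\<Union>n. \<Union>y\<in>- C n. P n y)" "x \<in> F t"
      obtain n y where ny: "x \<in> E n y" using Ec by blast
      then have "t \<in> P n y" using tx by (auto simp: P_def)
      then have "y \<in> C n" using tx by auto
      moreover have "dist y x < \<epsilon>" using ny Eb[of n y] by auto
      ultimately show "\<exists>y\<in>\<Union>n. C n. dist y x < \<epsilon>" by blast
    qed
  qed
  then have "\<exists>Y N. countable Y \<and> N \<in> null_sets M \<and> (\<forall>t\<in>space M - N. \<forall>x\<in>F t. \<exists>y\<in>Y. dist y x < 1 / Suc p)" for p :: nat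
    by simp
  then obtain Y N where YN: "\<And>p. countable (Y p)" "\<And>p. N p \<in> null_sets M"
    "\<And>p t x. t \<in> space M - N p \<Longrightarrow> x \<in> F t \<Longrightarrow> \<exists>y\<in>Y p. dist y x < 1 / Suc p" by metis
  show thesis
  proof
    show "countable (\<Union>p. Y p)" using YN(1) by auto
    show "(\<Union>p. N p) \<in> null_sets M" using YN(2) by (intro null_sets_UN) auto
    fix t assume t: "t \<in> space M - (\<Union>p. N p)"
    show "F t \<subseteq> closure (\<Union>p. Y p)"
    proof
      fix x assume x: "x \<in> F t"
      show "x \<in> closure (\<Union>p. Y p)"
        unfolding closure_approachable
      proof (intro allI impI)
        fix e :: real assume "e > 0"
        then obtain p where p: "inverse (real (Suc p)) < e" using reals_Archimedean by blast
        obtain y where "y \<in> Y p" "dist y x < 1 / Suc p" using YN(3)[of t p x] t x by blast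
        then show "\<exists>y\<in>\<Union>p. Y p. dist y x < e" using p by (auto simp: inverse_eq_divide intro!: bexI[of _ y])
      qed
    qed
  qed
qed

section \<open>Caratheodory functions and selections\<close>

text \<open>f is approximated by countably valued maps, the first enumerated point within
  \<open>1 / Suc p\<close>. It enters through its distances to these points, which are real
  functions, and continuity of \<open>h w\<close> at \<open>f w\<close> gives the limit.\<close>

lemma Caratheodory_measurable:
  fixes h :: "'w \<Rightarrow> 'y::metric_space \<Rightarrow> 'z::metric_space"
  assumes Y: "countable Y" and h: "\<And>y. y \<in> Y \<Longrightarrow> (\<lambda>w. h w y) \<in> borel_measurable M"
    and cont: "\<And>w. w \<in> space M \<Longrightarrow> isCont (h w) (f w)"
    and f: "\<And>y. y \<in> Y \<Longrightarrow> (\<lambda>w. dist (f w) y) \<in> borel_measurable M"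
    and cl: "\<And>w. w \<in> space M \<Longrightarrow> f w \<in> closure Y"
  shows "(\<lambda>w. h w (f w)) \<in> borel_measurable M"
proof (cases "Y = {}")
  case True
  then have "space M = {}" using cl by auto
  then show ?thesis by (auto simp: measurable_def)
next
  case False
  define ys where "ys = from_nat_into Y"
  have ys: "ys i \<in> Y" for i using from_nat_into[OF False] by (simp add: ys_def)
  define i where "i p w = (LEAST i. dist (f w) (ys i) < 1 / Suc p)" for p w
  have i: "dist (f w) (ys (i p w)) < 1 / Suc p" if w: "w \<in> space M" for p w
  proof -
    have "(0::real) < 1 / Suc p" by simp
    then obtain y where "y \<in> Y" "dist y (f w) < 1 / Suc p" using cl[OF w] unfolding closure_approachable by blast
    moreover then obtain j where "y = ys j" using from_nat_into_surj[OF Y] by (auto simp: ys_def)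
    ultimately have "dist (f w) (ys j) < 1 / Suc p" by (simp add: dist_commute)
    then show ?thesis unfolding i_def by (rule LeastI)
  qed
  show ?thesis
  proof (rule borel_measurable_LIMSEQ_metric)
    fix p
    have [measurable]: "(\<lambda>w. dist (f w) (ys j)) \<in> borel_measurable M" for j using f[OF ys] .
    have "i p \<in> measurable M (count_space UNIV)" unfolding i_def by measurable
    then show "(\<lambda>w. h w (ys (i p w))) \<in> borel_measurable M"
      using measurable_compose_countable[of "\<lambda>j w. h w (ys j)" M borel "i p"] h[OF ys] by blast
  next
    fix w assume w: "w \<in> space M"
    have "(\<lambda>p. ys (i p w)) \<longlonglongrightarrow> f w"
    proof (rule metric_LIMSEQ_I)
      fix e :: real assume "e > 0"
      then obtain n where n: "inverse (real (Suc n)) < e" using reals_Archimedean by blast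
      have "dist (ys (i p w)) (f w) < e" if "p \<ge> n" for p
      proof -
        have "1 / real (Suc p) \<le> 1 / Suc n" using that by (intro divide_left_mono) auto
        then show ?thesis using i[OF w, of p] n by (simp add: dist_commute inverse_eq_divide)
      qed
      then show "\<exists>no. \<forall>p\<ge>no. dist (ys (i p w)) (f w) < e" by blast
    qed
    then show "(\<lambda>p. h w (ys (i p w))) \<longlonglongrightarrow> h w (f w)" by (rule isCont_tendsto_compose[OF cont[OF w]])
  qed
qed

lemma nested_compact_meet:
  fixes G :: "nat \<Rightarrow> 'u::metric_space set"
  assumes "\<And>n. compact (G n)" "\<And>n. G (Suc n) \<subseteq> G n" "closed C" "\<And>n. G n \<inter> C \<noteq> {}"
  shows "\<exists>x\<in>C. \<forall>n. x \<in> G n"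
proof -
  have dec: "G n \<subseteq> G m" if "m \<le> n" for m n using lift_Suc_antimono_le[of G, OF assms(2) that] .
  have "G 0 \<inter> (\<Inter>n\<in>UNIV. G n \<inter> C) \<noteq> {}"
  proof (rule compact_imp_fip_image[OF assms(1)])
    show "closed (G n \<inter> C)" for n by (rule closed_Int[OF compact_imp_closed[OF assms(1)] assms(3)])
    fix I :: "nat set" assume I: "finite I"
    have "G (Max (insert 0 I)) \<inter> C \<subseteq> G 0 \<inter> (\<Inter>n\<in>I. G n \<inter> C)"
    proof -
      have "G (Max (insert 0 I)) \<subseteq> G n" if "n \<in> insert 0 I" for n using I that by (intro dec Max_ge) auto
      then show ?thesis by blast
    qed
    then show "G 0 \<inter> (\<Inter>n\<in>I. G n \<inter> C) \<noteq> {}" using assms(4) by blast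
  qed
  then show ?thesis by blast
qed

text \<open>One round of the Kuratowski and Ryll-Nardzewski scheme for compact values: a cut by the
  first enumerated ball that meets the value.\<close>

definition select_step :: "(nat \<Rightarrow> 'u::metric_space) \<Rightarrow> nat \<Rightarrow> ('a \<Rightarrow> 'u set) \<Rightarrow> 'a \<Rightarrow> 'u set" where
  "select_step ys n H t = H t \<inter> cball (ys (LEAST i. H t \<inter> cball (ys i) (1 / 2 ^ n) \<noteq> {})) (1 / 2 ^ n)"

text \<open>Each cut preserves compactness and the measurability of hits with closed sets, because
  the first index that meets the value is a measurable function of t. The nested values shrink to a
  single point.\<close>

lemma compact_measurable_selection:
  fixes F :: "'a \<Rightarrow> 'u::metric_space set"
  assumes Y: "countable Y" and F: "\<And>t. t \<in> space M \<Longrightarrow> compact (F t) \<and> F t \<noteq> {} \<and> F t \<subseteq> closure Y"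
    and meas: "\<And>C. closed C \<Longrightarrow> {t \<in> space M. F t \<inter> C \<noteq> {}} \<in> sets M"
  obtains u where "u \<in> borel_measurable M" "\<And>t. t \<in> space M \<Longrightarrow> u t \<in> F t"
proof (cases "space M = {}")
  case True
  show thesis by (rule that[of "\<lambda>_. undefined"]) (use True in auto)
next
  case ne: False
  then have "Y \<noteq> {}" using F by fastforce
  define ys where "ys = from_nat_into Y"
  define inv where "inv H \<longleftrightarrow> (\<forall>t\<in>space M. compact (H t) \<and> H t \<noteq> {} \<and> H t \<subseteq> closure Y) \<and>
    (\<forall>C. closed C \<longrightarrow> {t \<in> space M. H t \<inter> C \<noteq> {}} \<in> sets M)" for H :: "'a \<Rightarrow> 'u set"
  have ex: "\<exists>i. H t \<inter> cball (ys i) (1 / 2 ^ n) \<noteq> {}" if H: "inv H" "t \<in> space M" for H t n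
  proof -
    obtain x where x: "x \<in> H t" "x \<in> closure Y" using H by (fastforce simp: inv_def)
    have "(0::real) < 1 / 2 ^ n" by simp
    then obtain y where "y \<in> Y" "dist y x < 1 / 2 ^ n" using x(2) unfolding closure_approachable by blast
    moreover then obtain j where "y = ys j" using from_nat_into_surj[OF Y] by (auto simp: ys_def)
    ultimately show ?thesis using x(1) by (intro exI[of _ j]) (auto intro!: exI[of _ x])
  qed
  have step: "inv (select_step ys n H)" if H: "inv H" for n H
    unfolding inv_def
  proof (intro conjI ballI allI impI)
    fix t assume t: "t \<in> space M"
    show "compact (select_step ys n H t)" using H t unfolding select_step_def inv_def
      by (intro compact_Int_closed) auto
    show "select_step ys n H t \<noteq> {}" unfolding select_step_def by (rule LeastI_ex[OF ex[OF H t]])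
    show "select_step ys n H t \<subseteq> closure Y" using H t by (auto simp: inv_def select_step_def)
  next
    fix C :: "'u set" assume C: "closed C"
    let ?A = "\<lambda>i. {t \<in> space M. H t \<inter> cball (ys i) (1 / 2 ^ n) \<noteq> {}}"
    let ?B = "\<lambda>i. {t \<in> space M. H t \<inter> (cball (ys i) (1 / 2 ^ n) \<inter> C) \<noteq> {}}"
    have "{t \<in> space M. select_step ys n H t \<inter> C \<noteq> {}} = (\<Union>i. (?A i - (\<Union>j\<in>{..<i}. ?A j)) \<inter> ?B i)" (is "?L = ?R")
    proof (intro equalityI subsetI)
      fix t assume t: "t \<in> ?L"
      define i where "i = (LEAST i. H t \<inter> cball (ys i) (1 / 2 ^ n) \<noteq> {})"
      have "H t \<inter> cball (ys i) (1 / 2 ^ n) \<noteq> {}" unfolding i_def using t by (intro LeastI_ex[OF ex[OF H]]) auto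
      moreover have "H t \<inter> cball (ys j) (1 / 2 ^ n) = {}" if "j < i" for j
        using not_less_Least[OF that[unfolded i_def]] by blast
      moreover have "H t \<inter> (cball (ys i) (1 / 2 ^ n) \<inter> C) \<noteq> {}"
      proof -
        have "select_step ys n H t = H t \<inter> cball (ys i) (1 / 2 ^ n)" by (simp only: select_step_def i_def)
        then show ?thesis using t by auto
      qed
      ultimately show "t \<in> ?R" using t by blast
    next
      fix t assume "t \<in> ?R"
      then obtain i where i: "t \<in> ?A i" "\<And>j. j < i \<Longrightarrow> t \<notin> ?A j" "t \<in> ?B i" by blast
      have "(LEAST i. H t \<inter> cball (ys i) (1 / 2 ^ n) \<noteq> {}) = i"
        using i by (intro Least_equality) (auto simp: not_less[symmetric])
      then have "select_step ys n H t \<inter> C = H t \<inter> (cball (ys i) (1 / 2 ^ n) \<inter> C)" unfolding select_step_def by auto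
      then show "t \<in> ?L" using i(3) by simp
    qed
    moreover have "?R \<in> sets M"
      using H C by (intro sets.countable_UN'' sets.Int sets.Diff) (auto simp: inv_def)
    ultimately show "{t \<in> space M. select_step ys n H t \<inter> C \<noteq> {}} \<in> sets M" by simp
  qed
  define G where "G = rec_nat F (\<lambda>n H. select_step ys n H)"
  have G0: "G 0 = F" and GS: "G (Suc n) = select_step ys n (G n)" for n by (simp_all add: G_def)
  have invG: "inv (G n)" for n
  proof (induction n)
    case 0 then show ?case using F meas by (simp add: G0 inv_def)
  next
    case (Suc n) then show ?case unfolding GS by (rule step)
  qed
  have dec: "G (Suc n) t \<subseteq> G n t" for n t unfolding GS select_step_def by auto
  have diam: "dist x y \<le> 2 / 2 ^ n" if xy: "x \<in> G (Suc n) t" "y \<in> G (Suc n) t" for n t x y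
  proof -
    obtain z where "dist z x \<le> 1 / 2 ^ n" "dist z y \<le> 1 / 2 ^ n" using xy unfolding GS select_step_def by auto
    then show ?thesis using dist_triangle3[of x y z] by simp
  qed
  have meet: "\<exists>x\<in>C. \<forall>n. x \<in> G n t" if "t \<in> space M" "closed C" "\<And>n. G n t \<inter> C \<noteq> {}" for t C
    using that invG dec by (intro nested_compact_meet[of "\<lambda>n. G n t"]) (auto simp: inv_def)
  have "\<exists>x. \<forall>n. x \<in> G n t" if "t \<in> space M" for t
    using meet[OF that closed_UNIV] invG that by (auto simp: inv_def)
  then obtain u where u: "\<And>t n. t \<in> space M \<Longrightarrow> u t \<in> G n t" by metis
  have uniq: "x = u t" if t: "t \<in> space M" and x: "\<And>n. x \<in> G n t" for x t
  proof (rule ccontr)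
    assume "x \<noteq> u t"
    then have "dist x (u t) > 0" by simp
    have lim: "(\<lambda>n. 2 * (1 / 2) ^ n :: real) \<longlonglongrightarrow> 2 * 0" by (intro tendsto_intros LIMSEQ_power_zero) simp
    have bd: "dist x (u t) \<le> 2 * (1 / 2) ^ n" for n
      using diam[OF x u[OF t], of n] by (simp add: power_divide)
    have "dist x (u t) \<le> 2 * 0" by (rule LIMSEQ_le_const[OF lim]) (use bd in blast)
    with \<open>dist x (u t) > 0\<close> show False by simp
  qed
  have "u \<in> borel_measurable M"
  proof (rule borel_measurableI)
    fix S :: "'u set" assume S: "open S"
    \<comment> \<open>By compactness of the nested values, \<open>u t\<close> lies outside S exactly
      when every \<open>G n t\<close> meets the complement of S. This covers arbitrary open sets S,
      with no countable base involved.\<close>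
    have "u -` S \<inter> space M = space M - (\<Inter>n. {t \<in> space M. G n t \<inter> - S \<noteq> {}})" (is "?L = ?R")
    proof (intro equalityI subsetI)
      fix t assume t: "t \<in> ?L"
      have "\<not> (\<forall>n. G n t \<inter> - S \<noteq> {})"
      proof
        assume "\<forall>n. G n t \<inter> - S \<noteq> {}"
        then obtain x where "x \<in> - S" "\<forall>n. x \<in> G n t" using meet[of t "- S"] t S by auto
        then show False using uniq[of t x] t by auto
      qed
      then show "t \<in> ?R" using t by blast
    next
      fix t assume "t \<in> ?R" then show "t \<in> ?L" using u[of t] by blast
    qed
    moreover have "(\<Inter>n. {t \<in> space M. G n t \<inter> - S \<noteq> {}}) \<in> sets M"
    proof -
      have "{t \<in> space M. G n t \<inter> - S \<noteq> {}} \<in> sets M" for n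
        using invG[of n] closed_Compl[OF S] unfolding inv_def by blast
      then show ?thesis by (intro sets.countable_INT) auto
    qed
    ultimately show "u -` S \<inter> space M \<in> sets M" by auto
  qed
  moreover have "u t \<in> F t" if "t \<in> space M" for t using u[OF that, of 0] by (simp add: G0)
  ultimately show thesis using that by blast
qed

text \<open>The selection is taken from the exact solutions. Their hits with a closed set are
  expressed through approximate solutions at countably many points, and compactness of
  \<open>F t\<close> turns a sequence of these into an exact solution.\<close>

lemma Filippov_selection:
  fixes M :: "'a::euclidean_space measure" and F :: "'a \<Rightarrow> 'u::metric_space set" and g :: "nat \<Rightarrow> 'a \<Rightarrow> 'u \<Rightarrow> real"
  assumes M: "finite_measure M" and op: "\<And>G. open G \<Longrightarrow> G \<inter> space M \<in> sets M"
    and outer: "\<And>N e. N \<in> null_sets M \<Longrightarrow> 0 < e \<Longrightarrow> \<exists>G. open G \<and> N \<subseteq> G \<and> measure M (G \<inter> space M) < e"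
    and F: "\<And>t. t \<in> space M \<Longrightarrow> compact (F t)"
    and meas: "\<And>G. open G \<Longrightarrow> {t \<in> space M. F t \<inter> G \<noteq> {}} \<in> sets M"
    and g: "\<And>k t u. 0 \<le> g k t u" "\<And>k t. t \<in> space M \<Longrightarrow> continuous_on UNIV (g k t)"
      "\<And>k u. (\<lambda>t. g k t u) \<in> borel_measurable M"
    and ex: "\<And>t. t \<in> space M \<Longrightarrow> \<exists>u\<in>F t. \<forall>k. g k t u = 0"
  obtains u N where "u \<in> borel_measurable M" "N \<in> null_sets M"
    "\<And>t. t \<in> space M - N \<Longrightarrow> u t \<in> F t \<and> (\<forall>k. g k t (u t) = 0)"
proof -
  have "\<exists>Y N. countable Y \<and> N \<in> null_sets M \<and> (\<forall>t\<in>space M - N. F t \<subseteq> closure Y)"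
    by (rule compact_multifunction_essentially_separable[OF M op outer F meas]) blast+
  then obtain Y N where Y: "countable Y" and N: "N \<in> null_sets M" and FY: "\<And>t. t \<in> space M - N \<Longrightarrow> F t \<subseteq> closure Y"
    by blast
  define c :: 'u where "c = undefined"
  \<comment> \<open>On the exceptional null set the value is an arbitrary singleton, so that H is
    nonempty and compact at every time.\<close>
  define H where "H t = (if t \<in> N then {c} else {u \<in> F t. \<forall>k. g k t u = 0})" for t
  have H1: "compact (H t) \<and> H t \<noteq> {} \<and> H t \<subseteq> closure (insert c Y)" if t: "t \<in> space M" for t
  proof (cases "t \<in> N")
    case True then show ?thesis using closure_subset[of "insert c Y"] by (auto simp: H_def)
  next
    case False
    have "{u \<in> F t. \<forall>k. g k t u = 0} = F t \<inter> (\<Inter>k. {u. g k t u = 0})" by auto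
    moreover have "compact (F t \<inter> (\<Inter>k. {u. g k t u = 0}))"
      using F[OF t] g(2)[OF t] by (intro compact_Int_closed closed_INT ballI closed_Collect_eq) auto
    moreover have "F t \<subseteq> closure (insert c Y)"
      using FY[of t] t False closure_mono[OF subset_insertI[of Y c]] by blast
    ultimately show ?thesis using False ex[OF t] by (auto simp: H_def)
  qed
  have H2: "{t \<in> space M. H t \<inter> C \<noteq> {}} \<in> sets M" if C: "closed C" for C
  proof -
    \<comment> \<open>For a fixed point y each condition is measurable in t. Only the constraints up
      to p enter, so that at an exact solution finitely many neighbourhoods have to be
      intersected.\<close>
    define A where "A p y = {t \<in> space M. F t \<inter> ball y (1 / Suc p) \<noteq> {}} \<inter>
       (if \<exists>c\<in>C. dist y c < 1 / Suc p then space M else {}) \<inter> (\<Inter>k\<in>{..p}. {t \<in> space M. g k t y < 1 / Suc p})" for p y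
    have A: "A p y \<in> sets M" for p y
    proof -
      have "{t \<in> space M. g k t y < 1 / Suc p} \<in> sets M" for k using g(3)[of k y] by measurable
      then have "(\<Inter>k\<in>{..p}. {t \<in> space M. g k t y < 1 / Suc p}) \<in> sets M" by (intro sets.finite_INT) auto
      then show ?thesis unfolding A_def by (intro sets.Int meas) auto
    qed
    have "{t \<in> space M. H t \<inter> C \<noteq> {}} = (if c \<in> C then N else {}) \<union> ((space M - N) \<inter> (\<Inter>p. \<Union>y\<in>Y. A p y))" (is "?L = ?R")
    proof (intro equalityI subsetI)
      fix t assume t: "t \<in> ?L"
      show "t \<in> ?R"
      proof (cases "t \<in> N")
        case True then show ?thesis using t by (auto simp: H_def split: if_splits)
      next
        case False
        then obtain u where u: "u \<in> F t" "\<And>k. g k t u = 0" "u \<in> C" using t by (auto simp: H_def)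
        have uc: "u \<in> closure Y" using FY[of t] t False u(1) by auto
        have "\<exists>y\<in>Y. t \<in> A p y" for p
        proof -
          have p: "(0::real) < 1 / Suc p" by simp
          have "\<forall>\<^sub>F y in nhds u. \<forall>k\<in>{..p}. g k t y < 1 / Suc p"
          proof (subst eventually_ball_finite_distrib)
            show "\<forall>k\<in>{..p}. \<forall>\<^sub>F y in nhds u. g k t y < 1 / Suc p"
            proof
              fix k
              have "(g k t \<longlongrightarrow> g k t u) (nhds u)"
                using g(2)[of t k] t by (auto simp: continuous_on_eq_continuous_at isCont_def tendsto_at_iff_tendsto_nhds)
              then show "\<forall>\<^sub>F y in nhds u. g k t y < 1 / Suc p" using p u(2)[of k] by (intro order_tendstoD) auto
            qed
          qed auto
          then obtain d where d: "d > 0" "\<And>y. dist y u < d \<Longrightarrow> \<forall>k\<in>{..p}. g k t y < 1 / Suc p"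
            unfolding eventually_nhds_metric by blast
          obtain y where y: "y \<in> Y" "dist y u < min d (1 / Suc p)"
            using uc p d(1) unfolding closure_approachable by (metis min_less_iff_conj)
          then have "t \<in> A p y" using t u d(2)[of y] by (auto simp: A_def)
          then show ?thesis using y(1) by blast
        qed
        then show ?thesis using False t by blast
      qed
    next
      fix t assume t: "t \<in> ?R"
      show "t \<in> ?L"
      proof (cases "t \<in> N")
        case True
        then have "c \<in> C" "t \<in> space M" using t N by (auto split: if_splits dest: sets.sets_into_space null_setsD2)
        then show ?thesis using True by (auto simp: H_def)
      next
        case False
        then have "\<forall>p. \<exists>y\<in>Y. t \<in> A p y" and ts: "t \<in> space M" using t by (auto split: if_splits)
        then obtain y where y: "\<And>p. t \<in> A p (y p)" by metis
        have "\<exists>x\<in>F t. dist (y p) x < 1 / Suc p" for p using y[of p] by (auto simp: A_def)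
        then obtain x where x: "\<And>p. x p \<in> F t" "\<And>p. dist (y p) (x p) < 1 / Suc p" by metis
        have "\<exists>z\<in>C. dist (y p) z < 1 / Suc p" for p using y[of p] by (auto simp: A_def split: if_splits)
        then obtain z where z: "\<And>p. z p \<in> C" "\<And>p. dist (y p) (z p) < 1 / Suc p" by metis
        have gy: "g k t (y p) < 1 / Suc p" if "k \<le> p" for k p using y[of p] that by (auto simp: A_def)
        \<comment> \<open>The points chosen at level p in \<open>F t\<close> and in C are both
          within \<open>1 / Suc p\<close> of \<open>y p\<close>; along a subsequence all three
          therefore have one limit, which lies in \<open>F t\<close> and in C.\<close>
        obtain l r where l: "l \<in> F t" and r: "strict_mono r" "(x \<circ> r) \<longlonglongrightarrow> l"
          using F[OF ts] x(1) unfolding compact_eq_seq_compact_metric seq_compact_def by metis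
        have to0: "(\<lambda>n. 1 / real (Suc (r n))) \<longlonglongrightarrow> 0"
          using LIMSEQ_subseq_LIMSEQ[OF LIMSEQ_Suc[OF lim_1_over_n] r(1)] by (simp add: o_def)
        have near: "(\<lambda>n. b (r n)) \<longlonglongrightarrow> m" if "(\<lambda>n. a (r n)) \<longlonglongrightarrow> m" "\<And>p. dist (b p) (a p) < 1 / Suc p"
          for a b :: "nat \<Rightarrow> 'u" and m
        proof -
          have "(\<lambda>n. dist (b (r n)) (a (r n))) \<longlonglongrightarrow> 0"
            by (rule tendsto_sandwich[OF _ _ tendsto_const to0]) (use that(2) in \<open>auto intro!: always_eventually less_imp_le\<close>)
          moreover have "(\<lambda>n. dist (a (r n)) m) \<longlonglongrightarrow> 0" using that(1) by (simp add: tendsto_dist_iff[symmetric])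
          ultimately have s: "(\<lambda>n. dist (b (r n)) (a (r n)) + dist (a (r n)) m) \<longlonglongrightarrow> 0"
            using tendsto_add by fastforce
          have "(\<lambda>n. dist (b (r n)) m) \<longlonglongrightarrow> 0"
            by (rule tendsto_sandwich[OF _ _ tendsto_const s]) (simp_all add: dist_triangle)
          then show ?thesis by (simp add: tendsto_dist_iff[symmetric])
        qed
        have yl: "(\<lambda>n. y (r n)) \<longlonglongrightarrow> l" by (rule near[of x]) (use r(2) x(2) in \<open>auto simp: o_def\<close>)
        have "(\<lambda>n. z (r n)) \<longlonglongrightarrow> l" by (rule near[OF yl]) (use z(2) in \<open>auto simp: dist_commute\<close>)
        then have "l \<in> C" using closed_sequentially[OF C, of "\<lambda>n. z (r n)"] z(1) by blast
        moreover have "g k t l = 0" for k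
        proof -
          have "(\<lambda>n. g k t (y (r n))) \<longlonglongrightarrow> g k t l"
            using g(2)[OF ts, of k] by (intro isCont_tendsto_compose[OF _ yl]) (auto simp: continuous_on_eq_continuous_at)
          moreover have "\<forall>\<^sub>F n in sequentially. g k t (y (r n)) \<le> 1 / real (Suc (r n))"
            using eventually_ge_at_top[of k]
          proof eventually_elim
            fix n assume "k \<le> n"
            then have "k \<le> r n" using seq_suble[OF r(1), of n] by simp
            then show "g k t (y (r n)) \<le> 1 / real (Suc (r n))" using gy by (intro less_imp_le)
          qed
          ultimately have "g k t l \<le> 0" by (intro tendsto_le[OF sequentially_bot to0])
          then show ?thesis using g(1)[of k t l] by simp
        qed
        ultimately show ?thesis using l False ts by (auto simp: H_def)
      qed
    qed
    moreover have "?R \<in> sets M"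
    proof -
      have "(\<Union>y\<in>Y. A p y) \<in> sets M" for p using A Y by (intro sets.countable_UN') auto
      then have "(\<Inter>p. \<Union>y\<in>Y. A p y) \<in> sets M" by (intro sets.countable_INT) auto
      then show ?thesis using N by auto
    qed
    ultimately show ?thesis by simp
  qed
  obtain u where u: "u \<in> borel_measurable M" "\<And>t. t \<in> space M \<Longrightarrow> u t \<in> H t"
    by (rule compact_measurable_selection[of "insert c Y" M H]) (use Y H1 H2 in auto)
  have "u t \<in> F t \<and> (\<forall>k. g k t (u t) = 0)" if "t \<in> space M - N" for t
    using u(2)[of t] that by (auto simp: H_def)
  then show thesis by (rule that[OF u(1) N])
qed

section \<open>Measurable families of measures\<close>

text \<open>The indicator of an open set is the limit of truncated multiples of the distance to the
  complement. The full space has to be excluded because the distance to the empty set is 0 by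
  convention.\<close>

lemma emeasure_open_limit:
  assumes P: "\<mu> \<in> Prob" and G: "open G" "G \<noteq> UNIV"
  shows "(\<lambda>n. \<integral>x. min 1 (real n * infdist x (- G)) \<partial>\<mu>) \<longlonglongrightarrow> measure \<mu> G"
proof -
  interpret prob_space \<mu> using Prob_simps(3)[OF P] .
  have ne: "- G \<noteq> {}" and cl: "closed (- G)" using G by auto
  have "(\<lambda>n. \<integral>x. min 1 (real n * infdist x (- G)) \<partial>\<mu>) \<longlonglongrightarrow> (\<integral>x. indicator G x \<partial>\<mu>)"
  proof (rule integral_dominated_convergence[where w = "\<lambda>_. 1"])
    show "(indicator G :: _ \<Rightarrow> real) \<in> borel_measurable \<mu>" using G(1) by (simp add: Prob_simps(4)[OF P])
    have "(\<lambda>x. min 1 (real n * infdist x (- G))) \<in> borel_measurable borel" for n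
      by (intro borel_measurable_continuous_onI continuous_intros)
    then show "(\<lambda>x. min 1 (real n * infdist x (- G))) \<in> borel_measurable \<mu>" for n by (simp add: Prob_simps(4)[OF P])
    show "AE x in \<mu>. (\<lambda>n. min 1 (real n * infdist x (- G))) \<longlonglongrightarrow> indicator G x"
    proof (rule AE_I2)
      fix x
      show "(\<lambda>n. min 1 (real n * infdist x (- G))) \<longlonglongrightarrow> indicator G x"
      proof (cases "x \<in> G")
        case True
        then have "infdist x (- G) \<noteq> 0" using in_closed_iff_infdist_zero[OF cl ne] by auto
        then have d: "infdist x (- G) > 0" using infdist_nonneg[of x "- G"] by linarith
        obtain N where N: "1 / infdist x (- G) < real N" using reals_Archimedean2 by blast
        have "1 \<le> real n * infdist x (- G)" if "n \<ge> N" for n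
        proof -
          have "1 / infdist x (- G) \<le> real n" using N that by linarith
          then show ?thesis using d by (simp add: divide_le_eq)
        qed
        then have "\<forall>\<^sub>F n in sequentially. min 1 (real n * infdist x (- G)) = 1"
          unfolding eventually_sequentially by (intro exI[of _ N]) auto
        then show ?thesis using True by (simp add: tendsto_eventually)
      next
        case False
        then have "infdist x (- G) = 0" using in_closed_iff_infdist_zero[OF cl ne] by auto
        then show ?thesis using False by simp
      qed
    qed
  qed (auto simp: infdist_nonneg)
  then show ?thesis by (simp add: Prob_simps(2)[OF P])
qed

text \<open>Open sets form an intersection-stable generator, and their masses are limits of
  integrals of Lipschitz functions, for which \<open>W1\<close> continuity of a curve yields
  measurability in time.\<close>

lemma Prob_kernel_measurable:
  fixes \<mu> :: "'t \<Rightarrow> 'a::euclidean_space measure"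
  assumes P: "\<And>t. t \<in> space M \<Longrightarrow> \<mu> t \<in> Prob"
    and meas: "\<And>L (f :: 'a \<Rightarrow> real). L-lipschitz_on UNIV f \<Longrightarrow> (\<lambda>t. \<integral>x. f x \<partial>\<mu> t) \<in> borel_measurable M"
  shows "\<mu> \<in> measurable M (subprob_algebra borel)"
proof (rule measurable_subprob_algebra_generated[where G = "{S. open S}" and \<Omega> = UNIV])
  show "sets (borel :: 'a measure) = sigma_sets UNIV {S. open S}" unfolding borel_def by (simp add: sets_measure_of)
  show "Int_stable {S :: 'a set. open S}" by (auto simp: Int_stable_def)
  show "subprob_space (\<mu> t)" "sets (\<mu> t) = sets borel" if "t \<in> space M" for t
    using Prob_simps[OF P[OF that]] prob_space_imp_subprob_space by auto
  have one: "emeasure (\<mu> t) UNIV = 1" if "t \<in> space M" for t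
    using prob_space.emeasure_space_1[OF Prob_simps(3)[OF P[OF that]]] Prob_simps(2)[OF P[OF that]] by simp
  show U: "(\<lambda>t. emeasure (\<mu> t) UNIV) \<in> borel_measurable M"
    by (subst measurable_cong[OF one]) auto
  fix G :: "'a set" assume "G \<in> {S. open S}"
  then have G: "open G" by simp
  show "(\<lambda>t. emeasure (\<mu> t) G) \<in> borel_measurable M"
  proof (cases "G = UNIV")
    case True then show ?thesis using U by simp
  next
    case False
    have "(\<lambda>t. measure (\<mu> t) G) \<in> borel_measurable M"
    proof (rule borel_measurable_LIMSEQ_metric)
      show "(\<lambda>n. \<integral>x. min 1 (real n * infdist x (- G)) \<partial>\<mu> t) \<longlonglongrightarrow> measure (\<mu> t) G" if "t \<in> space M" for t
        by (rule emeasure_open_limit[OF P[OF that] G False])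
      show "(\<lambda>t. \<integral>x. min 1 (real n * infdist x (- G)) \<partial>\<mu> t) \<in> borel_measurable M" for n
      proof (rule meas[of "real n"], rule lipschitz_onI)
        fix x y :: 'a
        have "\<bar>infdist x (- G) - infdist y (- G)\<bar> \<le> dist x y"
          using infdist_triangle[of x "- G" y] infdist_triangle[of y "- G" x] by (simp add: dist_commute abs_le_iff)
        then have "real n * \<bar>infdist x (- G) - infdist y (- G)\<bar> \<le> real n * dist x y" by (intro mult_left_mono) auto
        then have "\<bar>real n * infdist x (- G) - real n * infdist y (- G)\<bar> \<le> real n * dist x y"
          by (simp add: right_diff_distrib[symmetric] abs_mult)
        then show "dist (min 1 (real n * infdist x (- G))) (min 1 (real n * infdist y (- G))) \<le> real n * dist x y"
          unfolding dist_real_def by linarith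
      qed simp
    qed
    then have "(\<lambda>t. ennreal (measure (\<mu> t) G)) \<in> borel_measurable M" by measurable
    moreover have "emeasure (\<mu> t) G = ennreal (measure (\<mu> t) G)" if "t \<in> space M" for t
    proof -
      interpret prob_space "\<mu> t" by (rule Prob_simps(3)[OF P[OF that]])
      show ?thesis by (rule emeasure_eq_measure)
    qed
    ultimately show ?thesis by (subst measurable_cong[where g = "\<lambda>t. ennreal (measure (\<mu> t) G)"]) auto
  qed
qed auto

text \<open>Dependence of the integrand on t is removed by pushing \<open>\<mu> t\<close> to the
  slice over t and integrating one fixed function of the pair.\<close>

lemma integral_kernel_measurable:
  fixes h :: "'t \<Rightarrow> 'a::euclidean_space \<Rightarrow> real"
  assumes K: "\<mu> \<in> measurable M (subprob_algebra borel)" and h: "(\<lambda>(t, x). h t x) \<in> borel_measurable (M \<Otimes>\<^sub>M borel)"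
  shows "(\<lambda>t. \<integral>x. h t x \<partial>\<mu> t) \<in> borel_measurable M"
proof -
  note [measurable] = K h measurable_distr2
  have "(\<lambda>t. \<integral>z. (case z of (t, x) \<Rightarrow> h t x) \<partial>(distr (\<mu> t) (M \<Otimes>\<^sub>M borel) (\<lambda>x. (t, x)))) \<in> borel_measurable M"
    by measurable
  moreover have "(\<integral>z. (case z of (t, x) \<Rightarrow> h t x) \<partial>(distr (\<mu> t) (M \<Otimes>\<^sub>M borel) (\<lambda>x. (t, x)))) = (\<integral>x. h t x \<partial>\<mu> t)"
    if t: "t \<in> space M" for t
  proof -
    have s: "sets (\<mu> t) = sets borel" using measurable_space[OF K t] by (simp add: space_subprob_algebra)
    have "(\<lambda>x. (t, x)) \<in> measurable borel (M \<Otimes>\<^sub>M borel)" using t by measurable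
    then have "(\<lambda>x. (t, x)) \<in> measurable (\<mu> t) (M \<Otimes>\<^sub>M borel)" using measurable_cong_sets[OF s refl] by blast
    from integral_distr[OF this h] show ?thesis by simp
  qed
  ultimately show ?thesis by (simp cong: measurable_cong)
qed

section \<open>A priori estimates for the continuity equation\<close>

text \<open>Translates the Lebesgue integrals of \<open>AC_curve\<close> into gauge integrals, in
  which the estimates are carried out, and writes them as increments of a primitive.\<close>

lemma L1_nonneg_integral:
  fixes g :: "real \<Rightarrow> real"
  assumes "g absolutely_integrable_on {0..T}" "0 \<le> s" "s \<le> t" "t \<le> T"
  shows "(LINT r:{s..t}|lebesgue. g r) = integral {s..t} g"
    "integral {s..t} g = integral {0..t} g - integral {0..s} g" "g absolutely_integrable_on {s..t}"
proof -
  show a: "g absolutely_integrable_on {s..t}"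
    by (rule set_integrable_subset[OF assms(1)]) (use assms in auto)
  then show "(LINT r:{s..t}|lebesgue. g r) = integral {s..t} g" by (rule set_lebesgue_integral_eq_integral(2))
  have "g integrable_on {0..t}"
    using set_integrable_subset[OF assms(1), of "{0..t}"] assms set_lebesgue_integral_eq_integral(1) by auto
  then show "integral {s..t} g = integral {0..t} g - integral {0..s} g"
    using Henstock_Kurzweil_Integration.integral_combine[of 0 s t g] assms by simp
qed

lemma continuous_indefinite_integral:
  fixes g :: "real \<Rightarrow> real"
  assumes "g absolutely_integrable_on {0..T}" shows "continuous_on {0..T} (\<lambda>t. integral {0..t} g)"
  by (rule indefinite_integral_continuous_1[OF set_lebesgue_integral_eq_integral(1)[OF assms]])

lemma absolutely_integrable_times_continuous:
  fixes g f :: "real \<Rightarrow> real"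
  assumes g: "g absolutely_integrable_on {a..b}" and f: "continuous_on {a..b} f"
  shows "(\<lambda>r. f r * g r) absolutely_integrable_on {a..b}"
proof (rule absolutely_integrable_bounded_measurable_product_real)
  show "f \<in> borel_measurable (lebesgue_on {a..b})"
    by (rule continuous_imp_measurable_on_sets_lebesgue[OF f]) simp
  show "bounded (f ` {a..b})"
    by (rule compact_imp_bounded[OF compact_continuous_image[OF f]]) simp
qed (use g in auto)

lemma integral_mono_set:
  fixes g :: "real \<Rightarrow> real"
  assumes "g absolutely_integrable_on {0..T}" "\<And>t. t \<in> {0..T} \<Longrightarrow> 0 \<le> g t" "0 \<le> s" "s \<le> t" "t \<le> T"
  shows "0 \<le> integral {s..t} g"
  using assms by (intro integral_nonneg set_lebesgue_integral_eq_integral(1)[OF L1_nonneg_integral(3)[OF assms(1,3,4,5)]]) auto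

lemma AC_curveD:
  assumes "AC_curve T \<mu>"
  obtains g where "g absolutely_integrable_on {0..T}" "\<And>t. t \<in> {0..T} \<Longrightarrow> 0 \<le> g t"
    "\<And>t. t \<in> {0..T} \<Longrightarrow> \<mu> t \<in> Prob_c"
    "\<And>s t. 0 \<le> s \<Longrightarrow> s \<le> t \<Longrightarrow> t \<le> T \<Longrightarrow> W1 (\<mu> s) (\<mu> t) \<le> integral {0..t} g - integral {0..s} g"
proof -
  obtain g where g: "L1_nonneg T g" "\<And>s t. 0 \<le> s \<Longrightarrow> s \<le> t \<Longrightarrow> t \<le> T \<Longrightarrow> W1 (\<mu> s) (\<mu> t) \<le> (LINT r:{s..t}|lebesgue. g r)"
    using assms by (auto simp: AC_curve_def)
  then have ai: "g absolutely_integrable_on {0..T}" by (auto simp: L1_nonneg_def)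
  have "W1 (\<mu> s) (\<mu> t) \<le> integral {0..t} g - integral {0..s} g" if "0 \<le> s" "s \<le> t" "t \<le> T" for s t
    using g(2)[OF that] L1_nonneg_integral(1,2)[OF ai that] by simp
  then show thesis using that[OF ai] g(1) assms by (auto simp: L1_nonneg_def AC_curve_def)
qed

lemma W1_curve_Lipschitz_continuous:
  fixes \<mu> :: "real \<Rightarrow> 'a::euclidean_space measure" and I :: "real \<Rightarrow> real"
  assumes I: "continuous_on {0..T} I" and \<mu>: "\<And>t. t \<in> {0..T} \<Longrightarrow> \<mu> t \<in> Prob_c"
    and W: "\<And>s t. 0 \<le> s \<Longrightarrow> s \<le> t \<Longrightarrow> t \<le> T \<Longrightarrow> W1 (\<mu> s) (\<mu> t) \<le> I t - I s"
    and f: "L-lipschitz_on UNIV (f :: 'a \<Rightarrow> real)"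
  shows "continuous_on {0..T} (\<lambda>t. \<integral>x. f x \<partial>\<mu> t)"
  unfolding continuous_on_iff
proof (intro ballI allI impI)
  fix t e :: real assume t: "t \<in> {0..T}" and e: "e > 0"
  have L: "L \<ge> 0" using f lipschitz_on_nonneg by blast
  obtain d where d: "d > 0" "\<And>s. s \<in> {0..T} \<Longrightarrow> dist s t < d \<Longrightarrow> dist (I s) (I t) < e / (L + 1)"
    using I t e L unfolding continuous_on_iff by (metis add_nonneg_pos divide_pos_pos zero_less_one)
  have "dist (\<integral>x. f x \<partial>\<mu> s) (\<integral>x. f x \<partial>\<mu> t) < e" if s: "s \<in> {0..T}" "dist s t < d" for s
  proof -
    have "\<bar>(\<integral>x. f x \<partial>\<mu> s) - (\<integral>x. f x \<partial>\<mu> t)\<bar> \<le> L * \<bar>I s - I t\<bar>"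
    proof (cases "s \<le> t")
      case True
      have "\<bar>(\<integral>x. f x \<partial>\<mu> s) - (\<integral>x. f x \<partial>\<mu> t)\<bar> \<le> L * W1 (\<mu> s) (\<mu> t)"
        by (intro W1_Lipschitz_bound_UNIV f \<mu> s t)
      also have "\<dots> \<le> L * \<bar>I s - I t\<bar>" using W[of s t] s t True L by (intro mult_left_mono) auto
      finally show ?thesis .
    next
      case False
      have "\<bar>(\<integral>x. f x \<partial>\<mu> t) - (\<integral>x. f x \<partial>\<mu> s)\<bar> \<le> L * W1 (\<mu> t) (\<mu> s)"
        by (intro W1_Lipschitz_bound_UNIV f \<mu> s t)
      also have "\<dots> \<le> L * \<bar>I s - I t\<bar>" using W[of t s] s t False L by (intro mult_left_mono) auto
      finally show ?thesis by (simp add: abs_minus_commute)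
    qed
    also have "\<dots> \<le> (L + 1) * \<bar>I s - I t\<bar>" by (intro mult_right_mono) auto
    also have "\<dots> < e" using d(2)[OF s] L by (simp add: dist_real_def pos_less_divide_eq mult.commute)
    finally show ?thesis by (simp add: dist_real_def)
  qed
  then show "\<exists>d>0. \<forall>x'\<in>{0..T}. dist x' t < d \<longrightarrow> dist (\<integral>x. f x \<partial>\<mu> x') (\<integral>x. f x \<partial>\<mu> t) < e"
    using d(1) by blast
qed

lemma AC_curve_Lipschitz_continuous:
  fixes \<mu> :: "real \<Rightarrow> 'a::euclidean_space measure"
  assumes "AC_curve T \<mu>" "L-lipschitz_on UNIV (f :: 'a \<Rightarrow> real)"
  shows "continuous_on {0..T} (\<lambda>t. \<integral>x. f x \<partial>\<mu> t)"
proof -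
  obtain g where g: "g absolutely_integrable_on {0..T}" "\<And>t. t \<in> {0..T} \<Longrightarrow> 0 \<le> g t"
    "\<And>t. t \<in> {0..T} \<Longrightarrow> \<mu> t \<in> Prob_c"
    "\<And>s t. 0 \<le> s \<Longrightarrow> s \<le> t \<Longrightarrow> t \<le> T \<Longrightarrow> W1 (\<mu> s) (\<mu> t) \<le> integral {0..t} g - integral {0..s} g"
    by (rule AC_curveD[OF assms(1)]) blast
  show ?thesis
    by (rule W1_curve_Lipschitz_continuous[OF continuous_indefinite_integral[OF g(1)] g(3) g(4) assms(2)])
qed

section \<open>Gronwall's estimate and weak time derivatives\<close>

text \<open>f at most doubles on an interval over which k has integral at most 1/2, and [0, T] is
  exhausted by at most \<open>Suc N\<close> of these. A power of 2 serves as well as an exponential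
  because only the dependence on k matters.\<close>

lemma Gronwall_doubling:
  fixes f k :: "real \<Rightarrow> real"
  assumes T: "0 \<le> T" and f: "continuous_on {0..T} f" "\<And>t. t \<in> {0..T} \<Longrightarrow> 0 \<le> f t"
    and k: "k absolutely_integrable_on {0..T}" "\<And>t. t \<in> {0..T} \<Longrightarrow> 0 \<le> k t"
    and fk: "\<And>s t. 0 \<le> s \<Longrightarrow> s \<le> t \<Longrightarrow> t \<le> T \<Longrightarrow> f t - f s \<le> integral {s..t} (\<lambda>r. f r * k r)"
    and N: "2 * integral {0..T} k \<le> real (Suc N)" and t: "t \<in> {0..T}"
  shows "f t \<le> 2 ^ Suc N * f 0"
proof -
  define \<kappa> where "\<kappa> t = integral {0..t} k" for t
  have \<kappa>c: "continuous_on {0..T} \<kappa>" unfolding \<kappa>_def by (rule continuous_indefinite_integral[OF k(1)])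
  have step: "f t \<le> 2 * f s" if st: "0 \<le> s" "s \<le> t" "t \<le> T" "\<kappa> t - \<kappa> s \<le> 1/2" for s t
  proof -
    \<comment> \<open>At a maximiser of f the right-hand side is at most half the maximum, which the
      left-hand side absorbs.\<close>
    have "compact {s..t}" "{s..t} \<noteq> {}" "continuous_on {s..t} f" using st continuous_on_subset[OF f(1)] by auto
    from continuous_attains_sup[OF this] obtain \<tau> where \<tau>: "\<tau> \<in> {s..t}" "\<And>r. r \<in> {s..t} \<Longrightarrow> f r \<le> f \<tau>" by auto
    have sub: "{s..\<tau>} \<subseteq> {0..T}" and s\<tau>: "0 \<le> s" "s \<le> \<tau>" "\<tau> \<le> T" using \<tau>(1) st by auto
    note k\<tau> = L1_nonneg_integral(3)[OF k(1) s\<tau>]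
    have "f \<tau> - f s \<le> integral {s..\<tau>} (\<lambda>r. f r * k r)" by (rule fk[OF s\<tau>])
    also have "\<dots> \<le> integral {s..\<tau>} (\<lambda>r. f \<tau> * k r)"
    proof (rule integral_le)
      show "(\<lambda>r. f r * k r) integrable_on {s..\<tau>}"
        by (rule set_lebesgue_integral_eq_integral(1)[OF absolutely_integrable_times_continuous[OF k\<tau> continuous_on_subset[OF f(1) sub]]])
      show "(\<lambda>r. f \<tau> * k r) integrable_on {s..\<tau>}"
        by (rule integrable_on_mult_right[OF set_lebesgue_integral_eq_integral(1)[OF k\<tau>]])
      show "f r * k r \<le> f \<tau> * k r" if "r \<in> {s..\<tau>}" for r
        using \<tau>(1) that st k(2)[of r] by (intro mult_right_mono \<tau>(2)) auto
    qed
    also have "\<dots> = f \<tau> * (\<kappa> \<tau> - \<kappa> s)" using L1_nonneg_integral(2)[OF k(1) s\<tau>] by (simp add: \<kappa>_def)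
    also have "\<dots> \<le> f \<tau> * (1/2)"
    proof (rule mult_left_mono)
      have "0 \<le> \<kappa> t - \<kappa> \<tau>"
        using L1_nonneg_integral(2)[OF k(1), of \<tau> t] integral_mono_set[OF k, of \<tau> t] \<tau>(1) st by (auto simp: \<kappa>_def)
      then show "\<kappa> \<tau> - \<kappa> s \<le> 1/2" using st(4) by linarith
      show "0 \<le> f \<tau>" using f(2) s\<tau> by auto
    qed
    finally have "f \<tau> \<le> 2 * f s" by linarith
    then show ?thesis using \<tau>(2)[of t] st by auto
  qed
  have "f t \<le> 2 ^ Suc i * f 0" if "\<kappa> t \<le> real (Suc i) / 2" "t \<in> {0..T}" for i t
    using that
  proof (induction i arbitrary: t)
    case 0 then show ?case using step[of 0 t] by (simp add: \<kappa>_def)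
  next
    case (Suc i)
    show ?case
    proof (cases "\<kappa> t \<le> real (Suc i) / 2")
      case True
      then have "f t \<le> 2 ^ Suc i * f 0" using Suc by blast
      also have "\<dots> \<le> 2 ^ Suc (Suc i) * f 0" using f(2)[of 0] T by (intro mult_right_mono) auto
      finally show ?thesis .
    next
      case False
      \<comment> \<open>Cut at the time where the primitive of k reaches the previous multiple of
        1/2.\<close>
      have "\<exists>s\<ge>0. s \<le> t \<and> \<kappa> s = real (Suc i) / 2"
        using False Suc.prems(2) continuous_on_subset[OF \<kappa>c, of "{0..t}"] by (intro IVT') (auto simp: \<kappa>_def)
      then obtain s where s: "0 \<le> s" "s \<le> t" "\<kappa> s = real (Suc i) / 2" by blast
      have "f t \<le> 2 * f s" using s Suc.prems by (intro step) (auto simp: add_divide_distrib)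
      also have "f s \<le> 2 ^ Suc i * f 0" using s Suc.prems by (intro Suc.IH) auto
      finally show ?thesis by simp
    qed
  qed
  moreover have "\<kappa> t \<le> real (Suc N) / 2"
  proof -
    have "0 \<le> \<kappa> T - \<kappa> t"
      using L1_nonneg_integral(2)[OF k(1), of t T] integral_mono_set[OF k, of t T] t by (auto simp: \<kappa>_def)
    then show ?thesis using N by (simp add: \<kappa>_def)
  qed
  ultimately show ?thesis using t by blast
qed

lemma smooth_step_kernel_continuous:
  "continuous_on A (\<lambda>r. deriv smooth_step ((r - c) / \<epsilon>) / \<epsilon>)"
proof -
  have "continuous_on UNIV (\<lambda>r. deriv smooth_step ((1 / \<epsilon>) * r + (- c / \<epsilon>)))"
    by (rule Cr_k_continuous[OF Cr_k_affine[OF smooth_step(7)]])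
  moreover have "(1 / \<epsilon>) * r + (- c / \<epsilon>) = (r - c) / \<epsilon>" for r by (simp add: diff_divide_distrib)
  ultimately have "continuous_on UNIV (\<lambda>r. deriv smooth_step ((r - c) / \<epsilon>))" by simp
  then have "continuous_on UNIV (\<lambda>r. deriv smooth_step ((r - c) / \<epsilon>) * (1 / \<epsilon>))"
    by (rule continuous_on_mult_right)
  then show ?thesis using continuous_on_subset by fastforce
qed

text \<open>The kernel is a one-sided mollifier: it is supported between s and
  \<open>s + \<epsilon> n\<close>, and once this interval lies inside [0, T] its mass is 1, the
  total rise of the step.\<close>

lemma smooth_step_kernel_limit:
  fixes F :: "real \<Rightarrow> real"
  assumes F: "continuous_on {0..T} F" and s: "0 < s" "s < T" and \<epsilon>: "\<And>n. 0 < \<epsilon> n" "\<epsilon> \<longlonglongrightarrow> 0"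
  shows "(\<lambda>n. integral {0..T} (\<lambda>r. deriv smooth_step ((r - s) / \<epsilon> n) / \<epsilon> n * F r)) \<longlonglongrightarrow> F s"
proof (rule LIMSEQ_I)
  fix e :: real assume e: "e > 0"
  define k where "k n r = deriv smooth_step ((r - s) / \<epsilon> n) / \<epsilon> n" for n r
  obtain d where d: "d > 0" "\<And>r. r \<in> {0..T} \<Longrightarrow> dist r s < d \<Longrightarrow> dist (F r) (F s) < e / 2"
    using F s e unfolding continuous_on_iff by (metis atLeastAtMost_iff half_gt_zero less_imp_le)
  have "\<forall>\<^sub>F n in sequentially. \<epsilon> n < min d (T - s)" using \<epsilon>(2) d(1) s by (intro order_tendstoD(2)) auto
  then obtain N where N: "\<And>n. n \<ge> N \<Longrightarrow> \<epsilon> n < d" "\<And>n. n \<ge> N \<Longrightarrow> \<epsilon> n < T - s" by (auto simp: eventually_sequentially)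
  have "norm (integral {0..T} (\<lambda>r. k n r * F r) - F s) < e" if n: "n \<ge> N" for n
  proof -
    have kn: "0 \<le> k n r" for r using smooth_step(2) \<epsilon>(1)[of n] by (simp add: k_def)
    have k0: "k n r = 0" if "\<not> (s \<le> r \<and> r \<le> s + \<epsilon> n)" for r
      using that \<epsilon>(1)[of n] smooth_step(3)[of "(r - s) / \<epsilon> n"] by (auto simp: k_def field_simps)
    have kc: "continuous_on A (k n)" for A unfolding k_def [abs_def] by (rule smooth_step_kernel_continuous)
    have D: "((\<lambda>r. smooth_step ((r - s) / \<epsilon> n)) has_real_derivative k n r) (at r within A)" for r A
    proof -
      have "((\<lambda>r. (r - s) / \<epsilon> n) has_real_derivative 1 / \<epsilon> n) (at r)"
        using \<epsilon>(1)[of n] by (auto intro!: derivative_eq_intros)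
      from DERIV_chain2[OF smooth_step(1) this]
      show ?thesis unfolding k_def by (auto intro: has_field_derivative_at_within)
    qed
    have "(k n has_integral (smooth_step ((T - s) / \<epsilon> n) - smooth_step ((0 - s) / \<epsilon> n))) {0..T}"
      using s by (intro fundamental_theorem_of_calculus)
        (auto simp: has_real_derivative_iff_has_vector_derivative[symmetric] intro: D)
    moreover have "smooth_step ((T - s) / \<epsilon> n) = 1" using N(2)[OF n] \<epsilon>(1)[of n] by (intro smooth_step(5)) (simp add: le_divide_eq)
    moreover have "smooth_step ((0 - s) / \<epsilon> n) = 0" using s \<epsilon>(1)[of n] by (intro smooth_step(4)) (simp add: divide_le_0_iff)
    ultimately have k1: "(k n has_integral 1) {0..T}" by simp
    have i1: "(\<lambda>r. k n r * F r) integrable_on {0..T}"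
      by (intro integrable_continuous_real continuous_intros kc F)
    have i2: "((\<lambda>r. k n r * F s) has_integral F s) {0..T}"
      using has_integral_mult_left[OF k1, of "F s"] by simp
    have i3: "((\<lambda>r. k n r * (e / 2)) has_integral e / 2) {0..T}"
      using has_integral_mult_left[OF k1, of "e / 2"] by simp
    have "integral {0..T} (\<lambda>r. k n r * F r) - F s = integral {0..T} (\<lambda>r. k n r * F r - k n r * F s)"
      using integral_diff[OF i1 has_integral_integrable[OF i2]] integral_unique[OF i2] by simp
    also have "norm \<dots> \<le> integral {0..T} (\<lambda>r. k n r * (e / 2))"
    proof (rule integral_norm_bound_integral)
      show "(\<lambda>r. k n r * F r - k n r * F s) integrable_on {0..T}" using i1 i2 by (auto intro: integrable_diff)
      show "(\<lambda>r. k n r * (e / 2)) integrable_on {0..T}" using i3 by auto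
      fix r assume r: "r \<in> {0..T}"
      show "norm (k n r * F r - k n r * F s) \<le> k n r * (e / 2)"
      proof (cases "s \<le> r \<and> r \<le> s + \<epsilon> n")
        case True
        then have "dist r s < d" using N(1)[OF n] by (auto simp: dist_real_def)
        then have "\<bar>F r - F s\<bar> \<le> e / 2" using d(2)[OF r] by (simp add: dist_real_def)
        from mult_left_mono[OF this kn[of r]] show ?thesis
          using kn[of r] by (simp add: right_diff_distrib[symmetric] abs_mult)
      qed (simp add: k0)
    qed
    also have "\<dots> = e / 2" using i3 by (rule integral_unique)
    finally show ?thesis using e by linarith
  qed
  then show "\<exists>no. \<forall>n\<ge>no. norm (integral {0..T} (\<lambda>r. deriv smooth_step ((r - s) / \<epsilon> n) / \<epsilon> n * F r) - F s) < e"
    unfolding k_def by blast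
qed

text \<open>The test functions are differences of a step rising just after s and one rising just
  after t, that is, smooth approximations of the indicator of (s, t]. Their derivatives are the
  mollifying kernels at s and t.\<close>

lemma weak_derivative_bound_open:
  fixes F B :: "real \<Rightarrow> real"
  assumes F: "continuous_on {0..T} F" and B: "B absolutely_integrable_on {0..T}" and st: "0 < s" "s < t" "t < T"
    and weak: "\<And>\<eta> a b. (\<And>k. Cr_k k UNIV \<eta>) \<Longrightarrow> (\<And>r. r \<notin> {a..b} \<Longrightarrow> \<eta> r = 0) \<Longrightarrow> 0 < a \<Longrightarrow> b < T \<Longrightarrow>
       (\<And>r. 0 \<le> \<eta> r) \<Longrightarrow> 0 \<le> integral {0..T} (\<lambda>r. deriv \<eta> r * F r + \<eta> r * B r)"
  shows "F t - F s \<le> integral {s..t} B"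
proof -
  \<comment> \<open>Small enough for the second step to be complete before T, so that the cut-off is
    supported in the open time interval.\<close>
  define \<epsilon> where "\<epsilon> n = ((T - t) / 2) * (1 / Suc n)" for n
  have \<epsilon>: "0 < \<epsilon> n" "\<epsilon> n < T - t" for n
  proof -
    show "0 < \<epsilon> n" using st by (simp add: \<epsilon>_def)
    have "(T - t) / 2 * (1 / Suc n) \<le> (T - t) / 2 * 1" using st by (intro mult_left_mono) auto
    then have "\<epsilon> n \<le> (T - t) / 2" by (simp only: \<epsilon>_def mult_1_right)
    then show "\<epsilon> n < T - t" using st by argo
  qed
  have "\<epsilon> \<longlonglongrightarrow> ((T - t) / 2) * 0" unfolding \<epsilon>_def by (intro tendsto_intros LIMSEQ_Suc[OF lim_1_over_n])
  then have \<epsilon>0: "\<epsilon> \<longlonglongrightarrow> 0" by simp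
  define \<eta> where "\<eta> n r = smooth_step ((1 / \<epsilon> n) * r + (- s / \<epsilon> n)) + (- 1) * smooth_step ((1 / \<epsilon> n) * r + (- t / \<epsilon> n))" for n r
  have arg: "(1 / \<epsilon> n) * r + (- c / \<epsilon> n) = (r - c) / \<epsilon> n" for n r c by (simp add: diff_divide_distrib)
  have \<eta>_alt: "\<eta> n r = smooth_step ((r - s) / \<epsilon> n) - smooth_step ((r - t) / \<epsilon> n)" for n r
    unfolding \<eta>_def arg by simp
  have sm: "Cr_k k UNIV (\<eta> n)" for k n
    unfolding \<eta>_def [abs_def] by (intro Cr_k_add Cr_k_mult Cr_k_const) (rule Cr_k_affine[OF smooth_step(6)])+
  have D: "(\<eta> n has_real_derivative (deriv smooth_step ((r - s) / \<epsilon> n) / \<epsilon> n - deriv smooth_step ((r - t) / \<epsilon> n) / \<epsilon> n)) (at r)" for n r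
  proof -
    have K: "((\<lambda>r. smooth_step ((r - c) / \<epsilon> n)) has_real_derivative deriv smooth_step ((r - c) / \<epsilon> n) / \<epsilon> n) (at r)" for c
    proof -
      have "((\<lambda>r. (r - c) / \<epsilon> n) has_real_derivative 1 / \<epsilon> n) (at r)"
        using \<epsilon>(1)[of n] by (auto intro!: derivative_eq_intros)
      from DERIV_chain2[OF smooth_step(1) this] show ?thesis by simp
    qed
    show ?thesis unfolding \<eta>_alt [abs_def] by (rule DERIV_diff[OF K K])
  qed
  have \<eta>0: "\<eta> n r = 0" if "r \<notin> {s..t + \<epsilon> n}" for n r
  proof (cases "r < s")
    case True
    then show ?thesis unfolding \<eta>_alt using \<epsilon>(1)[of n] st by (subst (1 2) smooth_step(4)) (auto simp: divide_le_0_iff)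
  next
    case False
    then have "r > t + \<epsilon> n" using that by auto
    then show ?thesis unfolding \<eta>_alt using \<epsilon>(1)[of n] st by (subst (1 2) smooth_step(5)) (auto simp: le_divide_eq)
  qed
  have \<eta>nn: "0 \<le> \<eta> n r" for n r
    unfolding \<eta>_alt using \<epsilon>(1)[of n] st smooth_step_mono[of "(r - t) / \<epsilon> n" "(r - s) / \<epsilon> n"] by (simp add: divide_right_mono)
  have \<eta>le: "\<eta> n r \<le> 1" for n r unfolding \<eta>_alt using smooth_step_bounds[of "(r - s) / \<epsilon> n"] smooth_step_bounds[of "(r - t) / \<epsilon> n"] by linarith
  have \<eta>c: "continuous_on A (\<eta> n)" for A n using Cr_k_continuous[OF sm] continuous_on_subset by blast
  note dc = smooth_step_kernel_continuous
  have Bi: "(\<lambda>r. \<eta> n r * B r) absolutely_integrable_on {0..T}" for n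
    by (rule absolutely_integrable_times_continuous[OF B \<eta>c])
  have ineq: "0 \<le> (integral {0..T} (\<lambda>r. deriv smooth_step ((r - s) / \<epsilon> n) / \<epsilon> n * F r)
       - integral {0..T} (\<lambda>r. deriv smooth_step ((r - t) / \<epsilon> n) / \<epsilon> n * F r)) + integral {0..T} (\<lambda>r. \<eta> n r * B r)" for n
  proof -
    have ii: "(\<lambda>r. deriv smooth_step ((r - c) / \<epsilon> n) / \<epsilon> n * F r) integrable_on {0..T}" for c
      by (intro integrable_continuous_real continuous_on_mult dc F)
    have "0 \<le> integral {0..T} (\<lambda>r. deriv (\<eta> n) r * F r + \<eta> n r * B r)"
      by (rule weak[where a = s and b = "t + \<epsilon> n", OF sm \<eta>0 _ _ \<eta>nn]) (use st \<epsilon>(2)[of n] in auto)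
    also have "(\<lambda>r. deriv (\<eta> n) r * F r + \<eta> n r * B r) = (\<lambda>r. (deriv smooth_step ((r - s) / \<epsilon> n) / \<epsilon> n * F r
      - deriv smooth_step ((r - t) / \<epsilon> n) / \<epsilon> n * F r) + \<eta> n r * B r)"
      using DERIV_imp_deriv[OF D] by (simp add: left_diff_distrib)
    also have "integral {0..T} \<dots> = (integral {0..T} (\<lambda>r. deriv smooth_step ((r - s) / \<epsilon> n) / \<epsilon> n * F r)
       - integral {0..T} (\<lambda>r. deriv smooth_step ((r - t) / \<epsilon> n) / \<epsilon> n * F r)) + integral {0..T} (\<lambda>r. \<eta> n r * B r)"
      by (subst integral_add[OF integrable_diff[OF ii ii] set_lebesgue_integral_eq_integral(1)[OF Bi]])
        (subst integral_diff[OF ii ii], rule refl)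
    finally show ?thesis .
  qed
  have limB: "(\<lambda>n. integral {0..T} (\<lambda>r. \<eta> n r * B r)) \<longlonglongrightarrow> integral {0..T} (\<lambda>r. if r \<in> {s<..t} then B r else 0)"
  proof (rule dominated_convergence(2))
    show "(\<lambda>r. \<eta> n r * B r) integrable_on {0..T}" for n by (rule set_lebesgue_integral_eq_integral(1)[OF Bi])
    show "(\<lambda>r. \<bar>B r\<bar>) integrable_on {0..T}"
      using absolutely_integrable_on_def B by (auto simp: absolutely_integrable_on_def)
    show "norm (\<eta> n r * B r) \<le> \<bar>B r\<bar>" for n r using \<eta>nn[of n r] \<eta>le[of n r] by (simp add: abs_mult mult_left_le_one_le)
    fix r
    have "\<forall>\<^sub>F n in sequentially. \<eta> n r = (if r \<in> {s<..t} then 1 else 0)"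
    proof -
      have ev: "\<forall>\<^sub>F n in sequentially. \<epsilon> n < d" if "d > 0" for d using \<epsilon>0 that by (rule order_tendstoD(2))
      consider "r \<le> s" | "s < r" "r \<le> t" | "t < r" by linarith
      then show ?thesis
      proof cases
        case 1
        have "\<eta> n r = 0" for n
          unfolding \<eta>_alt using \<epsilon>(1)[of n] st 1 by (subst (1 2) smooth_step(4)) (auto simp: divide_le_0_iff)
        then show ?thesis using 1 by simp
      next
        case 2
        have "\<forall>\<^sub>F n in sequentially. \<epsilon> n < r - s" using 2 by (intro ev) simp
        then show ?thesis
        proof eventually_elim
          fix n assume n: "\<epsilon> n < r - s"
          have "smooth_step ((r - s) / \<epsilon> n) = 1" using n \<epsilon>(1)[of n] by (intro smooth_step(5)) (simp add: le_divide_eq)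
          moreover have "smooth_step ((r - t) / \<epsilon> n) = 0" using 2 \<epsilon>(1)[of n] by (intro smooth_step(4)) (simp add: divide_le_0_iff)
          ultimately show "\<eta> n r = (if r \<in> {s<..t} then 1 else 0)" using 2 by (simp add: \<eta>_alt)
        qed
      next
        case 3
        have "\<forall>\<^sub>F n in sequentially. \<epsilon> n < r - t" using 3 by (intro ev) simp
        then show ?thesis
        proof eventually_elim
          fix n assume n: "\<epsilon> n < r - t"
          have "smooth_step ((r - s) / \<epsilon> n) = 1" using n st \<epsilon>(1)[of n] by (intro smooth_step(5)) (simp add: le_divide_eq)
          moreover have "smooth_step ((r - t) / \<epsilon> n) = 1" using n \<epsilon>(1)[of n] by (intro smooth_step(5)) (simp add: le_divide_eq)
          ultimately show "\<eta> n r = (if r \<in> {s<..t} then 1 else 0)" using 3 by (simp add: \<eta>_alt)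
        qed
      qed
    qed
    then have "\<forall>\<^sub>F n in sequentially. \<eta> n r * B r = (if r \<in> {s<..t} then B r else 0)"
      by eventually_elim simp
    then show "(\<lambda>n. \<eta> n r * B r) \<longlonglongrightarrow> (if r \<in> {s<..t} then B r else 0)" by (rule tendsto_eventually)
  qed
  \<comment> \<open>The step vanishes at 0, so the limit of the cut-offs leaves out the left
    endpoint.\<close>
  have "integral {0..T} (\<lambda>r. if r \<in> {s<..t} then B r else 0) = integral {0..T} (\<lambda>r. if r \<in> {s..t} then B r else 0)"
    by (rule integral_spike[of "{s}"]) auto
  also have "\<dots> = integral {s..t} B" using st by (subst integral_restrict_Int) (auto simp: Int_absorb2)
  finally have Bst: "integral {0..T} (\<lambda>r. if r \<in> {s<..t} then B r else 0) = integral {s..t} B" .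
  have "(\<lambda>n. (integral {0..T} (\<lambda>r. deriv smooth_step ((r - s) / \<epsilon> n) / \<epsilon> n * F r)
       - integral {0..T} (\<lambda>r. deriv smooth_step ((r - t) / \<epsilon> n) / \<epsilon> n * F r)) + integral {0..T} (\<lambda>r. \<eta> n r * B r))
     \<longlonglongrightarrow> (F s - F t) + integral {s..t} B"
    using limB unfolding Bst
    by (intro tendsto_add tendsto_diff smooth_step_kernel_limit F \<epsilon>(1) \<epsilon>0) (use st in auto)
  then have "0 \<le> (F s - F t) + integral {s..t} B" by (rule LIMSEQ_le_const) (use ineq in blast)
  then show ?thesis by simp
qed

text \<open>F minus the primitive of B is nonincreasing on the open interval, and continuity extends
  this to the endpoints.\<close>

lemma weak_derivative_bound:
  fixes F B :: "real \<Rightarrow> real"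
  assumes F: "continuous_on {0..T} F" and B: "B absolutely_integrable_on {0..T}" and st: "0 \<le> s" "s \<le> t" "t \<le> T"
    and weak: "\<And>\<eta> a b. (\<And>k. Cr_k k UNIV \<eta>) \<Longrightarrow> (\<And>r. r \<notin> {a..b} \<Longrightarrow> \<eta> r = 0) \<Longrightarrow> 0 < a \<Longrightarrow> b < T \<Longrightarrow>
       (\<And>r. 0 \<le> \<eta> r) \<Longrightarrow> 0 \<le> integral {0..T} (\<lambda>r. deriv \<eta> r * F r + \<eta> r * B r)"
  shows "F t - F s \<le> integral {s..t} B"
proof (cases "s = t")
  case True then show ?thesis by simp
next
  case False
  then have lt: "s < t" using st by simp
  define I where "I t = integral {0..t} B" for t
  have I: "continuous_on {0..T} I" unfolding I_def by (rule continuous_indefinite_integral[OF B])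
  define G where "G t = F t - I t" for t
  have G: "continuous_on {0..T} G" unfolding G_def by (intro continuous_intros F I)
  define a b where "a n = s + (t - s) / 3 * (1 / Suc n)" and "b n = t - (t - s) / 3 * (1 / Suc n)" for n :: nat
  have ab: "s < a n" "a n < b n" "b n < t" for n
  proof -
    define h where "h = (t - s) / 3 * (1 / Suc n)"
    have "h > 0" unfolding h_def using lt by (intro mult_pos_pos) auto
    moreover have "h \<le> (t - s) / 3 * 1" unfolding h_def using lt by (intro mult_left_mono) auto
    moreover have "a n = s + h" "b n = t - h" by (simp_all only: a_def b_def h_def)
    ultimately show "s < a n" "a n < b n" "b n < t" using lt by argo+
  qed
  have "G (b n) - G (a n) \<le> 0" for n
  proof -
    have "F (b n) - F (a n) \<le> integral {a n..b n} B"
      by (rule weak_derivative_bound_open[OF F B _ _ _ weak]) (use ab[of n] st in auto)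
    also have "\<dots> = I (b n) - I (a n)" unfolding I_def using ab[of n] st by (intro L1_nonneg_integral(2)[OF B]) auto
    finally show ?thesis by (simp add: G_def)
  qed
  moreover have "a \<longlonglongrightarrow> s + (t - s) / 3 * 0" "b \<longlonglongrightarrow> t - (t - s) / 3 * 0"
    unfolding a_def b_def by (intro tendsto_intros LIMSEQ_Suc[OF lim_1_over_n])+
  then have lim: "a \<longlonglongrightarrow> s" "b \<longlonglongrightarrow> t" by simp_all
  have mem: "a n \<in> {0..T}" "b n \<in> {0..T}" for n using ab[of n] st by auto
  have "(\<lambda>n. G (a n)) \<longlonglongrightarrow> G s"
    by (rule continuous_on_tendsto_compose[OF G lim(1)]) (use st mem in auto)
  moreover have "(\<lambda>n. G (b n)) \<longlonglongrightarrow> G t"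
    by (rule continuous_on_tendsto_compose[OF G lim(2)]) (use st mem in auto)
  ultimately have "(\<lambda>n. G (b n) - G (a n)) \<longlonglongrightarrow> G t - G s" "\<And>n. G (b n) - G (a n) \<le> 0" by (auto intro: tendsto_diff)
  then have "G t - G s \<le> 0" by (intro LIMSEQ_le_const2) auto
  then show ?thesis using L1_nonneg_integral(2)[OF B st] by (simp add: G_def I_def)
qed

section \<open>Almost everywhere convergent convex combinations\<close>

definition tail_combinations :: "(nat \<Rightarrow> 'w \<Rightarrow> 'b::real_vector) \<Rightarrow> nat \<Rightarrow> ('w \<Rightarrow> 'b) set" where
  "tail_combinations z n = {\<lambda>x. \<Sum>k\<in>{n..N}. c k *\<^sub>R z k x | c N. (\<forall>k. (0::real) \<le> c k) \<and> (\<Sum>k\<in>{n..N}. c k) = 1}"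

lemma tail_combinations_antimono:
  assumes "n \<le> m" shows "tail_combinations z m \<subseteq> tail_combinations z n"
proof
  fix f assume "f \<in> tail_combinations z m"
  then obtain c N where c: "f = (\<lambda>x. \<Sum>k\<in>{m..N}. c k *\<^sub>R z k x)" "\<And>k. 0 \<le> c k" "(\<Sum>k\<in>{m..N}. c k) = 1"
    by (auto simp: tail_combinations_def)
  define c' where "c' k = (if m \<le> k then c k else 0)" for k
  have eq: "(\<Sum>k\<in>{m..N}. h k) = (\<Sum>k\<in>{n..N}. if m \<le> k then h k else 0)" for h :: "nat \<Rightarrow> 'v::comm_monoid_add"
    using assms by (intro sum.mono_neutral_cong_left) auto
  have "f = (\<lambda>x. \<Sum>k\<in>{n..N}. c' k *\<^sub>R z k x)"
    unfolding c(1) eq by (auto simp: c'_def fun_eq_iff intro!: sum.cong)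
  moreover have "(\<Sum>k\<in>{n..N}. c' k) = 1" using c(3) unfolding eq by (simp add: c'_def)
  moreover have "\<And>k. 0 \<le> c' k" using c(2) by (simp add: c'_def)
  ultimately show "f \<in> tail_combinations z n" unfolding tail_combinations_def by blast
qed

lemma tail_combinations_midpoint:
  assumes "f \<in> tail_combinations z n" "g \<in> tail_combinations z n"
  shows "(\<lambda>x. (1/2) *\<^sub>R (f x + g x)) \<in> tail_combinations z n"
proof -
  obtain c N where c: "f = (\<lambda>x. \<Sum>k\<in>{n..N}. c k *\<^sub>R z k x)" "\<And>k. 0 \<le> c k" "(\<Sum>k\<in>{n..N}. c k) = 1"
    using assms(1) by (auto simp: tail_combinations_def)
  obtain d N' where d: "g = (\<lambda>x. \<Sum>k\<in>{n..N'}. d k *\<^sub>R z k x)" "\<And>k. 0 \<le> d k" "(\<Sum>k\<in>{n..N'}. d k) = 1"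
    using assms(2) by (auto simp: tail_combinations_def)
  let ?N = "max N N'"
  have eq: "(\<Sum>k\<in>{n..N}. h k) = (\<Sum>k\<in>{n..?N}. if k \<le> N then h k else 0)"
     "(\<Sum>k\<in>{n..N'}. h k) = (\<Sum>k\<in>{n..?N}. if k \<le> N' then h k else 0)" for h :: "nat \<Rightarrow> 'v::comm_monoid_add"
    by (intro sum.mono_neutral_cong_left; auto)+
  define e where "e k = (1/2) * ((if k \<le> N then c k else 0) + (if k \<le> N' then d k else 0))" for k
  have "(\<lambda>x. (1/2) *\<^sub>R (f x + g x)) = (\<lambda>x. \<Sum>k\<in>{n..?N}. e k *\<^sub>R z k x)"
    unfolding c(1) d(1) eq sum.distrib[symmetric] scaleR_sum_right
    by (auto simp: e_def fun_eq_iff scaleR_add_left scaleR_add_right add_divide_distrib intro!: sum.cong)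
  moreover have "(\<Sum>k\<in>{n..?N}. e k) = 1"
    using c(3) d(3) unfolding eq e_def sum_distrib_left[symmetric] sum.distrib by simp
  moreover have "\<And>k. 0 \<le> e k" using c(2) d(2) by (simp add: e_def)
  ultimately show ?thesis unfolding tail_combinations_def by blast
qed

text \<open>The near-minimisers of the \<open>L\<^sup>2\<close> norm over the convex hulls of the tails form a Cauchy sequence.\<close>

lemma convex_combinations_converge_AE:
  fixes z :: "nat \<Rightarrow> 'w \<Rightarrow> 'b::euclidean_space"
  assumes M: "finite_measure M" and z: "\<And>n. z n \<in> borel_measurable M"
    and bd: "\<And>n x. x \<in> space M \<Longrightarrow> norm (z n x) \<le> B"
  obtains c N where "\<And>n k. (0::real) \<le> c n k" "\<And>n. (\<Sum>k\<in>{n..N n}. c n k) = 1"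
    "AE x in M. convergent (\<lambda>n. \<Sum>k\<in>{n..N n}. c n k *\<^sub>R z k x)"
proof -
  interpret finite_measure M by fact
  define A where "A = tail_combinations z"
  have Am: "f \<in> borel_measurable M" if "f \<in> A n" for f n
    using that z unfolding A_def tail_combinations_def by (auto intro!: borel_measurable_sum borel_measurable_scaleR)
  have Ab: "norm (f x) \<le> B" if f: "f \<in> A n" and x: "x \<in> space M" for f n x
  proof -
    obtain c N where c: "f = (\<lambda>x. \<Sum>k\<in>{n..N}. c k *\<^sub>R z k x)" "\<And>k. 0 \<le> c k" "(\<Sum>k\<in>{n..N}. c k) = 1"
      using f by (auto simp: A_def tail_combinations_def)
    have "norm (f x) \<le> (\<Sum>k\<in>{n..N}. norm (c k *\<^sub>R z k x))" unfolding c(1) by (rule norm_sum)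
    also have "\<dots> \<le> (\<Sum>k\<in>{n..N}. c k * B)" using c(2) bd[OF x] by (intro sum_mono) (auto intro: mult_left_mono)
    also have "\<dots> = B" using c(3) by (simp add: sum_distrib_right[symmetric])
    finally show ?thesis .
  qed
  define J where "J f = (\<integral>x. (norm (f x))\<^sup>2 \<partial>M)" for f :: "'w \<Rightarrow> 'b"
  have int: "integrable M (\<lambda>x. (norm (f x))\<^sup>2)" if "f \<in> A n" for f n
  proof (rule integrable_const_bound)
    show "AE x in M. norm ((norm (f x))\<^sup>2) \<le> B\<^sup>2"
      using Ab[OF that] by (intro AE_I2) (auto intro: power_mono)
    show "(\<lambda>x. (norm (f x))\<^sup>2) \<in> borel_measurable M" using Am[OF that] by measurable
  qed
  have Jnn: "0 \<le> J f" for f unfolding J_def by (rule integral_nonneg_AE) auto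
  have Jb: "J f \<le> B\<^sup>2 * measure M (space M)" if "f \<in> A n" for f n
  proof -
    have "J f \<le> (\<integral>x. B\<^sup>2 \<partial>M)" unfolding J_def
      using Ab[OF that] int[OF that] by (intro integral_mono) (auto intro: power_mono)
    then show ?thesis by (simp add: mult.commute)
  qed
  have zA: "z n \<in> A n" for n
    unfolding A_def tail_combinations_def by (auto intro!: exI[of _ "\<lambda>_. 1"] exI[of _ n])
  define d where "d n = Inf (J ` A n)" for n
  have bdd: "bdd_below (J ` A n)" for n using Jnn by (intro bdd_belowI[of _ 0]) auto
  have dle: "d n \<le> J f" if "f \<in> A n" for f n unfolding d_def using bdd that by (intro cInf_lower) auto
  have dinc: "incseq d"
  proof (rule incseq_SucI)
    fix n show "d n \<le> d (Suc n)" unfolding d_def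
      using zA bdd tail_combinations_antimono[of n "Suc n" z] by (intro cInf_superset_mono) (auto simp: A_def)
  qed
  have "d n \<le> B\<^sup>2 * measure M (space M)" for n using dle[OF zA] Jb[OF zA] order_trans by blast
  then obtain D where D: "d \<longlonglongrightarrow> D" "\<And>n. d n \<le> D" using incseq_convergent[OF dinc] by metis
  have "\<exists>f\<in>A n. J f < d n + 1 / Suc n" for n
    using cInf_lessD[of "J ` A n" "d n + 1 / Suc n"] zA[of n] by (auto simp: d_def)
  then obtain f where f: "\<And>n. f n \<in> A n" "\<And>n. J (f n) < d n + 1 / Suc n" by metis
  have fm: "f n \<in> borel_measurable M" for n using Am f(1) by blast
  \<comment> \<open>Parallelogram identity: the midpoint lies in the hull of the n-th tail, so its
    energy is at least \<open>d n\<close>, while the energies of both functions exceed the limits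
    \<open>d n\<close> and D by at most \<open>1 / Suc n\<close>.\<close>
  have L2: "(\<integral>x. (norm (f n x - f m x))\<^sup>2 \<partial>M) \<le> 2 * (D - d n) + 4 / Suc n" if "n \<le> m" for n m
  proof -
    have fmn: "f m \<in> A n" using f(1)[of m] tail_combinations_antimono[OF that] by (auto simp: A_def)
    let ?h = "\<lambda>x. (1/2) *\<^sub>R (f n x + f m x)"
    have h: "?h \<in> A n" unfolding A_def using f(1)[of n] fmn by (intro tail_combinations_midpoint) (auto simp: A_def)
    have "(norm (f n x - f m x))\<^sup>2 = 2 * (norm (f n x))\<^sup>2 + 2 * (norm (f m x))\<^sup>2 - 4 * (norm (?h x))\<^sup>2" for x
      by (simp add: power2_norm_eq_inner inner_diff inner_add inner_commute power_divide algebra_simps)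
    then have "(\<integral>x. (norm (f n x - f m x))\<^sup>2 \<partial>M) = 2 * J (f n) + 2 * J (f m) - 4 * J ?h"
      unfolding J_def using int[OF f(1)[of n]] int[OF fmn] int[OF h] by simp
    also have "\<dots> \<le> 2 * (d n + 1 / Suc n) + 2 * (D + 1 / Suc n) - 4 * d n"
    proof -
      have "1 / real (Suc m) \<le> 1 / Suc n" using that by (intro divide_left_mono) auto
      then show ?thesis using f(2)[of n] f(2)[of m] D(2)[of m] dle[OF h] by argo
    qed
    finally show ?thesis by simp
  qed
  have fint: "integrable M (f n)" for n
    using Ab[OF f(1)] fm by (intro integrable_const_bound[of _ B]) auto
  have cauchy: "\<exists>N. \<forall>i\<ge>N. \<forall>j\<ge>N. (\<integral>x. norm (f i x - f j x) \<partial>M) < e" if e: "e > 0" for e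
  proof -
    define V where "V = measure M (space M)"
    \<comment> \<open>The passage from squares to first powers uses that r is at most a + r^2/a for
      r >= 0. This choice keeps the contribution of the constant a below e/2 on a space of mass
      V.\<close>
    define a where "a = (e / 2) / (V + 1)"
    have V: "V \<ge> 0" by (simp add: V_def)
    have a: "a > 0" using e V by (simp add: a_def)
    have "(\<lambda>n. 2 * (D - d n) + 4 * (1 / Suc n)) \<longlonglongrightarrow> 2 * (D - D) + 4 * 0"
      by (intro tendsto_intros D(1) LIMSEQ_Suc[OF lim_1_over_n])
    then have "\<forall>\<^sub>F n in sequentially. 2 * (D - d n) + 4 * (1 / Suc n) < a * e / 2"
      using a e by (intro order_tendstoD) auto
    then obtain N where N: "\<And>n. n \<ge> N \<Longrightarrow> 2 * (D - d n) + 4 * (1 / Suc n) < a * e / 2"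
      by (auto simp: eventually_sequentially)
    have main: "(\<integral>x. norm (f i x - f j x) \<partial>M) < e" if "i \<ge> N" "i \<le> j" for i j
    proof -
      have i2: "integrable M (\<lambda>x. (norm (f i x - f j x))\<^sup>2)"
      proof (rule integrable_const_bound)
        show "AE x in M. norm ((norm (f i x - f j x))\<^sup>2) \<le> (B + B)\<^sup>2"
        proof (rule AE_I2)
          fix x assume x: "x \<in> space M"
          have "norm (f i x - f j x) \<le> B + B"
            using norm_triangle_ineq4[of "f i x" "f j x"] Ab[OF f(1) x, of i] Ab[OF f(1) x, of j] by linarith
          from power_mono[OF this norm_ge_zero, of 2]
          show "norm ((norm (f i x - f j x))\<^sup>2) \<le> (B + B)\<^sup>2" by (simp only: real_norm_def abs_of_nonneg zero_le_power2)
        qed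
      qed (use fm in measurable)
      have "(\<integral>x. norm (f i x - f j x) \<partial>M) \<le> (\<integral>x. a + (norm (f i x - f j x))\<^sup>2 / a \<partial>M)"
      proof (rule integral_mono)
        fix x
        let ?n = "norm (f i x - f j x)"
        show "?n \<le> a + ?n\<^sup>2 / a"
        proof (cases "?n \<le> a")
          case True then show ?thesis using a by (simp add: add_increasing2)
        next
          case False
          then have "?n * a \<le> ?n * ?n" by (intro mult_left_mono) auto
          then have "?n \<le> ?n\<^sup>2 / a" using a by (simp add: pos_le_divide_eq power2_eq_square)
          then show ?thesis using a by linarith
        qed
      qed (use i2 fint in auto)
      also have "\<dots> = a * V + (\<integral>x. (norm (f i x - f j x))\<^sup>2 \<partial>M) / a"
        using i2 by (simp add: V_def mult.commute)
      also have "\<dots> < a * V + (a * e / 2) / a"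
        using L2[OF that(2)] N[OF that(1)] a by (intro add_strict_left_mono divide_strict_right_mono) auto
      also have "\<dots> \<le> e"
      proof -
        have "V + 1 \<noteq> 0" using V by linarith
        from nonzero_eq_divide_eq[OF this, THEN iffD1, OF a_def] have "a * (V + 1) = e / 2" .
        then have "a * V \<le> e / 2" using a by (simp add: distrib_left)
        then show ?thesis using a by simp
      qed
      finally show ?thesis .
    qed
    have "(\<integral>x. norm (f i x - f j x) \<partial>M) < e" if "i \<ge> N" "j \<ge> N" for i j
      using main[of i j] main[of j i] that by (cases "i \<le> j") (auto simp: norm_minus_commute)
    then show ?thesis by blast
  qed
  obtain r where r: "strict_mono r" "AE x in M. Cauchy (\<lambda>i. f (r i) x)"
    using cauchy_L1_AE_cauchy_subseq[OF fint cauchy] by blast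
  \<comment> \<open>Tails decrease and \<open>r n\<close> is at least n, so after passing to the
    subsequence the n-th function still combines only indices from n on.\<close>
  have "f (r n) \<in> A n" for n
    using f(1)[of "r n"] tail_combinations_antimono[OF seq_suble[OF r(1), of n], of z] by (auto simp: A_def)
  define Q where "Q n c N \<longleftrightarrow> f (r n) = (\<lambda>x. \<Sum>k\<in>{n..N}. c k *\<^sub>R z k x) \<and> (\<forall>k. (0::real) \<le> c k) \<and> (\<Sum>k\<in>{n..N}. c k) = 1"
    for n c N
  have "\<forall>n. \<exists>c N. Q n c N"
    using \<open>\<And>n. f (r n) \<in> A n\<close> unfolding A_def tail_combinations_def Q_def by blast
  from choice[OF this] obtain c where "\<forall>n. \<exists>N. Q n (c n) N" ..
  from choice[OF this] obtain N where "\<forall>n. Q n (c n) (N n)" ..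
  then have cN: "\<And>n. f (r n) = (\<lambda>x. \<Sum>k\<in>{n..N n}. c n k *\<^sub>R z k x)" "\<And>n k. (0::real) \<le> c n k"
      "\<And>n. (\<Sum>k\<in>{n..N n}. c n k) = 1" by (auto simp: Q_def)
  have "AE x in M. convergent (\<lambda>n. \<Sum>k\<in>{n..N n}. c n k *\<^sub>R z k x)"
    using r(2) unfolding cN(1) by eventually_elim (simp add: Cauchy_convergent_iff)
  with cN(2,3) show thesis by (rule that)
qed

text \<open>The n-th combination involves only indices from n on, so it stays close to the limit as
  soon as these terms do.\<close>

lemma convex_combination_limit:
  fixes b :: "nat \<Rightarrow> 'b::real_normed_vector"
  assumes b: "b \<longlonglongrightarrow> l" and c: "\<And>n k. (0::real) \<le> c n k" "\<And>n. (\<Sum>k\<in>{n..N n}. c n k) = 1"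
  shows "(\<lambda>n. \<Sum>k\<in>{n..N n}. c n k *\<^sub>R b k) \<longlonglongrightarrow> l"
proof (rule LIMSEQ_I)
  fix e :: real assume e: "e > 0"
  obtain n0 where n0: "\<And>k. k \<ge> n0 \<Longrightarrow> norm (b k - l) < e / 2" using LIMSEQ_D[OF b, of "e/2"] e by auto
  have "norm ((\<Sum>k\<in>{n..N n}. c n k *\<^sub>R b k) - l) < e" if "n \<ge> n0" for n
  proof -
    have "(\<Sum>k\<in>{n..N n}. c n k *\<^sub>R b k) - l = (\<Sum>k\<in>{n..N n}. c n k *\<^sub>R (b k - l))"
      using c(2)[of n] by (simp add: scaleR_diff_right sum_subtractf scaleR_sum_left[symmetric])
    also have "norm \<dots> \<le> (\<Sum>k\<in>{n..N n}. norm (c n k *\<^sub>R (b k - l)))" by (rule norm_sum)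
    also have "\<dots> \<le> (\<Sum>k\<in>{n..N n}. c n k * (e / 2))"
    proof (rule sum_mono)
      fix k assume "k \<in> {n..N n}"
      then have "norm (b k - l) \<le> e / 2" using n0[of k] that by (intro less_imp_le) auto
      from mult_left_mono[OF this c(1)[of n k]] show "norm (c n k *\<^sub>R (b k - l)) \<le> c n k * (e / 2)"
        using c(1)[of n k] by simp
    qed
    also have "\<dots> = e / 2" by (simp only: sum_distrib_right[symmetric] c(2))
    finally show ?thesis using e by simp
  qed
  then show "\<exists>no. \<forall>n\<ge>no. norm ((\<Sum>k\<in>{n..N n}. c n k *\<^sub>R b k) - l) < e" by blast
qed

section \<open>Supports and time modulus of solutions\<close>

text \<open>Testing with a nonnegative time cut-off times \<open>\<psi>\<close> gives a weak
  differential inequality for the integral of \<open>\<psi>\<close>, in which the velocity term has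
  been replaced by its upper bound B.\<close>

lemma CE_weak_inequality:
  fixes \<mu> :: "real \<Rightarrow> 'a::euclidean_space measure" and \<psi> :: "'a \<Rightarrow> real"
  assumes \<mu>: "\<And>t. t \<in> {0..T} \<Longrightarrow> \<mu> t \<in> Prob_c" and CE: "solves_CE T \<mu> w"
    and \<psi>: "\<And>k. C_k k \<psi>" "\<And>x. norm x > R \<Longrightarrow> \<psi> x = 0"
    and F: "continuous_on {0..T} (\<lambda>t. \<integral>x. \<psi> x \<partial>\<mu> t)" and B: "B absolutely_integrable_on {0..T}"
    and wB: "AE t in lebesgue_on {0..T}. (\<integral>x. grad \<psi> x \<bullet> w t x \<partial>\<mu> t) \<le> B t"
    and st: "0 \<le> s" "s \<le> t" "t \<le> T"
  shows "(\<integral>x. \<psi> x \<partial>\<mu> t) - (\<integral>x. \<psi> x \<partial>\<mu> s) \<le> integral {s..t} B"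
proof (rule weak_derivative_bound[OF F B st])
  let ?F = "\<lambda>t. \<integral>x. \<psi> x \<partial>\<mu> t"
  fix \<eta> :: "real \<Rightarrow> real" and a b :: real
  assume \<eta>: "\<And>k. Cr_k k UNIV \<eta>" "\<And>r. r \<notin> {a..b} \<Longrightarrow> \<eta> r = 0" "0 < a" "b < T" "\<And>r. 0 \<le> \<eta> r"
  define \<phi> where "\<phi> = (\<lambda>p. \<eta> (fst p) * \<psi> (snd p))"
  obtain \<eta>' where \<eta>': "\<And>r. (\<eta> has_real_derivative \<eta>' r) (at r)" "continuous_on UNIV \<eta>'"
    using \<eta>(1)[of "Suc 0"] by auto
  have d\<eta>: "deriv \<eta> r = \<eta>' r" for r using DERIV_imp_deriv[OF \<eta>'(1)] .
  have \<phi>: "\<phi> \<in> test_functions T" unfolding \<phi>_def by (rule test_function_product(1)[OF \<eta>(1-4) \<psi>])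
  have CEi: "CE_integrand \<phi> w t x = \<eta>' t * \<psi> x + \<eta> t * (grad \<psi> x \<bullet> w t x)" for t x
    unfolding \<phi>_def by (rule test_function_product(2)[OF \<eta>(1-4) \<psi> \<eta>'(1)])
  have ae1: "AE t in lebesgue_on {0..T}. integrable (\<mu> t) (CE_integrand \<phi> w t)"
    and si: "set_integrable lebesgue {0..T} (\<lambda>t. \<integral>x. CE_integrand \<phi> w t x \<partial>\<mu> t)"
    and z: "(LINT t:{0..T}|lebesgue. (\<integral>x. CE_integrand \<phi> w t x \<partial>\<mu> t)) = 0"
    using CE \<phi> by (auto simp: solves_CE_def)
  have \<psi>c: "continuous_on UNIV \<psi>" using C_k_continuous[OF \<psi>(1)] .
  have \<eta>c: "continuous_on {0..T} \<eta>" "continuous_on {0..T} \<eta>'"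
    using Cr_k_continuous[OF \<eta>(1)] \<eta>'(2) continuous_on_subset by blast+
  have i1: "(\<lambda>t. \<eta>' t * ?F t) absolutely_integrable_on {0..T}"
    by (intro absolutely_integrable_continuous_real continuous_on_mult \<eta>c F)
  have i2: "(\<lambda>t. \<eta> t * B t) absolutely_integrable_on {0..T}"
    by (rule absolutely_integrable_times_continuous[OF B \<eta>c(1)])
  have i3: "(\<lambda>t. \<eta>' t * ?F t + \<eta> t * B t) absolutely_integrable_on {0..T}"
    by (rule set_integral_add(1)[OF i1 i2])
  have "AE t in lebesgue_on {0..T}. (\<integral>x. CE_integrand \<phi> w t x \<partial>\<mu> t) \<le> \<eta>' t * ?F t + \<eta> t * B t"
    using ae1 wB AE_space
  proof eventually_elim
    fix t assume t: "integrable (\<mu> t) (CE_integrand \<phi> w t)" "(\<integral>x. grad \<psi> x \<bullet> w t x \<partial>\<mu> t) \<le> B t" "t \<in> space (lebesgue_on {0..T})"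
    have t0: "t \<in> {0..T}" using t(3) by simp
    have i\<psi>: "integrable (\<mu> t) \<psi>" by (rule integrable_Prob_c[OF \<mu>[OF t0] \<psi>c])
    have "(\<integral>x. CE_integrand \<phi> w t x \<partial>\<mu> t) = \<eta>' t * ?F t + \<eta> t * (\<integral>x. grad \<psi> x \<bullet> w t x \<partial>\<mu> t)"
    \<comment> \<open>The velocity term inherits integrability from the full integrand only where
      the cut-off is nonzero; elsewhere it drops out of both sides.\<close>
    proof (cases "\<eta> t = 0")
      case True then show ?thesis by (simp add: CEi)
    next
      case False
      have "integrable (\<mu> t) (\<lambda>x. CE_integrand \<phi> w t x - \<eta>' t * \<psi> x)" using t(1) i\<psi> by auto
      then have "integrable (\<mu> t) (\<lambda>x. \<eta> t * (grad \<psi> x \<bullet> w t x))" by (simp add: CEi)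
      then have "integrable (\<mu> t) (\<lambda>x. grad \<psi> x \<bullet> w t x)" using False by simp
      then show ?thesis using i\<psi> by (simp add: CEi)
    qed
    also have "\<dots> \<le> \<eta>' t * ?F t + \<eta> t * B t" using t(2) \<eta>(5) by (intro add_left_mono mult_left_mono)
    finally show "(\<integral>x. CE_integrand \<phi> w t x \<partial>\<mu> t) \<le> \<eta>' t * ?F t + \<eta> t * B t" .
  qed
  then have "AE t in lebesgue. t \<in> {0..T} \<longrightarrow> (\<integral>x. CE_integrand \<phi> w t x \<partial>\<mu> t) \<le> \<eta>' t * ?F t + \<eta> t * B t"
    by (simp add: AE_restrict_space_iff)
  then have "(LINT t:{0..T}|lebesgue. (\<integral>x. CE_integrand \<phi> w t x \<partial>\<mu> t)) \<le> (LINT t:{0..T}|lebesgue. \<eta>' t * ?F t + \<eta> t * B t)"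
    using si i3 unfolding set_lebesgue_integral_def set_integrable_def
    by (intro integral_mono_AE) (auto elim!: eventually_mono simp: indicator_def)
  then have "0 \<le> (LINT t:{0..T}|lebesgue. \<eta>' t * ?F t + \<eta> t * B t)" using z by simp
  then show "0 \<le> integral {0..T} (\<lambda>r. deriv \<eta> r * ?F r + \<eta> r * B r)"
    unfolding d\<eta> set_lebesgue_integral_eq_integral(2)[OF i3] .
qed

text \<open>G is a concave truncation of the identity on the half-line: its slope \<open>ch\<close>
  decreases from 1 before A to 0 after 2 A. Concavity and G(0) = 0 give y G'(y) \<le> G(y), which
  keeps the Gronwall inequality intact under truncation.\<close>

lemma smooth_truncation:
  fixes A :: real assumes A: "A > 0"
  obtains G ch where "\<And>k. Cr_k k UNIV G" "\<And>y. (G has_real_derivative ch y) (at y)"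
    "\<And>y. 2 * A \<le> y \<Longrightarrow> G y = G (2 * A)" "\<And>y. 0 \<le> y \<Longrightarrow> y * ch y \<le> G y" "\<And>y. 0 \<le> y \<Longrightarrow> G y \<le> y"
    "\<And>y. A \<le> y \<Longrightarrow> A \<le> G y" "\<And>y. 0 \<le> ch y"
proof -
  define ch where "ch y = 1 + (- 1) * smooth_step ((1 / A) * y + (- 1))" for y
  have sm: "Cr_k k UNIV ch" for k
    unfolding ch_def [abs_def] by (intro Cr_k_add Cr_k_mult Cr_k_const) (rule Cr_k_affine[OF smooth_step(6)])
  have ch01: "0 \<le> ch y" "ch y \<le> 1" for y unfolding ch_def using smooth_step_bounds[of "(1 / A) * y + (- 1)"] by auto
  have ch1: "ch y = 1" if "y \<le> A" for y unfolding ch_def using that A by (simp add: smooth_step(4))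
  have ch0: "ch y = 0" if "2 * A \<le> y" for y unfolding ch_def using that A by (simp add: smooth_step(5) le_divide_eq)
  have dec: "ch y \<le> ch x" if "x \<le> y" for x y
    unfolding ch_def using smooth_step_mono[of "(1 / A) * x + (- 1)" "(1 / A) * y + (- 1)"] that A by (simp add: divide_right_mono)
  obtain G0 where G0: "\<And>y. (G0 has_real_derivative ch y) (at y)"
    using continuous_antiderivative[OF Cr_k_continuous[OF sm]] by blast
  define G where "G y = G0 y + - G0 0" for y
  have D: "(G has_real_derivative ch y) (at y)" for y
    unfolding G_def [abs_def] using DERIV_add[OF G0[of y] DERIV_const[where k = "- G0 0"]] by simp
  have Gs: "Cr_k k UNIV G" for k
    by (rule Cr_k_Suc_imp) (rule Cr_k_SucI[OF D sm])
  have G00: "G 0 = 0" by (simp add: G_def)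
  have mono: "G x \<le> G y" if "x \<le> y" for x y
    by (rule DERIV_nonneg_imp_nondecreasing[OF that]) (use D ch01 in blast)
  have mvt: "\<exists>z. x < z \<and> z < y \<and> G y - G x = (y - x) * ch z" if "x < y" for x y
    using MVT2[OF that, of G ch] D by blast
  show thesis
  proof (rule that[OF Gs D])
    fix y assume y: "2 * A \<le> y"
    show "G y = G (2 * A)"
    proof (cases "y = 2 * A")
      case False
      then have "2 * A < y" using y by simp
      from mvt[OF this] obtain z where "2 * A < z" "G y - G (2 * A) = (y - 2 * A) * ch z" by blast
      then show ?thesis using ch0[of z] by simp
    qed simp
  next
    fix y :: real assume y: "0 \<le> y"
    show "y * ch y \<le> G y"
    proof (cases "y = 0")
      case False
      then have "0 < y" using y by simp
      from mvt[OF this] obtain z where "z < y" "G y = y * ch z" using G00 by auto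
      then show ?thesis using dec[of z y] y by (auto intro: mult_left_mono)
    qed (simp add: G00)
    show "G y \<le> y"
    proof (cases "y = 0")
      case False
      then have "0 < y" using y by simp
      from mvt[OF this] obtain z where "G y = y * ch z" using G00 by auto
      then show ?thesis using ch01(2)[of z] y mult_left_mono[of "ch z" 1 y] by simp
    qed (simp add: G00)
  next
    fix y assume y: "A \<le> y"
    obtain z where "z < A" "G A = A * ch z" using mvt[OF A] G00 by auto
    then have "G A = A" using ch1[of z] by simp
    then show "A \<le> G y" using mono[OF y] by simp
  qed (rule ch01)
qed

lemma moment1_integrand_Lipschitz: "1-lipschitz_on UNIV (norm :: 'a::euclidean_space \<Rightarrow> real)"
  by (rule lipschitz_onI) (auto simp: dist_norm dist_real_def norm_triangle_ineq3)

lemma Markov_Prob: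
  assumes P: "\<mu> \<in> Prob_c" and f: "continuous_on UNIV f" "\<And>x. 0 \<le> f x" and A: "A > 0" "\<And>x. x \<in> C \<Longrightarrow> A \<le> f x"
    and C: "closed C"
  shows "A * measure \<mu> C \<le> (\<integral>x. f x \<partial>\<mu>)"
proof -
  note P' = Prob_simps[OF Prob_c_D(1)[OF P]]
  interpret prob_space \<mu> by (rule P')
  have Cm: "C \<in> sets \<mu>" using C P'(1) by auto
  have "(\<integral>x. A * indicator C x \<partial>\<mu>) \<le> (\<integral>x. f x \<partial>\<mu>)"
  proof (rule integral_mono)
    show "integrable \<mu> (\<lambda>x. A * indicator C x)"
      using Cm by (intro integrable_mult_right integrable_real_indicator) (auto simp: emeasure_eq_measure)
    show "integrable \<mu> f" by (rule integrable_Prob_c[OF P f(1)])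
    show "A * indicator C x \<le> f x" for x using A(2)[of x] f(2)[of x] by (auto simp: indicator_def)
  qed
  then show ?thesis by (simp add: P'(2))
qed

text \<open>
  Truncated moments of order \<open>2 j\<close> grow by at most the factor \<open>(2 ^ Suc N) ^ j\<close>; letting
  \<open>j\<close> tend to infinity in Markov's inequality bounds the supports.
\<close>

lemma CE_support_bound:
  fixes \<mu> :: "real \<Rightarrow> 'a::euclidean_space measure"
  assumes T: "0 \<le> T" and AC: "AC_curve T \<mu>" and CE: "solves_CE T \<mu> w" and m: "L1_nonneg T m"
    and growth: "AE t in lebesgue_on {0..T}. \<forall>x. norm (w t x) \<le> m t * (1 + norm x + moment1 (\<mu> t))"
    and mom: "\<And>t. t \<in> {0..T} \<Longrightarrow> moment1 (\<mu> t) \<le> Mb" and Mb: "0 \<le> Mb"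
    and \<mu>0: "\<mu> 0 \<in> Prob_on (cball 0 R0)" and N: "2 * (3 + Mb) * integral {0..T} m \<le> real (Suc N)"
    and t: "t \<in> {0..T}"
  shows "\<mu> t \<in> Prob_on (cball 0 (sqrt (2 * (2 ^ Suc N * (1 + R0\<^sup>2)))))"
proof -
  have \<mu>: "\<mu> t \<in> Prob_c" if "t \<in> {0..T}" for t using AC that by (auto simp: AC_curve_def)
  have mi: "m absolutely_integrable_on {0..T}" and mnn: "\<And>t. t \<in> {0..T} \<Longrightarrow> 0 \<le> m t" using m by (auto simp: L1_nonneg_def)
  \<comment> \<open>\<open>1 + R0\<^sup>2\<close> bounds y on the initial support and
    \<open>2 ^ Suc N\<close> is the Gronwall factor of one power. Truncated moments of
    \<open>y ^ j\<close> stay below \<open>y0 ^ j\<close>, and the threshold \<open>2 * y0\<close>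
    in \<open>C\<close> leaves the factor \<open>(1/2) ^ j\<close>.\<close>
  define y0 where "y0 = 2 ^ Suc N * (1 + R0\<^sup>2)"
  have y0: "y0 \<ge> 1"
  proof -
    have "(1::real) * 1 \<le> 2 ^ Suc N * (1 + R0\<^sup>2)" by (intro mult_mono one_le_power) auto
    then show ?thesis by (simp add: y0_def)
  qed
  define y where "y x = 1 + x \<bullet> x" for x :: 'a
  have y1: "y x \<ge> 1" for x by (simp add: y_def)
  have yc: "continuous_on UNIV y" unfolding y_def [abs_def] by (intro continuous_intros)
  define C where "C = {x. 2 * y0 \<le> y x}"
  have Cc: "closed C" unfolding C_def using yc by (intro closed_Collect_le continuous_intros)
  have key: "measure (\<mu> t) C \<le> (1/2) ^ j" if j: "j > 0" for j :: nat
  proof -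
    define A where "A = (2 * y0) ^ j"
    have A: "A > 0" using y0 by (simp add: A_def)
    obtain G ch where G: "\<And>k. Cr_k k UNIV G" "\<And>y. (G has_real_derivative ch y) (at y)"
      "\<And>y. 2 * A \<le> y \<Longrightarrow> G y = G (2 * A)" "\<And>y. 0 \<le> y \<Longrightarrow> y * ch y \<le> G y" "\<And>y. 0 \<le> y \<Longrightarrow> G y \<le> y"
      "\<And>y. A \<le> y \<Longrightarrow> A \<le> G y" "\<And>y. 0 \<le> ch y"
      by (rule smooth_truncation[OF A]) blast
    define f where "f x = G (y x ^ j)" for x
    \<comment> \<open>Subtracting the terminal value of G produces compact support and leaves the
      gradient unchanged.\<close>
    define \<psi> where "\<psi> x = f x - G (2 * A)" for x
    have Cy: "C_k k y" for k
      unfolding y_def [abs_def] using C_k_add[OF C_k_const C_k_inner_self, of k 1 0] by simp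
    have Cf: "C_k k f" for k
      unfolding f_def [abs_def] by (rule C_k_compose[OF C_k_power[OF Cy] G(1)]) simp
    have C\<psi>: "C_k k \<psi>" for k unfolding \<psi>_def [abs_def] by (rule C_k_diff[OF Cf C_k_const])
    have fnn: "0 \<le> f x" for x
    proof -
      have "0 \<le> y x ^ j" using y1[of x] by simp
      moreover then have "0 \<le> y x ^ j * ch (y x ^ j)" using G(7) by simp
      ultimately show ?thesis using G(4)[of "y x ^ j"] by (simp add: f_def)
    qed
    have yj: "y x \<le> y x ^ j" for x using y1[of x] j self_le_power by blast
    have supp: "\<psi> x = 0" if x: "norm x > sqrt (2 * A)" for x
    proof -
      have "(sqrt (2 * A))\<^sup>2 \<le> (norm x)\<^sup>2" using x A by (intro power_mono) auto
      then have "2 * A \<le> x \<bullet> x" using A by (simp add: power2_norm_eq_inner)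
      then have "2 * A \<le> y x ^ j" using yj[of x] by (simp add: y_def)
      from G(3)[OF this] show ?thesis by (simp add: \<psi>_def f_def)
    qed
    have gradpsi: "grad \<psi> x = (ch (y x ^ j) * (real j * y x ^ (j - 1)) * 2) *\<^sub>R x" for x
    proof -
      have Dy: "(y has_derivative (\<lambda>h. 2 * (h \<bullet> x))) (at x)"
        unfolding y_def [abs_def] by (auto intro!: derivative_eq_intros simp: inner_commute)
      have Dp: "((\<lambda>y. y ^ j) has_real_derivative real j * y x ^ (j - 1)) (at (y x))"
        by (auto intro!: derivative_eq_intros)
      have "((\<lambda>y. G (y ^ j)) has_real_derivative ch (y x ^ j) * (real j * y x ^ (j - 1))) (at (y x))"
        by (rule DERIV_chain2[OF G(2) Dp])
      from has_derivative_compose[OF Dy this[unfolded has_field_derivative_def]]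
      have "(f has_derivative (\<lambda>h. ch (y x ^ j) * (real j * y x ^ (j - 1)) * (2 * (h \<bullet> x)))) (at x)"
        unfolding f_def [abs_def] by simp
      then have "(\<psi> has_derivative (\<lambda>h. ch (y x ^ j) * (real j * y x ^ (j - 1)) * (2 * (h \<bullet> x)))) (at x)"
        unfolding \<psi>_def [abs_def] using has_derivative_diff[OF _ has_derivative_const] by fastforce
      then have "GDERIV \<psi> x :> (ch (y x ^ j) * (real j * y x ^ (j - 1)) * 2) *\<^sub>R x"
        unfolding gderiv_def by (simp add: mult.assoc)
      then show ?thesis by (rule grad_eq)
    qed
    define k where "k r = real j * ((3 + Mb) * m r)" for r
    have ki: "k absolutely_integrable_on {0..T}"
      unfolding k_def using mi by (intro set_integrable_mult_right) auto
    have knn: "0 \<le> k r" if "r \<in> {0..T}" for r using mnn[OF that] Mb by (simp add: k_def)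
    \<comment> \<open>The constant \<open>3 + Mb\<close> comes from
      \<open>2 * norm x \<le> 1 + (norm x)\<^sup>2\<close>; the concavity bound y G'(y) \<le> G(y)
      then turns the derivative back into f.\<close>
    have pt: "grad \<psi> x \<bullet> w r x \<le> k r * f x"
      if r: "r \<in> {0..T}" and w: "norm (w r x) \<le> m r * (1 + norm x + moment1 (\<mu> r))" for r x
    proof -
      define q where "q = ch (y x ^ j) * (real j * y x ^ (j - 1))"
      have q: "q \<ge> 0" using G(7) y1[of x] by (simp add: q_def)
      have "grad \<psi> x \<bullet> w r x = q * (2 * (x \<bullet> w r x))" by (simp add: gradpsi q_def)
      also have "\<dots> \<le> q * (m r * ((3 + Mb) * y x))"
      proof (rule mult_left_mono[OF _ q])
        have "2 * (x \<bullet> w r x) \<le> 2 * (norm x * norm (w r x))" using norm_cauchy_schwarz[of x "w r x"] by simp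
        also have "\<dots> \<le> 2 * (norm x * (m r * (1 + norm x + Mb)))"
          using w mom[OF r] mnn[OF r]
          by (intro mult_left_mono order_trans[OF w]) (auto intro!: mult_left_mono)
        also have "\<dots> = m r * (2 * norm x * (1 + Mb) + 2 * (norm x)\<^sup>2)" by (simp add: power2_eq_square algebra_simps)
        also have "\<dots> \<le> m r * ((3 + Mb) * y x)"
        proof (rule mult_left_mono[OF _ mnn[OF r]])
          have "0 \<le> (norm x - 1)\<^sup>2" by simp
          then have "2 * norm x \<le> 1 + (norm x)\<^sup>2" by (simp add: power2_eq_square algebra_simps)
          then have "2 * norm x * (1 + Mb) \<le> (1 + (norm x)\<^sup>2) * (1 + Mb)" using Mb by (intro mult_right_mono) auto
          moreover have "y x = 1 + (norm x)\<^sup>2" by (simp add: y_def power2_norm_eq_inner)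
          ultimately show "2 * norm x * (1 + Mb) + 2 * (norm x)\<^sup>2 \<le> (3 + Mb) * y x" by (simp add: algebra_simps)
        qed
        finally show "2 * (x \<bullet> w r x) \<le> m r * ((3 + Mb) * y x)" .
      qed
      also have "\<dots> = k r * (ch (y x ^ j) * (y x ^ (j - 1) * y x))" by (simp add: q_def k_def)
      also have "y x ^ (j - 1) * y x = y x ^ j" using j by (cases j) auto
      also have "k r * (ch (y x ^ j) * y x ^ j) \<le> k r * f x"
        using G(4)[of "y x ^ j"] y1[of x] knn[OF r] by (intro mult_left_mono) (auto simp: f_def mult.commute)
      finally show ?thesis .
    qed
    have \<psi>L: "\<exists>L. L-lipschitz_on UNIV \<psi>"
    proof -
      have "{x. \<psi> x \<noteq> 0} \<subseteq> cball 0 (sqrt (2 * A))" using supp by (force simp: not_less[symmetric])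
      then have "compact (closure {x. \<psi> x \<noteq> 0})" using bounded_subset[OF bounded_cball] by auto
      then show ?thesis by (rule C_k_bounded_Lipschitz[OF C\<psi>]) blast
    qed
    then have \<psi>cont: "continuous_on {0..T} (\<lambda>t. \<integral>x. \<psi> x \<partial>\<mu> t)" using AC_curve_Lipschitz_continuous[OF AC] by blast
    define \<Phi> where "\<Phi> t = (\<integral>x. f x \<partial>\<mu> t)" for t
    have fint: "integrable (\<mu> t) f" if "t \<in> {0..T}" for t
      by (rule integrable_Prob_c[OF \<mu>[OF that] C_k_continuous[OF Cf]])
    have \<Phi>\<psi>: "\<Phi> t = (\<integral>x. \<psi> x \<partial>\<mu> t) + G (2 * A)" if t: "t \<in> {0..T}" for t
    proof -
      interpret prob_space "\<mu> t" by (rule Prob_simps(3)[OF Prob_c_D(1)[OF \<mu>[OF t]]])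
      show ?thesis using fint[OF t] by (simp add: \<Phi>_def \<psi>_def prob_space)
    qed
    have "continuous_on {0..T} (\<lambda>t. (\<integral>x. \<psi> x \<partial>\<mu> t) + G (2 * A))" by (intro continuous_intros \<psi>cont)
    then have \<Phi>c: "continuous_on {0..T} \<Phi>" by (rule continuous_on_eq) (rule \<Phi>\<psi>[symmetric])
    have \<Phi>nn: "0 \<le> \<Phi> t" for t unfolding \<Phi>_def using fnn by (intro integral_nonneg_AE) auto
    have Bi: "(\<lambda>r. \<Phi> r * k r) absolutely_integrable_on {0..T}"
      by (rule absolutely_integrable_times_continuous[OF ki \<Phi>c])
    \<comment> \<open>The rate k is proportional to j, so \<open>j * Suc N\<close> doublings
      suffice; the Gronwall bound takes their number as a successor.\<close>
    have "\<Phi> t \<le> 2 ^ Suc (j * Suc N - 1) * \<Phi> 0"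
    proof (rule Gronwall_doubling[OF T \<Phi>c \<Phi>nn ki knn _ _ t])
      fix s t assume st: "0 \<le> s" "s \<le> t" "t \<le> T"
      have "(\<integral>x. \<psi> x \<partial>\<mu> t) - (\<integral>x. \<psi> x \<partial>\<mu> s) \<le> integral {s..t} (\<lambda>r. \<Phi> r * k r)"
      proof (rule CE_weak_inequality[OF \<mu> CE C\<psi> supp \<psi>cont Bi _ st])
        show "AE t in lebesgue_on {0..T}. (\<integral>x. grad \<psi> x \<bullet> w t x \<partial>\<mu> t) \<le> \<Phi> t * k t"
          using growth AE_space
        proof eventually_elim
          fix r assume r: "\<forall>x. norm (w r x) \<le> m r * (1 + norm x + moment1 (\<mu> r))" "r \<in> space (lebesgue_on {0..T})"
          then have rT: "r \<in> {0..T}" by simp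
          show "(\<integral>x. grad \<psi> x \<bullet> w r x \<partial>\<mu> r) \<le> \<Phi> r * k r"
          proof (cases "integrable (\<mu> r) (\<lambda>x. grad \<psi> x \<bullet> w r x)")
            case True
            have "(\<integral>x. grad \<psi> x \<bullet> w r x \<partial>\<mu> r) \<le> (\<integral>x. k r * f x \<partial>\<mu> r)"
              using True fint[OF rT] pt[OF rT] r(1) by (intro integral_mono) auto
            then show ?thesis by (simp add: \<Phi>_def mult.commute)
          next
            \<comment> \<open>A non-integrable pairing has integral 0 by convention, and the bound
              is nonnegative.\<close>
            case False
            then show ?thesis using \<Phi>nn[of r] knn[OF rT] by (simp add: not_integrable_integral_eq)
          qed
        qed
      qed
      then show "\<Phi> t - \<Phi> s \<le> integral {s..t} (\<lambda>r. \<Phi> r * k r)" using \<Phi>\<psi> st by simp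
    next
      have "integral {0..T} k = real j * ((3 + Mb) * integral {0..T} m)" unfolding k_def by simp
      then have "2 * integral {0..T} k = real j * (2 * (3 + Mb) * integral {0..T} m)" by simp
      also have "\<dots> \<le> real j * real (Suc N)" using N by (intro mult_left_mono) auto
      also have "\<dots> = real (Suc (j * Suc N - 1))" using j by (simp add: distrib_left)
      finally show "2 * integral {0..T} k \<le> real (Suc (j * Suc N - 1))" .
    qed auto
    also have "Suc (j * Suc N - 1) = Suc N * j" using j by simp
    also have "2 ^ (Suc N * j) * \<Phi> 0 \<le> 2 ^ (Suc N * j) * (1 + R0\<^sup>2) ^ j"
    proof (rule mult_left_mono)
      have 0: "0 \<in> {0..T}" using T by simp
      show "\<Phi> 0 \<le> (1 + R0\<^sup>2) ^ j" unfolding \<Phi>_def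
      proof (rule integral_Prob_on_le[OF \<mu>0 fint[OF 0]])
        fix x :: 'a assume "x \<in> cball 0 R0"
        then have "norm x \<le> R0" by simp
        then have "(norm x)\<^sup>2 \<le> R0\<^sup>2" by (intro power_mono) auto
        then have "y x \<le> 1 + R0\<^sup>2" by (simp add: y_def power2_norm_eq_inner)
        then have "y x ^ j \<le> (1 + R0\<^sup>2) ^ j" using y1[of x] by (intro power_mono) auto
        moreover have "f x \<le> y x ^ j" unfolding f_def using y1[of x] by (intro G(5)) simp
        ultimately show "f x \<le> (1 + R0\<^sup>2) ^ j" by simp
      qed
    qed simp
    also have "2 ^ (Suc N * j) * (1 + R0\<^sup>2) ^ j = y0 ^ j" by (simp only: y0_def power_mult_distrib power_mult)
    finally have \<Phi>t: "\<Phi> t \<le> y0 ^ j" .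
    have "A * measure (\<mu> t) C \<le> \<Phi> t"
      unfolding \<Phi>_def
    proof (rule Markov_Prob[OF \<mu>[OF t] C_k_continuous[OF Cf] fnn A _ Cc])
      fix x assume "x \<in> C"
      then have "(2 * y0) ^ j \<le> y x ^ j" using y0 by (intro power_mono) (auto simp: C_def)
      then show "A \<le> f x" unfolding f_def A_def[symmetric] by (rule G(6))
    qed
    then have "2 ^ j * y0 ^ j * measure (\<mu> t) C \<le> y0 ^ j" using \<Phi>t by (simp add: A_def power_mult_distrib)
    then have "y0 ^ j * (2 ^ j * measure (\<mu> t) C) \<le> y0 ^ j * 1" by (simp add: mult.assoc mult.left_commute)
    then have "2 ^ j * measure (\<mu> t) C \<le> 1" by (rule mult_left_le_imp_le) (use y0 in simp)
    then show ?thesis by (simp add: power_divide le_divide_eq mult.commute)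
  qed
  have "measure (\<mu> t) C \<le> 0"
  proof (rule LIMSEQ_le_const)
    show "(\<lambda>j. (1/2::real) ^ j) \<longlonglongrightarrow> 0" by (rule LIMSEQ_power_zero) simp
    show "\<exists>N. \<forall>n\<ge>N. measure (\<mu> t) C \<le> (1/2) ^ n" using key by (intro exI[of _ 1]) auto
  qed
  then have "measure (\<mu> t) C = 0" by (simp add: measure_le_0_iff)
  moreover interpret prob_space "\<mu> t" by (rule Prob_simps(3)[OF Prob_c_D(1)[OF \<mu>[OF t]]])
  have "C \<in> sets (\<mu> t)" using Cc Prob_simps(1)[OF Prob_c_D(1)[OF \<mu>[OF t]]] by auto
  ultimately have "C \<in> null_sets (\<mu> t)" by (auto simp: null_sets_def emeasure_eq_measure)
  then have "AE x in \<mu> t. x \<notin> C" by (rule AE_not_in)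
  then have "AE x in \<mu> t. x \<in> cball 0 (sqrt (2 * y0))"
  proof eventually_elim
    fix x assume "x \<notin> C"
    then have "(norm x)\<^sup>2 \<le> 2 * y0" by (auto simp: C_def y_def power2_norm_eq_inner)
    then show "x \<in> cball 0 (sqrt (2 * y0))" by (simp add: real_le_rsqrt)
  qed
  then show ?thesis using Prob_on_iff[OF closed_cball] Prob_c_D(1)[OF \<mu>[OF t]] unfolding y0_def by blast
qed

lemma C_k_cutoff:
  fixes R :: real
  obtains ch :: "'a::euclidean_space \<Rightarrow> real" where "\<And>k. C_k k ch" "\<And>x. x \<bullet> x \<le> R\<^sup>2 + 1 \<Longrightarrow> ch x = 1"
    "\<And>x. norm x > sqrt (R\<^sup>2 + 2) \<Longrightarrow> ch x = 0"
proof -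
  define ch where "ch x = 1 - smooth_step ((x \<bullet> x - R\<^sup>2) - 1)" for x :: 'a
  have "C_k k (\<lambda>x::'a. (x \<bullet> x - R\<^sup>2) - 1)" for k
    using C_k_diff[OF C_k_diff[OF C_k_inner_self[of k 0] C_k_const] C_k_const] by simp
  then have "C_k k ch" for k
    unfolding ch_def [abs_def] by (rule C_k_diff[OF C_k_const C_k_compose[OF _ smooth_step(6)]]) simp
  moreover have "ch x = 1" if "x \<bullet> x \<le> R\<^sup>2 + 1" for x using that by (simp add: ch_def smooth_step(4))
  moreover have "ch x = 0" if x: "norm x > sqrt (R\<^sup>2 + 2)" for x
  proof -
    have "(sqrt (R\<^sup>2 + 2))\<^sup>2 \<le> (norm x)\<^sup>2" using x by (intro power_mono) auto
    then have "R\<^sup>2 + 2 \<le> x \<bullet> x" by (simp add: power2_norm_eq_inner)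
    then show ?thesis by (simp add: ch_def smooth_step(5))
  qed
  ultimately show thesis using that by blast
qed

text \<open>Smooth potentials with gradient at most 1 are cut off outside the ball that carries the
  curve. Integrating \<open>1 + norm x + moment1 (\<mu> r)\<close> against the measure produces the
  factor \<open>1 + 2 * moment1 (\<mu> r)\<close>.\<close>

lemma CE_W1_bound:
  fixes \<mu> :: "real \<Rightarrow> 'a::euclidean_space measure"
  assumes AC: "AC_curve T \<mu>" and CE: "solves_CE T \<mu> w" and m: "L1_nonneg T m"
    and growth: "AE t in lebesgue_on {0..T}. \<forall>x. norm (w t x) \<le> m t * (1 + norm x + moment1 (\<mu> t))"
    and supp: "\<And>t. t \<in> {0..T} \<Longrightarrow> \<mu> t \<in> Prob_on (cball 0 R)" and st: "0 \<le> s" "s \<le> t" "t \<le> T"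
  shows "W1 (\<mu> s) (\<mu> t) \<le> integral {s..t} (\<lambda>r. (1 + 2 * moment1 (\<mu> r)) * m r)"
proof -
  have \<mu>: "\<mu> t \<in> Prob_c" if "t \<in> {0..T}" for t using AC that by (auto simp: AC_curve_def)
  have mi: "m absolutely_integrable_on {0..T}" and mnn: "\<And>t. t \<in> {0..T} \<Longrightarrow> 0 \<le> m t" using m by (auto simp: L1_nonneg_def)
  have s: "s \<in> {0..T}" and t: "t \<in> {0..T}" using st by auto
  have momc: "continuous_on {0..T} (\<lambda>t. moment1 (\<mu> t))"
    unfolding moment1_def by (rule AC_curve_Lipschitz_continuous[OF AC moment1_integrand_Lipschitz])
  have Bi: "(\<lambda>r. (1 + 2 * moment1 (\<mu> r)) * m r) absolutely_integrable_on {0..T}"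
    by (intro absolutely_integrable_times_continuous mi continuous_intros momc)
  obtain ch :: "'a \<Rightarrow> real" where ch: "\<And>k. C_k k ch" "\<And>x. x \<bullet> x \<le> R\<^sup>2 + 1 \<Longrightarrow> ch x = 1"
    "\<And>x. norm x > sqrt (R\<^sup>2 + 2) \<Longrightarrow> ch x = 0"
    by (rule C_k_cutoff[of R]) blast
  have inR: "x \<bullet> x < R\<^sup>2 + 1" if "x \<in> cball 0 R" for x :: 'a
  proof -
    have "norm x \<le> R" using that by simp
    then have "(norm x)\<^sup>2 \<le> R\<^sup>2" by (intro power_mono) auto
    then show ?thesis by (simp add: power2_norm_eq_inner)
  qed
  have "W1 (\<mu> t) (\<mu> s) \<le> integral {s..t} (\<lambda>r. (1 + 2 * moment1 (\<mu> r)) * m r)"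
  proof (rule Kantorovich_duality[OF supp[OF t] supp[OF s] compact_cball])
    fix f :: "'a \<Rightarrow> real" assume f: "\<And>k. C_k k f" "\<And>x. norm (grad f x) \<le> 1"
    define \<psi> where "\<psi> x = f x * ch x" for x
    have C\<psi>: "C_k k \<psi>" for k unfolding \<psi>_def [abs_def] by (rule C_k_mult[OF f(1) ch(1)])
    have \<psi>0: "\<psi> x = 0" if "norm x > sqrt (R\<^sup>2 + 2)" for x using ch(3)[OF that] by (simp add: \<psi>_def)
    have gr: "grad \<psi> x = grad f x" if x: "x \<in> cball 0 R" for x
    proof -
      have "(f has_derivative (\<lambda>h. h \<bullet> grad f x)) (at x)" using C_k_GDERIV[OF f(1)] unfolding gderiv_def .
      then have "(\<psi> has_derivative (\<lambda>h. h \<bullet> grad f x)) (at x)"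
      proof (rule has_derivative_transform_within_open[where s = "{x. x \<bullet> x < R\<^sup>2 + 1}"])
        show "open {x::'a. x \<bullet> x < R\<^sup>2 + 1}" by (intro open_Collect_less continuous_intros)
        show "x \<in> {x. x \<bullet> x < R\<^sup>2 + 1}" using inR[OF x] by simp
        show "f z = \<psi> z" if "z \<in> {x. x \<bullet> x < R\<^sup>2 + 1}" for z using that ch(2)[of z] by (simp add: \<psi>_def)
      qed
      then show ?thesis using grad_eq[of \<psi> x "grad f x"] by (simp add: gderiv_def)
    qed
    have "\<exists>L. L-lipschitz_on UNIV \<psi>"
    proof -
      have "{x. \<psi> x \<noteq> 0} \<subseteq> cball 0 (sqrt (R\<^sup>2 + 2))" using \<psi>0 by (force simp: not_less[symmetric])
      then have "compact (closure {x. \<psi> x \<noteq> 0})" using bounded_subset[OF bounded_cball] by auto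
      then show ?thesis by (rule C_k_bounded_Lipschitz[OF C\<psi>]) blast
    qed
    then have \<psi>cont: "continuous_on {0..T} (\<lambda>t. \<integral>x. \<psi> x \<partial>\<mu> t)" using AC_curve_Lipschitz_continuous[OF AC] by blast
    have eq: "(\<integral>x. f x \<partial>\<mu> r) = (\<integral>x. \<psi> x \<partial>\<mu> r)" if r: "r \<in> {0..T}" for r
    proof (rule integral_cong_AE)
      note P = Prob_simps(4)[OF Prob_c_D(1)[OF \<mu>[OF r]]]
      show "f \<in> borel_measurable (\<mu> r)" "\<psi> \<in> borel_measurable (\<mu> r)"
        using borel_measurable_continuous_onI[OF C_k_continuous[OF f(1)]] borel_measurable_continuous_onI[OF C_k_continuous[OF C\<psi>]]
        by (simp_all add: P)
      show "AE x in \<mu> r. f x = \<psi> x" using Prob_onD(2)[OF supp[OF r]]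
      proof eventually_elim
        fix x :: 'a assume "x \<in> cball 0 R"
        from inR[OF this] show "f x = \<psi> x" using ch(2)[of x] by (simp add: \<psi>_def)
      qed
    qed
    have "(\<integral>x. \<psi> x \<partial>\<mu> t) - (\<integral>x. \<psi> x \<partial>\<mu> s) \<le> integral {s..t} (\<lambda>r. (1 + 2 * moment1 (\<mu> r)) * m r)"
    proof (rule CE_weak_inequality[OF \<mu> CE C\<psi> \<psi>0 \<psi>cont Bi _ st])
      show "AE t in lebesgue_on {0..T}. (\<integral>x. grad \<psi> x \<bullet> w t x \<partial>\<mu> t) \<le> (1 + 2 * moment1 (\<mu> t)) * m t"
        using growth AE_space
      proof eventually_elim
        fix r assume r: "\<forall>x. norm (w r x) \<le> m r * (1 + norm x + moment1 (\<mu> r))" "r \<in> space (lebesgue_on {0..T})"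
        then have rT: "r \<in> {0..T}" by simp
        interpret prob_space "\<mu> r" by (rule Prob_simps(3)[OF Prob_c_D(1)[OF \<mu>[OF rT]]])
        have nint: "integrable (\<mu> r) (\<lambda>x. norm x)" by (rule integrable_Prob_c[OF \<mu>[OF rT]]) (intro continuous_intros)
        have mnn': "0 \<le> moment1 (\<mu> r)" unfolding moment1_def by (rule integral_nonneg_AE) simp
        show "(\<integral>x. grad \<psi> x \<bullet> w r x \<partial>\<mu> r) \<le> (1 + 2 * moment1 (\<mu> r)) * m r"
        proof (cases "integrable (\<mu> r) (\<lambda>x. grad \<psi> x \<bullet> w r x)")
          case True
          have "(\<integral>x. grad \<psi> x \<bullet> w r x \<partial>\<mu> r) \<le> (\<integral>x. m r * ((1 + moment1 (\<mu> r)) + norm x) \<partial>\<mu> r)"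
          proof (rule integral_mono_AE[OF True])
            show "integrable (\<mu> r) (\<lambda>x. m r * ((1 + moment1 (\<mu> r)) + norm x))" using nint by auto
            show "AE x in \<mu> r. grad \<psi> x \<bullet> w r x \<le> m r * ((1 + moment1 (\<mu> r)) + norm x)"
              using Prob_onD(2)[OF supp[OF rT]]
            proof eventually_elim
              fix x :: 'a assume x: "x \<in> cball 0 R"
              have "grad \<psi> x \<bullet> w r x \<le> norm (grad f x) * norm (w r x)" unfolding gr[OF x] by (rule norm_cauchy_schwarz)
              also have "\<dots> \<le> 1 * norm (w r x)" using f(2)[of x] by (intro mult_right_mono) auto
              also have "\<dots> \<le> m r * ((1 + moment1 (\<mu> r)) + norm x)" using r(1) by (simp add: algebra_simps)
              finally show "grad \<psi> x \<bullet> w r x \<le> m r * ((1 + moment1 (\<mu> r)) + norm x)" .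
            qed
          qed
          also have "\<dots> = m r * ((1 + moment1 (\<mu> r)) + moment1 (\<mu> r))"
            using nint by (simp add: moment1_def prob_space)
          finally show ?thesis by (simp add: algebra_simps)
        next
          case False
          then show ?thesis using mnn[OF rT] mnn' by (simp add: not_integrable_integral_eq)
        qed
      qed
    qed
    then show "(\<integral>x. f x \<partial>\<mu> t) - (\<integral>x. f x \<partial>\<mu> s) \<le> integral {s..t} (\<lambda>r. (1 + 2 * moment1 (\<mu> r)) * m r)"
      using eq[OF s] eq[OF t] by simp
  qed
  then show ?thesis using W1_commute[OF \<mu>[OF s] \<mu>[OF t]] by simp
qed

lemma real_le_Suc: obtains N where "x \<le> real (Suc N)"
proof -
  obtain n where "x \<le> real n" using real_arch_simple by blast
  then have "x \<le> real (Suc n)" by simp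
  then show thesis by (rule that)
qed

text \<open>R and C are chosen before the curve, so the moment bound that enters them has to come
  from m, T and \<open>\<mu>0\<close> alone.\<close>

theorem CE_a_priori:
  fixes \<mu>0 :: "'a::euclidean_space measure"
  assumes T: "0 \<le> T" and m: "L1_nonneg T m" and \<mu>0: "\<mu>0 \<in> Prob_c"
  obtains R C where "R > 0" "C \<ge> 0"
    "\<And>\<mu> w. AC_curve T \<mu> \<Longrightarrow> \<mu> 0 = \<mu>0 \<Longrightarrow> solves_CE T \<mu> w \<Longrightarrow>
       (AE t in lebesgue_on {0..T}. \<forall>x. norm (w t x) \<le> m t * (1 + norm x + moment1 (\<mu> t))) \<Longrightarrow>
       (\<forall>t\<in>{0..T}. \<mu> t \<in> Prob_on (cball 0 R)) \<and>
       (\<forall>s t. 0 \<le> s \<and> s \<le> t \<and> t \<le> T \<longrightarrow> W1 (\<mu> s) (\<mu> t) \<le> integral {s..t} (\<lambda>r. C * m r))"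
proof -
  have mi: "m absolutely_integrable_on {0..T}" and mnn: "\<And>t. t \<in> {0..T} \<Longrightarrow> 0 \<le> m t" using m by (auto simp: L1_nonneg_def)
  have 0: "0 \<in> {0..T}" using T by simp
  obtain R0 where R0: "R0 > 0" "\<mu>0 \<in> Prob_on (cball 0 R0)" by (rule Prob_c_cball[OF \<mu>0]) blast
  obtain N1 where N1: "2 * integral {0..T} (\<lambda>r. 2 * m r) \<le> real (Suc N1)"
    by (rule real_le_Suc[of "2 * integral {0..T} (\<lambda>r. 2 * m r)"])
  \<comment> \<open>\<open>1 + 2 * moment1\<close> satisfies a Gronwall inequality with rate
    \<open>2 * m\<close>, because the moment is the integral of a 1-Lipschitz function.\<close>
  define Mb where "Mb = 2 ^ Suc N1 * (1 + 2 * moment1 \<mu>0)"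
  have mom_nn: "0 \<le> moment1 \<nu>" for \<nu> :: "'a measure" unfolding moment1_def by (rule integral_nonneg_AE) simp
  have Mb: "Mb \<ge> 0" using mom_nn[of \<mu>0] by (simp add: Mb_def)
  obtain N where N: "2 * (3 + Mb) * integral {0..T} m \<le> real (Suc N)"
    by (rule real_le_Suc[of "2 * (3 + Mb) * integral {0..T} m"])
  define R where "R = sqrt (2 * (2 ^ Suc N * (1 + R0\<^sup>2)))"
  have R: "R > 0" unfolding R_def by (simp add: add_pos_nonneg)
  show thesis
  proof (rule that[of R "1 + 2 * Mb"])
    fix \<mu> w assume AC: "AC_curve T \<mu>" and \<mu>00: "\<mu> 0 = \<mu>0" and CE: "solves_CE T \<mu> w"
      and growth: "AE t in lebesgue_on {0..T}. \<forall>x. norm (w t x) \<le> m t * (1 + norm x + moment1 (\<mu> t))"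
    have \<mu>: "\<mu> t \<in> Prob_c" if "t \<in> {0..T}" for t using AC that by (auto simp: AC_curve_def)
    have momc: "continuous_on {0..T} (\<lambda>t. moment1 (\<mu> t))"
      unfolding moment1_def by (rule AC_curve_Lipschitz_continuous[OF AC moment1_integrand_Lipschitz])
    have "\<exists>x\<in>{0..T}. \<forall>y\<in>{0..T}. moment1 (\<mu> y) \<le> moment1 (\<mu> x)"
      using T by (intro continuous_attains_sup momc) auto
    then obtain M1 where M1: "\<And>t. t \<in> {0..T} \<Longrightarrow> moment1 (\<mu> t) \<le> M1" by blast
    then have M1nn: "0 \<le> M1" using mom_nn order_trans 0 by blast
    \<comment> \<open>M1, and hence N', depends on the curve. The resulting ball serves only as the
      common support that the \<open>W1\<close> estimate asks for.\<close>
    obtain N' where N': "2 * (3 + M1) * integral {0..T} m \<le> real (Suc N')"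
    by (rule real_le_Suc[of "2 * (3 + M1) * integral {0..T} m"])
    have \<mu>0R: "\<mu> 0 \<in> Prob_on (cball 0 R0)" using R0 \<mu>00 by simp
    have supp1: "\<mu> t \<in> Prob_on (cball 0 (sqrt (2 * (2 ^ Suc N' * (1 + R0\<^sup>2)))))" if "t \<in> {0..T}" for t
      by (rule CE_support_bound[OF T AC CE m growth M1 M1nn \<mu>0R N' that])
    have W: "W1 (\<mu> s) (\<mu> t) \<le> integral {s..t} (\<lambda>r. (1 + 2 * moment1 (\<mu> r)) * m r)" if "0 \<le> s" "s \<le> t" "t \<le> T" for s t
      by (rule CE_W1_bound[OF AC CE m growth supp1 that])
    define f where "f t = 1 + 2 * moment1 (\<mu> t)" for t
    have fc: "continuous_on {0..T} f" unfolding f_def by (intro continuous_intros momc)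
    have m2: "(\<lambda>r. 2 * m r) absolutely_integrable_on {0..T}" using mi by auto
    have fbound: "f t \<le> 2 ^ Suc N1 * f 0" if t: "t \<in> {0..T}" for t
    proof (rule Gronwall_doubling[OF T fc _ m2 _ _ N1 t])
      fix s t assume st: "0 \<le> s" "s \<le> t" "t \<le> T"
      have "moment1 (\<mu> t) - moment1 (\<mu> s) \<le> 1 * W1 (\<mu> t) (\<mu> s)"
        using W1_Lipschitz_bound_UNIV[OF \<mu> \<mu> moment1_integrand_Lipschitz, of t s] st by (simp add: moment1_def abs_le_iff)
      also have "W1 (\<mu> t) (\<mu> s) = W1 (\<mu> s) (\<mu> t)" using st by (intro W1_commute \<mu>) auto
      finally have "f t - f s \<le> 2 * integral {s..t} (\<lambda>r. (1 + 2 * moment1 (\<mu> r)) * m r)" using W[OF st] by (simp add: f_def)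
      also have "\<dots> = integral {s..t} (\<lambda>r. f r * (2 * m r))"
        by (simp add: f_def mult.left_commute integral_mult_right[symmetric] del: integral_mult_right)
      finally show "f t - f s \<le> integral {s..t} (\<lambda>r. f r * (2 * m r))" .
    qed (use mom_nn mnn in \<open>auto simp: f_def\<close>)
    have mom: "moment1 (\<mu> t) \<le> Mb" if "t \<in> {0..T}" for t
      using fbound[OF that] mom_nn[of "\<mu> t"] by (simp add: f_def Mb_def \<mu>00)
    have "\<mu> t \<in> Prob_on (cball 0 R)" if "t \<in> {0..T}" for t
      unfolding R_def by (rule CE_support_bound[OF T AC CE m growth mom Mb \<mu>0R N that])
    moreover have "W1 (\<mu> s) (\<mu> t) \<le> integral {s..t} (\<lambda>r. (1 + 2 * Mb) * m r)" if st: "0 \<le> s" "s \<le> t" "t \<le> T" for s t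
    proof -
      have sub: "{s..t} \<subseteq> {0..T}" using st by auto
      note ms = L1_nonneg_integral(3)[OF mi st]
      have "integral {s..t} (\<lambda>r. (1 + 2 * moment1 (\<mu> r)) * m r) \<le> integral {s..t} (\<lambda>r. (1 + 2 * Mb) * m r)"
      proof (rule integral_le)
        show "(\<lambda>r. (1 + 2 * moment1 (\<mu> r)) * m r) integrable_on {s..t}"
          by (intro set_lebesgue_integral_eq_integral(1) absolutely_integrable_times_continuous[OF ms] continuous_intros
              continuous_on_subset[OF momc sub])
        show "(\<lambda>r. (1 + 2 * Mb) * m r) integrable_on {s..t}"
          by (rule integrable_on_mult_right[OF set_lebesgue_integral_eq_integral(1)[OF ms]])
        show "(1 + 2 * moment1 (\<mu> r)) * m r \<le> (1 + 2 * Mb) * m r" if "r \<in> {s..t}" for r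
          using mom[of r] mnn[of r] sub that by (intro mult_right_mono) auto
      qed
      then show ?thesis using W[OF st] by simp
    qed
    ultimately show "(\<forall>t\<in>{0..T}. \<mu> t \<in> Prob_on (cball 0 R)) \<and>
       (\<forall>s t. 0 \<le> s \<and> s \<le> t \<and> t \<le> T \<longrightarrow> W1 (\<mu> s) (\<mu> t) \<le> integral {s..t} (\<lambda>r. (1 + 2 * Mb) * m r))" by blast
  qed (use R Mb in auto)
qed

section \<open>The controlled velocity field\<close>

text \<open>The three properties of a measure on which essential separability and the selection
  results rest.\<close>

lemma lebesgue_on_bounded:
  fixes S :: "real set"
  assumes S: "S \<in> sets lebesgue" "S \<subseteq> {0..T}"
  shows "finite_measure (lebesgue_on S)" "open G \<Longrightarrow> G \<inter> space (lebesgue_on S) \<in> sets (lebesgue_on S)"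
    "N \<in> null_sets (lebesgue_on S) \<Longrightarrow> 0 < e \<Longrightarrow> \<exists>G. open G \<and> N \<subseteq> G \<and> measure (lebesgue_on S) (G \<inter> space (lebesgue_on S)) < e"
proof -
  have "S \<in> lmeasurable"
    by (rule bounded_set_imp_lmeasurable[OF bounded_subset[OF bounded_closed_interval S(2)] S(1)])
  then show "finite_measure (lebesgue_on S)" by (rule finite_measure_lebesgue_on)
  show op: "G \<inter> space (lebesgue_on S) \<in> sets (lebesgue_on S)" if "open G" for G
    using that S(1) by (auto simp: sets_restrict_space)
  assume N: "N \<in> null_sets (lebesgue_on S)" and e: "0 < e"
  have Nn: "N \<in> null_sets lebesgue" using N S(1) by (simp add: null_sets_restrict_space)
  obtain G where G: "open G" "N \<subseteq> G" "(G - N) \<in> lmeasurable" "emeasure lebesgue (G - N) < ennreal e"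
    using sets_lebesgue_outer_open[OF null_setsD2[OF Nn] e] by metis
  have "emeasure (lebesgue_on S) (G \<inter> S) = emeasure lebesgue (G \<inter> S)"
    using S(1) by (subst emeasure_restrict_space) auto
  also have "\<dots> \<le> emeasure lebesgue G" using G(1) S(1) by (intro emeasure_mono) auto
  also have "\<dots> = emeasure lebesgue (G - N)" using emeasure_Diff_null_set[OF Nn, of G] G(1) by simp
  finally have "emeasure (lebesgue_on S) (G \<inter> S) < ennreal e" using G(4) by (rule le_less_trans)
  then have "measure (lebesgue_on S) (G \<inter> S) < e"
    unfolding measure_def using e by (metis enn2real_less_iff less_top order_less_trans ennreal_less_top less_le_not_le)
  then show "\<exists>G. open G \<and> N \<subseteq> G \<and> measure (lebesgue_on S) (G \<inter> space (lebesgue_on S)) < e"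
    using G by (intro exI[of _ G]) simp
qed

lemma lebesgue_on_full_subset:
  fixes f :: "real \<Rightarrow> real"
  assumes S: "S \<in> sets lebesgue" "S \<subseteq> {0..T}" "{0..T} - S \<in> null_sets lebesgue"
  shows "set_integrable lebesgue {0..T} f \<longleftrightarrow> integrable (lebesgue_on S) f"
    "integrable (lebesgue_on S) f \<Longrightarrow> (LINT t:{0..T}|lebesgue. f t) = (\<integral>t. f t \<partial>lebesgue_on S)"
proof -
  have neg: "negligible ({0..T} - S)" using S(3) by (simp add: negligible_iff_null_sets)
  have neg1: "negligible {x \<in> {0..T} - S. f x \<noteq> 0}" by (rule negligible_subset[OF neg]) auto
  have neg2: "negligible {x \<in> S - {0..T}. f x \<noteq> 0}"
  proof -
    have "{x \<in> S - {0..T}. f x \<noteq> 0} = {}" using S(2) by auto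
    then show ?thesis by (simp only: negligible_empty)
  qed
  have eqI: "integrable (lebesgue_on S) f \<longleftrightarrow> set_integrable lebesgue S f"
    using S(1) integrable_restrict_space[of S lebesgue f] by (simp add: set_integrable_def)
  show 1: "set_integrable lebesgue {0..T} f \<longleftrightarrow> integrable (lebesgue_on S) f"
    unfolding eqI by (rule absolutely_integrable_spike_set_eq[OF neg1 neg2])
  assume i: "integrable (lebesgue_on S) f"
  have "(LINT t:{0..T}|lebesgue. f t) = integral {0..T} f"
    using i 1 by (intro set_lebesgue_integral_eq_integral(2)) simp
  also have "\<dots> = integral S f" by (rule integral_spike_set[OF neg1 neg2])
  also have "\<dots> = (LINT t:S|lebesgue. f t)" using i eqI by (intro set_lebesgue_integral_eq_integral(2)[symmetric]) simp
  also have "\<dots> = (\<integral>t. f t \<partial>lebesgue_on S)"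
    using S(1) integral_restrict_space[of S lebesgue f] by (simp add: set_lebesgue_integral_def)
  finally show "(LINT t:{0..T}|lebesgue. f t) = (\<integral>t. f t \<partial>lebesgue_on S)" .
qed

lemma W1_topology_eventually:
  assumes op: "openin W1_topology G" and \<mu>: "\<mu> \<in> G" and \<nu>: "\<And>n. \<nu> n \<in> Prob_c" and lim: "(\<lambda>n. W1 (\<nu> n) \<mu>) \<longlonglongrightarrow> 0"
  shows "\<forall>\<^sub>F n in sequentially. \<nu> n \<in> G"
proof -
  have \<mu>c: "\<mu> \<in> Prob_c" using op \<mu> by (auto simp: openin_W1_topology)
  obtain r where r: "r > 0" "\<And>\<rho>. \<rho> \<in> Prob_c \<Longrightarrow> W1 \<mu> \<rho> < r \<Longrightarrow> \<rho> \<in> G"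
    using op \<mu> by (auto simp: openin_W1_topology)
  have "\<forall>\<^sub>F n in sequentially. W1 (\<nu> n) \<mu> < r" using lim r(1) by (rule order_tendstoD(2))
  then show ?thesis
    by eventually_elim (use r(2) \<nu> W1_commute[OF \<nu> \<mu>c] in auto)
qed

lemma W1_closedin_limit:
  assumes cl: "closedin W1_topology C" and \<mu>: "\<mu> \<in> Prob_c" and \<nu>: "\<And>n. \<nu> n \<in> Prob_c"
    and lim: "(\<lambda>n. W1 (\<nu> n) \<mu>) \<longlonglongrightarrow> 0" and ev: "\<forall>\<^sub>F n in sequentially. \<nu> n \<in> C"
  shows "\<mu> \<in> C"
proof (rule ccontr)
  assume "\<mu> \<notin> C"
  then have "\<mu> \<in> Prob_c - C" using \<mu> by simp
  moreover have "openin W1_topology (Prob_c - C)" using cl by (simp add: closedin_def topspace_W1_topology)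
  ultimately have "\<forall>\<^sub>F n in sequentially. \<nu> n \<in> Prob_c - C" using \<nu> lim by (intro W1_topology_eventually)
  with ev have "\<forall>\<^sub>F n in sequentially. False" by eventually_elim simp
  then show False by simp
qed

lemma convex_functions_sum:
  fixes f :: "'i \<Rightarrow> 'a \<Rightarrow> 'b::real_vector"
  assumes A: "convex_functions A" and I: "finite I" "\<And>i. i \<in> I \<Longrightarrow> f i \<in> A" "\<And>i. i \<in> I \<Longrightarrow> 0 \<le> c i" "(\<Sum>i\<in>I. c i) = 1"
  shows "(\<lambda>x. \<Sum>i\<in>I. c i *\<^sub>R f i x) \<in> A"
  using assms(2,3,4,5)
proof (induction I arbitrary: c rule: finite_induct)
  case empty then show ?case by simp
next
  case (insert j I)
  define s where "s = (\<Sum>i\<in>I. c i)"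
  have s: "0 \<le> s" "c j + s = 1" using insert unfolding s_def by (auto intro!: sum_nonneg)
  show ?case
  proof (cases "s = 0")
    case True
    have "c i = 0" if "i \<in> I" for i
      using True insert.prems(2) insert.hyps(1) that sum_nonneg_eq_0_iff[of I c] by (auto simp: s_def)
    then have "(\<lambda>x. \<Sum>i\<in>insert j I. c i *\<^sub>R f i x) = f j" using insert.hyps s True by auto
    then show ?thesis using insert.prems(1) by simp
  next
    case False
    have g: "(\<lambda>x. \<Sum>i\<in>I. (c i / s) *\<^sub>R f i x) \<in> A"
      using insert.prems s False by (intro insert.IH) (auto simp: sum_divide_distrib[symmetric] s_def[symmetric])
    have fj: "f j \<in> A" "0 \<le> c j" using insert.prems by auto
    have "(\<lambda>x. c j *\<^sub>R f j x + s *\<^sub>R (\<Sum>i\<in>I. (c i / s) *\<^sub>R f i x)) \<in> A"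
      using A[unfolded convex_functions_def, rule_format, OF fj(1) g, of "c j" s] fj(2) s by simp
    moreover have "(\<lambda>x. c j *\<^sub>R f j x + s *\<^sub>R (\<Sum>i\<in>I. (c i / s) *\<^sub>R f i x)) = (\<lambda>x. \<Sum>i\<in>insert j I. c i *\<^sub>R f i x)"
      using insert.hyps False by (auto simp: scaleR_sum_right fun_eq_iff)
    ultimately show ?thesis by simp
  qed
qed

text \<open>Continuity is uniform at the points of a compact set even though the nearby points
  \<open>u j\<close> range over the whole space.\<close>

lemma continuous_near_compact:
  fixes \<phi> :: "'u::metric_space \<Rightarrow> 'b::real_normed_vector"
  assumes \<phi>: "continuous_on UNIV \<phi>" and C: "compact C" and u': "\<And>j. u' j \<in> C" and d: "(\<lambda>j. dist (u j) (u' j)) \<longlonglongrightarrow> 0"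
  shows "(\<lambda>j. \<phi> (u j) - \<phi> (u' j)) \<longlonglongrightarrow> 0"
proof (rule LIMSEQ_I)
  fix \<epsilon> :: real assume \<epsilon>: "\<epsilon> > 0"
  have "\<exists>n::nat. \<forall>y\<in>C. \<forall>x. dist x y < 1 / Suc n \<longrightarrow> dist (\<phi> x) (\<phi> y) < \<epsilon>"
  proof (rule ccontr)
    assume "\<not> ?thesis"
    then have "\<forall>n::nat. \<exists>y x. y \<in> C \<and> dist x y < 1 / Suc n \<and> \<not> dist (\<phi> x) (\<phi> y) < \<epsilon>" by blast
    then obtain y x where yx: "\<And>n::nat. y n \<in> C" "\<And>n. dist (x n) (y n) < 1 / Suc n" "\<And>n. \<not> dist (\<phi> (x n)) (\<phi> (y n)) < \<epsilon>"
      by metis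
    obtain q r where q: "q \<in> C" and r: "strict_mono r" "(y \<circ> r) \<longlonglongrightarrow> q"
      using C yx(1) unfolding compact_eq_seq_compact_metric seq_compact_def by metis
    have yq: "(\<lambda>n. y (r n)) \<longlonglongrightarrow> q" using r(2) by (simp add: o_def)
    have to0: "(\<lambda>n. 1 / real (Suc (r n))) \<longlonglongrightarrow> 0"
      using LIMSEQ_subseq_LIMSEQ[OF LIMSEQ_Suc[OF lim_1_over_n] r(1)] by (simp add: o_def)
    have "(\<lambda>n. dist (x (r n)) (y (r n))) \<longlonglongrightarrow> 0"
      by (rule tendsto_sandwich[OF _ _ tendsto_const to0]) (use yx(2) in \<open>auto intro!: always_eventually less_imp_le\<close>)
    moreover have "(\<lambda>n. dist (y (r n)) q) \<longlonglongrightarrow> 0" using yq by (simp add: tendsto_dist_iff[symmetric])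
    ultimately have s: "(\<lambda>n. dist (x (r n)) (y (r n)) + dist (y (r n)) q) \<longlonglongrightarrow> 0" using tendsto_add by fastforce
    have "(\<lambda>n. dist (x (r n)) q) \<longlonglongrightarrow> 0"
      by (rule tendsto_sandwich[OF _ _ tendsto_const s]) (simp_all add: dist_triangle)
    then have xq: "(\<lambda>n. x (r n)) \<longlonglongrightarrow> q" by (simp add: tendsto_dist_iff[symmetric])
    have c: "isCont \<phi> q" using \<phi> by (simp add: continuous_on_eq_continuous_at)
    have "(\<lambda>n. dist (\<phi> (x (r n))) (\<phi> (y (r n)))) \<longlonglongrightarrow> dist (\<phi> q) (\<phi> q)"
      by (intro tendsto_dist isCont_tendsto_compose[OF c] xq yq)
    then have "\<forall>\<^sub>F n in sequentially. dist (\<phi> (x (r n))) (\<phi> (y (r n))) < \<epsilon>" using \<epsilon> by (intro order_tendstoD(2)) auto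
    then show False using yx(3) by (auto simp: eventually_sequentially)
  qed
  then obtain n :: nat where n: "\<And>y x. y \<in> C \<Longrightarrow> dist x y < 1 / Suc n \<Longrightarrow> dist (\<phi> x) (\<phi> y) < \<epsilon>" by blast
  have "\<forall>\<^sub>F j in sequentially. dist (u j) (u' j) < 1 / Suc n" using d by (rule order_tendstoD(2)) simp
  then obtain N where N: "\<And>j. j \<ge> N \<Longrightarrow> dist (u j) (u' j) < 1 / Suc n" by (auto simp: eventually_sequentially)
  then show "\<exists>no. \<forall>j\<ge>no. norm (\<phi> (u j) - \<phi> (u' j) - 0) < \<epsilon>"
    using n[OF u'] by (intro exI[of _ N]) (simp add: dist_norm)
qed

lemma countable_dense_closure:
  obtains D :: "'a::second_countable_topology set" where "countable D" "closure D = UNIV"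
proof -
  obtain D :: "'a set" where D: "countable D" "\<And>X. open X \<Longrightarrow> X \<noteq> {} \<Longrightarrow> \<exists>d\<in>D. d \<in> X"
    using countable_dense_exists by metis
  have "closure D = UNIV"
  proof (rule ccontr)
    assume "closure D \<noteq> UNIV"
    then have "- closure D \<noteq> {}" by auto
    from D(2)[OF _ this] obtain d where "d \<in> D" "d \<in> - closure D" by auto
    then show False using closure_subset[of D] by auto
  qed
  with D(1) show thesis by (rule that)
qed

text \<open>
  \<open>S\<close> is the set of times at which all the almost-everywhere hypotheses hold, and all measures live
  on the ball \<open>K\<close> that contains the supports of the trajectories.
\<close>

locale control_system =
  fixes T R :: real and S :: "real set"
    and U :: "real \<Rightarrow> 'a::euclidean_space measure \<Rightarrow> 'u::metric_space set"
    and v :: "real \<Rightarrow> 'a measure \<Rightarrow> 'u \<Rightarrow> 'a \<Rightarrow> 'a" and m l L :: "real \<Rightarrow> real"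
  assumes T: "T > 0" and R: "R > 0" and S: "S \<in> sets lebesgue" "S \<subseteq> {0..T}" "{0..T} - S \<in> null_sets lebesgue"
    and U_compact: "\<And>t \<mu>. t \<in> S \<Longrightarrow> \<mu> \<in> Prob_c \<Longrightarrow> compact (U t \<mu>)"
    and U_measurable: "\<And>\<mu> G. \<mu> \<in> Prob_c \<Longrightarrow> open G \<Longrightarrow> {t \<in> S. U t \<mu> \<inter> G \<noteq> {}} \<in> sets lebesgue"
    and U_continuous: "\<And>t. t \<in> S \<Longrightarrow> setmap_W1_continuous (U t)"
    and v_measurable: "\<And>\<mu> u x. \<mu> \<in> Prob_c \<Longrightarrow> (\<lambda>t. v t \<mu> u x) \<in> borel_measurable (lebesgue_on S)"
    and v_continuous: "\<And>t \<mu>. t \<in> S \<Longrightarrow> \<mu> \<in> Prob_c \<Longrightarrow> continuous_on UNIV (\<lambda>(u, x). v t \<mu> u x)"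
    and m: "L1_nonneg T m" and growth: "\<And>t \<mu> u x. t \<in> S \<Longrightarrow> \<mu> \<in> Prob_c \<Longrightarrow> norm (v t \<mu> u x) \<le> m t * (1 + norm x + moment1 \<mu>)"
    and v_Lipschitz: "\<And>t \<mu> u. t \<in> S \<Longrightarrow> \<mu> \<in> Prob_on (cball 0 R) \<Longrightarrow> (l t)-lipschitz_on (cball 0 R) (v t \<mu> u)"
    and v_W1: "\<And>t \<mu> \<nu> u x. t \<in> S \<Longrightarrow> \<mu> \<in> Prob_on (cball 0 R) \<Longrightarrow> \<nu> \<in> Prob_on (cball 0 R) \<Longrightarrow> x \<in> cball 0 R \<Longrightarrow>
       norm (v t \<mu> u x - v t \<nu> u x) \<le> L t * W1 \<mu> \<nu>"
    and V_convex: "\<And>t \<mu>. t \<in> S \<Longrightarrow> \<mu> \<in> Prob_c \<Longrightarrow> convex_functions {v t \<mu> u | u. u \<in> U t \<mu>}"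
begin

abbreviation K :: "'a set" where "K \<equiv> cball 0 R"
abbreviation M :: "real measure" where "M \<equiv> lebesgue_on S"

text \<open>Abstracts what is used of a trajectory: its support and a continuous modulus. The
  approximating trajectories and their limit are both instances, the limit before it is known to
  solve any equation.\<close>

definition curve :: "(real \<Rightarrow> 'a measure) \<Rightarrow> bool" where
  "curve \<mu> \<longleftrightarrow> (\<forall>t\<in>{0..T}. \<mu> t \<in> Prob_on K) \<and> (\<exists>J. continuous_on {0..T} J \<and>
     (\<forall>s t. 0 \<le> s \<and> s \<le> t \<and> t \<le> T \<longrightarrow> W1 (\<mu> s) (\<mu> t) \<le> J t - J s))"

text \<open>Time is clamped to \<open>[0, T]\<close> and space projected to \<open>K\<close> to obtain everywhere continuous functions.\<close>

definition clamp_time :: "real \<Rightarrow> real" where "clamp_time s = max 0 (min T s)"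

lemma clamp_time: "clamp_time s \<in> {0..T}" "t \<in> {0..T} \<Longrightarrow> clamp_time t = t" "isCont clamp_time s"
  using T by (auto simp: clamp_time_def [abs_def] intro!: continuous_intros)

abbreviation proj :: "'a \<Rightarrow> 'a" where "proj \<equiv> closest_point K"

lemma proj: "proj x \<in> K" "x \<in> K \<Longrightarrow> proj x = x" "isCont proj x"
proof -
  have "K \<noteq> {}" using R by simp
  then show "proj x \<in> K" by (intro closest_point_in_set) auto
  show "x \<in> K \<Longrightarrow> proj x = x" by (rule closest_point_self)
  show "isCont proj x" by (intro continuous_at_closest_point) (use \<open>K \<noteq> {}\<close> in auto)
qed

lemma S_T: "t \<in> S \<Longrightarrow> t \<in> {0..T}" using S(2) by auto

lemma Prob_on_K: "\<mu> \<in> Prob_on K \<Longrightarrow> \<mu> \<in> Prob_c" by (rule Prob_on_Prob_c[OF compact_cball])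

lemma curve_Prob: "curve \<mu> \<Longrightarrow> t \<in> {0..T} \<Longrightarrow> \<mu> t \<in> Prob_on K" "curve \<mu> \<Longrightarrow> t \<in> {0..T} \<Longrightarrow> \<mu> t \<in> Prob_c"
  using Prob_on_K by (auto simp: curve_def)

lemma curve_tendsto:
  assumes \<mu>: "curve \<mu>" shows "((\<lambda>s. W1 (\<mu> (clamp_time s)) (\<mu> (clamp_time s0))) \<longlongrightarrow> 0) (nhds s0)"
proof -
  obtain J where J: "continuous_on {0..T} J" "\<And>s t. 0 \<le> s \<Longrightarrow> s \<le> t \<Longrightarrow> t \<le> T \<Longrightarrow> W1 (\<mu> s) (\<mu> t) \<le> J t - J s"
    using \<mu> unfolding curve_def by blast
  have c: "continuous_on UNIV (\<lambda>s. J (clamp_time s))"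
    by (rule continuous_on_compose2[OF J(1)]) (use clamp_time in \<open>auto simp: continuous_on_eq_continuous_at\<close>)
  then have "((\<lambda>s. J (clamp_time s)) \<longlongrightarrow> J (clamp_time s0)) (nhds s0)"
    using tendsto_at_iff_tendsto_nhds[of "\<lambda>s. J (clamp_time s)" s0] by (simp add: continuous_on_eq_continuous_at isCont_def)
  then have lim: "((\<lambda>s. \<bar>J (clamp_time s) - J (clamp_time s0)\<bar>) \<longlongrightarrow> 0) (nhds s0)"
    by (intro tendsto_rabs_zero) (simp add: LIM_zero_iff)
  have "\<bar>W1 (\<mu> a) (\<mu> b)\<bar> \<le> \<bar>J a - J b\<bar>" if ab: "a \<in> {0..T}" "b \<in> {0..T}" for a b
  proof -
    have nn: "0 \<le> W1 (\<mu> a) (\<mu> b)" by (intro W1_nonneg Prob_c_D(1) curve_Prob[OF \<mu>] ab)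
    show ?thesis
    proof (cases "a \<le> b")
      case True then show ?thesis using J(2)[of a b] ab nn by auto
    next
      case False
      have "W1 (\<mu> a) (\<mu> b) = W1 (\<mu> b) (\<mu> a)" by (intro W1_commute curve_Prob[OF \<mu>] ab)
      then show ?thesis using J(2)[of b a] ab nn False by auto
    qed
  qed
  then show ?thesis using clamp_time(1)
    by (intro Lim_null_comparison[OF always_eventually lim]) auto
qed

lemma curve_seq:
  assumes \<mu>: "curve \<mu>" and q: "q \<longlonglongrightarrow> t" and t: "t \<in> {0..T}"
  shows "(\<lambda>n. W1 (\<mu> (clamp_time (q n))) (\<mu> t)) \<longlonglongrightarrow> 0"
proof -
  have "(\<lambda>n. W1 (\<mu> (clamp_time (q n))) (\<mu> (clamp_time t))) \<longlonglongrightarrow> 0"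
    using filterlim_compose[OF curve_tendsto[OF \<mu>, of t] q] by simp
  then show ?thesis using clamp_time(2)[OF t] by simp
qed

section \<open>Joint measurability along curves\<close>

definition vfield :: "(real \<Rightarrow> 'a measure) \<Rightarrow> real \<Rightarrow> real \<times> 'u \<times> 'a \<Rightarrow> 'a" where
  "vfield \<mu> t y = v t (\<mu> (clamp_time (fst y))) (fst (snd y)) (proj (snd (snd y)))"

text \<open>With the measure frozen at time s0 the map is continuous by hypothesis; changing the
  measure costs at most \<open>L t\<close> times a \<open>W1\<close> distance that tends to
  0.\<close>

lemma vfield_isCont:
  assumes \<mu>: "curve \<mu>" and t: "t \<in> S" shows "isCont (vfield \<mu> t) y"
proof -
  obtain s0 u0 x0 where y: "y = (s0, u0, x0)" by (cases y) auto
  let ?\<nu> = "\<mu> (clamp_time s0)"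
  have \<nu>: "?\<nu> \<in> Prob_on K" using curve_Prob[OF \<mu> clamp_time(1)] by simp
  define h where "h z = v t ?\<nu> (fst (snd z)) (proj (snd (snd z)))" for z :: "real \<times> 'u \<times> 'a"
  define g where "g = (\<lambda>(u, x). v t ?\<nu> u x)"
  define f where "f z = (fst (snd z), proj (snd (snd z)))" for z :: "real \<times> 'u \<times> 'a"
  have "isCont (\<lambda>z. proj (snd (snd z))) y" by (rule isCont_o2[OF _ proj(3)]) (intro continuous_intros)
  then have "isCont f y" unfolding f_def by (intro continuous_intros)
  moreover have "isCont g (f y)" unfolding g_def using v_continuous[OF t Prob_on_K[OF \<nu>]] by (simp add: continuous_on_eq_continuous_at f_def)
  ultimately have "isCont (\<lambda>z. g (f z)) y" by (rule isCont_o2)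
  then have h: "isCont h y" by (simp add: h_def [abs_def] g_def f_def)
  have "((\<lambda>z. W1 (\<mu> (clamp_time (fst z))) ?\<nu>) \<longlongrightarrow> 0) (at y)"
  proof (rule filterlim_compose[OF curve_tendsto[OF \<mu>]])
    show "filterlim fst (nhds s0) (at y)" using tendsto_fst[OF tendsto_ident_at, of y UNIV] by (simp add: y)
  qed
  then have lim: "((\<lambda>z. L t * W1 (\<mu> (clamp_time (fst z))) ?\<nu>) \<longlongrightarrow> 0) (at y)" by (rule tendsto_mult_right_zero)
  have "((\<lambda>z. vfield \<mu> t z - h z) \<longlongrightarrow> 0) (at y)"
  proof (rule Lim_null_comparison[OF always_eventually lim], rule allI)
    fix z show "norm (vfield \<mu> t z - h z) \<le> L t * W1 (\<mu> (clamp_time (fst z))) ?\<nu>"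
      unfolding vfield_def h_def using v_W1[OF t curve_Prob(1)[OF \<mu> clamp_time(1)] \<nu> proj(1)] .
  qed
  then have "((\<lambda>z. (vfield \<mu> t z - h z) + h z) \<longlongrightarrow> 0 + h y) (at y)" using h by (intro tendsto_add) (auto simp: isCont_def)
  moreover have "h y = vfield \<mu> t y" by (simp add: h_def vfield_def y)
  ultimately show ?thesis by (simp add: isCont_def)
qed

text \<open>The projection extends the velocity field from K to the whole space, so that bounds
  known on K hold everywhere.\<close>

definition W :: "(real \<Rightarrow> 'a measure) \<Rightarrow> (real \<Rightarrow> 'u) \<Rightarrow> real \<times> 'a \<Rightarrow> 'a" where
  "W \<mu> u z = v (fst z) (\<mu> (clamp_time (fst z))) (u (fst z)) (proj (snd z))"

lemma W_eq: "t \<in> S \<Longrightarrow> x \<in> K \<Longrightarrow> W \<mu> u (t, x) = v t (\<mu> t) (u t) x"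
  using S_T by (simp add: W_def clamp_time(2) proj(2))

lemma W_measurable:
  assumes \<mu>: "curve \<mu>" and Y: "countable Y" and uY: "\<And>t. t \<in> S \<Longrightarrow> u t \<in> closure Y"
    and um: "\<And>y. y \<in> Y \<Longrightarrow> (\<lambda>t. dist (u t) y) \<in> borel_measurable M"
  shows "W \<mu> u \<in> borel_measurable (M \<Otimes>\<^sub>M borel)"
proof -
  obtain D1 :: "real set" where D1: "countable D1" "closure D1 = UNIV" by (rule countable_dense_closure)
  obtain D2 :: "'a set" where D2: "countable D2" "closure D2 = UNIV" by (rule countable_dense_closure)
  have "(\<lambda>z. vfield \<mu> (fst z) (fst z, u (fst z), snd z)) \<in> borel_measurable (M \<Otimes>\<^sub>M borel)"
  proof (rule Caratheodory_measurable[where Y = "D1 \<times> Y \<times> D2" and h = "\<lambda>z. vfield \<mu> (fst z)" and f = "\<lambda>z. (fst z, u (fst z), snd z)"])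
    show "countable (D1 \<times> Y \<times> D2)" using D1 D2 Y by auto
    fix y assume y: "y \<in> D1 \<times> Y \<times> D2"
    have "(\<lambda>t. vfield \<mu> t y) \<in> borel_measurable M"
      unfolding vfield_def by (rule v_measurable[OF curve_Prob(2)[OF \<mu> clamp_time(1)]])
    then show "(\<lambda>z. vfield \<mu> (fst z) y) \<in> borel_measurable (M \<Otimes>\<^sub>M borel)"
      by (rule measurable_compose[OF measurable_fst])
    have m1: "(\<lambda>t. dist t (fst y)) \<in> borel_measurable M"
    proof -
      have "(\<lambda>t. dist t (fst y)) \<in> borel_measurable lebesgue"
        by (intro measurable_completion) simp
      then show ?thesis by (rule measurable_restrict_space1)
    qed
    have m2: "(\<lambda>t. dist (u t) (fst (snd y))) \<in> borel_measurable M" using y by (intro um) auto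
    have [measurable]: "(\<lambda>z. dist (fst z) (fst y)) \<in> borel_measurable (M \<Otimes>\<^sub>M (borel :: 'a measure))"
      "(\<lambda>z. dist (u (fst z)) (fst (snd y))) \<in> borel_measurable (M \<Otimes>\<^sub>M (borel :: 'a measure))"
      "(\<lambda>z. dist (snd z) (snd (snd y))) \<in> borel_measurable (M \<Otimes>\<^sub>M (borel :: 'a measure))"
      by (rule measurable_compose[OF measurable_fst m1], rule measurable_compose[OF measurable_fst m2], measurable)
    show "(\<lambda>z. dist (fst z, u (fst z), snd z) y) \<in> borel_measurable (M \<Otimes>\<^sub>M borel)"
      unfolding dist_prod_def fst_conv snd_conv by measurable
  next
    fix z assume z: "z \<in> space (M \<Otimes>\<^sub>M (borel :: 'a measure))"
    then have zS: "fst z \<in> S" by (auto simp: space_pair_measure)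
    show "isCont (vfield \<mu> (fst z)) (fst z, u (fst z), snd z)" by (rule vfield_isCont[OF \<mu> zS])
    show "(fst z, u (fst z), snd z) \<in> closure (D1 \<times> Y \<times> D2)"
      unfolding closure_Times using D1 D2 uY[OF zS] by auto
  qed
  then show ?thesis by (simp add: W_def [abs_def] vfield_def)
qed

lemma essentially_separable:
  fixes u :: "real \<Rightarrow> 'u"
  assumes u: "u \<in> borel_measurable M"
  obtains Y N where "countable Y" "N \<in> null_sets M" "\<And>t. t \<in> S - N \<Longrightarrow> u t \<in> closure Y"
proof -
  note LB = lebesgue_on_bounded[OF S(1,2)]
  have "\<exists>Y N. countable Y \<and> N \<in> null_sets M \<and> (\<forall>t\<in>space M - N. {u t} \<subseteq> closure Y)"
  proof (rule compact_multifunction_essentially_separable[OF LB, of "\<lambda>t. {u t}"])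
    fix G :: "'u set" assume "open G"
    then have "u -` G \<inter> space M \<in> sets M" using u by (intro measurable_sets[OF u]) auto
    moreover have "{t \<in> space M. {u t} \<inter> G \<noteq> {}} = u -` G \<inter> space M" by auto
    ultimately show "{t \<in> space M. {u t} \<inter> G \<noteq> {}} \<in> sets M" by simp
  qed (assumption+, simp, blast)
  then show thesis using that by auto
qed

text \<open>The control is separably valued off a null set; overwriting it there by a constant gives
  a version to which the separable case applies.\<close>

lemma W_joint_measurable:
  assumes \<mu>: "curve \<mu>" and u: "u \<in> borel_measurable M"
  obtains u' where "AE t in M. u' t = u t" "W \<mu> u' \<in> borel_measurable (M \<Otimes>\<^sub>M borel)"
proof -
  obtain Y N where Y: "countable Y" and N: "N \<in> null_sets M" and uY: "\<And>t. t \<in> S - N \<Longrightarrow> u t \<in> closure Y"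
    by (rule essentially_separable[OF u]) blast
  define c :: 'u where "c = undefined"
  define u' where "u' t = (if t \<in> N then c else u t)" for t
  have "W \<mu> u' \<in> borel_measurable (M \<Otimes>\<^sub>M borel)"
  proof (rule W_measurable[OF \<mu>, of "insert c Y"])
    show "u' t \<in> closure (insert c Y)" if "t \<in> S" for t
    proof (cases "t \<in> N")
      case True
      have "c \<in> closure (insert c Y)" using closure_subset[of "insert c Y"] by auto
      then show ?thesis using True by (simp add: u'_def)
    next
      case False
      then have "u t \<in> closure (insert c Y)" using uY[of t] that closure_mono[OF subset_insertI[of Y c]] by blast
      then show ?thesis using False by (simp add: u'_def)
    qed
    fix y
    have "(\<lambda>t. dist (u t) y) \<in> borel_measurable M"
      by (rule measurable_compose[OF u]) (intro borel_measurable_continuous_onI continuous_intros)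
    moreover have "N \<in> sets M" using N by auto
    ultimately have "(\<lambda>t. if t \<in> N then dist c y else dist (u t) y) \<in> borel_measurable M" by measurable
    moreover have "(\<lambda>t. dist (u' t) y) = (\<lambda>t. if t \<in> N then dist c y else dist (u t) y)" by (auto simp: u'_def)
    ultimately show "(\<lambda>t. dist (u' t) y) \<in> borel_measurable M" by simp
  qed (use Y in auto)
  moreover have "AE t in M. u' t = u t" by (rule AE_I'[OF N]) (auto simp: u'_def)
  ultimately show thesis by (rule that[rotated])
qed

text \<open>Measurability is known at a fixed measure, hence along the piecewise constant curves
  obtained by rounding time. Passing to the limit uses both halves of continuity: a hit with an open
  set persists by lower semicontinuity, and avoidance of a closed set persists by upper
  semicontinuity.\<close>

lemma U_curve_measurable:
  assumes \<mu>: "curve \<mu>" and G: "open G"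
  shows "{t \<in> S. U t (\<mu> t) \<inter> G \<noteq> {}} \<in> sets lebesgue"
proof -
  define q where "q n t = real_of_int \<lfloor>real (Suc n) * t\<rfloor> / real (Suc n)" for n t
  have q: "(\<lambda>n. q n t) \<longlonglongrightarrow> t" for t
  proof -
    have "\<bar>q n t - t\<bar> \<le> 1 / Suc n" for n
    proof -
      have "\<bar>real_of_int \<lfloor>real (Suc n) * t\<rfloor> - real (Suc n) * t\<bar> \<le> 1" by linarith
      then have "\<bar>real_of_int \<lfloor>real (Suc n) * t\<rfloor> - real (Suc n) * t\<bar> / Suc n \<le> 1 / Suc n" by (intro divide_right_mono) auto
      moreover have "q n t - t = (real_of_int \<lfloor>real (Suc n) * t\<rfloor> - real (Suc n) * t) / Suc n" by (simp add: q_def diff_divide_distrib)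
      ultimately show ?thesis by simp
    qed
    then have "(\<lambda>n. q n t - t) \<longlonglongrightarrow> 0"
      by (intro Lim_null_comparison[OF always_eventually LIMSEQ_Suc[OF lim_1_over_n]]) auto
    then show ?thesis by (simp add: LIM_zero_iff)
  qed
  have meas: "{t \<in> S. U t (\<mu> (clamp_time (q n t))) \<inter> G \<noteq> {}} \<in> sets lebesgue" if "open G" for n G
  proof -
    have "{t \<in> S. U t (\<mu> (clamp_time (q n t))) \<inter> G \<noteq> {}} =
      (\<Union>z::int. {t. \<lfloor>real (Suc n) * t\<rfloor> = z} \<inter> {t \<in> S. U t (\<mu> (clamp_time (real_of_int z / real (Suc n)))) \<inter> G \<noteq> {}})"
      by (auto simp: q_def)
    moreover have "{t. \<lfloor>real (Suc n) * t\<rfloor> = z} \<in> sets lebesgue" for z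
    proof -
      have "{t \<in> space borel. \<lfloor>real (Suc n) * t\<rfloor> = z} \<in> sets borel" by measurable
      then show ?thesis by simp
    qed
    ultimately show ?thesis
      using that curve_Prob(2)[OF \<mu> clamp_time(1)]
      by (auto intro!: sets.countable_UN'' sets.Int U_measurable)
  qed
  \<comment> \<open>Open sets inside closed sets inside G, exhausting G, so that hits and misses are
    compared with a margin. The full space is treated apart because the distance to the empty set is
    0 by convention.\<close>
  define H where "H k = {y. G = UNIV \<or> infdist y (- G) > 1 / Suc k}" for k :: nat
  define H' where "H' k = {y. G = UNIV \<or> infdist y (- G) \<ge> 1 / Suc k}" for k :: nat
  have Ho: "open (H k)" for k
  proof (cases "G = UNIV")
    case False
    have "open {y. infdist y (- G) > 1 / Suc k}" by (intro open_Collect_less continuous_intros)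
    then show ?thesis using False by (simp add: H_def)
  qed (simp add: H_def)
  have H'c: "closed (H' k)" for k
  proof (cases "G = UNIV")
    case False
    have "closed {y. infdist y (- G) \<ge> 1 / Suc k}" by (intro closed_Collect_le continuous_intros)
    then show ?thesis using False by (simp add: H'_def)
  qed (simp add: H'_def)
  have HH': "H k \<subseteq> H' k" for k by (auto simp: H_def H'_def)
  have H'G: "H' k \<subseteq> G" for k
  proof
    fix y assume y: "y \<in> H' k"
    show "y \<in> G"
    proof (rule ccontr)
      assume "y \<notin> G"
      then have "infdist y (- G) = 0" "G \<noteq> UNIV" by auto
      then show False using y by (simp add: H'_def)
    qed
  qed
  have HG: "\<exists>k. y \<in> H k" if "y \<in> G" for y
  proof (cases "G = UNIV")
    case False
    then have "- G \<noteq> {}" "closed (- G)" using G by auto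
    then have "infdist y (- G) \<noteq> 0" using that in_closed_iff_infdist_zero[of "- G" y] by auto
    then have "infdist y (- G) > 0" using infdist_nonneg[of y "- G"] by linarith
    then obtain k where "inverse (real (Suc k)) < infdist y (- G)" using reals_Archimedean by blast
    then show ?thesis by (auto simp: H_def inverse_eq_divide)
  qed (simp add: H_def)
  have "{t \<in> S. U t (\<mu> t) \<inter> G \<noteq> {}} = (\<Union>k. \<Union>n0. \<Inter>n\<in>{n0..}. {t \<in> S. U t (\<mu> (clamp_time (q n t))) \<inter> H k \<noteq> {}})" (is "?A = ?B")
  proof (intro equalityI subsetI)
    fix t assume t: "t \<in> ?A"
    then obtain y where y: "y \<in> U t (\<mu> t)" "y \<in> G" and tS: "t \<in> S" by auto
    obtain k where k: "y \<in> H k" using HG[OF y(2)] ..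
    have "openin W1_topology {\<nu> \<in> Prob_c. U t \<nu> \<inter> H k \<noteq> {}}"
      using U_continuous[OF tS] Ho unfolding setmap_W1_continuous_def by blast
    then have "\<forall>\<^sub>F n in sequentially. \<mu> (clamp_time (q n t)) \<in> {\<nu> \<in> Prob_c. U t \<nu> \<inter> H k \<noteq> {}}"
      using y k curve_Prob(2)[OF \<mu> S_T[OF tS]] curve_Prob(2)[OF \<mu> clamp_time(1)]
      by (intro W1_topology_eventually[OF _ _ _ curve_seq[OF \<mu> q S_T[OF tS]]]) auto
    then obtain n0 where "\<And>n. n \<ge> n0 \<Longrightarrow> U t (\<mu> (clamp_time (q n t))) \<inter> H k \<noteq> {}" by (auto simp: eventually_sequentially)
    then show "t \<in> ?B" using tS by blast
  next
    fix t assume "t \<in> ?B"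
    then obtain k n0 where n0: "\<And>n. n \<ge> n0 \<Longrightarrow> U t (\<mu> (clamp_time (q n t))) \<inter> H k \<noteq> {}" and tS: "t \<in> S" by fastforce
    show "t \<in> ?A"
    proof (rule ccontr)
      assume "t \<notin> ?A"
      then have "U t (\<mu> t) \<subseteq> - H' k" using H'G[of k] tS by auto
      moreover have "openin W1_topology {\<nu> \<in> Prob_c. U t \<nu> \<subseteq> - H' k}"
        using U_continuous[OF tS] H'c[of k] unfolding setmap_W1_continuous_def by (auto simp: open_Compl)
      ultimately have "\<forall>\<^sub>F n in sequentially. \<mu> (clamp_time (q n t)) \<in> {\<nu> \<in> Prob_c. U t \<nu> \<subseteq> - H' k}"
        using curve_Prob(2)[OF \<mu> S_T[OF tS]] curve_Prob(2)[OF \<mu> clamp_time(1)]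
        by (intro W1_topology_eventually[OF _ _ _ curve_seq[OF \<mu> q S_T[OF tS]]]) auto
      then have "\<forall>\<^sub>F n in sequentially. False"
        using eventually_ge_at_top[of n0] by eventually_elim (use n0 HH'[of k] in blast)
      then show False by simp
    qed
  qed
  moreover have "?B \<in> sets lebesgue"
  proof -
    have "(\<Inter>n\<in>{n0..}. {t \<in> S. U t (\<mu> (clamp_time (q n t))) \<inter> H k \<noteq> {}}) \<in> sets lebesgue" for k n0
      by (intro sets.countable_INT' ) (auto intro: meas[OF Ho])
    then show ?thesis by (intro sets.countable_UN'') auto
  qed
  ultimately show ?thesis by simp
qed

end

section \<open>Passing to the limit\<close>

definition full_in :: "real \<Rightarrow> real set \<Rightarrow> bool" where
  "full_in T A \<longleftrightarrow> A \<in> sets lebesgue \<and> A \<subseteq> {0..T} \<and> {0..T} - A \<in> null_sets lebesgue"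

lemma full_in_diff_null:
  assumes A: "full_in T A" and N: "N \<in> null_sets (lebesgue_on A)" shows "full_in T (A - N)"
proof -
  have Nn: "N \<in> null_sets lebesgue" using N A by (simp add: null_sets_restrict_space full_in_def)
  have "{0..T} - (A - N) \<subseteq> ({0..T} - A) \<union> N" by auto
  moreover have "({0..T} - A) \<union> N \<in> null_sets lebesgue" using A Nn by (auto simp: full_in_def)
  moreover have "{0..T} - (A - N) \<in> sets lebesgue"
    using A null_setsD2[OF Nn] by (intro sets.Diff) (auto simp: full_in_def)
  ultimately have "{0..T} - (A - N) \<in> null_sets lebesgue" by (metis null_sets_subset)
  then show ?thesis using A Nn by (auto simp: full_in_def)
qed

lemma full_in_Int:
  assumes A: "full_in T A" and B: "full_in T B" shows "full_in T (A \<inter> B)"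
proof -
  have "{0..T} - (A \<inter> B) = ({0..T} - A) \<union> ({0..T} - B)" by auto
  then show ?thesis using A B by (auto simp: full_in_def)
qed

lemma full_in_AE:
  assumes A: "full_in T A" and AE: "AE t in lebesgue_on A. P t"
  obtains B where "full_in T B" "B \<subseteq> A" "\<And>t. t \<in> B \<Longrightarrow> P t"
proof -
  obtain N where N: "{t \<in> space (lebesgue_on A). \<not> P t} \<subseteq> N" "emeasure (lebesgue_on A) N = 0" "N \<in> sets (lebesgue_on A)"
    using AE by (rule AE_E)
  then have "N \<in> null_sets (lebesgue_on A)" by auto
  from full_in_diff_null[OF A this] show thesis by (rule that) (use N(1) in auto)
qed

lemma full_in_AE_I:
  assumes A: "full_in T A" and P: "\<And>t. t \<in> A \<Longrightarrow> P t" and B: "B \<in> sets lebesgue" "B \<subseteq> {0..T}"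
  shows "AE t in lebesgue_on B. P t"
proof -
  have "AE t in lebesgue. t \<notin> {0..T} - A" using A by (intro AE_not_in) (simp add: full_in_def)
  then have "AE t in lebesgue. t \<in> B \<longrightarrow> P t" by eventually_elim (use P B in auto)
  then show ?thesis using B by (simp add: AE_restrict_space_iff)
qed

lemma full_in_integral:
  fixes f g :: "real \<Rightarrow> real"
  assumes A: "full_in T A" and B: "full_in T B" and eq: "\<And>t. t \<in> A \<inter> B \<Longrightarrow> f t = g t"
  shows "set_integrable lebesgue {0..T} f \<longleftrightarrow> integrable (lebesgue_on B) g"
    "integrable (lebesgue_on B) g \<Longrightarrow> (LINT t:{0..T}|lebesgue. f t) = (\<integral>t. g t \<partial>lebesgue_on B)"
proof -
  have C: "full_in T (A \<inter> B)" by (rule full_in_Int[OF A B])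
  note c = lebesgue_on_full_subset[of "A \<inter> B" T] and b = lebesgue_on_full_subset[of B T]
  have i: "integrable (lebesgue_on (A \<inter> B)) f \<longleftrightarrow> integrable (lebesgue_on (A \<inter> B)) g"
    by (rule Bochner_Integration.integrable_cong) (use eq in auto)
  have v: "(\<integral>t. f t \<partial>lebesgue_on (A \<inter> B)) = (\<integral>t. g t \<partial>lebesgue_on (A \<inter> B))"
    by (rule Bochner_Integration.integral_cong) (use eq in auto)
  have cf: "set_integrable lebesgue {0..T} f \<longleftrightarrow> integrable (lebesgue_on (A \<inter> B)) f"
    "set_integrable lebesgue {0..T} g \<longleftrightarrow> integrable (lebesgue_on (A \<inter> B)) g"
    "set_integrable lebesgue {0..T} g \<longleftrightarrow> integrable (lebesgue_on B) g"
    using c(1) b(1) B C by (auto simp: full_in_def)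
  show 1: "set_integrable lebesgue {0..T} f \<longleftrightarrow> integrable (lebesgue_on B) g" using cf i by simp
  assume ig: "integrable (lebesgue_on B) g"
  have "(LINT t:{0..T}|lebesgue. f t) = (\<integral>t. f t \<partial>lebesgue_on (A \<inter> B))"
    using c(2)[of f] ig 1 cf C by (auto simp: full_in_def)
  also have "\<dots> = (LINT t:{0..T}|lebesgue. g t)" using c(2)[of g] ig cf C v by (auto simp: full_in_def)
  also have "\<dots> = (\<integral>t. g t \<partial>lebesgue_on B)" using b(2)[of g] ig B by (auto simp: full_in_def)
  finally show "(LINT t:{0..T}|lebesgue. f t) = (\<integral>t. g t \<partial>lebesgue_on B)" .
qed

context control_system
begin

lemma full_S: "full_in T S" using S by (simp add: full_in_def)

section \<open>Pairing bounded fields with curves\<close>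

text \<open>On the ball both the norm of a point and the first moment of a measure are at most R,
  whence \<open>1 + 2 * R\<close>.\<close>

definition \<beta> :: "real \<Rightarrow> real" where "\<beta> t = m t * (1 + 2 * R)"

lemma \<beta>_nonneg: "t \<in> S \<Longrightarrow> 0 \<le> \<beta> t"
  using m R S_T by (auto simp: \<beta>_def L1_nonneg_def)

lemma \<beta>_integrable: "integrable M \<beta>"
proof -
  have "integrable M m" using m lebesgue_on_full_subset(1)[OF S] by (simp add: L1_nonneg_def)
  then show ?thesis unfolding \<beta>_def by simp
qed

lemma v_bound:
  assumes "t \<in> S" "\<mu> \<in> Prob_on K" "x \<in> K" shows "norm (v t \<mu> u x) \<le> \<beta> t"
proof -
  have i: "integrable \<mu> (\<lambda>x. norm x)" by (rule integrable_Prob_on[OF assms(2) compact_cball]) (intro continuous_intros)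
  have "moment1 \<mu> \<le> R" unfolding moment1_def by (rule integral_Prob_on_le[OF assms(2) i]) simp
  moreover have "0 \<le> m t" using m S_T[OF assms(1)] by (simp add: L1_nonneg_def)
  moreover have "norm x \<le> R" using assms(3) by simp
  ultimately have "m t * (1 + norm x + moment1 \<mu>) \<le> m t * (1 + 2 * R)" by (intro mult_left_mono) auto
  then show ?thesis using growth[OF assms(1) Prob_on_K[OF assms(2)], of u x] by (simp add: \<beta>_def)
qed

definition bounded_field :: "(real \<times> 'a \<Rightarrow> 'a) \<Rightarrow> bool" where
  "bounded_field w \<longleftrightarrow> w \<in> borel_measurable (M \<Otimes>\<^sub>M borel) \<and> (\<forall>t\<in>S. \<forall>x. norm (w (t, x)) \<le> \<beta> t)"

lemma W_bounded: "curve \<mu> \<Longrightarrow> t \<in> S \<Longrightarrow> norm (W \<mu> u (t, x)) \<le> \<beta> t"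
  unfolding W_def fst_conv snd_conv by (rule v_bound[OF _ curve_Prob(1)[OF _ clamp_time(1)] proj(1)])

lemma W_bounded_field: "curve \<mu> \<Longrightarrow> W \<mu> u \<in> borel_measurable (M \<Otimes>\<^sub>M borel) \<Longrightarrow> bounded_field (W \<mu> u)"
  by (simp add: bounded_field_def W_bounded)

lemma bounded_field_combination:
  assumes w: "\<And>k. bounded_field (w k)" and c: "\<And>k. 0 \<le> c k" "(\<Sum>k\<in>I. c k) = 1"
  shows "bounded_field (\<lambda>z. \<Sum>k\<in>I. c k *\<^sub>R w k z)"
  unfolding bounded_field_def
proof (intro conjI ballI allI)
  show "(\<lambda>z. \<Sum>k\<in>I. c k *\<^sub>R w k z) \<in> borel_measurable (M \<Otimes>\<^sub>M borel)"
    using w by (intro borel_measurable_sum borel_measurable_scaleR) (auto simp: bounded_field_def)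
  fix t x assume t: "t \<in> S"
  have "norm (\<Sum>k\<in>I. c k *\<^sub>R w k (t, x)) \<le> (\<Sum>k\<in>I. norm (c k *\<^sub>R w k (t, x)))" by (rule norm_sum)
  also have "\<dots> \<le> (\<Sum>k\<in>I. c k * \<beta> t)"
  proof (rule sum_mono)
    fix k
    have "norm (w k (t, x)) \<le> \<beta> t" using w t by (auto simp: bounded_field_def)
    from mult_left_mono[OF this c(1)[of k]] show "norm (c k *\<^sub>R w k (t, x)) \<le> c k * \<beta> t" using c(1)[of k] by simp
  qed
  also have "\<dots> = \<beta> t" using c(2) by (simp add: sum_distrib_right[symmetric])
  finally show "norm (\<Sum>k\<in>I. c k *\<^sub>R w k (t, x)) \<le> \<beta> t" .
qed

lemma curve_integral_measurable:
  fixes f :: "'a \<Rightarrow> real"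
  assumes \<mu>: "curve \<mu>" and f: "C-lipschitz_on UNIV f"
  shows "(\<lambda>t. \<integral>x. f x \<partial>\<mu> t) \<in> borel_measurable M"
proof -
  obtain J where J: "continuous_on {0..T} J" "\<And>s t. 0 \<le> s \<Longrightarrow> s \<le> t \<Longrightarrow> t \<le> T \<Longrightarrow> W1 (\<mu> s) (\<mu> t) \<le> J t - J s"
    using \<mu> unfolding curve_def by blast
  have "continuous_on {0..T} (\<lambda>t. \<integral>x. f x \<partial>\<mu> t)"
    by (rule W1_curve_Lipschitz_continuous[OF J(1) curve_Prob(2)[OF \<mu>] J(2) f])
  then show ?thesis by (intro continuous_imp_measurable_on_sets_lebesgue continuous_on_subset[OF _ S(2)] S(1))
qed

definition pairing :: "(real \<times> 'a \<Rightarrow> real) \<Rightarrow> (real \<times> 'a \<Rightarrow> 'a) \<Rightarrow> (real \<Rightarrow> 'a measure) \<Rightarrow> (real \<times> 'a \<Rightarrow> 'a) \<Rightarrow> real \<Rightarrow> real" where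
  "pairing P Q \<mu> w t = (\<integral>x. P (t, x) + Q (t, x) \<bullet> w (t, x) \<partial>\<mu> t)"

context
  fixes P :: "real \<times> 'a \<Rightarrow> real" and Q :: "real \<times> 'a \<Rightarrow> 'a" and B :: real
  assumes B: "0 \<le> B" and Pb: "\<And>p. \<bar>P p\<bar> \<le> B" and Qb: "\<And>p. norm (Q p) \<le> B"
    and Pl: "B-lipschitz_on UNIV P" and Ql: "B-lipschitz_on UNIV Q"
begin

lemma integrand_bound: assumes "norm y \<le> b" shows "\<bar>P p + Q p \<bullet> y\<bar> \<le> B * (1 + b)"
proof -
  have "\<bar>Q p \<bullet> y\<bar> \<le> norm (Q p) * norm y" by (rule Cauchy_Schwarz_ineq2)
  also have "\<dots> \<le> B * b" using Qb assms B by (intro mult_mono) auto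
  finally show ?thesis using Pb[of p] by (simp add: distrib_left)
qed

lemma integrand_measurable:
  assumes w: "bounded_field w"
  shows "(\<lambda>(t, x). P (t, x) + Q (t, x) \<bullet> w (t, x)) \<in> borel_measurable (M \<Otimes>\<^sub>M borel)"
proof -
  have "(\<lambda>t. t) \<in> borel_measurable M" by (intro continuous_imp_measurable_on_sets_lebesgue continuous_on_id S(1))
  then have f: "fst \<in> borel_measurable (M \<Otimes>\<^sub>M (borel :: 'a measure))" by (rule measurable_compose[OF measurable_fst])
  have s: "snd \<in> borel_measurable (M \<Otimes>\<^sub>M (borel :: 'a measure))" by (rule measurable_snd)
  have id: "(\<lambda>z. (fst z, snd z)) \<in> borel_measurable (M \<Otimes>\<^sub>M (borel :: 'a measure))" by (rule borel_measurable_Pair[OF f s])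
  have Pm: "(\<lambda>z. P (fst z, snd z)) \<in> borel_measurable (M \<Otimes>\<^sub>M borel)" and Qm: "(\<lambda>z. Q (fst z, snd z)) \<in> borel_measurable (M \<Otimes>\<^sub>M borel)"
    using measurable_compose[OF id borel_measurable_continuous_onI[OF lipschitz_on_continuous_on[OF Pl]]]
      measurable_compose[OF id borel_measurable_continuous_onI[OF lipschitz_on_continuous_on[OF Ql]]] by auto
  have "(\<lambda>z. P (fst z, snd z) + Q (fst z, snd z) \<bullet> w z) \<in> borel_measurable (M \<Otimes>\<^sub>M borel)"
    using Pm Qm w by (intro borel_measurable_add borel_measurable_inner) (auto simp: bounded_field_def)
  then show ?thesis by (simp add: split_beta)
qed

lemma section_measurable:
  assumes w: "bounded_field w" and t: "t \<in> S"
  shows "(\<lambda>x. P (t, x) + Q (t, x) \<bullet> w (t, x)) \<in> borel_measurable borel"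
  using measurable_compose[OF measurable_Pair1'[of t M borel] integrand_measurable[OF w]] t by simp

lemma pairing_integrand_integrable:
  assumes \<mu>: "curve \<mu>" and w: "bounded_field w" and t: "t \<in> S"
  shows "integrable (\<mu> t) (\<lambda>x. P (t, x) + Q (t, x) \<bullet> w (t, x))"
proof (rule integrable_Prob_on_bounded[OF curve_Prob(1)[OF \<mu> S_T[OF t]] section_measurable[OF w t]])
  show "norm (P (t, x) + Q (t, x) \<bullet> w (t, x)) \<le> B * (1 + \<beta> t)" for x
    using integrand_bound[of "w (t, x)" "\<beta> t" "(t, x)"] w t by (auto simp: bounded_field_def)
qed

lemma pairing_bound:
  assumes \<mu>: "curve \<mu>" and w: "bounded_field w" and t: "t \<in> S"
  shows "norm (pairing P Q \<mu> w t) \<le> B * (1 + \<beta> t)"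
  unfolding pairing_def
proof (rule norm_integral_Prob_on_le[OF curve_Prob(1)[OF \<mu> S_T[OF t]] pairing_integrand_integrable[OF \<mu> w t]])
  show "norm (P (t, x) + Q (t, x) \<bullet> w (t, x)) \<le> B * (1 + \<beta> t)" for x
    using integrand_bound[of "w (t, x)" "\<beta> t" "(t, x)"] w t by (auto simp: bounded_field_def)
qed

lemma dominating_integrable: "integrable M (\<lambda>t. C * (1 + \<beta> t))"
proof -
  interpret finite_measure M by (rule lebesgue_on_bounded(1)[OF S(1,2)])
  show ?thesis using \<beta>_integrable by simp
qed

lemma pairing_measurable:
  assumes \<mu>: "curve \<mu>" and w: "bounded_field w"
  shows "pairing P Q \<mu> w \<in> borel_measurable M"
proof -
  have "\<mu> \<in> measurable M (subprob_algebra borel)"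
  proof (rule Prob_kernel_measurable)
    show "\<mu> t \<in> Prob" if "t \<in> space M" for t using that S_T by (intro Prob_c_D(1) curve_Prob(2)[OF \<mu>]) simp
  qed (rule curve_integral_measurable[OF \<mu>])
  from integral_kernel_measurable[OF this integrand_measurable[OF w]]
  show ?thesis unfolding pairing_def [abs_def] by simp
qed

lemma pairing_integrable:
  assumes \<mu>: "curve \<mu>" and w: "bounded_field w"
  shows "integrable M (pairing P Q \<mu> w)"
proof (rule Bochner_Integration.integrable_bound[OF dominating_integrable[of B] pairing_measurable[OF assms]])
  show "AE t in M. norm (pairing P Q \<mu> w t) \<le> norm (B * (1 + \<beta> t))"
  proof (rule AE_I2)
    fix t assume "t \<in> space M"
    then have t: "t \<in> S" by simp
    show "norm (pairing P Q \<mu> w t) \<le> norm (B * (1 + \<beta> t))"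
      using pairing_bound[OF assms t] B \<beta>_nonneg[OF t] by simp
  qed
qed

lemma pairing_combination:
  assumes \<mu>: "curve \<mu>" and w: "\<And>k. bounded_field (w k)" and c: "(\<Sum>k\<in>I. c k) = 1" and t: "t \<in> S"
  shows "pairing P Q \<mu> (\<lambda>z. \<Sum>k\<in>I. c k *\<^sub>R w k z) t = (\<Sum>k\<in>I. c k * pairing P Q \<mu> (w k) t)"
proof -
  have "P (t, x) + Q (t, x) \<bullet> (\<Sum>k\<in>I. c k *\<^sub>R w k (t, x)) = (\<Sum>k\<in>I. c k * (P (t, x) + Q (t, x) \<bullet> w k (t, x)))" for x
    using c by (simp add: inner_sum_right distrib_left sum.distrib sum_distrib_right[symmetric])
  then show ?thesis unfolding pairing_def
    using pairing_integrand_integrable[OF \<mu> w t] by (simp add: Bochner_Integration.integral_sum)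
qed

text \<open>A common Lipschitz constant of the fields makes the integrands Lipschitz on K with a
  constant independent of n, so \<open>W1\<close> controls the exchange of measures although the
  fields vary too.\<close>

lemma pairing_measure_convergence:
  assumes \<mu>s: "\<And>n. curve (\<mu>s n)" and \<mu>: "curve \<mu>" and w: "\<And>n. bounded_field (w n)"
    and wl: "\<And>n. C-lipschitz_on K (\<lambda>x. w n (t, x))" and t: "t \<in> S"
    and conv: "(\<lambda>n. W1 (\<mu>s n t) (\<mu> t)) \<longlonglongrightarrow> 0"
  shows "(\<lambda>n. pairing P Q (\<mu>s n) (w n) t - pairing P Q \<mu> (w n) t) \<longlonglongrightarrow> 0"
proof -
  have C: "0 \<le> C" using lipschitz_on_nonneg[OF wl] .
  have "norm (pairing P Q (\<mu>s n) (w n) t - pairing P Q \<mu> (w n) t) \<le> (B + B * \<beta> t + B * C) * W1 (\<mu>s n t) (\<mu> t)" for n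
    unfolding pairing_def real_norm_def
  proof (rule W1_Lipschitz_bound[OF curve_Prob(1)[OF \<mu>s S_T[OF t]] curve_Prob(1)[OF \<mu> S_T[OF t]] compact_cball section_measurable[OF w t]])
    show "(B + B * \<beta> t + B * C)-lipschitz_on K (\<lambda>x. P (t, x) + Q (t, x) \<bullet> w n (t, x))"
    proof (rule lipschitz_onI)
      fix x y assume xy: "x \<in> K" "y \<in> K"
      let ?w = "\<lambda>x. w n (t, x)"
      have P1: "\<bar>P (t, x) - P (t, y)\<bar> \<le> B * dist x y"
        using lipschitz_onD[OF Pl, of "(t, x)" "(t, y)"] by (simp add: dist_real_def dist_Pair_Pair)
      have Q1: "norm (Q (t, x) - Q (t, y)) \<le> B * dist x y"
        using lipschitz_onD[OF Ql, of "(t, x)" "(t, y)"] by (simp add: dist_norm[symmetric] dist_Pair_Pair)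
      have w1: "norm (?w x - ?w y) \<le> C * dist x y" using lipschitz_onD[OF wl xy] by (simp add: dist_norm)
      have "Q (t, x) \<bullet> ?w x - Q (t, y) \<bullet> ?w y = (Q (t, x) - Q (t, y)) \<bullet> ?w x + Q (t, y) \<bullet> (?w x - ?w y)"
        by (simp add: inner_diff_left inner_diff_right)
      also have "\<bar>\<dots>\<bar> \<le> \<bar>(Q (t, x) - Q (t, y)) \<bullet> ?w x\<bar> + \<bar>Q (t, y) \<bullet> (?w x - ?w y)\<bar>" by (rule abs_triangle_ineq)
      also have "\<dots> \<le> norm (Q (t, x) - Q (t, y)) * norm (?w x) + norm (Q (t, y)) * norm (?w x - ?w y)"
        by (intro add_mono Cauchy_Schwarz_ineq2)
      also have "\<dots> \<le> (B * dist x y) * \<beta> t + B * (C * dist x y)"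
        using Q1 w1 w[of n] t Qb B by (intro add_mono mult_mono) (auto simp: bounded_field_def)
      finally have "\<bar>Q (t, x) \<bullet> ?w x - Q (t, y) \<bullet> ?w y\<bar> \<le> (B * dist x y) * \<beta> t + B * (C * dist x y)" .
      with P1 show "dist (P (t, x) + Q (t, x) \<bullet> ?w x) (P (t, y) + Q (t, y) \<bullet> ?w y) \<le> (B + B * \<beta> t + B * C) * dist x y"
        by (simp add: dist_real_def algebra_simps abs_le_iff)
    qed (use B C \<beta>_nonneg[OF t] in auto)
  qed
  then show ?thesis
    by (intro Lim_null_comparison[OF always_eventually tendsto_mult_right_zero[OF conv]] allI)
qed

lemma pairing_field_convergence:
  assumes \<mu>: "curve \<mu>" and w: "\<And>n. bounded_field (w n)" and w': "bounded_field w'" and t: "t \<in> S"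
    and conv: "\<And>x. x \<in> K \<Longrightarrow> (\<lambda>n. w n (t, x)) \<longlonglongrightarrow> w' (t, x)"
  shows "(\<lambda>n. pairing P Q \<mu> (w n) t) \<longlonglongrightarrow> pairing P Q \<mu> w' t"
  unfolding pairing_def
proof (rule integral_dominated_convergence[where w = "\<lambda>_. B * (1 + \<beta> t)"])
  note PK = curve_Prob(1)[OF \<mu> S_T[OF t]]
  note pm = Prob_simps(4)[OF Prob_onD(1)[OF PK]]
  interpret prob_space "\<mu> t" by (rule Prob_simps(3)[OF Prob_onD(1)[OF PK]])
  show "(\<lambda>x. P (t, x) + Q (t, x) \<bullet> w' (t, x)) \<in> borel_measurable (\<mu> t)"
    unfolding pm by (rule section_measurable[OF w' t])
  show "(\<lambda>x. P (t, x) + Q (t, x) \<bullet> w n (t, x)) \<in> borel_measurable (\<mu> t)" for n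
    unfolding pm by (rule section_measurable[OF w t])
  show "integrable (\<mu> t) (\<lambda>_. B * (1 + \<beta> t))" by simp
  show "AE x in \<mu> t. (\<lambda>n. P (t, x) + Q (t, x) \<bullet> w n (t, x)) \<longlonglongrightarrow> P (t, x) + Q (t, x) \<bullet> w' (t, x)"
    using Prob_onD(2)[OF PK] by eventually_elim (intro tendsto_intros conv)
  show "AE x in \<mu> t. norm (P (t, x) + Q (t, x) \<bullet> w n (t, x)) \<le> B * (1 + \<beta> t)" for n
  proof (rule AE_I2)
    fix x show "norm (P (t, x) + Q (t, x) \<bullet> w n (t, x)) \<le> B * (1 + \<beta> t)"
      using integrand_bound[of "w n (t, x)" "\<beta> t" "(t, x)"] w[of n] t by (auto simp: bounded_field_def)
  qed
qed

text \<open>The jointly measurable field w stands in for the actual velocity w0. They agree for t in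
  the full set A and x in K, which is enough because each \<open>\<mu> t\<close> is concentrated on
  K.\<close>

lemma CE_pairing:
  assumes \<mu>: "curve \<mu>" and w: "bounded_field w" and A: "full_in T A" "A \<subseteq> S"
    and eq: "\<And>t x. t \<in> A \<Longrightarrow> x \<in> K \<Longrightarrow> w (t, x) = w0 t x" and cont: "\<And>t. t \<in> A \<Longrightarrow> continuous_on UNIV (w0 t)"
    and rep: "\<And>w t x. CE_integrand \<phi> w t x = P (t, x) + Q (t, x) \<bullet> w t x"
  shows "AE t in lebesgue_on {0..T}. integrable (\<mu> t) (CE_integrand \<phi> w0 t)"
    "set_integrable lebesgue {0..T} (\<lambda>t. \<integral>x. CE_integrand \<phi> w0 t x \<partial>\<mu> t)"
    "(LINT t:{0..T}|lebesgue. (\<integral>x. CE_integrand \<phi> w0 t x \<partial>\<mu> t)) = (\<integral>t. pairing P Q \<mu> w t \<partial>M)"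
proof -
  have c: "continuous_on UNIV (\<lambda>x. P (t, x) + Q (t, x) \<bullet> w0 t x)" if "t \<in> A" for t
    by (intro continuous_intros cont[OF that] continuous_on_compose2[OF lipschitz_on_continuous_on[OF Pl]]
        continuous_on_compose2[OF lipschitz_on_continuous_on[OF Ql]]) auto
  have i: "integrable (\<mu> t) (CE_integrand \<phi> w0 t)" if t: "t \<in> A" for t
  proof -
    have "integrable (\<mu> t) (\<lambda>x. P (t, x) + Q (t, x) \<bullet> w0 t x)"
      by (rule integrable_Prob_on[OF curve_Prob(1)[OF \<mu> S_T] compact_cball c[OF t]]) (use t A(2) in auto)
    moreover have "CE_integrand \<phi> w0 t = (\<lambda>x. P (t, x) + Q (t, x) \<bullet> w0 t x)" by (rule ext) (rule rep)
    ultimately show ?thesis by simp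
  qed
  then show "AE t in lebesgue_on {0..T}. integrable (\<mu> t) (CE_integrand \<phi> w0 t)"
    by (rule full_in_AE_I[OF A(1)]) auto
  have e: "(\<integral>x. CE_integrand \<phi> w0 t x \<partial>\<mu> t) = pairing P Q \<mu> w t" if t: "t \<in> A \<inter> S" for t
  proof -
    have tA: "t \<in> A" and tS: "t \<in> S" using t by auto
    note PK = curve_Prob(1)[OF \<mu> S_T[OF tS]]
    note pm = Prob_simps(4)[OF Prob_onD(1)[OF PK]]
    have "(\<integral>x. P (t, x) + Q (t, x) \<bullet> w0 t x \<partial>\<mu> t) = (\<integral>x. P (t, x) + Q (t, x) \<bullet> w (t, x) \<partial>\<mu> t)"
    proof (rule integral_cong_AE)
      show "AE x in \<mu> t. P (t, x) + Q (t, x) \<bullet> w0 t x = P (t, x) + Q (t, x) \<bullet> w (t, x)"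
        using Prob_onD(2)[OF PK] by eventually_elim (simp add: eq[OF tA])
    qed (simp_all only: pm section_measurable[OF w tS] borel_measurable_continuous_onI[OF c[OF tA]])
    then show ?thesis by (simp add: pairing_def rep)
  qed
  note f = full_in_integral[OF A(1) full_S e]
  show "set_integrable lebesgue {0..T} (\<lambda>t. \<integral>x. CE_integrand \<phi> w0 t x \<partial>\<mu> t)"
    using f(1) pairing_integrable[OF \<mu> w] by simp
  show "(LINT t:{0..T}|lebesgue. (\<integral>x. CE_integrand \<phi> w0 t x \<partial>\<mu> t)) = (\<integral>t. pairing P Q \<mu> w t \<partial>M)"
    by (rule f(2)[OF _ pairing_integrable[OF \<mu> w]])
qed

text \<open>Exchanging each measure for the limit shows that the integrals against
  \<open>\<mu>\<close> tend to 0, and so do their convex combinations. At a fixed curve the pairing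
  is affine in the field, so these are the integrals of the combined fields, which converge
  pointwise.\<close>

lemma pairing_integral_limit:
  assumes \<mu>s: "\<And>n. curve (\<mu>s n)" and \<mu>: "curve \<mu>" and w: "\<And>n. bounded_field (w n)" and w': "bounded_field w'"
    and wl: "\<And>n t. t \<in> S \<Longrightarrow> (l t)-lipschitz_on K (\<lambda>x. w n (t, x))"
    and conv: "\<And>t. t \<in> S \<Longrightarrow> (\<lambda>n. W1 (\<mu>s n t) (\<mu> t)) \<longlonglongrightarrow> 0"
    and zero: "\<And>n. (\<integral>t. pairing P Q (\<mu>s n) (w n) t \<partial>M) = 0"
    and c: "\<And>n k. (0::real) \<le> c n k" "\<And>n. (\<Sum>k\<in>{n..N n}. c n k) = 1"
    and A: "full_in T A" "A \<subseteq> S"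
    and lim: "\<And>t x. t \<in> A \<Longrightarrow> x \<in> K \<Longrightarrow> (\<lambda>n. \<Sum>j\<in>{n..N n}. c n j *\<^sub>R w j (t, x)) \<longlonglongrightarrow> w' (t, x)"
  shows "(\<integral>t. pairing P Q \<mu> w' t \<partial>M) = 0"
proof -
  note pi = pairing_integrable
  define a where "a n = (\<integral>t. pairing P Q (\<mu>s n) (w n) t \<partial>M)" for n
  define b where "b n = (\<integral>t. pairing P Q \<mu> (w n) t \<partial>M)" for n
  have "(\<lambda>n. \<integral>t. pairing P Q (\<mu>s n) (w n) t - pairing P Q \<mu> (w n) t \<partial>M) \<longlonglongrightarrow> (\<integral>t. 0 \<partial>M)"
  proof (rule integral_dominated_convergence[where w = "\<lambda>t. (2 * B) * (1 + \<beta> t)"])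
    show "AE t in M. (\<lambda>n. pairing P Q (\<mu>s n) (w n) t - pairing P Q \<mu> (w n) t) \<longlonglongrightarrow> 0"
    proof (rule AE_I2)
      fix t assume "t \<in> space M"
      then have t: "t \<in> S" by simp
      show "(\<lambda>n. pairing P Q (\<mu>s n) (w n) t - pairing P Q \<mu> (w n) t) \<longlonglongrightarrow> 0"
        by (rule pairing_measure_convergence[OF \<mu>s \<mu> w wl[OF t] t conv[OF t]])
    qed
    fix n
    show "AE t in M. norm (pairing P Q (\<mu>s n) (w n) t - pairing P Q \<mu> (w n) t) \<le> (2 * B) * (1 + \<beta> t)"
    proof (rule AE_I2)
      fix t assume "t \<in> space M"
      then have t: "t \<in> S" by simp
      show "norm (pairing P Q (\<mu>s n) (w n) t - pairing P Q \<mu> (w n) t) \<le> (2 * B) * (1 + \<beta> t)"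
        using pairing_bound[OF \<mu>s[of n] w[of n] t] pairing_bound[OF \<mu> w[of n] t] by (simp add: algebra_simps)
    qed
  qed (use pi[OF \<mu>s w] pi[OF \<mu> w] dominating_integrable[of "2 * B"] in \<open>auto intro: borel_measurable_integrable\<close>)
  moreover have "(\<integral>t. pairing P Q (\<mu>s n) (w n) t - pairing P Q \<mu> (w n) t \<partial>M) = - b n" for n
    using Bochner_Integration.integral_diff[OF pi[OF \<mu>s[of n] w[of n]] pi[OF \<mu> w[of n]]] zero[of n] by (simp add: b_def)
  ultimately have "(\<lambda>n. - b n) \<longlonglongrightarrow> 0" by simp
  then have "b \<longlonglongrightarrow> 0" using tendsto_minus_cancel[of b 0] by simp
  then have cb: "(\<lambda>n. \<Sum>j\<in>{n..N n}. c n j *\<^sub>R b j) \<longlonglongrightarrow> 0" by (rule convex_combination_limit[OF _ c])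
  define Z where "Z n z = (\<Sum>j\<in>{n..N n}. c n j *\<^sub>R w j z)" for n z
  have Zb: "bounded_field (Z n)" for n unfolding Z_def [abs_def] by (rule bounded_field_combination[OF w c(1) c(2)])
  have Z: "(\<integral>t. pairing P Q \<mu> (Z n) t \<partial>M) = (\<Sum>j\<in>{n..N n}. c n j *\<^sub>R b j)" for n
  proof -
    have "(\<integral>t. pairing P Q \<mu> (Z n) t \<partial>M) = (\<integral>t. (\<Sum>j\<in>{n..N n}. c n j * pairing P Q \<mu> (w j) t) \<partial>M)"
      unfolding Z_def [abs_def]
      by (rule Bochner_Integration.integral_cong) (auto intro: pairing_combination[OF \<mu> w c(2)])
    also have "\<dots> = (\<Sum>j\<in>{n..N n}. c n j *\<^sub>R b j)"
      using pi[OF \<mu> w] by (simp add: b_def Bochner_Integration.integral_sum)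
    finally show ?thesis .
  qed
  have "(\<lambda>n. \<integral>t. pairing P Q \<mu> (Z n) t \<partial>M) \<longlonglongrightarrow> (\<integral>t. pairing P Q \<mu> w' t \<partial>M)"
  proof (rule integral_dominated_convergence[where w = "\<lambda>t. B * (1 + \<beta> t)"])
    have "AE t in M. t \<in> A" by (rule full_in_AE_I[OF A(1)]) (use S in auto)
    then show "AE t in M. (\<lambda>n. pairing P Q \<mu> (Z n) t) \<longlonglongrightarrow> pairing P Q \<mu> w' t"
    proof eventually_elim
      fix t assume t: "t \<in> A"
      then have tS: "t \<in> S" using A(2) by auto
      show "(\<lambda>n. pairing P Q \<mu> (Z n) t) \<longlonglongrightarrow> pairing P Q \<mu> w' t"
        by (rule pairing_field_convergence[OF \<mu> Zb w' tS]) (unfold Z_def, rule lim[OF t])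
    qed
    fix n
    show "AE t in M. norm (pairing P Q \<mu> (Z n) t) \<le> B * (1 + \<beta> t)"
      by (rule AE_I2) (use pairing_bound[OF \<mu> Zb] in auto)
  qed (use pi[OF \<mu> w'] pi[OF \<mu> Zb] dominating_integrable[of B] in \<open>auto intro: borel_measurable_integrable\<close>)
  from LIMSEQ_unique[OF this[unfolded Z] cb] show ?thesis .
qed

end

section \<open>Attaining the limit velocity\<close>

lemma v_continuous_control:
  assumes "t \<in> S" "\<mu> \<in> Prob_c" shows "continuous_on UNIV (\<lambda>u. v t \<mu> u x)"
proof -
  have "continuous_on UNIV ((\<lambda>(u, x). v t \<mu> u x) \<circ> (\<lambda>u. (u, x)))"
    by (intro continuous_on_compose continuous_intros continuous_on_subset[OF v_continuous[OF assms]]) auto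
  then show ?thesis by (simp add: o_def)
qed

text \<open>
  The limit velocity at a fixed time: controls in \<open>U t (\<mu>s n t)\<close> are close to the compact set
  \<open>U t (\<mu> t)\<close>, so limits of convex combinations of the velocities stay in the convex set
  \<open>V t (\<mu> t)\<close>.
\<close>

lemma limit_velocity_attained:
  assumes \<mu>s: "\<And>n. curve (\<mu>s n)" and \<mu>: "curve \<mu>" and t: "t \<in> S"
    and conv: "(\<lambda>n. W1 (\<mu>s n t) (\<mu> t)) \<longlonglongrightarrow> 0"
    and us: "\<And>n. us n \<in> U t (\<mu>s n t)"
    and c: "\<And>n k. (0::real) \<le> c n k" "\<And>n. (\<Sum>k\<in>{n..N n}. c n k) = 1"
    and X: "\<And>k. X k \<in> K"
    and lim: "\<And>k. (\<lambda>n. \<Sum>j\<in>{n..N n}. c n j *\<^sub>R v t (\<mu>s j t) (us j) (X k)) \<longlonglongrightarrow> z k"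
  shows "\<exists>u\<in>U t (\<mu> t). \<forall>k. v t (\<mu> t) u (X k) = z k"
proof -
  have tT: "t \<in> {0..T}" using S_T[OF t] .
  note \<mu>c = curve_Prob[OF \<mu> tT] and \<mu>sc = curve_Prob[OF \<mu>s tT]
  define C where "C = U t (\<mu> t)"
  have Cc: "compact C" unfolding C_def by (rule U_compact[OF t \<mu>c(2)])
  \<comment> \<open>Upper semicontinuity of \<open>U t\<close> at the limit measure, applied to an
    open neighbourhood of its value.\<close>
  have near: "\<forall>\<^sub>F n in sequentially. \<exists>y\<in>C. dist (us n) y < \<epsilon>" if \<epsilon>: "\<epsilon> > 0" for \<epsilon>
  proof -
    let ?G = "\<Union>y\<in>C. ball y \<epsilon>"
    have "openin W1_topology {\<nu> \<in> Prob_c. U t \<nu> \<subseteq> ?G}"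
      using U_continuous[OF t] open_UN[of C "\<lambda>y. ball y \<epsilon>"] unfolding setmap_W1_continuous_def by blast
    moreover have "\<mu> t \<in> {\<nu> \<in> Prob_c. U t \<nu> \<subseteq> ?G}" using \<mu>c(2) \<epsilon> by (force simp: C_def)
    ultimately have "\<forall>\<^sub>F n in sequentially. \<mu>s n t \<in> {\<nu> \<in> Prob_c. U t \<nu> \<subseteq> ?G}"
      using \<mu>sc(2) conv by (rule W1_topology_eventually)
    then show ?thesis
    proof eventually_elim
      fix n assume "\<mu>s n t \<in> {\<nu> \<in> Prob_c. U t \<nu> \<subseteq> ?G}"
      then have "us n \<in> ?G" using us[of n] by blast
      then show "\<exists>y\<in>C. dist (us n) y < \<epsilon>" by (auto simp: dist_commute)
    qed
  qed
  have Cne: "C \<noteq> {}"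
  proof
    assume "C = {}"
    then show False using near[of 1] by simp
  qed
  \<comment> \<open>Replacing each control by a nearest point of C makes it admissible at the limit
    measure, where convexity of the velocity set is available.\<close>
  have "\<exists>y\<in>C. \<forall>y'\<in>C. dist (us n) y \<le> dist (us n) y'" for n
    by (rule continuous_attains_inf[OF Cc Cne]) (intro continuous_intros)
  then obtain u' where u': "\<And>n. u' n \<in> C" "\<And>n y'. y' \<in> C \<Longrightarrow> dist (us n) (u' n) \<le> dist (us n) y'" by metis
  have d: "(\<lambda>n. dist (us n) (u' n)) \<longlonglongrightarrow> 0"
  proof (rule order_tendstoI)
    fix a :: real assume "a < 0"
    then show "\<forall>\<^sub>F n in sequentially. a < dist (us n) (u' n)" by (intro always_eventually) (auto intro: less_le_trans)
  next
    fix a :: real assume "0 < a"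
    from near[OF this] show "\<forall>\<^sub>F n in sequentially. dist (us n) (u' n) < a"
      by eventually_elim (use u'(2) in \<open>auto intro: le_less_trans\<close>)
  qed
  note vc = v_continuous_control[OF t \<mu>c(2)]
  have diff: "(\<lambda>j. v t (\<mu>s j t) (us j) (X k) - v t (\<mu> t) (u' j) (X k)) \<longlonglongrightarrow> 0" for k
  proof -
    have "(\<lambda>j. v t (\<mu>s j t) (us j) (X k) - v t (\<mu> t) (us j) (X k)) \<longlonglongrightarrow> 0"
      by (rule Lim_null_comparison[OF always_eventually tendsto_mult_right_zero[OF conv, of "L t"]])
        (use v_W1[OF t \<mu>sc(1) \<mu>c(1) X] in auto)
    moreover have "(\<lambda>j. v t (\<mu> t) (us j) (X k) - v t (\<mu> t) (u' j) (X k)) \<longlonglongrightarrow> 0"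
      by (rule continuous_near_compact[OF vc Cc u'(1) d])
    ultimately show ?thesis using tendsto_add by fastforce
  qed
  \<comment> \<open>Convexity realises the whole combined function by one control, so a single
    subsequence works at all points \<open>X k\<close>.\<close>
  have "\<exists>u\<in>C. v t (\<mu> t) u = (\<lambda>x. \<Sum>j\<in>{n..N n}. c n j *\<^sub>R v t (\<mu> t) (u' j) x)" for n
  proof -
    have "(\<lambda>x. \<Sum>j\<in>{n..N n}. c n j *\<^sub>R v t (\<mu> t) (u' j) x) \<in> {v t (\<mu> t) u | u. u \<in> U t (\<mu> t)}"
      by (rule convex_functions_sum[OF V_convex[OF t \<mu>c(2)]]) (use u'(1) c in \<open>auto simp: C_def\<close>)
    then show ?thesis by (auto simp: C_def)
  qed
  then obtain u2 where u2: "\<And>n. u2 n \<in> C" "\<And>n. v t (\<mu> t) (u2 n) = (\<lambda>x. \<Sum>j\<in>{n..N n}. c n j *\<^sub>R v t (\<mu> t) (u' j) x)" by metis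
  obtain u r where u: "u \<in> C" and r: "strict_mono r" "(u2 \<circ> r) \<longlonglongrightarrow> u"
    using Cc u2(1) unfolding compact_eq_seq_compact_metric seq_compact_def by metis
  have "v t (\<mu> t) u (X k) = z k" for k
  proof -
    have "(\<lambda>n. \<Sum>j\<in>{n..N n}. c n j *\<^sub>R (v t (\<mu>s j t) (us j) (X k) - v t (\<mu> t) (u' j) (X k))) \<longlonglongrightarrow> 0"
      by (rule convex_combination_limit[OF diff c])
    then have "(\<lambda>n. (\<Sum>j\<in>{n..N n}. c n j *\<^sub>R v t (\<mu>s j t) (us j) (X k)) - v t (\<mu> t) (u2 n) (X k)) \<longlonglongrightarrow> 0"
      by (simp add: u2(2) scaleR_diff_right sum_subtractf)
    from tendsto_diff[OF lim[of k] this] have "(\<lambda>n. v t (\<mu> t) (u2 n) (X k)) \<longlonglongrightarrow> z k" by simp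
    from LIMSEQ_subseq_LIMSEQ[OF this r(1)] have "(\<lambda>n. v t (\<mu> t) (u2 (r n)) (X k)) \<longlonglongrightarrow> z k" by (simp add: o_def)
    moreover have "(\<lambda>n. v t (\<mu> t) (u2 (r n)) (X k)) \<longlonglongrightarrow> v t (\<mu> t) u (X k)"
      using vc[of "X k"] r(2) by (intro isCont_tendsto_compose[of u "\<lambda>u. v t (\<mu> t) u (X k)"])
        (auto simp: continuous_on_eq_continuous_at o_def)
    ultimately show ?thesis by (rule LIMSEQ_unique[rotated])
  qed
  with u show ?thesis by (auto simp: C_def)
qed

lemma dense_Lipschitz_convergence:
  fixes w :: "nat \<Rightarrow> 'a \<Rightarrow> 'a"
  assumes w: "\<And>n. C-lipschitz_on K (w n)" and w': "C-lipschitz_on K w'"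
    and X: "\<And>k::nat. X k \<in> K" "K \<subseteq> closure (range X)" and conv: "\<And>k. (\<lambda>n. w n (X k)) \<longlonglongrightarrow> w' (X k)" and x: "x \<in> K"
  shows "(\<lambda>n. w n x) \<longlonglongrightarrow> w' x"
proof (rule metric_LIMSEQ_I)
  fix e :: real assume e: "e > 0"
  have C: "C \<ge> 0" using lipschitz_on_nonneg[OF w'] .
  have "e / (3 * (C + 1)) > 0" using e C by simp
  then obtain k where k: "dist (X k) x < e / (3 * (C + 1))"
    using subsetD[OF X(2) x] unfolding closure_approachable by blast
  have Ck: "C * dist x (X k) \<le> e / 3"
  proof -
    have "C * dist x (X k) \<le> (C + 1) * dist x (X k)" by (intro mult_right_mono) auto
    also have "\<dots> \<le> (C + 1) * (e / (3 * (C + 1)))" using k C by (intro mult_left_mono) (auto simp: dist_commute)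
    also have "\<dots> = e / 3" using C by (simp add: field_simps)
    finally show ?thesis .
  qed
  obtain n0 where n0: "\<And>n. n \<ge> n0 \<Longrightarrow> dist (w n (X k)) (w' (X k)) < e / 3"
    using metric_LIMSEQ_D[OF conv[of k], of "e / 3"] e by auto
  have "dist (w n x) (w' x) < e" if "n \<ge> n0" for n
  proof -
    have "dist (w n x) (w n (X k)) \<le> e / 3" using lipschitz_onD[OF w[of n] x X(1)[of k]] Ck by linarith
    moreover have "dist (w' (X k)) (w' x) \<le> e / 3" using lipschitz_onD[OF w' X(1)[of k] x] Ck by (simp add: dist_commute)
    moreover have "dist (w n x) (w' x) \<le> dist (w n x) (w n (X k)) + dist (w n (X k)) (w' (X k)) + dist (w' (X k)) (w' x)"
      using dist_triangle[of "w n x" "w' x" "w n (X k)"] dist_triangle[of "w n (X k)" "w' x" "w' (X k)"] by linarith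
    ultimately show ?thesis using n0[OF that] by linarith
  qed
  then show "\<exists>no. \<forall>n\<ge>no. dist (w n x) (w' x) < e" by blast
qed

end

section \<open>The closure theorem\<close>

text \<open>Completeness of Lebesgue measure: the values on the complementary null set are
  arbitrary.\<close>

lemma full_in_measurable:
  fixes f :: "real \<Rightarrow> 'b::topological_space"
  assumes A: "full_in T A" and f: "f \<in> borel_measurable (lebesgue_on A)"
  shows "f \<in> borel_measurable (lebesgue_on {0..T})"
proof (rule measurableI)
  fix G :: "'b set" assume "G \<in> sets borel"
  then have "f -` G \<inter> A \<in> sets (lebesgue_on A)" using measurable_sets[OF f] by simp
  then have 1: "f -` G \<inter> A \<in> sets lebesgue" using A by (subst (asm) sets_restrict_space_iff) (auto simp: full_in_def)
  have "f -` G \<inter> ({0..T} - A) \<subseteq> {0..T} - A" by auto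
  then have "negligible (f -` G \<inter> ({0..T} - A))"
    using A by (meson full_in_def negligible_iff_null_sets negligible_subset)
  then have 2: "f -` G \<inter> ({0..T} - A) \<in> sets lebesgue" by (rule negligible_imp_sets)
  have "f -` G \<inter> {0..T} = (f -` G \<inter> A) \<union> (f -` G \<inter> ({0..T} - A))" using A by (auto simp: full_in_def)
  then have "f -` G \<inter> {0..T} \<in> sets lebesgue" using 1 2 by simp
  then show "f -` G \<inter> space (lebesgue_on {0..T}) \<in> sets (lebesgue_on {0..T})"
    by (subst sets_restrict_space_iff) auto
qed simp

context control_system
begin

lemma W_Lipschitz:
  assumes \<mu>: "curve \<mu>" and t: "t \<in> S" shows "(l t)-lipschitz_on K (\<lambda>x. W \<mu> u (t, x))"
proof -
  have "(l t)-lipschitz_on K (v t (\<mu> t) (u t))" by (rule v_Lipschitz[OF t curve_Prob(1)[OF \<mu> S_T[OF t]]])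
  then show ?thesis unfolding lipschitz_on_def using W_eq[OF t] by simp
qed

text \<open>
  A Mazur argument on \<open>S \<times> \<nat>\<close>, where \<open>\<nat>\<close> indexes the points \<open>X k\<close> and carries any probability measure
  of full support; dividing by \<open>1 + \<beta> t\<close> makes the fields uniformly bounded.
\<close>

lemma velocity_combinations_converge:
  fixes X :: "nat \<Rightarrow> 'a"
  assumes w: "\<And>n. bounded_field (w n)"
  obtains c N A where "\<And>n k. (0::real) \<le> c n k" "\<And>n. (\<Sum>k\<in>{n..N n}. c n k) = 1"
    "full_in T A" "A \<subseteq> S" "\<And>t k. t \<in> A \<Longrightarrow> convergent (\<lambda>n. \<Sum>j\<in>{n..N n}. c n j *\<^sub>R w j (t, X k))"
proof -
  define G where "G = measure_pmf (geometric_pmf (1/2))"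
  interpret G: prob_space G unfolding G_def by (rule measure_pmf.prob_space_axioms)
  interpret M: finite_measure M by (rule lebesgue_on_bounded(1)[OF S(1,2)])
  interpret pair_sigma_finite M G ..
  define z where "z n p = (1 / (1 + \<beta> (fst p))) *\<^sub>R w n (fst p, X (snd p))" for n and p :: "real \<times> nat"
  have zm: "z n \<in> borel_measurable (M \<Otimes>\<^sub>M G)" for n
  proof -
    have "X \<in> borel_measurable G" by (simp add: G_def)
    then have "(\<lambda>p. X (snd p)) \<in> borel_measurable (M \<Otimes>\<^sub>M G)" by (rule measurable_compose[OF measurable_snd])
    then have "(\<lambda>p. (fst p, X (snd p))) \<in> measurable (M \<Otimes>\<^sub>M G) (M \<Otimes>\<^sub>M borel)"
      by (rule measurable_Pair[OF measurable_fst])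
    from measurable_compose[OF this, of "w n" borel] w
    have 1: "(\<lambda>p. w n (fst p, X (snd p))) \<in> borel_measurable (M \<Otimes>\<^sub>M G)" by (simp add: bounded_field_def)
    have "\<beta> \<in> borel_measurable M" by (rule borel_measurable_integrable[OF \<beta>_integrable])
    then have 2: "(\<lambda>p. \<beta> (fst p)) \<in> borel_measurable (M \<Otimes>\<^sub>M G)" by (rule measurable_compose[OF measurable_fst])
    show ?thesis unfolding z_def [abs_def] by (intro borel_measurable_scaleR borel_measurable_divide borel_measurable_add borel_measurable_const 1 2)
  qed
  have zb: "norm (z n p) \<le> 1" if "p \<in> space (M \<Otimes>\<^sub>M G)" for n p
  proof -
    have t: "fst p \<in> S" using that by (auto simp: space_pair_measure)
    have "norm (w n (fst p, X (snd p))) \<le> \<beta> (fst p)" using w[of n] t by (simp add: bounded_field_def)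
    then show ?thesis using \<beta>_nonneg[OF t] by (simp add: z_def)
  qed
  have fm: "finite_measure (M \<Otimes>\<^sub>M G)" by (intro finite_measure_pair_measure M.finite_measure_axioms G.finite_measure_axioms)
  obtain c N where c: "\<And>n k. (0::real) \<le> c n k" "\<And>n. (\<Sum>k\<in>{n..N n}. c n k) = 1"
    and AE: "AE p in M \<Otimes>\<^sub>M G. convergent (\<lambda>n. \<Sum>k\<in>{n..N n}. c n k *\<^sub>R z k p)"
    by (rule convex_combinations_converge_AE[where z = z and B = 1, OF fm zm]) (erule zb, meson)
  have "AE t in M. \<forall>k. convergent (\<lambda>n. \<Sum>j\<in>{n..N n}. c n j *\<^sub>R z j (t, k))"
  proof -
    have "set_pmf (geometric_pmf (1/2)) = UNIV" by (rule set_pmf_geometric) auto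
    then show ?thesis using AE_pair[OF AE] unfolding G_def AE_measure_pmf_iff by simp
  qed
  then obtain A where A: "full_in T A" "A \<subseteq> S"
    and cv: "\<And>t. t \<in> A \<Longrightarrow> \<forall>k. convergent (\<lambda>n. \<Sum>j\<in>{n..N n}. c n j *\<^sub>R z j (t, k))"
    by (rule full_in_AE[OF full_S]) blast
  have "convergent (\<lambda>n. \<Sum>j\<in>{n..N n}. c n j *\<^sub>R w j (t, X k))" if t: "t \<in> A" for t k
  proof -
    have p: "1 + \<beta> t \<noteq> 0" using \<beta>_nonneg[of t] t A(2) by fastforce
    have "convergent (\<lambda>n. (1 + \<beta> t) *\<^sub>R (\<Sum>j\<in>{n..N n}. c n j *\<^sub>R z j (t, k)))"
    proof -
      from cv[OF t] obtain L where "(\<lambda>n. \<Sum>j\<in>{n..N n}. c n j *\<^sub>R z j (t, k)) \<longlonglongrightarrow> L"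
        unfolding convergent_def by blast
      from tendsto_scaleR[OF tendsto_const this] show ?thesis by (rule convergentI)
    qed
    moreover have "(1 + \<beta> t) *\<^sub>R (\<Sum>j\<in>{n..N n}. c n j *\<^sub>R z j (t, k)) = (\<Sum>j\<in>{n..N n}. c n j *\<^sub>R w j (t, X k))" for n
      using p by (simp add: z_def scaleR_sum_right)
    ultimately show ?thesis by simp
  qed
  with c A show thesis by (rule that)
qed

text \<open>The constraints for the selection are the distances between the velocity and the
  prescribed limit at each point \<open>X k\<close>, so an exact zero of all of them generates the
  limit.\<close>

lemma limit_control:
  fixes X :: "nat \<Rightarrow> 'a"
  assumes \<mu>: "curve \<mu>" and A: "full_in T A" "A \<subseteq> S" and X: "\<And>k. X k \<in> K"
    and z: "\<And>k. z k \<in> borel_measurable (lebesgue_on A)"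
    and ex: "\<And>t. t \<in> A \<Longrightarrow> \<exists>u\<in>U t (\<mu> t). \<forall>k. v t (\<mu> t) u (X k) = z k t"
  obtains u A' where "u \<in> borel_measurable (lebesgue_on {0..T})" "full_in T A'" "A' \<subseteq> A"
    "\<And>t. t \<in> A' \<Longrightarrow> u t \<in> U t (\<mu> t)" "\<And>t k. t \<in> A' \<Longrightarrow> v t (\<mu> t) (u t) (X k) = z k t"
proof -
  have As: "A \<in> sets lebesgue" "A \<subseteq> {0..T}" using A by (auto simp: full_in_def)
  note LB = lebesgue_on_bounded[OF As]
  have "\<exists>u N. u \<in> borel_measurable (lebesgue_on A) \<and> N \<in> null_sets (lebesgue_on A) \<and>
    (\<forall>t\<in>space (lebesgue_on A) - N. u t \<in> U t (\<mu> t) \<and> (\<forall>k. norm (v t (\<mu> t) (u t) (X k) - z k t) = 0))"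
  proof (rule Filippov_selection[OF LB, of "\<lambda>t. U t (\<mu> t)" "\<lambda>k t u. norm (v t (\<mu> t) u (X k) - z k t)"])
    fix t assume "t \<in> space (lebesgue_on A)"
    then have t: "t \<in> A" "t \<in> S" using A by auto
    note \<mu>c = curve_Prob(2)[OF \<mu> S_T[OF t(2)]]
    show "compact (U t (\<mu> t))" by (rule U_compact[OF t(2) \<mu>c])
    show "continuous_on UNIV (\<lambda>u. norm (v t (\<mu> t) u (X k) - z k t))" for k
      by (intro continuous_intros v_continuous_control[OF t(2) \<mu>c])
    show "\<exists>u\<in>U t (\<mu> t). \<forall>k. norm (v t (\<mu> t) u (X k) - z k t) = 0" using ex[OF t(1)] by simp
  next
    fix G :: "'u set" assume "open G"
    from U_curve_measurable[OF \<mu> this] have "{t \<in> S. U t (\<mu> t) \<inter> G \<noteq> {}} \<inter> A \<in> sets lebesgue" using As by auto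
    moreover have "{t \<in> space (lebesgue_on A). U t (\<mu> t) \<inter> G \<noteq> {}} = {t \<in> S. U t (\<mu> t) \<inter> G \<noteq> {}} \<inter> A" using A by auto
    ultimately show "{t \<in> space (lebesgue_on A). U t (\<mu> t) \<inter> G \<noteq> {}} \<in> sets (lebesgue_on A)"
      using As by (subst sets_restrict_space_iff) auto
  next
    fix k u
    \<comment> \<open>A constant control is separably valued, so this field supplies measurability
      in time along the curve.\<close>
    have W: "W \<mu> (\<lambda>_. u) \<in> borel_measurable (M \<Otimes>\<^sub>M borel)" by (rule W_measurable[OF \<mu>, of "{u}"]) auto
    have "(\<lambda>t. W \<mu> (\<lambda>_. u) (t, X k)) \<in> borel_measurable M"
      by (rule measurable_compose[OF measurable_Pair2' W]) simp
    then have 1: "(\<lambda>t. W \<mu> (\<lambda>_. u) (t, X k)) \<in> borel_measurable (lebesgue_on A)" by (rule measurable_restrict_mono[OF _ A(2)])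
    have "W \<mu> (\<lambda>_. u) (t, X k) = v t (\<mu> t) u (X k)" if "t \<in> space (lebesgue_on A)" for t
      using that A(2) by (intro W_eq X) auto
    then have "(\<lambda>t. v t (\<mu> t) u (X k)) \<in> borel_measurable (lebesgue_on A)"
      using 1 measurable_cong[of "lebesgue_on A" "\<lambda>t. W \<mu> (\<lambda>_. u) (t, X k)" "\<lambda>t. v t (\<mu> t) u (X k)" borel] by blast
    then show "(\<lambda>t. norm (v t (\<mu> t) u (X k) - z k t)) \<in> borel_measurable (lebesgue_on A)"
      by (intro measurable_compose[OF borel_measurable_diff borel_measurable_norm] z)
  qed (assumption | simp | blast)+
  then obtain u N where u: "u \<in> borel_measurable (lebesgue_on A)" and N: "N \<in> null_sets (lebesgue_on A)"
    and uN: "\<And>t. t \<in> A - N \<Longrightarrow> u t \<in> U t (\<mu> t) \<and> (\<forall>k. norm (v t (\<mu> t) (u t) (X k) - z k t) = 0)" by auto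
  show thesis
    by (rule that[OF full_in_measurable[OF A(1) u] full_in_diff_null[OF A(1) N]]) (use uN in auto)
qed

lemma solution_pairing_zero:
  assumes CE: "solves_CE T \<mu> w0" and \<phi>: "\<phi> \<in> test_functions T"
    and e: "(LINT t:{0..T}|lebesgue. (\<integral>x. CE_integrand \<phi> w0 t x \<partial>\<mu> t)) = y"
  shows "y = 0"
  using CE \<phi> e by (simp add: solves_CE_def)

text \<open>Four full sets of times are intersected: A0 for admissibility of the given controls, A1
  for convergence at the points \<open>X k\<close>, A' for the selection, and A2 for agreement of u'
  with u.\<close>

theorem closure_theorem:
  assumes \<mu>s: "\<And>n. curve (\<mu>s n)" and \<mu>: "curve \<mu>"
    and conv: "\<And>t. t \<in> {0..T} \<Longrightarrow> (\<lambda>n. W1 (\<mu>s n t) (\<mu> t)) \<longlonglongrightarrow> 0"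
    and us: "\<And>n. us n \<in> borel_measurable M" "\<And>n. AE t in M. us n t \<in> U t (\<mu>s n t)"
    and CE: "\<And>n. solves_CE T (\<mu>s n) (\<lambda>t x. v t (\<mu>s n t) (us n t) x)"
  obtains u where "u \<in> borel_measurable (lebesgue_on {0..T})" "AE t in lebesgue_on {0..T}. u t \<in> U t (\<mu> t)"
    "solves_CE T \<mu> (\<lambda>t x. v t (\<mu> t) (u t) x)"
proof -
  have "\<exists>u'. (AE t in M. u' t = us n t) \<and> W (\<mu>s n) u' \<in> borel_measurable (M \<Otimes>\<^sub>M borel)" for n
    by (rule W_joint_measurable[OF \<mu>s[of n] us(1)[of n]]) blast
  then obtain us' where us'_AE: "\<And>n. AE t in M. us' n t = us n t"
    and us'_meas: "\<And>n. W (\<mu>s n) (us' n) \<in> borel_measurable (M \<Otimes>\<^sub>M borel)" by metis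
  define w where "w n = W (\<mu>s n) (us' n)" for n
  have wb: "bounded_field (w n)" for n unfolding w_def by (rule W_bounded_field[OF \<mu>s us'_meas])
  have wl: "(l t)-lipschitz_on K (\<lambda>x. w n (t, x))" if "t \<in> S" for n t unfolding w_def by (rule W_Lipschitz[OF \<mu>s that])
  have "AE t in M. \<forall>n. us' n t = us n t \<and> us n t \<in> U t (\<mu>s n t)"
    using us'_AE us(2) by (simp add: AE_all_countable)
  then obtain A0 where A0: "full_in T A0" "A0 \<subseteq> S"
    and good: "\<And>t. t \<in> A0 \<Longrightarrow> \<forall>n. us' n t = us n t \<and> us n t \<in> U t (\<mu>s n t)"
    by (rule full_in_AE[OF full_S]) blast
  have w_eq: "w n (t, x) = v t (\<mu>s n t) (us n t) x" if "t \<in> A0" "x \<in> K" for n t x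
    using that good[of t] A0(2) by (auto simp: w_def W_eq)
  \<comment> \<open>A velocity that is Lipschitz on K is determined by its values at countably many
    dense points, which turns an equation between functions into countably many equations between
    vectors.\<close>
  obtain D where D: "countable D" "D \<subseteq> K" "K \<subseteq> closure D" by (rule separable)
  have "D \<noteq> {}" using D(3) R by auto
  define X where "X = from_nat_into D"
  have X: "X k \<in> K" for k unfolding X_def by (rule subsetD[OF D(2) from_nat_into[OF \<open>D \<noteq> {}\<close>]])
  have Xd: "K \<subseteq> closure (range X)" using D(1,3) \<open>D \<noteq> {}\<close> by (simp add: X_def range_from_nat_into)
  obtain c N A1 where c: "\<And>n k. (0::real) \<le> c n k" "\<And>n. (\<Sum>k\<in>{n..N n}. c n k) = 1"
    and A1: "full_in T A1" "A1 \<subseteq> S"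
    and cv: "\<And>t k. t \<in> A1 \<Longrightarrow> convergent (\<lambda>n. \<Sum>j\<in>{n..N n}. c n j *\<^sub>R w j (t, X k))"
    by (rule velocity_combinations_converge[where w = w and X = X, OF wb]) blast
  define A where "A = A0 \<inter> A1"
  have A: "full_in T A" "A \<subseteq> S" unfolding A_def using full_in_Int[OF A0(1) A1(1)] A0(2) by auto
  define z where "z k t = lim (\<lambda>n. \<Sum>j\<in>{n..N n}. c n j *\<^sub>R w j (t, X k))" for k t
  have lim: "(\<lambda>n. \<Sum>j\<in>{n..N n}. c n j *\<^sub>R w j (t, X k)) \<longlonglongrightarrow> z k t" if "t \<in> A" for k t
    using cv[of t k] that unfolding A_def z_def by (simp add: convergent_LIMSEQ_iff)
  have zm: "z k \<in> borel_measurable (lebesgue_on A)" for k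
    unfolding z_def [abs_def]
  proof (rule borel_measurable_lim_metric)
    fix n
    have "(\<lambda>t. w j (t, X k)) \<in> borel_measurable (lebesgue_on A)" for j
      by (rule measurable_restrict_mono[OF measurable_compose[OF measurable_Pair2'] A(2)])
        (use wb in \<open>auto simp: bounded_field_def\<close>)
    then show "(\<lambda>t. \<Sum>j\<in>{n..N n}. c n j *\<^sub>R w j (t, X k)) \<in> borel_measurable (lebesgue_on A)"
      by (intro borel_measurable_sum borel_measurable_scaleR borel_measurable_const)
  qed
  have ex: "\<exists>u\<in>U t (\<mu> t). \<forall>k. v t (\<mu> t) u (X k) = z k t" if t: "t \<in> A" for t
  proof (rule limit_velocity_attained[OF \<mu>s \<mu> _ _ _ c X])
    show tS: "t \<in> S" using t A(2) by auto
    show "(\<lambda>n. W1 (\<mu>s n t) (\<mu> t)) \<longlonglongrightarrow> 0" by (rule conv[OF S_T[OF tS]])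
    show "us n t \<in> U t (\<mu>s n t)" for n using good[of t] t by (auto simp: A_def)
    show "(\<lambda>n. \<Sum>j\<in>{n..N n}. c n j *\<^sub>R v t (\<mu>s j t) (us j t) (X k)) \<longlonglongrightarrow> z k t" for k
      using lim[OF t, of k] w_eq[OF _ X] t by (simp add: A_def)
  qed
  obtain u A' where u: "u \<in> borel_measurable (lebesgue_on {0..T})" and A': "full_in T A'" "A' \<subseteq> A"
    and uU: "\<And>t. t \<in> A' \<Longrightarrow> u t \<in> U t (\<mu> t)" and uz: "\<And>t k. t \<in> A' \<Longrightarrow> v t (\<mu> t) (u t) (X k) = z k t"
    by (rule limit_control[where \<mu> = \<mu> and A = A and X = X and z = z]) (use \<mu> A X zm ex in blast)+
  \<comment> \<open>The equation is stated for u; u' is a version of it whose velocity field is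
    jointly measurable.\<close>
  obtain u' where u'_AE: "AE t in M. u' t = u t" and W'm: "W \<mu> u' \<in> borel_measurable (M \<Otimes>\<^sub>M borel)"
    by (rule W_joint_measurable[OF \<mu> measurable_restrict_mono[OF u S(2)]])
  obtain A2 where A2: "full_in T A2" "A2 \<subseteq> S" and u'_eq: "\<And>t. t \<in> A2 \<Longrightarrow> u' t = u t"
    by (rule full_in_AE[OF full_S u'_AE]) blast
  have W'b: "bounded_field (W \<mu> u')" by (rule W_bounded_field[OF \<mu> W'm])
  define E where "E = A' \<inter> A2"
  have E: "full_in T E" "E \<subseteq> S" "E \<subseteq> A'" "E \<subseteq> A"
    unfolding E_def using full_in_Int[OF A'(1) A2(1)] A'(2) A2(2) by auto
  have W'_eq: "W \<mu> u' (t, x) = v t (\<mu> t) (u t) x" if "t \<in> E" "x \<in> K" for t x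
    using that u'_eq[of t] A2(2) by (auto simp: E_def W_eq)
  \<comment> \<open>On E the limits at the points \<open>X k\<close> are the velocities of u; the
    common Lipschitz constant \<open>l t\<close> spreads the convergence over K.\<close>
  have Zlim: "(\<lambda>n. \<Sum>j\<in>{n..N n}. c n j *\<^sub>R w j (t, x)) \<longlonglongrightarrow> W \<mu> u' (t, x)" if t: "t \<in> E" and x: "x \<in> K" for t x
  proof (rule dense_Lipschitz_convergence[OF _ _ X Xd _ x])
    have tS: "t \<in> S" using t E by auto
    show "(l t)-lipschitz_on K (\<lambda>x. W \<mu> u' (t, x))" by (rule W_Lipschitz[OF \<mu> tS])
    show "(l t)-lipschitz_on K (\<lambda>x. \<Sum>j\<in>{n..N n}. c n j *\<^sub>R w j (t, x))" for n
    proof (rule lipschitz_onI)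
      fix x y assume xy: "x \<in> K" "y \<in> K"
      have "norm ((\<Sum>j\<in>{n..N n}. c n j *\<^sub>R w j (t, x)) - (\<Sum>j\<in>{n..N n}. c n j *\<^sub>R w j (t, y)))
        = norm (\<Sum>j\<in>{n..N n}. c n j *\<^sub>R (w j (t, x) - w j (t, y)))"
        by (simp add: sum_subtractf scaleR_diff_right)
      also have "\<dots> \<le> (\<Sum>j\<in>{n..N n}. norm (c n j *\<^sub>R (w j (t, x) - w j (t, y))))" by (rule norm_sum)
      also have "\<dots> \<le> (\<Sum>j\<in>{n..N n}. c n j * (l t * dist x y))"
      proof (rule sum_mono)
        fix j
        have "norm (w j (t, x) - w j (t, y)) \<le> l t * dist x y"
          using lipschitz_onD[OF wl[OF tS] xy, of j] by (simp add: dist_norm)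
        from mult_left_mono[OF this c(1)[of n j]]
        show "norm (c n j *\<^sub>R (w j (t, x) - w j (t, y))) \<le> c n j * (l t * dist x y)" using c(1)[of n j] by simp
      qed
      also have "\<dots> = l t * dist x y" using c(2)[of n] by (simp add: sum_distrib_right[symmetric])
      finally show "dist (\<Sum>j\<in>{n..N n}. c n j *\<^sub>R w j (t, x)) (\<Sum>j\<in>{n..N n}. c n j *\<^sub>R w j (t, y)) \<le> l t * dist x y"
        by (simp add: dist_norm)
    qed (rule lipschitz_on_nonneg[OF wl[OF tS]])
    fix k
    have "z k t = W \<mu> u' (t, X k)" using uz[of t k] W'_eq[OF t X] t E by auto
    then show "(\<lambda>n. \<Sum>j\<in>{n..N n}. c n j *\<^sub>R w j (t, X k)) \<longlonglongrightarrow> W \<mu> u' (t, X k)" using lim[of t k] t E by auto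
  qed
  have vc: "continuous_on UNIV (v t \<nu> u)" if "t \<in> S" "\<nu> \<in> Prob_c" for t \<nu> u
  proof -
    have "continuous_on UNIV ((\<lambda>(u, x). v t \<nu> u x) \<circ> (\<lambda>x. (u, x)))"
      by (intro continuous_on_compose continuous_intros continuous_on_subset[OF v_continuous[OF that]]) auto
    then show ?thesis by (simp add: o_def)
  qed
  have "solves_CE T \<mu> (\<lambda>t x. v t (\<mu> t) (u t) x)"
    unfolding solves_CE_def
  proof (rule ballI)
    fix \<phi> :: "real \<times> 'a \<Rightarrow> real" assume \<phi>: "\<phi> \<in> test_functions T"
    obtain P :: "real \<times> 'a \<Rightarrow> real" and Q B where rep: "\<And>w t x. CE_integrand \<phi> w t x = P (t, x) + Q (t, x) \<bullet> w t x"
      and PQ: "B \<ge> 0" "\<And>p. \<bar>P p\<bar> \<le> B" "\<And>p. norm (Q p) \<le> B" "B-lipschitz_on UNIV P" "B-lipschitz_on UNIV Q"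
      by (rule test_function_representation[OF \<phi>]) blast
    have zero: "(\<integral>t. pairing P Q (\<mu>s n) (w n) t \<partial>M) = 0" for n
    proof (rule solution_pairing_zero[OF CE \<phi>])
      show "(LINT t:{0..T}|lebesgue. (\<integral>x. CE_integrand \<phi> (\<lambda>t x. v t (\<mu>s n t) (us n t) x) t x \<partial>\<mu>s n t)) = (\<integral>t. pairing P Q (\<mu>s n) (w n) t \<partial>M)"
        by (rule CE_pairing(3)[OF PQ \<mu>s wb A0 w_eq vc rep]) (use A0(2) curve_Prob(2)[OF \<mu>s S_T] in auto)
    qed
    have "(\<integral>t. pairing P Q \<mu> (W \<mu> u') t \<partial>M) = 0"
      by (rule pairing_integral_limit[OF PQ \<mu>s \<mu> wb W'b wl conv[OF S_T] zero c E(1,2) Zlim])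
    moreover note CE_pairing[OF PQ \<mu> W'b E(1,2) W'_eq vc rep]
    moreover have "t \<in> E \<Longrightarrow> t \<in> S" "t \<in> E \<Longrightarrow> \<mu> t \<in> Prob_c" for t using E(2) curve_Prob(2)[OF \<mu> S_T] by auto
    ultimately show "(AE t in lebesgue_on {0..T}. integrable (\<mu> t) (CE_integrand \<phi> (\<lambda>t x. v t (\<mu> t) (u t) x) t)) \<and>
      set_integrable lebesgue {0..T} (\<lambda>t. \<integral>x. CE_integrand \<phi> (\<lambda>t x. v t (\<mu> t) (u t) x) t x \<partial>\<mu> t) \<and>
      (LINT t:{0..T}|lebesgue. (\<integral>x. CE_integrand \<phi> (\<lambda>t x. v t (\<mu> t) (u t) x) t x \<partial>\<mu> t)) = 0" by simp
  qed
  moreover have "AE t in lebesgue_on {0..T}. u t \<in> U t (\<mu> t)" by (rule full_in_AE_I[OF A'(1) uU]) auto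
  ultimately show thesis using u by (intro that)
qed

end

section \<open>Existence of an optimal pair\<close>

text \<open>Being eventually below every competitor plus e also makes sense when the costs are
  unbounded below. Lower semicontinuity at the limit then excludes that case without separate
  treatment.\<close>

lemma minimizing_sequence:
  fixes X :: "real set"
  assumes "X \<noteq> {}"
  obtains a :: "nat \<Rightarrow> real" where "\<And>n. a n \<in> X" "\<And>s e. s \<in> X \<Longrightarrow> 0 < e \<Longrightarrow> \<forall>\<^sub>F n in sequentially. a n \<le> s + e"
proof (cases "bdd_below X")
  case True
  have "\<exists>x\<in>X. x < Inf X + 1 / Suc n" for n by (rule cInf_lessD[OF assms]) simp
  then obtain a where a: "\<And>n. a n \<in> X" "\<And>n. a n < Inf X + 1 / Suc n" by metis
  have "\<forall>\<^sub>F n in sequentially. a n \<le> s + e" if "s \<in> X" "0 < e" for s e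
  proof -
    have "\<forall>\<^sub>F n in sequentially. 1 / real (Suc n) < e" using LIMSEQ_Suc[OF lim_1_over_n] that(2) by (rule order_tendstoD(2))
    then show ?thesis
    proof eventually_elim
      fix n assume "1 / real (Suc n) < e"
      then show "a n \<le> s + e" using a(2)[of n] cInf_lower[OF that(1) True] by linarith
    qed
  qed
  with a(1) show thesis by (rule that)
next
  case False
  then have "\<exists>x\<in>X. x < - real n" for n unfolding bdd_below_def by (metis linorder_not_le)
  then obtain a where a: "\<And>n. a n \<in> X" "\<And>n. a n < - real n" by metis
  have "\<forall>\<^sub>F n in sequentially. a n \<le> s + e" for s e
  proof -
    obtain k where "- (s + e) \<le> real k" using real_arch_simple by blast
    then have "a n \<le> s + e" if "n \<ge> k" for n using a(2)[of n] that by (simp add: less_imp_le)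
    then show ?thesis by (auto simp: eventually_sequentially)
  qed
  with a(1) show thesis by (rule that)
qed

lemma C0_norm_upper:
  fixes f :: "'a::topological_space \<Rightarrow> 'b::real_normed_vector"
  assumes "compact K" "continuous_on K f" "x \<in> K" shows "norm (f x) \<le> C0_norm K f"
  unfolding C0_norm_def
proof (rule cSUP_upper[OF assms(3)])
  have "compact ((\<lambda>x. norm (f x)) ` K)" by (intro compact_continuous_image continuous_intros assms)
  then show "bdd_above ((\<lambda>x. norm (f x)) ` K)" by (intro bounded_imp_bdd_above compact_imp_bounded)
qed

text \<open>Sublevel sets are closed relative to the measures on K, so the sequence and its limit
  have to stay there.\<close>

lemma W1_lsc_on_limit:
  assumes lsc: "W1_lsc_on (Prob_on K) \<phi>" and K: "compact K" and \<mu>: "\<mu> \<in> Prob_on K" and \<nu>: "\<And>n. \<nu> n \<in> Prob_on K"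
    and lim: "(\<lambda>n. W1 (\<nu> n) \<mu>) \<longlonglongrightarrow> 0" and ev: "\<forall>\<^sub>F n in sequentially. \<phi> (\<nu> n) \<le> c"
  shows "\<phi> \<mu> \<le> c"
proof -
  note Pc = Prob_on_Prob_c[OF K]
  obtain D where D: "closedin W1_topology D" "{\<mu> \<in> Prob_c \<inter> Prob_on K. \<phi> \<mu> \<le> c} = D \<inter> Prob_on K"
    using lsc unfolding W1_lsc_on_def closedin_subtopology by metis
  have "\<forall>\<^sub>F n in sequentially. \<nu> n \<in> D" using ev by eventually_elim (use D(2) \<nu> Pc in blast)
  then have "\<mu> \<in> D" by (rule W1_closedin_limit[OF D(1) Pc[OF \<mu>] Pc[OF \<nu>] lim])
  then show ?thesis using D(2) \<mu> by blast
qed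

theorem theorem6:
  fixes T :: real
    and \<mu>0 :: "(real ^ 'd) measure"
    and U :: "real \<Rightarrow> (real ^ 'd) measure \<Rightarrow> 'u::metric_space set"
    and v :: "real \<Rightarrow> (real ^ 'd) measure \<Rightarrow> 'u \<Rightarrow> real ^ 'd \<Rightarrow> real ^ 'd"
    and \<phi> :: "(real ^ 'd) measure \<Rightarrow> real"
    and \<K> :: "real \<Rightarrow> (real ^ 'd) measure set"
    and \<Q> :: "(real ^ 'd) measure set"
  assumes T_pos: "T > 0"
    and mu0: "\<mu>0 \<in> Prob_c"
    and U_compact: "\<And>t \<mu>. t \<in> {0..T} \<Longrightarrow> \<mu> \<in> Prob_c \<Longrightarrow> compact (U t \<mu>)"
    and v_C0: "\<And>t \<mu> u. t \<in> {0..T} \<Longrightarrow> \<mu> \<in> Prob_c \<Longrightarrow> continuous_on UNIV (v t \<mu> u)"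
    and U_measurable: "\<And>\<mu>. \<mu> \<in> Prob_c \<Longrightarrow> setmap_measurable T (\<lambda>t. U t \<mu>)"
    and U_continuous: "\<And>t. t \<in> {0..T} \<Longrightarrow> setmap_W1_continuous (U t)"
    and v_measurable:
      "\<And>\<mu> u x. \<mu> \<in> Prob_c \<Longrightarrow> (\<lambda>t. v t \<mu> u x) \<in> borel_measurable (lebesgue_on {0..T})"
    and v_continuous:
      "\<And>t \<mu>. t \<in> {0..T} \<Longrightarrow> \<mu> \<in> Prob_c \<Longrightarrow> continuous_on UNIV (\<lambda>(u, x). v t \<mu> u x)"
    and v_growth:
      "\<exists>m. L1_nonneg T m \<and>
         (AE t in lebesgue_on {0..T}. \<forall>\<mu>\<in>Prob_c. \<forall>u x.
            norm (v t \<mu> u x) \<le> m t * (1 + norm x + moment1 \<mu>))"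
    and v_Lipschitz:
      "\<And>K. compact K \<Longrightarrow>
         \<exists>l L. L1_nonneg T l \<and> L1_nonneg T L \<and>
           (AE t in lebesgue_on {0..T}.
              (\<forall>\<mu>\<in>Prob_on K. \<forall>u. (l t)-lipschitz_on K (v t \<mu> u)) \<and>
              (\<forall>\<mu>\<in>Prob_on K. \<forall>\<nu>\<in>Prob_on K. \<forall>u.
                 C0_norm K (\<lambda>x. v t \<mu> u x - v t \<nu> u x) \<le> L t * W1 \<mu> \<nu>))"
    and V_convex:
      "\<And>t \<mu>. t \<in> {0..T} \<Longrightarrow> \<mu> \<in> Prob_c \<Longrightarrow> convex_functions {v t \<mu> u | u. u \<in> U t \<mu>}"
    and phi_lsc: "\<And>K. compact K \<Longrightarrow> W1_lsc_on (Prob_on K) \<phi>"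
    and K_closed: "\<And>t. t \<in> {0..T} \<Longrightarrow> closedin W1_topology (\<K> t)"
    and Q_closed: "closedin W1_topology \<Q>"
    and feasible: "\<exists>\<mu> u. admissible_pair T \<mu>0 U v \<K> \<Q> \<mu> u"
  shows "\<exists>\<mu> u. optimal_pair T \<mu>0 U v \<phi> \<K> \<Q> \<mu> u"
proof -
  obtain m where m: "L1_nonneg T m" and m_AE: "AE t in lebesgue_on {0..T}. \<forall>\<mu>\<in>Prob_c. \<forall>u x.
      norm (v t \<mu> u x) \<le> m t * (1 + norm x + moment1 \<mu>)" using v_growth by blast
  obtain R C where R: "R > 0" and C: "C \<ge> 0" and ap: "\<And>\<mu> w. AC_curve T \<mu> \<Longrightarrow> \<mu> 0 = \<mu>0 \<Longrightarrow> solves_CE T \<mu> w \<Longrightarrow>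
       (AE t in lebesgue_on {0..T}. \<forall>x. norm (w t x) \<le> m t * (1 + norm x + moment1 (\<mu> t))) \<Longrightarrow>
       (\<forall>t\<in>{0..T}. \<mu> t \<in> Prob_on (cball 0 R)) \<and>
       (\<forall>s t. 0 \<le> s \<and> s \<le> t \<and> t \<le> T \<longrightarrow> W1 (\<mu> s) (\<mu> t) \<le> integral {s..t} (\<lambda>r. C * m r))"
    by (rule CE_a_priori[OF less_imp_le[OF T_pos] m mu0]) blast
  \<comment> \<open>The ball comes from T, m and \<open>\<mu>0\<close>, so it can be fixed before
    the functions l and L, which depend on it, are extracted.\<close>
  define K :: "(real ^ 'd) set" where "K = cball 0 R"
  have Kc: "compact K" by (simp add: K_def)
  note Pc = Prob_on_Prob_c[OF Kc]
  obtain l L where lL: "AE t in lebesgue_on {0..T}.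
      (\<forall>\<mu>\<in>Prob_on K. \<forall>u. (l t)-lipschitz_on K (v t \<mu> u)) \<and>
      (\<forall>\<mu>\<in>Prob_on K. \<forall>\<nu>\<in>Prob_on K. \<forall>u. C0_norm K (\<lambda>x. v t \<mu> u x - v t \<nu> u x) \<le> L t * W1 \<mu> \<nu>)"
    using v_Lipschitz[OF Kc] by blast
  have full: "full_in T {0..T}" by (simp add: full_in_def)
  obtain S where S: "full_in T S" "S \<subseteq> {0..T}"
    and good: "\<And>t. t \<in> S \<Longrightarrow> (\<forall>\<mu>\<in>Prob_c. \<forall>u x. norm (v t \<mu> u x) \<le> m t * (1 + norm x + moment1 \<mu>)) \<and>
      (\<forall>\<mu>\<in>Prob_on K. \<forall>u. (l t)-lipschitz_on K (v t \<mu> u)) \<and>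
      (\<forall>\<mu>\<in>Prob_on K. \<forall>\<nu>\<in>Prob_on K. \<forall>u. C0_norm K (\<lambda>x. v t \<mu> u x - v t \<nu> u x) \<le> L t * W1 \<mu> \<nu>)"
    by (rule full_in_AE[OF full AE_conjI[OF m_AE lL]]) blast
  interpret control_system T R S U v m l L
  proof unfold_locales
    fix \<mu> :: "(real ^ 'd) measure" and G :: "'u set" assume \<mu>: "\<mu> \<in> Prob_c" and "open G"
    then have "{t \<in> {0..T}. U t \<mu> \<inter> G \<noteq> {}} \<in> sets lebesgue" using U_measurable by (simp add: setmap_measurable_def)
    moreover have "{t \<in> S. U t \<mu> \<inter> G \<noteq> {}} = {t \<in> {0..T}. U t \<mu> \<inter> G \<noteq> {}} \<inter> S" using S(2) by auto
    moreover have "S \<in> sets lebesgue" using S(1) by (simp add: full_in_def)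
    ultimately show "{t \<in> S. U t \<mu> \<inter> G \<noteq> {}} \<in> sets lebesgue" by (simp only: sets.Int)
  next
    fix t :: real and \<mu> \<nu> :: "(real ^ 'd) measure" and u x
    assume t: "t \<in> S" and p: "\<mu> \<in> Prob_on (cball 0 R)" "\<nu> \<in> Prob_on (cball 0 R)" and x: "x \<in> cball (0::real ^ 'd) R"
    then have p': "\<mu> \<in> Prob_on K" "\<nu> \<in> Prob_on K" "x \<in> K" and tT: "t \<in> {0..T}" using S(2) by (auto simp: K_def)
    have "continuous_on K (\<lambda>x. v t \<mu> u x - v t \<nu> u x)"
      by (intro continuous_on_diff continuous_on_subset[OF v_C0[OF tT Pc] subset_UNIV] p')
    from C0_norm_upper[OF Kc this p'(3)]
    have "norm (v t \<mu> u x - v t \<nu> u x) \<le> C0_norm K (\<lambda>x. v t \<mu> u x - v t \<nu> u x)" .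
    also have "\<dots> \<le> L t * W1 \<mu> \<nu>" using good[OF t] p' by blast
    finally show "norm (v t \<mu> u x - v t \<nu> u x) \<le> L t * W1 \<mu> \<nu>" .
  next
    fix \<mu> :: "(real ^ 'd) measure" and u x assume "\<mu> \<in> Prob_c"
    from v_measurable[OF this] show "(\<lambda>t. v t \<mu> u x) \<in> borel_measurable (lebesgue_on S)"
      by (rule measurable_restrict_mono[OF _ S(2)])
  qed (use T_pos R S good m U_compact U_continuous v_continuous V_convex in \<open>auto simp: full_in_def K_def\<close>)
  \<comment> \<open>One integrable density bounds the speed of all admissible curves; it passes to
    the limit and witnesses its absolute continuity.\<close>
  define g where "g r = C * m r" for r
  have g: "L1_nonneg T g" "g absolutely_integrable_on {0..T}"
    using m C by (auto simp: L1_nonneg_def g_def [abs_def])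
  define I where "I t = integral {0..t} g" for t
  have Ic: "continuous_on {0..T} I" unfolding I_def by (rule continuous_indefinite_integral[OF g(2)])
  have adm: "(\<forall>t\<in>{0..T}. \<mu> t \<in> Prob_on K) \<and> (\<forall>s t. 0 \<le> s \<and> s \<le> t \<and> t \<le> T \<longrightarrow> W1 (\<mu> s) (\<mu> t) \<le> I t - I s)"
    if a: "admissible_pair T \<mu>0 U v \<K> \<Q> \<mu> u" for \<mu> u
  proof -
    have ac: "AC_curve T \<mu>" and \<mu>0: "\<mu> 0 = \<mu>0" and ce: "solves_CE T \<mu> (\<lambda>t x. v t (\<mu> t) (u t) x)"
      using a by (auto simp: admissible_pair_def)
    have "AE t in lebesgue_on {0..T}. t \<in> {0..T}" by (rule AE_I2) simp
    with m_AE have "AE t in lebesgue_on {0..T}. \<forall>x. norm (v t (\<mu> t) (u t) x) \<le> m t * (1 + norm x + moment1 (\<mu> t))"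
      by eventually_elim (use ac in \<open>auto simp: AC_curve_def\<close>)
    note b = ap[OF ac \<mu>0 ce this]
    have "W1 (\<mu> s) (\<mu> t) \<le> I t - I s" if st: "0 \<le> s" "s \<le> t" "t \<le> T" for s t
    proof -
      have "W1 (\<mu> s) (\<mu> t) \<le> integral {s..t} g" using b st by (simp add: g_def [abs_def])
      then show ?thesis using L1_nonneg_integral(2)[OF g(2) st] by (simp add: I_def)
    qed
    then show ?thesis using b by (simp add: K_def)
  qed
  have "{\<phi> (\<mu> T) | \<mu> u. admissible_pair T \<mu>0 U v \<K> \<Q> \<mu> u} \<noteq> {}" using feasible by blast
  then obtain a where a: "\<And>n. a n \<in> {\<phi> (\<mu> T) | \<mu> u. admissible_pair T \<mu>0 U v \<K> \<Q> \<mu> u}"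
    and amin: "\<And>s e. s \<in> {\<phi> (\<mu> T) | \<mu> u. admissible_pair T \<mu>0 U v \<K> \<Q> \<mu> u} \<Longrightarrow> 0 < e \<Longrightarrow> \<forall>\<^sub>F n in sequentially. a n \<le> s + e"
    by (rule minimizing_sequence) blast
  have "\<exists>\<mu> u. admissible_pair T \<mu>0 U v \<K> \<Q> \<mu> u \<and> \<phi> (\<mu> T) = a n" for n using a[of n] by auto
  then obtain \<mu>s us where ap_s: "\<And>n. admissible_pair T \<mu>0 U v \<K> \<Q> (\<mu>s n) (us n)" and cost: "\<And>n. \<phi> (\<mu>s n T) = a n" by metis
  have \<mu>sK: "\<mu>s n t \<in> Prob_on K" if "t \<in> {0..T}" for n t using adm[OF ap_s] that by blast
  have \<mu>sI: "W1 (\<mu>s n s) (\<mu>s n t) \<le> I t - I s" if "0 \<le> s" "s \<le> t" "t \<le> T" for n s t using adm[OF ap_s] that by blast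
  have "\<exists>r \<nu>. strict_mono r \<and> (\<forall>t\<in>{0..T}. \<nu> t \<in> Prob_on K) \<and> (\<forall>t\<in>{0..T}. (\<lambda>n. W1 (\<mu>s (r n) t) (\<nu> t)) \<longlonglongrightarrow> 0)"
    by (rule curves_seq_compact[where \<mu> = \<mu>s, OF T_pos Kc \<mu>sK Ic \<mu>sI]) (assumption | blast)+
  then obtain r \<nu> where r: "strict_mono (r :: nat \<Rightarrow> nat)" and \<nu>K: "\<And>t. t \<in> {0..T} \<Longrightarrow> \<nu> t \<in> Prob_on K"
    and \<nu>lim: "\<And>t. t \<in> {0..T} \<Longrightarrow> (\<lambda>n. W1 (\<mu>s (r n) t) (\<nu> t)) \<longlonglongrightarrow> 0" by blast
  have s0: "\<mu>s n 0 = \<mu>0" for n using ap_s by (simp add: admissible_pair_def)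
  have 0: "0 \<in> {0..T}" using T_pos by simp
  have \<mu>0K: "\<mu>0 \<in> Prob_on K" using \<mu>sK[OF 0, of 0] by (simp add: s0)
  \<comment> \<open>The limit is only determined up to \<open>W1\<close>-distance zero, so its initial value is prescribed by hand.\<close>
  define \<mu> where "\<mu> = \<nu>(0 := \<mu>0)"
  have \<mu>K: "\<mu> t \<in> Prob_on K" if "t \<in> {0..T}" for t using \<nu>K[OF that] \<mu>0K by (simp add: \<mu>_def)
  have \<mu>lim: "(\<lambda>n. W1 (\<mu>s (r n) t) (\<mu> t)) \<longlonglongrightarrow> 0" if "t \<in> {0..T}" for t
    using \<nu>lim[OF that] W1_refl[OF Prob_onD(1)[OF \<mu>0K]] by (simp add: \<mu>_def s0)
  have \<mu>I: "W1 (\<mu> s) (\<mu> t) \<le> I t - I s" if st: "0 \<le> s" "s \<le> t" "t \<le> T" for s t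
  proof (rule LIMSEQ_le_const)
    have t: "s \<in> {0..T}" "t \<in> {0..T}" using st by auto
    show "(\<lambda>n. I t - I s + (W1 (\<mu>s (r n) s) (\<mu> s) + W1 (\<mu>s (r n) t) (\<mu> t))) \<longlonglongrightarrow> I t - I s"
      using tendsto_add[OF tendsto_const tendsto_add[OF \<mu>lim[OF t(1)] \<mu>lim[OF t(2)]]] by simp
    have "W1 (\<mu> s) (\<mu> t) \<le> I t - I s + (W1 (\<mu>s (r n) s) (\<mu> s) + W1 (\<mu>s (r n) t) (\<mu> t))" for n
    proof -
      note c = Pc[OF \<mu>K[OF t(1)]] Pc[OF \<mu>K[OF t(2)]] Pc[OF \<mu>sK[OF t(1)]] Pc[OF \<mu>sK[OF t(2)]]
      have "W1 (\<mu> s) (\<mu> t) \<le> W1 (\<mu> s) (\<mu>s (r n) s) + W1 (\<mu>s (r n) s) (\<mu> t)" by (intro W1_triangle c)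
      moreover have "W1 (\<mu>s (r n) s) (\<mu> t) \<le> W1 (\<mu>s (r n) s) (\<mu>s (r n) t) + W1 (\<mu>s (r n) t) (\<mu> t)" by (intro W1_triangle c)
      moreover have "W1 (\<mu> s) (\<mu>s (r n) s) = W1 (\<mu>s (r n) s) (\<mu> s)" by (intro W1_commute c)
      ultimately show ?thesis using \<mu>sI[OF st, of "r n"] by linarith
    qed
    then show "\<exists>N. \<forall>n\<ge>N. W1 (\<mu> s) (\<mu> t) \<le> I t - I s + (W1 (\<mu>s (r n) s) (\<mu> s) + W1 (\<mu>s (r n) t) (\<mu> t))" by blast
  qed
  have curve_s: "curve (\<mu>s n)" for n unfolding curve_def using \<mu>sK \<mu>sI Ic by (auto simp: K_def)
  have curve_\<mu>: "curve \<mu>" unfolding curve_def using \<mu>K \<mu>I Ic by (auto simp: K_def)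
  have usm: "us n \<in> borel_measurable M" and usU: "AE t in M. us n t \<in> U t (\<mu>s n t)" for n
  proof -
    have u: "us n \<in> borel_measurable (lebesgue_on {0..T})" "AE t in lebesgue_on {0..T}. us n t \<in> U t (\<mu>s n t)"
      using ap_s[of n] by (auto simp: admissible_pair_def measurable_selection_def)
    show "us n \<in> borel_measurable M" by (rule measurable_restrict_mono[OF u(1) S(2)])
    obtain A where "full_in T A" "\<And>t. t \<in> A \<Longrightarrow> us n t \<in> U t (\<mu>s n t)" by (rule full_in_AE[OF full u(2)]) blast
    then show "AE t in M. us n t \<in> U t (\<mu>s n t)" by (rule full_in_AE_I) (use S in \<open>auto simp: full_in_def\<close>)
  qed
  have ces: "solves_CE T (\<mu>s n) (\<lambda>t x. v t (\<mu>s n t) (us n t) x)" for n using ap_s[of n] by (simp add: admissible_pair_def)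
  obtain u where u: "u \<in> borel_measurable (lebesgue_on {0..T})" "AE t in lebesgue_on {0..T}. u t \<in> U t (\<mu> t)"
    and ce: "solves_CE T \<mu> (\<lambda>t x. v t (\<mu> t) (u t) x)"
    by (rule closure_theorem[of "\<lambda>n. \<mu>s (r n)" \<mu> "\<lambda>n. us (r n)", OF curve_s curve_\<mu> \<mu>lim usm usU ces])
  have ac: "AC_curve T \<mu>"
    unfolding AC_curve_def
  proof (intro conjI ballI exI[of _ g] allI impI)
    fix s t assume "0 \<le> s \<and> s \<le> t \<and> t \<le> T"
    then have st: "0 \<le> s" "s \<le> t" "t \<le> T" by auto
    show "W1 (\<mu> s) (\<mu> t) \<le> (LINT r:{s..t}|lebesgue. g r)"
      using \<mu>I[OF st] L1_nonneg_integral(1,2)[OF g(2) st] by (simp add: I_def)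
  qed (use Pc \<mu>K g(1) in auto)
  have T: "T \<in> {0..T}" using T_pos by simp
  have "\<mu> t \<in> \<K> t" if t: "t \<in> {0..T}" for t
    by (rule W1_closedin_limit[OF K_closed[OF t] Pc[OF \<mu>K[OF t]] Pc[OF \<mu>sK[OF t]] \<mu>lim[OF t]])
      (use ap_s t in \<open>auto simp: admissible_pair_def\<close>)
  moreover have "\<mu> T \<in> \<Q>"
    by (rule W1_closedin_limit[OF Q_closed Pc[OF \<mu>K[OF T]] Pc[OF \<mu>sK[OF T]] \<mu>lim[OF T]])
      (use ap_s in \<open>auto simp: admissible_pair_def\<close>)
  ultimately have "admissible_pair T \<mu>0 U v \<K> \<Q> \<mu> u"
    using ac u ce by (simp add: admissible_pair_def measurable_selection_def \<mu>_def)
  moreover have "\<phi> (\<mu> T) \<le> \<phi> (\<nu>' T)" if a': "admissible_pair T \<mu>0 U v \<K> \<Q> \<nu>' w" for \<nu>' w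
  \<comment> \<open>The costs along the sequence are eventually below that of the competitor plus e,
    and the sublevel set at this height is closed.\<close>
  proof (rule field_le_epsilon)
    fix e :: real assume e: "0 < e"
    have "\<forall>\<^sub>F n in sequentially. a n \<le> \<phi> (\<nu>' T) + e" by (rule amin[OF _ e]) (use a' in blast)
    then have ev: "\<forall>\<^sub>F n in sequentially. \<phi> (\<mu>s (r n) T) \<le> \<phi> (\<nu>' T) + e"
      using eventually_subseq[OF r] by (simp add: cost)
    show "\<phi> (\<mu> T) \<le> \<phi> (\<nu>' T) + e"
      by (rule W1_lsc_on_limit[OF phi_lsc[OF Kc] Kc \<mu>K[OF T] \<mu>sK[OF T] \<mu>lim[OF T] ev])
  qed
  ultimately show ?thesis unfolding optimal_pair_def by blast
qed

end
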